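(* Let $\alpha\in[0,1]$. For an odd prime $p$, integer $t$, integer $k$ and $x\in[0,1]$ define $F_{p,t}(z)=\sum_{j=0}^{p-1}\left(\frac{j+t}{p}\right)z^j$ and \[ G_{p,t}(k,x)=\zeta_p^{(k-1)t}\,\frac{F_{p,t}(\zeta_p^{k+x})}{F_{p,t}(\zeta_p)}, \] where $e(u)=e^{2\pi i u}$ and $\zeta_p^{y}=e(y/p)$. Let $\{\mathbb{X}(j)\}_{j\in\mathbb{Z}}$ be independent random variables each taking the values $\pm1$ with probability $1/2$, and define the random process \[ G_{\mathbb{X},\alpha}(x)=\sum_{j\in\mathbb{Z}}\frac{e(\alpha j)(e(x)-1)}{2\pi i(j+x)}\mathbb{X}(j),\qquad x\in[0,1]. \] Let $\lfloor y\rceil$ denote the integer nearest to $y$ (taken to be $\lfloor y\rfloor$ when $y$ is a half-integer). Then: (i) If $\varphi:C[0,1]\to\mathbb{C}$ is bounded and continuous, then \[ \lim_{p\to\infty}\frac1p\sum_{k=0}^{p-1}\varphi\bigl(G_{p,\lfloor\alpha p\rceil}(k,\cdot)\bigr)=\mathbb{E}\bigl(\varphi(G_{\mathbb{X},\alpha}(\cdot))\bigr), \] where $\varphi$ is applied to the functions $x\mapsto G_{p,\lfloor\alpha p\rceil}(k,x)$ and $x\mapsto G_{\mathbb{X},\alpha}(x)$ on $[0,1]$. (ii) For every $q>0$, \[ \lim_{p\to\infty}\frac{\|F_{p,\lfloor\alpha p\rceil}\|_q}{\sqrt p}=\kappa_q(\alpha):=\left(\int_0^1\mathbb{E}\bigl(|G_{\mathbb{X},\alpha}(x)|^q\bigr)\,dx\right)^{1/q}.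 \] (iii) \[ \lim_{p\to\infty}\frac{M(F_{p,\lfloor\alpha p\rceil})}{\sqrt p}=\kappa_0(\alpha):=\exp\left(\int_0^1\mathbb{E}\bigl(\log|G_{\mathbb{X},\alpha}(x)|\bigr)\,dx\right). \] Here limits are over primes $p$.
   Context: $\left(\frac{\cdot}{p}\right)$ is the Legendre symbol. For a polynomial $f$ and $q>0$, $\|f\|_q=\left(\int_0^1|f(e(u))|^q\,du\right)^{1/q}$, and the Mahler measure is $M(f)=\exp\left(\int_0^1\log|f(e(u))|\,du\right)$. The series defining $G_{\mathbb{X},\alpha}$ is understood as the limit of the symmetric partial sums over $|j|\le J$ as $J\to\infty$ (which converges almost surely). $C[0,1]$ is the space of continuous complex-valued functions on $[0,1]$ with the supremum norm. *)

theory Defs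
  imports
    "HOL-Probability.Probability"
    "HOL-Number_Theory.Number_Theory"
    "HOL-Computational_Algebra.Polynomial"
begin

definition unit_exp :: "real \<Rightarrow> complex" where
  "unit_exp u = exp (2 * of_real pi * \<i> * of_real u)"

definition nearest_int :: "real \<Rightarrow> int" where
  (* the library's round rounds half-integers up; here they are rounded down *)
  "nearest_int y = (if frac y = 1/2 then \<lfloor>y\<rfloor> else round y)"

definition zeta_pow :: "nat \<Rightarrow> real \<Rightarrow> complex" where
  "zeta_pow p y = unit_exp (y / real p)"

definition shifted_fekete :: "nat \<Rightarrow> int \<Rightarrow> complex poly" where
  "shifted_fekete p t = (\<Sum>j<p. Polynomial.monom (of_int (Legendre (int j + t) (int p))) j)"

definition G_prime :: "nat \<Rightarrow> int \<Rightarrow> int \<Rightarrow> real \<Rightarrow> complex" where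
  "G_prime p t k x =
     zeta_pow p (real_of_int ((k - 1) * t)) *
       poly (shifted_fekete p t) (zeta_pow p (real_of_int k + x)) /
       poly (shifted_fekete p t) (zeta_pow p 1)"

definition poly_norm :: "real \<Rightarrow> complex poly \<Rightarrow> real" where
  "poly_norm q f = (LBINT u:{0..1}. cmod (poly f (unit_exp u)) powr q) powr (1 / q)"

definition mahler :: "complex poly \<Rightarrow> real" where
  "mahler f = exp (LBINT u:{0..1}. ln (cmod (poly f (unit_exp u))))"

definition series_kernel :: "int \<Rightarrow> real \<Rightarrow> complex" where
  (* (unit_exp x - 1) / (2 pi i (j + x)), with its continuous value 1 at the removable
     singularity x = -j; on [0,1] this concerns x = 0, j = 0 and x = 1, j = -1 *)
  "series_kernel j x =
     (if of_int j + x = 0 then 1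
      else (unit_exp x - 1) / (2 * of_real pi * \<i> * of_real (of_int j + x)))"

definition G_partial :: "(int \<Rightarrow> 'a \<Rightarrow> real) \<Rightarrow> real \<Rightarrow> 'a \<Rightarrow> nat \<Rightarrow> real \<Rightarrow> complex" where
  "G_partial X \<alpha> \<omega> J x =
     (\<Sum>j = - int J..int J. unit_exp (\<alpha> * of_int j) * series_kernel j x * of_real (X j \<omega>))"

definition G_random :: "(int \<Rightarrow> 'a \<Rightarrow> real) \<Rightarrow> real \<Rightarrow> 'a \<Rightarrow> real \<Rightarrow> complex" where
  (* The partial sums converge uniformly on [0,1] almost surely: the coefficients of X j
     differ by O(1/j^2), uniformly in x, from those of (unit_exp x - 1) / (2 pi i) times the almost
     surely convergent series of unit_exp (alpha j) X j / j over j ~= 0. On the exceptional null event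
     the path is set to 0, so that every path lies in C[0,1]. *)
  "G_random X \<alpha> \<omega> x =
     (if uniformly_convergent_on {0..1} (G_partial X \<alpha> \<omega>)
      then lim (\<lambda>J. G_partial X \<alpha> \<omega> J x) else 0)"

(* C[0,1] with the supremum metric; its points are the continuous functions that are
   extensional on {0..1}, hence the restrictions below. *)
definition C01 :: "(real \<Rightarrow> complex) metric" where
  "C01 = cfunspace (top_of_set {0..1}) euclidean_metric"

definition kappa :: "'a measure \<Rightarrow> (int \<Rightarrow> 'a \<Rightarrow> real) \<Rightarrow> real \<Rightarrow> real \<Rightarrow> real" where
  "kappa M X q \<alpha> =
     (LBINT x:{0..1}. (LINT \<omega>|M. cmod (G_random X \<alpha> \<omega> x) powr q)) powr (1 / q)"

definition kappa0 :: "'a measure \<Rightarrow> (int \<Rightarrow> 'a \<Rightarrow> real) \<Rightarrow> real \<Rightarrow> real" where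
  "kappa0 M X \<alpha> = exp (LBINT x:{0..1}. (LINT \<omega>|M. ln (cmod (G_random X \<alpha> \<omega> x))))"

definition primes_at_top :: "nat filter" where
  "primes_at_top = inf at_top (principal {p. prime p})"

end

theory Submission
  imports
    Defs
    "HOL-Complex_Analysis.Complex_Analysis"
begin

text \<open>
  Write \<open>\<chi>\<close> for the Legendre symbol. Since the Gauss sum turns \<open>\<chi>\<close> into its own Fourier transform,
  Lagrange interpolation at the roots of unity gives
  \<open>G_p(k,x) = \<Sum> \<zeta>^(jt) \<chi>(k - j) w_p(j + x)\<close>, summed over \<open>\<bar>j\<bar> \<le> (p - 1)/2\<close>, where \<open>w_p\<close> is a Dirichlet kernel
  converging to the kernel of the random series. Stepanov's method bounds
  \<open>\<Sum>_k \<Prod>_a \<chi>(k - a)\<close> by \<open>O(p^(3/4))\<close>; any power saving makes the \<open>\<chi>(k - j)\<close> asymptotically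
  independent signs, for fixed patterns of \<open>j\<close> as well as in the moments of the long sums over \<open>j\<close>. Up to \<open>O(1/J)\<close>
  the part of the sum with \<open>\<bar>j\<bar> > J\<close> depends on \<open>x\<close> only through the factor \<open>e(x) - 1\<close>, so a moment of one scalar
  sum controls it uniformly in \<open>x\<close>; this gives (i) for Lipschitz functionals, and inf-convolutions
  extend it to all bounded continuous ones.

  For (ii) and (iii), the circle is cut into the arcs \<open>[k/p, (k + 1)/p]\<close>, on which
  \<open>|F| = \<surd>p |G_p(k,x)|\<close>, and (i) is applied to truncations of \<open>\<integral> |f|^q\<close> and \<open>\<integral> ln |f|\<close>. The truncation error
  is uniformly small because of second moments: for the logarithm these exist since \<open>G_p(k,\<cdot>)\<close>
  extends to an entire function, bounded on a fixed disc and of modulus 1 at \<open>0\<close> or at \<open>1\<close>, so that it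
  has few zeros near \<open>[0,1]\<close> and, apart from the factors these contribute, is bounded below.
\<close>

text \<open>Computations modulo \<open>p\<close> are carried out with integer polynomials and
  divisibility by the constant polynomial \<open>[:int p:]\<close>; a nonzero polynomial over the
  field with \<open>p\<close> elements becomes one that is not divisible by it. A power saving is
  what the long tail demands: its coefficients have a small sum of squares, but an absolute sum of
  order log p, so expanding a moment of order 2r over tuples costs a factor (1 + log p)^(2r), which
  p^(-1/4) absorbs for every fixed r. The diagonal tuples are not counted: each is bounded by its
  value for independent signs, and these are summed back to a moment of a Rademacher sum. All
  moments are wanted because q is arbitrary. The exponent 3/4 is a convenience. The method allows a
  vanishing order near p^(1/2) for a fixed number m of factors; order near p^(1/4) makes the
  parameter inequality hold with room to spare as soon as p^(1/4) is at least 2m + 4, and for larger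
  m the trivial bound suffices.\<close>

hide_const (open) Module.smult up_ring.coeff up_ring.monom

section \<open>Character sums over products of linear factors\<close>

text \<open>Pigeonhole principle replacing the dimension count for a linear system over \<open>F_p\<close>.\<close>

lemma siegel_mod:
  fixes \<Lambda> :: "('i \<Rightarrow> int) \<Rightarrow> 'c \<Rightarrow> int"
  assumes "finite I" "finite C" "card C < card I" "1 < (p::nat)"
    and diff: "\<And>u v c. \<Lambda> (\<lambda>i. u i - v i) c = \<Lambda> u c - \<Lambda> v c"
  obtains w where "\<exists>i\<in>I. \<not> int p dvd w i" "\<And>c. c \<in> C \<Longrightarrow> int p dvd \<Lambda> w c"
proof -
  define U where "U = (\<Pi>\<^sub>E i\<in>I. {0..<int p})"
  define F where "F u = (\<lambda>c\<in>C. \<Lambda> u c mod int p)" for u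
  have fin: "finite (\<Pi>\<^sub>E c\<in>C. {0..<int p})"
    using assms by (intro finite_PiE) auto
  have "card (F ` U) \<le> card (\<Pi>\<^sub>E c\<in>C. {0..<int p})"
    using assms by (intro card_mono fin) (auto simp: F_def)
  also have "\<dots> = p ^ card C"
    using assms by (simp add: card_PiE)
  also have "\<dots> < p ^ card I"
    using assms by simp
  also have "\<dots> = card U"
    using assms by (simp add: card_PiE U_def)
  finally have "\<not> inj_on F U"
    by (rule pigeonhole)
  then obtain u v where uv: "u \<in> U" "v \<in> U" "u \<noteq> v" "F u = F v"
    by (auto simp: inj_on_def)
  then obtain i where i: "i \<in> I" "u i \<noteq> v i"
    unfolding U_def by (meson PiE_ext)
  have "u i \<in> {0..<int p}" "v i \<in> {0..<int p}"
    using uv i unfolding U_def by (auto simp: PiE_iff)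
  then have "\<not> int p dvd u i - v i"
    using i(2) by (metis atLeastLessThan_iff mod_eq_dvd_iff mod_pos_pos_trivial)
  moreover have "int p dvd \<Lambda> (\<lambda>i. u i - v i) c" if "c \<in> C" for c
  proof -
    have "F u c = F v c"
      using uv by simp
    then have "\<Lambda> u c mod int p = \<Lambda> v c mod int p"
      using that by (simp add: F_def)
    then show ?thesis
      by (simp add: diff mod_eq_dvd_iff)
  qed
  ultimately show ?thesis
    using i that[of "\<lambda>i. u i - v i"] by blast
qed

section \<open>Multiple roots of integer polynomials modulo p\<close>

text \<open>At \<open>b\<close> only the term in which every derivative falls on the power of the
  linear factor survives. This turns the vanishing of a derivative into the vanishing of the
  cofactor.\<close>

lemma pderiv_iter_at_root:
  "poly ((pderiv ^^ l) ([:-b, 1:] ^ l * H)) b = fact l * poly H (b :: int)"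
proof (induction l arbitrary: H)
  case (Suc l)
  have "pderiv ([:-b, 1:] ^ Suc l * H)
      = [:-b, 1:] ^ l * (smult (of_nat (Suc l)) H + [:-b, 1:] * pderiv H)"
    unfolding pderiv_mult pderiv_power_Suc by (simp add: algebra_simps pderiv_pCons)
  then show ?case
    by (simp only: funpow_Suc_right o_apply Suc) (simp add: algebra_simps)
qed simp

lemma prime_const_poly: "prime p \<Longrightarrow> prime_elem [:int p:]"
  by (simp add: prime_elem_const_poly_iff)

lemma const_dvd_mult_iff:
  "prime p \<Longrightarrow> [:int p:] dvd P * Q \<longleftrightarrow> [:int p:] dvd P \<or> [:int p:] dvd Q"
  using prime_const_poly prime_elem_dvd_mult_iff by blast

lemma const_dvd_power: "prime p \<Longrightarrow> [:int p:] dvd P ^ n \<Longrightarrow> [:int p:] dvd P"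
  using prime_const_poly prime_elem_dvd_power by blast

lemma const_dvd_poly: "[:c:] dvd P \<Longrightarrow> c dvd poly P (x :: int)"
  by (auto elim!: dvdE)

lemma const_not_dvd_linear: "prime p \<Longrightarrow> \<not> [:int p:] dvd [:-b, 1:]"
  by (auto simp: const_poly_dvd_iff coeff_pCons split: nat.splits dest!: spec[of _ 1] dest: not_prime_unit)

lemma const_dvd_cong: "[:int p:] dvd A - B \<Longrightarrow> [:int p:] dvd A \<longleftrightarrow> [:int p:] dvd B"
  by (metis dvd_diff_commute dvd_add_right_iff diff_add_cancel)

lemma const_dvd_trans:
  "[:int p:] dvd A - B \<Longrightarrow> [:int p:] dvd B - C \<Longrightarrow> [:int p:] dvd A - C"
  using dvd_add[of "[:int p:]" "A - B" "B - C"] by simp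

lemma divides_linear:
  fixes Q :: "int poly"
  assumes "int p dvd poly Q b"
  shows "[:int p:] dvd Q - [:-b, 1:] * synthetic_div Q b"
proof -
  have "Q = [:-b, 1:] * synthetic_div Q b + [:poly Q b:]"
    by (simp only: synthetic_div_correct')
  then have "Q - [:-b, 1:] * synthetic_div Q b = [:poly Q b:]"
    by (metis add_diff_cancel_left')
  then show ?thesis
    using assms by simp
qed

text \<open>The leading coefficients of \<open>Q\<close> may be multiples of \<open>p\<close>. Once
  its coefficients are reduced modulo \<open>p\<close>, the leading one is a unit; as
  \<open>M\<close> is monic, the product has the same leading coefficient, which therefore cannot be
  missing from \<open>P\<close>.\<close>

lemma degree_mod_bound:
  fixes P M Q :: "int poly"
  assumes "prime p" "lead_coeff M = 1" "[:int p:] dvd P - M * Q" "\<not> [:int p:] dvd P"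
  shows "degree M \<le> degree P"
proof -
  define Q0 where "Q0 = map_poly (\<lambda>c. c mod int p) Q"
  have cQ0: "coeff Q0 i = coeff Q i mod int p" for i
    by (simp add: Q0_def coeff_map_poly)
  have "[:int p:] dvd Q - Q0"
    by (auto simp: const_poly_dvd_iff cQ0 minus_mod_eq_mult_div)
  then have "[:int p:] dvd M * Q - M * Q0"
    by (metis dvd_mult right_diff_distrib)
  with assms(3) have d: "[:int p:] dvd P - M * Q0"
    by (rule const_dvd_trans)
  have "Q0 \<noteq> 0"
    using d assms(4) by auto
  have lc: "coeff (M * Q0) (degree M + degree Q0) = coeff Q0 (degree Q0)"
    using assms(2) by (simp add: coeff_mult_degree_sum)
  have "\<not> int p dvd coeff Q0 (degree Q0)"
  proof
    assume "int p dvd coeff Q0 (degree Q0)"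
    then have "coeff Q0 (degree Q0) = 0"
      by (metis cQ0 mod_mod_trivial dvd_eq_mod_eq_0)
    then show False
      using \<open>Q0 \<noteq> 0\<close> by simp
  qed
  moreover have "int p dvd coeff P (degree M + degree Q0) - coeff (M * Q0) (degree M + degree Q0)"
    using d by (simp add: const_poly_dvd_iff)
  ultimately have "coeff P (degree M + degree Q0) \<noteq> 0"
    using lc by (metis diff_0 dvd_minus_iff)
  then have "degree M + degree Q0 \<le> degree P"
    by (rule le_degree)
  then show ?thesis
    by simp
qed

text \<open>Modulo \<open>p\<close> the \<open>l\<close>-th derivative at \<open>b\<close> is
  \<open>fact l\<close> times the value of the cofactor, and \<open>fact l\<close> is invertible
  because \<open>l < p\<close>; so the cofactor has a further root at \<open>b\<close>.\<close>

lemma vanishing_step: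
  fixes P M Q :: "int poly"
  assumes "prime p" "[:int p:] dvd P - M * [:-b, 1:] ^ l * Q" "\<not> int p dvd poly M b" "l < p"
    "int p dvd poly ((pderiv ^^ l) P) b"
  shows "[:int p:] dvd P - M * [:-b, 1:] ^ Suc l * synthetic_div Q b"
proof -
  obtain E where "P - M * [:-b, 1:] ^ l * Q = [:int p:] * E"
    using assms(2) by (elim dvdE)
  then have P: "P = [:-b, 1:] ^ l * (M * Q) + smult (int p) E"
    by (simp add: algebra_simps)
  have "poly ((pderiv ^^ l) P) b = fact l * poly (M * Q) b + int p * poly ((pderiv ^^ l) E) b"
    unfolding P higher_pderiv_add higher_pderiv_smult by (simp add: pderiv_iter_at_root)
  then have "int p dvd fact l * (poly M b * poly Q b)"
    using assms(5) by (metis dvd_add_left_iff dvd_triv_left poly_mult)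
  moreover have "\<not> int p dvd fact l"
    using assms(1,4) by (metis int_dvd_int_iff not_le of_nat_fact prime_dvd_fact_iff)
  ultimately have "int p dvd poly Q b"
    using assms(1,3) by (simp add: prime_dvd_mult_iff)
  then have "[:int p:] dvd Q - [:-b, 1:] * synthetic_div Q b"
    by (rule divides_linear)
  then have "[:int p:] dvd M * [:-b, 1:] ^ l * (Q - [:-b, 1:] * synthetic_div Q b)"
    by (rule dvd_mult)
  then have "[:int p:] dvd M * [:-b, 1:] ^ l * Q - M * [:-b, 1:] ^ Suc l * synthetic_div Q b"
    by (simp add: algebra_simps)
  with assms(2) show ?thesis
    by (rule const_dvd_trans)
qed

text \<open>In characteristic \<open>p\<close> ordinary derivatives detect multiplicities only up to
  \<open>p\<close>, whence \<open>L \<le> p\<close>. The linear factors are split off point by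
  point, and at each point one order at a time; the degree of their product is then compared with
  that of \<open>P\<close>.\<close>

lemma mult_roots_bound:
  fixes P :: "int poly"
  assumes "prime p" "finite S" "\<And>b c. b \<in> S \<Longrightarrow> c \<in> S \<Longrightarrow> b \<noteq> c \<Longrightarrow> \<not> int p dvd b - c"
    "L \<le> p" "\<not> [:int p:] dvd P"
    "\<And>b l. b \<in> S \<Longrightarrow> l < L \<Longrightarrow> int p dvd poly ((pderiv ^^ l) P) b"
  shows "card S * L \<le> degree P"
proof -
  have "\<exists>Q. [:int p:] dvd P - (\<Prod>b\<in>T. [:-b, 1:] ^ L) * Q" if "T \<subseteq> S" for T
    using finite_subset[OF that assms(2)] that
  proof (induction T rule: finite_induct)
    case empty
    show ?case
      by (rule exI[of _ P]) simp
  next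
    case (insert b T)
    define M where "M = (\<Prod>b\<in>T. [:-b, 1:] ^ L)"
    have "poly M b = (\<Prod>c\<in>T. (b - c) ^ L)"
      by (simp add: M_def poly_prod)
    moreover have "\<not> int p dvd (\<Prod>c\<in>T. (b - c) ^ L)"
    proof
      assume "int p dvd (\<Prod>c\<in>T. (b - c) ^ L)"
      moreover have "prime (int p)"
        using assms(1) by simp
      ultimately obtain c where "c \<in> T" "int p dvd (b - c) ^ L"
        using insert.hyps(1) by (auto simp: prime_dvd_prod_iff)
      then have "int p dvd b - c"
        using \<open>prime (int p)\<close> by (meson prime_dvd_power)
      moreover have "b \<noteq> c"
        using \<open>c \<in> T\<close> insert.hyps by blast
      ultimately show False
        using \<open>c \<in> T\<close> insert.prems assms(3)[of b c] by blast
    qed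
    ultimately have nd: "\<not> int p dvd poly M b"
      by simp
    have "\<exists>Q. [:int p:] dvd P - M * [:-b, 1:] ^ l * Q" if "l \<le> L" for l
      using that
    proof (induction l)
      case 0
      then show ?case
        using insert by (auto simp: M_def)
    next
      case (Suc l)
      then obtain Q where "[:int p:] dvd P - M * [:-b, 1:] ^ l * Q"
        by auto
      then have "[:int p:] dvd P - M * [:-b, 1:] ^ Suc l * synthetic_div Q b"
        using insert.prems Suc.prems assms(4) by (intro vanishing_step assms nd) auto
      then show ?case
        by blast
    qed
    from this[of L] show ?case
      using insert.hyps by (simp add: M_def mult.commute)
  qed
  from this[of S] obtain Q where Q: "[:int p:] dvd P - (\<Prod>b\<in>S. [:-b, 1:] ^ L) * Q"
    by auto
  have "lead_coeff (\<Prod>b\<in>S. [:-b, 1:] ^ L) = 1"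
    by (simp add: lead_coeff_prod lead_coeff_power)
  then have "degree (\<Prod>b\<in>S. [:-b, 1:] ^ L) \<le> degree P"
    using degree_mod_bound[OF assms(1) _ Q assms(5)] by blast
  moreover have "degree (\<Prod>b\<in>S. [:-b, 1:] ^ L) = card S * L"
    by (subst degree_prod_eq_sum_degree) (auto simp: degree_power_eq)
  ultimately show ?thesis
    by simp
qed

text \<open>The order of vanishing at \<open>a\<close> modulo \<open>p\<close> is odd for \<open>r\<^sup>2 (x - a) h\<close> and even for \<open>c s\<^sup>2\<close>.\<close>

lemma square_descent:
  fixes r s h :: "int poly"
  assumes "prime p" "\<not> int p dvd c" "\<not> int p dvd poly h a"
    "[:int p:] dvd r\<^sup>2 * [:-a, 1:] * h - [:c:] * s\<^sup>2"
  shows "[:int p:] dvd r \<and> [:int p:] dvd s"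
  using assms(4)
proof (induction "degree r" arbitrary: r s rule: less_induct)
  case less
  define X where "X = [:-a, 1:]"
  have pX: "\<not> [:int p:] dvd X"
    unfolding X_def using assms(1) by (rule const_not_dvd_linear)
  have X0: "poly X a = 0"
    by (simp add: X_def)
  define s1 where "s1 = synthetic_div s a"
  define r1 where "r1 = synthetic_div r a"
  have D: "[:int p:] dvd r\<^sup>2 * X * h - [:c:] * s\<^sup>2"
    using less.prems by (simp add: X_def)
  have "int p dvd poly (r\<^sup>2 * X * h - [:c:] * s\<^sup>2) a"
    using D by (rule const_dvd_poly)
  then have "int p dvd c * (poly s a)\<^sup>2"
    by (simp add: X0)
  then have "int p dvd poly s a"
    using assms(1,2) by (meson prime_dvd_mult_iff prime_dvd_power prime_nat_int_transfer)
  then have s1: "[:int p:] dvd s - X * s1"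
    unfolding X_def s1_def by (rule divides_linear)
  \<comment> \<open>With \<open>s = X * s1\<close> modulo \<open>p\<close> one factor
    \<open>X\<close> cancels. The same done to \<open>r\<close> below restores the original shape
    with a polynomial of smaller degree, which is the descent.\<close>
  have "[:int p:] dvd X * (r\<^sup>2 * h - [:c:] * X * s1\<^sup>2)"
  proof -
    have "X * (r\<^sup>2 * h - C * X * s1\<^sup>2)
        = (r\<^sup>2 * X * h - C * s\<^sup>2) + C * (s + X * s1) * (s - X * s1)" for C
      by (simp add: power2_eq_square algebra_simps)
    from this[of "[:c:]"] show ?thesis
      using D s1 by (metis dvd_add dvd_mult)
  qed
  then have D1: "[:int p:] dvd r\<^sup>2 * h - [:c:] * X * s1\<^sup>2"
    using pX const_dvd_mult_iff[OF assms(1)] by blast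
  then have "int p dvd poly (r\<^sup>2 * h - [:c:] * X * s1\<^sup>2) a"
    by (rule const_dvd_poly)
  then have "int p dvd (poly r a)\<^sup>2 * poly h a"
    by (simp add: X0)
  then have ra: "int p dvd poly r a"
    using assms(1,3) by (meson prime_dvd_mult_iff prime_dvd_power prime_nat_int_transfer)
  then have r1: "[:int p:] dvd r - X * r1"
    unfolding X_def r1_def by (rule divides_linear)
  show ?case
  proof (cases "degree r = 0")
    case True
    then obtain r0 where "r = [:r0:]"
      by (meson degree_eq_zeroE)
    then have "[:int p:] dvd r"
      using ra by simp
    moreover from this have "[:int p:] dvd [:c:] * s\<^sup>2"
      using D const_dvd_cong by (metis dvd_mult2 dvd_power power2_eq_square)
    then have "[:int p:] dvd s"
      using assms(1,2) by (metis const_dvd_mult_iff const_dvd_power const_poly_dvd_const_poly_iff)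
    ultimately show ?thesis
      by simp
  next
    case False
    have "[:int p:] dvd X * (r1\<^sup>2 * X * h - [:c:] * s1\<^sup>2)"
    proof -
      have "X * (r1\<^sup>2 * X * h - C * s1\<^sup>2)
        = (r\<^sup>2 * h - C * X * s1\<^sup>2) - h * (r + X * r1) * (r - X * r1)" for C
        by (simp add: power2_eq_square algebra_simps)
      from this[of "[:c:]"] show ?thesis
        using D1 r1 by (metis dvd_diff dvd_mult)
    qed
    then have "[:int p:] dvd r1\<^sup>2 * X * h - [:c:] * s1\<^sup>2"
      using pX const_dvd_mult_iff[OF assms(1)] by blast
    moreover have "degree r1 < degree r"
      using False by (simp add: r1_def degree_synthetic_div)
    ultimately have "[:int p:] dvd r1 \<and> [:int p:] dvd s1"
      using less.hyps[of r1 s1] by (simp add: X_def)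
    then show ?thesis
      using r1 s1 by (meson const_dvd_cong dvd_mult)
  qed
qed

text \<open>Membership in the ideal \<open>(p, x^n)\<close> of the integer polynomials.\<close>

definition low_dvd :: "nat \<Rightarrow> nat \<Rightarrow> int poly \<Rightarrow> bool" where
  "low_dvd p n P \<longleftrightarrow> (\<forall>i<n. int p dvd coeff P i)"

lemma low_dvd_mult: "low_dvd p n P \<Longrightarrow> low_dvd p n (P * Q)"
  unfolding low_dvd_def by (auto simp: coeff_mult intro!: dvd_sum dvd_mult2)

lemma low_dvd_add: "low_dvd p n P \<Longrightarrow> low_dvd p n Q \<Longrightarrow> low_dvd p n (P + Q)"
  by (auto simp: low_dvd_def)

lemma low_dvd_const: "[:int p:] dvd P \<Longrightarrow> low_dvd p n P"
  by (auto simp: low_dvd_def const_poly_dvd_iff)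

lemma low_dvd_imp_dvd: "low_dvd p n P \<Longrightarrow> degree P < n \<Longrightarrow> [:int p:] dvd P"
  unfolding low_dvd_def const_poly_dvd_iff by (metis coeff_eq_0 dvd_0_right not_less order_le_less_trans)

lemma frobenius_add:
  fixes P Q :: "int poly"
  assumes "prime p"
  shows "[:int p:] dvd (P + Q) ^ p - (P ^ p + Q ^ p)"
proof -
  have p0: "0 < p"
    using assms prime_gt_0_nat by blast
  have "(P + Q) ^ p = (\<Sum>k\<le>p. of_nat (p choose k) * P ^ k * Q ^ (p - k))"
    by (rule binomial_ring)
  also have "{..p} = insert 0 (insert p {0<..<p})"
    using p0 by auto
  also have "(\<Sum>k\<in>insert 0 (insert p {0<..<p}). of_nat (p choose k) * P ^ k * Q ^ (p - k))
      = Q ^ p + P ^ p + (\<Sum>k\<in>{0<..<p}. of_nat (p choose k) * P ^ k * Q ^ (p - k))"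
    using p0 by (simp add: add.assoc)
  finally have eq: "(P + Q) ^ p - (P ^ p + Q ^ p) = (\<Sum>k\<in>{0<..<p}. of_nat (p choose k) * P ^ k * Q ^ (p - k))"
    by simp
  have "[:int p:] dvd of_nat (p choose k) * P ^ k * Q ^ (p - k)" if "k \<in> {0<..<p}" for k
  proof -
    have "p dvd (p choose k)"
      using that assms by (intro dvd_choose_prime) auto
    then have "[:int p:] dvd [:int (p choose k):]"
      by simp
    then show ?thesis
      unfolding of_nat_poly by (intro dvd_mult2)
  qed
  then show ?thesis
    unfolding eq by (rule dvd_sum)
qed

lemma fermat_int:
  assumes "prime p"
  shows "int p dvd a ^ p - a"
proof -
  define b where "b = nat (a mod int p)"
  have p0: "0 < p"
    using assms prime_gt_0_nat by blast
  have "[b ^ p = b] (mod p)"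
  proof (cases "p dvd b")
    case True
    then show ?thesis
      using p0 by (metis cong_0_iff cong_sym cong_trans dvd_power dvd_trans)
  next
    case False
    then have "[b * b ^ (p - 1) = b * 1] (mod p)"
      by (intro cong_mult cong_refl fermat_theorem assms)
    then show ?thesis
      using p0 by (simp add: power_eq_if)
  qed
  then have "[int b ^ p = int b] (mod int p)"
    by (metis cong_int_iff of_nat_power)
  moreover have "[a = int b] (mod int p)"
    using p0 by (simp add: b_def cong_def)
  ultimately have "[a ^ p = a] (mod int p)"
    by (meson cong_pow cong_sym cong_trans)
  then show ?thesis
    by (simp add: cong_iff_dvd_diff)
qed

text \<open>For \<open>f = a + x q\<close> the Frobenius map gives \<open>a^p + x^p q^p\<close>
  modulo \<open>p\<close>, of which only \<open>a^p = a\<close> lies below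
  \<open>x^p\<close>.\<close>

lemma low_dvd_frobenius:
  assumes "prime p"
  shows "low_dvd p p (f ^ p - [:poly f 0:])"
proof -
  obtain a q where f: "f = pCons a q"
    by (cases f)
  have f': "f = [:a:] + monom 1 1 * q" and f0: "poly f 0 = a"
    by (simp_all add: f monom_Suc)
  have 1: "low_dvd p p (([:a:] + monom 1 1 * q) ^ p - ([:a:] ^ p + (monom 1 1 * q) ^ p))"
    by (intro low_dvd_const frobenius_add assms)
  have 2: "low_dvd p p ((monom 1 1 * q) ^ p)"
    by (auto simp: low_dvd_def power_mult_distrib monom_power coeff_monom_mult)
  have "int p dvd a ^ p - a"
    using assms by (rule fermat_int)
  then have 3: "low_dvd p p ([:a:] ^ p - [:a:])"
    by (intro low_dvd_const) (simp add: poly_const_pow)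
  have "f ^ p - [:poly f 0:] = (([:a:] + monom 1 1 * q) ^ p - ([:a:] ^ p + (monom 1 1 * q) ^ p))
     + (monom 1 1 * q) ^ p + ([:a:] ^ p - [:a:])"
    unfolding f0 unfolding f' by simp
  then show ?thesis
    using low_dvd_add[OF low_dvd_add[OF 1 2] 3] by simp
qed

text \<open>For the lowest \<open>k\<close>, the hypothesis gives \<open>r\<^sub>k + s\<^sub>k f^((p - 1)/2) = 0\<close> modulo \<open>(p, x^p)\<close>; squaring,
  multiplying by \<open>f\<close> and using \<open>f^p = f(0)\<close> modulo \<open>(p, x^p)\<close> gives \<open>r\<^sub>k\<^sup>2 f = f(0) s\<^sub>k\<^sup>2\<close>, where the degrees are
  small enough for this to hold modulo \<open>p\<close>.\<close>

lemma auxiliary_nonzero: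
  fixes r s :: "nat \<Rightarrow> int poly"
  assumes "prime p" "odd p" "f = [:-a, 1:] * h" "\<not> int p dvd poly h a" "\<not> int p dvd poly f 0"
    and deg: "\<And>j. j < J \<Longrightarrow> degree (r j) < d" "\<And>j. j < J \<Longrightarrow> degree (s j) < d"
    and d: "2 * d + degree f \<le> p + 1"
    and dvd: "[:int p:] dvd (\<Sum>j<J. monom 1 (p * j) * (r j + s j * f ^ ((p - 1) div 2)))"
  shows "k < J \<Longrightarrow> [:int p:] dvd r k \<and> [:int p:] dvd s k"
proof (induction k rule: less_induct)
  case (less k)
  define g where "g = f ^ ((p - 1) div 2)"
  \<comment> \<open>Compare coefficients of \<open>x^(p k + i)\<close> with \<open>i < p\<close>:
    the summands with \<open>j < k\<close> vanish modulo \<open>p\<close> by induction, and those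
    with \<open>j > k\<close> begin only at \<open>x^(p j)\<close>.\<close>
  have "low_dvd p p (r k + s k * g)"
    unfolding low_dvd_def
  proof (intro allI impI)
    fix i assume i: "i < p"
    have "int p dvd coeff (\<Sum>j<J. monom 1 (p * j) * (r j + s j * g)) (p * k + i)"
      using dvd unfolding g_def const_poly_dvd_iff by blast
    also have "coeff (\<Sum>j<J. monom 1 (p * j) * (r j + s j * g)) (p * k + i)
       = (\<Sum>j<J. coeff (monom 1 (p * j) * (r j + s j * g)) (p * k + i))"
      by (simp add: coeff_sum)
    also have "\<dots> = coeff (monom 1 (p * k) * (r k + s k * g)) (p * k + i)
        + (\<Sum>j\<in>{..<J} - {k}. coeff (monom 1 (p * j) * (r j + s j * g)) (p * k + i))"
      using less.prems by (simp add: sum.remove[of _ k])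
    finally have "int p dvd coeff (monom 1 (p * k) * (r k + s k * g)) (p * k + i)
        + (\<Sum>j\<in>{..<J} - {k}. coeff (monom 1 (p * j) * (r j + s j * g)) (p * k + i))" .
    moreover have "int p dvd coeff (monom 1 (p * j) * (r j + s j * g)) (p * k + i)"
      if "j \<in> {..<J} - {k}" for j
    proof (cases "j < k")
      case True
      then have "[:int p:] dvd r j" "[:int p:] dvd s j"
        using less.IH[of j] less.prems by auto
      then have "[:int p:] dvd monom 1 (p * j) * (r j + s j * g)"
        by (simp add: dvd_mult)
      then show ?thesis
        unfolding const_poly_dvd_iff by blast
    next
      case False
      then have "Suc k \<le> j"
        using that by auto
      then have "p * Suc k \<le> p * j"
        by (rule mult_le_mono2)
      then have "p * k + i < p * j"
        using i by simp
      then show ?thesis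
        by (simp add: coeff_monom_mult)
    qed
    then have "int p dvd (\<Sum>j\<in>{..<J} - {k}. coeff (monom 1 (p * j) * (r j + s j * g)) (p * k + i))"
      by (rule dvd_sum)
    ultimately have "int p dvd coeff (monom 1 (p * k) * (r k + s k * g)) (p * k + i)"
      by (simp add: dvd_add_left_iff)
    then show "int p dvd coeff (r k + s k * g) i"
      by (simp add: coeff_monom_mult)
  qed
  then have 1: "low_dvd p p ((r k + s k * g) * ((r k - s k * g) * f))"
    by (rule low_dvd_mult)
  have 2: "low_dvd p p ((f ^ p - [:poly f 0:]) * (s k)\<^sup>2)"
    by (intro low_dvd_mult low_dvd_frobenius assms)
  have fp: "f * (g * g) = f ^ p"
  proof -
    have "f * (g * g) = f ^ Suc ((p - 1) div 2 + (p - 1) div 2)"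
      by (simp add: g_def power_add)
    also have "Suc ((p - 1) div 2 + (p - 1) div 2) = p"
      using assms(2) by (elim oddE) simp
    finally show ?thesis .
  qed
  have "(r k + s k * g) * ((r k - s k * g) * f) + (f ^ p - C) * (s k)\<^sup>2
      = (r k)\<^sup>2 * f - C * (s k)\<^sup>2" for C
    unfolding fp[symmetric] by (simp add: power2_eq_square algebra_simps)
  then have low: "low_dvd p p ((r k)\<^sup>2 * f - [:poly f 0:] * (s k)\<^sup>2)"
    using low_dvd_add[OF 1 2] by metis
  \<comment> \<open>Both polynomials have degree at most \<open>d - 1\<close>, so everything has
    degree at most \<open>2 * d - 2 + degree f\<close>, which \<open>d\<close> keeps below
    \<open>p\<close>.\<close>
  have "degree ((r k)\<^sup>2 * f) \<le> 2 * degree (r k) + degree f"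
    using degree_mult_le[of "(r k)\<^sup>2" f] degree_power_le[of "r k" 2] by linarith
  moreover have "degree ([:poly f 0:] * (s k)\<^sup>2) \<le> 2 * degree (s k)"
    using degree_smult_le[of "poly f 0" "(s k)\<^sup>2"] degree_power_le[of "s k" 2] by simp
  ultimately have "degree ((r k)\<^sup>2 * f - [:poly f 0:] * (s k)\<^sup>2) < p"
    using degree_diff_le_max[of "(r k)\<^sup>2 * f" "[:poly f 0:] * (s k)\<^sup>2"] deg[OF less.prems] d
    by linarith
  with low have "[:int p:] dvd (r k)\<^sup>2 * f - [:poly f 0:] * (s k)\<^sup>2"
    by (rule low_dvd_imp_dvd)
  then have "[:int p:] dvd (r k)\<^sup>2 * [:-a, 1:] * h - [:poly f 0:] * (s k)\<^sup>2"
    by (subst (asm) assms(3)) (simp only: mult.assoc)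
  then show ?case
    by (rule square_descent[OF assms(1,5,4)])
qed

section \<open>Stepanov's auxiliary polynomial\<close>

lemma pderiv_sum: "pderiv (sum g A) = (\<Sum>i\<in>A. pderiv (g i))"
  by (induction A rule: infinite_finite_induct) (simp_all add: pderiv_add)

text \<open>Modulo \<open>p\<close> the \<open>l\<close>-th derivative of \<open>f^(L + e) x^(pj) u\<close> is \<open>f^(L - l + e) x^(pj)\<close> times this polynomial.\<close>

fun stepanov_coeff :: "int poly \<Rightarrow> nat \<Rightarrow> int \<Rightarrow> nat \<Rightarrow> int poly \<Rightarrow> int poly" where
  "stepanov_coeff f L e 0 u = u"
| "stepanov_coeff f L e (Suc l) u =
     f * pderiv (stepanov_coeff f L e l u) + smult (int (L - l) + e) (pderiv f * stepanov_coeff f L e l u)"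

lemma stepanov_coeff_diff:
  "stepanov_coeff f L e l (u - v) = stepanov_coeff f L e l u - stepanov_coeff f L e l v"
  by (induction l) (simp_all add: pderiv_diff right_diff_distrib smult_diff_right)

lemma degree_stepanov_coeff: "degree (stepanov_coeff f L e l u) \<le> degree u + l * degree f"
proof (induction l)
  case (Suc l)
  let ?v = "stepanov_coeff f L e l u"
  have "degree (f * pderiv ?v) \<le> degree f + degree ?v"
    by (rule order_trans[OF degree_mult_le]) (simp add: degree_pderiv)
  moreover have "degree (smult (int (L - l) + e) (pderiv f * ?v)) \<le> degree f + degree ?v"
    by (rule order_trans[OF degree_smult_le], rule order_trans[OF degree_mult_le]) (simp add: degree_pderiv)
  ultimately have "degree (stepanov_coeff f L e (Suc l) u) \<le> degree f + degree ?v"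
    by (simp add: degree_add_le)
  then show ?case
    using Suc by simp
qed simp

definition stepanov_sum :: "nat \<Rightarrow> int poly \<Rightarrow> nat \<Rightarrow> nat \<Rightarrow> (nat \<Rightarrow> int poly) \<Rightarrow> (nat \<Rightarrow> int poly) \<Rightarrow> int poly" where
  "stepanov_sum p f N J r s = (\<Sum>j<J. monom 1 (p * j) * (r j + s j * f ^ N))"

text \<open>Modulo \<open>p\<close> the monomials \<open>x^(p j)\<close> behave as constants under
  differentiation. The shift \<open>int N\<close> for the second family accounts for the factor
  \<open>f ^ N\<close> that it carries.\<close>

lemma pderiv_stepanov:
  fixes f :: "int poly"
  assumes "0 < N" "l < L"
  shows "[:int p:] dvd pderiv (f ^ (L - l) * stepanov_sum p f N J
            (\<lambda>j. stepanov_coeff f L 0 l (r j)) (\<lambda>j. stepanov_coeff f L (int N) l (s j)))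
     - f ^ (L - Suc l) * stepanov_sum p f N J
            (\<lambda>j. stepanov_coeff f L 0 (Suc l) (r j)) (\<lambda>j. stepanov_coeff f L (int N) (Suc l) (s j))"
proof -
  define c where "c = L - Suc l"
  have c: "L - l = Suc c"
    using assms(2) by (simp add: c_def)
  obtain n where N: "N = Suc n"
    using assms(1) gr0_implies_Suc by blast
  define u where "u j = stepanov_coeff f L 0 l (r j)" for j
  define v where "v j = stepanov_coeff f L (int N) l (s j)" for j
  define u' where "u' j = stepanov_coeff f L 0 (Suc l) (r j)" for j
  define v' where "v' j = stepanov_coeff f L (int N) (Suc l) (s j)" for j
  have u': "u' j = f * pderiv (u j) + smult (int (Suc c)) (pderiv f * u j)" for j
    by (simp add: u'_def u_def c)
  have v': "v' j = f * pderiv (v j) + smult (int (Suc c) + int N) (pderiv f * v j)" for j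
    by (simp add: v'_def v_def c)
  have "pderiv (f ^ Suc c * (monom 1 (p * j) * (u j + v j * f ^ N)))
      - f ^ c * (monom 1 (p * j) * (u' j + v' j * f ^ N))
     = f ^ Suc c * (pderiv (monom 1 (p * j)) * (u j + v j * f ^ N))" for j
    unfolding u' v' N pderiv_mult pderiv_add pderiv_power_Suc
    by (simp add: algebra_simps smult_add_left numeral_poly)
  moreover have "[:int p:] dvd pderiv (monom 1 (p * j))" for j
    by (auto simp: pderiv_monom const_poly_dvd_iff)
  ultimately have *: "[:int p:] dvd pderiv (f ^ Suc c * (monom 1 (p * j) * (u j + v j * f ^ N)))
      - f ^ c * (monom 1 (p * j) * (u' j + v' j * f ^ N))" for j
    by (simp add: dvd_mult)
  have "[:int p:] dvd (\<Sum>j<J. pderiv (f ^ Suc c * (monom 1 (p * j) * (u j + v j * f ^ N)))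
      - f ^ c * (monom 1 (p * j) * (u' j + v' j * f ^ N)))"
    by (rule dvd_sum) (rule *)
  then have "[:int p:] dvd pderiv (f ^ Suc c * stepanov_sum p f N J u v)
      - f ^ c * stepanov_sum p f N J u' v'"
    by (simp only: stepanov_sum_def sum_distrib_left sum_subtractf pderiv_sum)
  then show ?thesis
    unfolding c c_def[symmetric] by (simp only: u_def[abs_def] v_def[abs_def] u'_def[abs_def] v'_def[abs_def])
qed

lemma pderiv_dvd: "[:c:] dvd P \<Longrightarrow> [:c:] dvd pderiv (P :: int poly)"
proof (elim dvdE)
  fix k
  assume "P = [:c:] * k"
  then have "pderiv P = [:c:] * pderiv k"
    by (simp add: pderiv_smult)
  then show ?thesis
    by (rule dvdI)
qed

lemma pderiv_iter_stepanov:
  fixes f :: "int poly"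
  assumes "0 < N" "l \<le> L"
  shows "[:int p:] dvd (pderiv ^^ l) (f ^ L * stepanov_sum p f N J r s)
     - f ^ (L - l) * stepanov_sum p f N J
            (\<lambda>j. stepanov_coeff f L 0 l (r j)) (\<lambda>j. stepanov_coeff f L (int N) l (s j))"
  using assms(2)
proof (induction l)
  case 0
  then show ?case by simp
next
  case (Suc l)
  let ?A = "(pderiv ^^ l) (f ^ L * stepanov_sum p f N J r s)"
  let ?B = "f ^ (L - l) * stepanov_sum p f N J
            (\<lambda>j. stepanov_coeff f L 0 l (r j)) (\<lambda>j. stepanov_coeff f L (int N) l (s j))"
  have "[:int p:] dvd ?A - ?B"
    using Suc by simp
  then have "[:int p:] dvd pderiv ?A - pderiv ?B"
    by (metis pderiv_dvd pderiv_diff)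
  then show ?case
    using pderiv_stepanov[OF assms(1), of l L p f J r s] Suc.prems
    by (auto intro: const_dvd_trans)
qed

text \<open>At integers \<open>x^p\<close> agrees with \<open>x\<close> modulo \<open>p\<close>, so
  a polynomial of degree about \<open>p * J\<close> takes the values of one of degree about
  \<open>J\<close>. This collapse makes vanishing to high order cheap to impose.\<close>

lemma poly_stepanov_sum_cong:
  assumes "prime p" "[poly f x ^ N = a] (mod int p)"
  shows "[poly (stepanov_sum p f N J r s) x
      = poly (\<Sum>j<J. monom 1 j * (r j + smult a (s j))) x] (mod int p)"
proof -
  have x: "[x ^ (p * j) = x ^ j] (mod int p)" for j
  proof -
    have "[x ^ p = x] (mod int p)"
      using fermat_int[OF assms(1)] by (simp add: cong_iff_dvd_diff)
    then show ?thesis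
      by (simp add: power_mult cong_pow)
  qed
  have "[(\<Sum>j<J. x ^ (p * j) * (poly (r j) x + poly (s j) x * poly f x ^ N))
      = (\<Sum>j<J. x ^ j * (poly (r j) x + poly (s j) x * a))] (mod int p)"
    by (intro cong_sum cong_mult cong_add x assms(2) cong_refl)
  then show ?thesis
    by (simp add: stepanov_sum_def poly_sum poly_monom mult.commute)
qed

text \<open>There are \<open>2 * d * J\<close> free coefficients, while \<open>L\<close> derivatives
  with fewer than \<open>d + L * degree f + J\<close> coefficients each are to vanish;
  \<open>ineq\<close> leaves a nontrivial solution. The resulting polynomial vanishes to order
  \<open>L\<close> on \<open>S\<close>, and its degree bounds \<open>card S * L\<close>.\<close>

lemma stepanov_count:
  fixes f :: "int poly"
  assumes p: "prime p" "odd p" and f: "f = [:-b, 1:] * h" "\<not> int p dvd poly h b" "\<not> int p dvd poly f 0"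
    and d: "2 * d + degree f \<le> p + 1" and L: "L \<le> p"
    and ineq: "L * (d + L * degree f + J) < 2 * d * J"
    and S: "finite S" "\<And>x y. x \<in> S \<Longrightarrow> y \<in> S \<Longrightarrow> x \<noteq> y \<Longrightarrow> \<not> int p dvd x - y"
    and Sa: "\<And>x. x \<in> S \<Longrightarrow> [poly f x ^ ((p - 1) div 2) = a] (mod int p)"
  shows "card S * L \<le> L * degree f + p * (J - 1) + d + (p - 1) div 2 * degree f"
proof -
  define N where "N = (p - 1) div 2"
  have "p \<ge> 3"
    using p prime_ge_2_nat[of p] by (cases "p = 2") auto
  then have N: "0 < N"
    by (simp add: N_def)
  define m where "m = degree f"
  define I where "I = {..<J} \<times> {..<d} \<times> (UNIV :: bool set)"
  define C where "C = {..<L} \<times> {..<d + L * m + J}"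
  define pol where "pol w e j = (\<Sum>i<d. monom (w (j, i, e)) i)" for w :: "nat \<times> nat \<times> bool \<Rightarrow> int" and e j
  \<comment> \<open>The collapsed \<open>l\<close>-th derivative at points where
    \<open>f ^ N\<close> is \<open>a\<close>. Requiring all its coefficients to vanish modulo
    \<open>p\<close> is more than vanishing on \<open>S\<close>, but gives few conditions,
    independent of \<open>S\<close>.\<close>
  define H where "H w l = (\<Sum>j<J. monom 1 j *
     (stepanov_coeff f L 0 l (pol w False j) + smult a (stepanov_coeff f L (int N) l (pol w True j))))" for w l
  define \<Lambda> where "\<Lambda> w = (\<lambda>(l, i). coeff (H w l) i)" for w
  have pol_diff: "pol (\<lambda>i. u i - v i) e j = pol u e j - pol v e j" for u v e j
    by (simp add: pol_def sum_subtractf diff_monom[symmetric])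
  have H_diff: "H (\<lambda>i. u i - v i) l = H u l - H v l" for u v l
    unfolding H_def pol_diff stepanov_coeff_diff
    by (simp add: sum_subtractf[symmetric] algebra_simps smult_diff_right)
  have cI: "card I = 2 * d * J" and cC: "card C = L * (d + L * m + J)"
    by (simp_all add: I_def C_def card_cartesian_product card_UNIV_bool)
  obtain w where w: "\<exists>i\<in>I. \<not> int p dvd w i" "\<And>c. c \<in> C \<Longrightarrow> int p dvd \<Lambda> w c"
  proof (rule siegel_mod[of I C p \<Lambda>])
    show "finite I" "finite C"
      by (simp_all add: I_def C_def)
    show "card C < card I"
      unfolding cI cC m_def by (rule ineq)
    show "1 < p"
      using \<open>p \<ge> 3\<close> by simp
    show "\<Lambda> (\<lambda>i. u i - v i) c = \<Lambda> u c - \<Lambda> v c" for u v c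
      by (cases c) (simp add: \<Lambda>_def H_diff)
  qed blast
  define r where "r = pol w False"
  define s where "s = pol w True"
  have d0: "0 < d"
    using ineq by (cases d) auto
  have J0: "0 < J"
    using ineq by (cases J) auto
  have degpol: "degree (pol w e j) < d" for e j
  proof -
    have "degree (pol w e j) \<le> d - 1"
      unfolding pol_def
      by (rule degree_sum_le) (auto intro!: order_trans[OF degree_monom_le])
    then show ?thesis
      using d0 by simp
  qed
  have degH: "degree (H w l) < d + L * m + J" if "l < L" for l
  proof -
    have lm: "l * m \<le> L * m"
      using that by simp
    have 0: "degree (stepanov_coeff f L e l (pol w b j)) \<le> (d - 1) + L * m" for e b j
      using degree_stepanov_coeff[of f L e l "pol w b j"] degpol[of b j] lm unfolding m_def by linarith
    have "degree (stepanov_coeff f L 0 l (pol w False j) + smult a (stepanov_coeff f L (int N) l (pol w True j)))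
        \<le> (d - 1) + L * m" for j
      by (intro degree_add_le 0 order_trans[OF degree_smult_le])
    then have "degree (H w l) \<le> (J - 1) + ((d - 1) + L * m)"
      unfolding H_def
      by (intro degree_sum_le order_trans[OF degree_mult_le] add_mono order_trans[OF degree_monom_le]) auto
    then show ?thesis
      using d0 J0 by linarith
  qed
  have H: "[:int p:] dvd H w l" if "l < L" for l
  proof -
    have "int p dvd coeff (H w l) i" for i
    proof (cases "i < d + L * m + J")
      case True
      then show ?thesis
        using w(2)[of "(l, i)"] that by (simp add: C_def \<Lambda>_def)
    next
      case False
      then show ?thesis
        using degH[OF that] by (simp add: coeff_eq_0)
    qed
    then show ?thesis
      by (simp add: const_poly_dvd_iff)
  qed
  \<comment> \<open>With the factor \<open>f ^ L\<close> each differentiation takes one power of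
    \<open>f\<close> from both families alike, so the shape of \<open>stepanov_sum\<close>
    persists.\<close>
  define R where "R = f ^ L * stepanov_sum p f N J r s"
  have "\<not> [:int p:] dvd R"
  proof
    assume "[:int p:] dvd R"
    moreover have "\<not> [:int p:] dvd f"
      using f(3) const_dvd_poly by blast
    ultimately have "[:int p:] dvd stepanov_sum p f N J r s"
      unfolding R_def using p(1) const_dvd_mult_iff const_dvd_power by blast
    then have "[:int p:] dvd (\<Sum>j<J. monom 1 (p * j) * (r j + s j * f ^ ((p - 1) div 2)))"
      by (simp add: stepanov_sum_def N_def)
    then have *: "[:int p:] dvd pol w False j \<and> [:int p:] dvd pol w True j" if "j < J" for j
      using auxiliary_nonzero[OF p f _ _ d, of J r s j] degpol that by (simp add: r_def s_def)
    obtain j i e where jie: "j < J" "i < d" "\<not> int p dvd w (j, i, e)"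
      using w(1) unfolding I_def by auto
    have "[:int p:] dvd pol w e j"
      using *[OF jie(1)] by (cases e) auto
    then have "int p dvd coeff (pol w e j) i"
      by (simp add: const_poly_dvd_iff)
    moreover have "coeff (pol w e j) i = w (j, i, e)"
      using jie(2) by (simp add: pol_def coeff_sum)
    ultimately show False
      using jie(3) by simp
  qed
  moreover have "int p dvd poly ((pderiv ^^ l) R) x" if "x \<in> S" "l < L" for x l
  proof -
    let ?r = "\<lambda>j. stepanov_coeff f L 0 l (r j)"
    let ?s = "\<lambda>j. stepanov_coeff f L (int N) l (s j)"
    have "[:int p:] dvd (pderiv ^^ l) R - f ^ (L - l) * stepanov_sum p f N J ?r ?s"
      unfolding R_def using pderiv_iter_stepanov[OF N] that by simp
    then have "int p dvd poly ((pderiv ^^ l) R - f ^ (L - l) * stepanov_sum p f N J ?r ?s) x"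
      by (rule const_dvd_poly)
    moreover have "int p dvd poly (stepanov_sum p f N J ?r ?s) x"
    proof -
      have "[poly (stepanov_sum p f N J ?r ?s) x = poly (H w l) x] (mod int p)"
        unfolding H_def r_def s_def
        using poly_stepanov_sum_cong[OF p(1), of f x N a J] Sa[OF that(1)] by (simp add: N_def)
      moreover have "int p dvd poly (H w l) x"
        by (intro const_dvd_poly H that)
      ultimately show ?thesis
        by (metis cong_dvd_iff)
    qed
    ultimately show ?thesis
      by (simp add: dvd_diff_left_iff)
  qed
  ultimately have "card S * L \<le> degree R"
    by (intro mult_roots_bound[OF p(1) S(1) S(2) L]) auto
  also have "degree R \<le> L * m + (p * (J - 1) + (d + N * m))"
  proof -
    have fN: "degree (f ^ n) \<le> n * m" for n
      using degree_power_le[of f n] by (simp add: m_def mult.commute)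
    have "degree (r j) \<le> d + N * m" for j
      using degpol[of False j] by (simp add: r_def)
    moreover have "degree (s j * f ^ N) \<le> d + N * m" for j
      using degpol[of True j] fN[of N] degree_mult_le[of "s j" "f ^ N"] by (simp add: s_def)
    ultimately have "degree (r j + s j * f ^ N) \<le> d + N * m" for j
      by (rule degree_add_le)
    then have "degree (stepanov_sum p f N J r s) \<le> p * (J - 1) + (d + N * m)"
      unfolding stepanov_sum_def
      by (intro degree_sum_le order_trans[OF degree_mult_le] add_mono order_trans[OF degree_monom_le]) auto
    then show ?thesis
      unfolding R_def using degree_mult_le[of "f ^ L" "stepanov_sum p f N J r s"] fN[of L] by linarith
  qed
  finally show ?thesis
    by (simp add: m_def N_def)
qed

section \<open>The Legendre symbol and its complete sums over products\<close>

lemma Legendre_cong: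
  assumes "[a = b] (mod p)"
  shows "Legendre a p = Legendre b p"
proof -
  have "[y = a] (mod p) \<longleftrightarrow> [y = b] (mod p)" "[a = y] (mod p) \<longleftrightarrow> [b = y] (mod p)" for y
    using assms by (meson cong_sym cong_trans)+
  then show ?thesis
    by (simp add: Legendre_def QuadRes_def)
qed

lemma abs_real_Legendre_le: "\<bar>real_of_int (Legendre a p)\<bar> \<le> 1"
  by (auto simp: Legendre_def)

lemma finite_residues_filter: "finite {x \<in> {0..<int p}. Q x}"
  by (rule finite_subset[of _ "{0..<int p}"]) auto

lemma Legendre_range: "Legendre a p \<in> {-1, 0, 1}"
  by (auto simp: Legendre_def)

lemma Legendre_eq_0_iff: "Legendre a p = 0 \<longleftrightarrow> p dvd a"
  by (auto simp: Legendre_def cong_0_iff)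

lemma small_cong_imp_eq:
  fixes x y :: int
  assumes "2 < p" "x \<in> {-1, 0, 1}" "y \<in> {-1, 0, 1}" "[x = y] (mod int p)"
  shows "x = y"
proof -
  have "int p dvd x - y"
    using assms(4) by (simp add: cong_iff_dvd_diff)
  then have "x - y = 0 \<or> int p \<le> \<bar>x - y\<bar>"
    by (metis abs_dvd_iff dvd_imp_le_int abs_of_nat dvd_abs_iff)
  then show ?thesis
    using assms(1-3) by auto
qed

lemma euler_Legendre:
  assumes "prime p" "odd p"
  shows "[Legendre a (int p) = a ^ ((p - 1) div 2)] (mod int p)"
proof -
  have "2 < p"
    using assms prime_ge_2_nat[of p] by (cases "p = 2") auto
  then show ?thesis
    using euler_criterion assms(1) by blast
qed

lemma Legendre_mult:
  assumes "prime p" "odd p"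
  shows "Legendre (a * b) (int p) = Legendre a (int p) * Legendre b (int p)"
proof (rule small_cong_imp_eq)
  show "2 < p"
    using assms prime_ge_2_nat[of p] by (cases "p = 2") auto
  show "Legendre (a * b) (int p) \<in> {-1, 0, 1}"
    by (rule Legendre_range)
  show "Legendre a (int p) * Legendre b (int p) \<in> {-1, 0, 1}"
    using Legendre_range[of a "int p"] Legendre_range[of b "int p"] by auto
  have "[Legendre (a * b) (int p) = a ^ ((p - 1) div 2) * b ^ ((p - 1) div 2)] (mod int p)"
    using euler_Legendre[OF assms, of "a * b"] by (simp add: power_mult_distrib)
  moreover have "[Legendre a (int p) * Legendre b (int p) = a ^ ((p - 1) div 2) * b ^ ((p - 1) div 2)] (mod int p)"
    by (intro cong_mult euler_Legendre assms)
  ultimately show "[Legendre (a * b) (int p) = Legendre a (int p) * Legendre b (int p)] (mod int p)"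
    by (meson cong_sym cong_trans)
qed

lemma Legendre_1: "1 < p \<Longrightarrow> Legendre 1 p = 1"
  unfolding Legendre_def QuadRes_def
  by (auto simp: cong_0_iff zdvd_not_zless intro!: exI[of _ 1])

lemma Legendre_prod:
  assumes "prime p" "odd p"
  shows "Legendre (\<Prod>i\<in>A. g i) (int p) = (\<Prod>i\<in>A. Legendre (g i) (int p))"
  using prime_gt_1_nat[OF assms(1)]
  by (induction A rule: infinite_finite_induct) (simp_all add: Legendre_mult[OF assms] Legendre_1)

lemma sum_residues_shift:
  fixes g :: "int \<Rightarrow> 'b :: comm_monoid_add"
  assumes "0 < p" "\<And>x y. [x = y] (mod p) \<Longrightarrow> g x = g y"
  shows "(\<Sum>x\<in>{0..<p}. g (x + s)) = (\<Sum>x\<in>{0..<p}. g x)"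
proof (rule sum.reindex_bij_witness[where i = "\<lambda>y. (y - s) mod p" and j = "\<lambda>x. (x + s) mod p"])
  fix x assume x: "x \<in> {0..<p}"
  show "((x + s) mod p - s) mod p = x"
    using x by (simp add: mod_diff_left_eq)
  show "(x + s) mod p \<in> {0..<p}"
    using assms(1) by simp
  show "g ((x + s) mod p) = g (x + s)"
    by (rule assms(2)) (simp add: cong_def)
next
  fix x assume x: "x \<in> {0..<p}"
  show "((x - s) mod p + s) mod p = x"
    using x by (simp add: mod_add_left_eq)
  show "(x - s) mod p \<in> {0..<p}"
    using assms(1) by simp
qed

lemma sum_int_eq_nat: "(\<Sum>k<p. g (int k)) = (\<Sum>x\<in>{0..<int p}. g x)"
  by (rule sum.reindex_bij_witness[where i = nat and j = int]) auto

text \<open>Stepanov's parameters with \<open>m = card A\<close>: vanishing order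
  \<open>2 * l\<close>, \<open>J = l + 1\<close> and \<open>d\<close> about
  \<open>(p - m) / 2\<close>. The degree is then \<open>p * l\<close> up to terms of order
  \<open>p * m\<close>, and division by \<open>2 * l\<close> leaves \<open>p / 2\<close> with a
  relative error of order \<open>m / l\<close>.\<close>

lemma stepanov_level_count:
  fixes A :: "int set"
  assumes p: "prime p" "odd p" and A: "finite A" "a0 \<in> A"
    "\<And>a b. a \<in> A \<Longrightarrow> b \<in> A \<Longrightarrow> a \<noteq> b \<Longrightarrow> \<not> int p dvd a - b" "\<And>a. a \<in> A \<Longrightarrow> \<not> int p dvd a"
    and l: "1 \<le> l" "(2 * l)\<^sup>2 * (card A + 2) + card A < p"
  shows "real (card {x \<in> {0..<int p}. Legendre (\<Prod>a\<in>A. x - a) (int p) = e})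
      \<le> real p / 2 + real (card A) + real p * (real (card A) + 1) / (2 * real l)" (is "real (card ?S) \<le> _")
proof -
  define m where "m = card A"
  define f where "f = (\<Prod>a\<in>A. [:-a, 1:])"
  define h where "h = (\<Prod>a\<in>A - {a0}. [:-a, 1:])"
  define d where "d = (p + 1 - m) div 2"
  have f: "f = [:-a0, 1:] * h"
    unfolding f_def h_def using A by (simp add: prod.remove)
  have prod_nd: "\<not> int p dvd (\<Prod>a\<in>B. g a)" if "B \<subseteq> A" "\<And>a. a \<in> B \<Longrightarrow> \<not> int p dvd g a" for B g
    using that finite_subset[OF that(1) A(1)] p(1) by (auto simp: prime_dvd_prod_iff)
  have "poly h a0 = (\<Prod>a\<in>A - {a0}. a0 - a)"
    by (simp add: h_def poly_prod)
  then have h0: "\<not> int p dvd poly h a0"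
    using prod_nd[of "A - {a0}" "\<lambda>a. a0 - a"] A by force
  have "poly f 0 = (\<Prod>a\<in>A. - a)"
    by (simp add: f_def poly_prod)
  then have f0: "\<not> int p dvd poly f 0"
    using prod_nd[of A uminus] A by simp
  have degf: "degree f = m"
    unfolding f_def m_def by (subst degree_prod_eq_sum_degree) auto
  have mp: "m < p"
    using l by (simp add: m_def)
  have "(2 * l)\<^sup>2 \<ge> 2 * l"
    using l(1) by (simp add: power2_eq_square)
  then have lp: "2 * l \<le> p"
    using l(2) by (simp add: algebra_simps)
  \<comment> \<open>After cancelling \<open>2 * d * l\<close> the claim is that
    \<open>2 * d\<close>, at least \<open>p - m\<close>, exceeds
    \<open>2 * l * (2 * l * m + l + 1)\<close>; the second part of \<open>l\<close> is designed for
    this.\<close>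
  have "2 * l * (d + 2 * l * m + (l + 1)) < 2 * d * (l + 1)"
  proof -
    have "2 * l * (l + 1) \<le> 2 * l * (2 * l)"
      using l(1) by (intro mult_left_mono) auto
    then have "2 * l * (2 * l * m) + 2 * l * (l + 1) \<le> (2 * l)\<^sup>2 * (m + 1)"
      by (simp add: power2_eq_square algebra_simps)
    also have "\<dots> \<le> (2 * l)\<^sup>2 * (m + 2)"
      by simp
    also have "\<dots> < p - m"
      using l(2) by (simp add: m_def)
    also have "p - m \<le> 2 * d"
      by (simp add: d_def)
    finally show ?thesis
      by (simp add: algebra_simps)
  qed
  then have ineq: "2 * l * (d + 2 * l * degree f + (l + 1)) < 2 * d * (l + 1)"
    by (simp add: degf)
  have d2: "2 * d + degree f \<le> p + 1"
    using mp by (simp add: d_def degf)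
  have "card ?S * (2 * l) \<le> 2 * l * degree f + p * (l + 1 - 1) + d + (p - 1) div 2 * degree f"
  proof (rule stepanov_count[OF p f h0 f0 d2 lp ineq])
    show "finite ?S"
      by (rule finite_residues_filter)
    show "\<not> int p dvd x - y" if "x \<in> ?S" "y \<in> ?S" "x \<noteq> y" for x y
      using that by (metis (no_types, lifting) atLeastLessThan_iff mem_Collect_eq mod_eq_dvd_iff mod_pos_pos_trivial)
    show "[poly f x ^ ((p - 1) div 2) = e] (mod int p)" if "x \<in> ?S" for x
      using that euler_Legendre[OF p, of "poly f x"] by (auto simp: f_def poly_prod cong_sym)
  qed
  then have "real (card ?S * (2 * l)) \<le> real (2 * l * m + p * l + d + (p - 1) div 2 * m)"
    unfolding degf by (simp only: of_nat_le_iff) simp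
  also have "\<dots> \<le> 2 * real l * real m + real p * real l + real p + real p * real m"
  proof -
    have "d \<le> p"
      using mp prime_gt_0_nat[OF p(1)] by (simp add: d_def)
    moreover have "(p - 1) div 2 * m \<le> p * m"
      by (intro mult_right_mono) auto
    ultimately have "2 * l * m + p * l + d + (p - 1) div 2 * m \<le> 2 * l * m + p * l + p + p * m"
      by linarith
    then have "real (2 * l * m + p * l + d + (p - 1) div 2 * m) \<le> real (2 * l * m + p * l + p + p * m)"
      by (simp only: of_nat_le_iff)
    then show ?thesis
      by simp
  qed
  finally have "real (card ?S) * (2 * real l) \<le> 2 * real l * real m + real p * real l + real p + real p * real m"
    by simp
  then show ?thesis
    using l(1) by (simp add: field_simps m_def)
qed

lemma card_residue_class_le_1:
  "card {x \<in> {0..<int p}. int p dvd x - a} \<le> 1"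
proof -
  have "x = y" if "x \<in> {0..<int p}" "int p dvd x - a" "y \<in> {0..<int p}" "int p dvd y - a" for x y
  proof -
    have "int p dvd x - y"
      using dvd_diff[OF that(2,4)] by simp
    then show ?thesis
      using that(1,3) by (metis atLeastLessThan_iff mod_eq_dvd_iff mod_pos_pos_trivial)
  qed
  then show ?thesis
    unfolding One_nat_def by (subst card_le_Suc0_iff_eq[OF finite_residues_filter]) blast
qed

text \<open>Both sign classes have at most \<open>p / 2 + E\<close> elements, and together they miss
  at most \<open>card A\<close> residues; so each is bounded below as well. The sum is the
  difference of their cardinalities.\<close>

lemma Legendre_prod_sum_bound_aux:
  fixes A :: "int set"
  assumes p: "prime p" "odd p" and A: "finite A" "a0 \<in> A"
    "\<And>a b. a \<in> A \<Longrightarrow> b \<in> A \<Longrightarrow> a \<noteq> b \<Longrightarrow> \<not> int p dvd a - b" "\<And>a. a \<in> A \<Longrightarrow> \<not> int p dvd a"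
    and l: "1 \<le> l" "(2 * l)\<^sup>2 * (card A + 2) + card A < p"
  shows "\<bar>\<Sum>x\<in>{0..<int p}. real_of_int (Legendre (\<Prod>a\<in>A. x - a) (int p))\<bar>
      \<le> 3 * real (card A) + real p * (real (card A) + 1) / real l"
proof -
  define S where "S e = {x \<in> {0..<int p}. Legendre (\<Prod>a\<in>A. x - a) (int p) = e}" for e
  define E where "E = real (card A) + real p * (real (card A) + 1) / (2 * real l)"
  have fin: "finite (S e)" for e
    unfolding S_def by (rule finite_residues_filter)
  have b: "real (card (S e)) \<le> real p / 2 + E" for e
    unfolding S_def E_def using stepanov_level_count[OF p A l, of e] by simp
  have S0: "card (S 0) \<le> card A"
  proof -
    have "S 0 \<subseteq> (\<Union>a\<in>A. {x \<in> {0..<int p}. int p dvd x - a})"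
      using p(1) A(1) by (auto simp: S_def Legendre_eq_0_iff prime_dvd_prod_iff)
    then have "card (S 0) \<le> card (\<Union>a\<in>A. {x \<in> {0..<int p}. int p dvd x - a})"
      using A(1) by (intro card_mono finite_UN_I finite_residues_filter)
    also have "\<dots> \<le> (\<Sum>a\<in>A. card {x \<in> {0..<int p}. int p dvd x - a})"
      using A(1) by (rule card_UN_le)
    also have "\<dots> \<le> (\<Sum>a\<in>A. 1)"
      by (intro sum_mono card_residue_class_le_1)
    finally show ?thesis
      by simp
  qed
  have part: "{0..<int p} = S 1 \<union> (S (-1) \<union> S 0)"
    using Legendre_range by (fastforce simp: S_def)
  have dis: "S 1 \<inter> (S (-1) \<union> S 0) = {}" "S (-1) \<inter> S 0 = {}"
    by (auto simp: S_def)
  have "card {0..<int p} = card (S 1) + (card (S (-1)) + card (S 0))"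
    unfolding part using dis fin by (simp add: card_Un_disjoint)
  then have cp: "real p = real (card (S 1)) + real (card (S (-1))) + real (card (S 0))"
    by simp
  have "(\<Sum>x\<in>S e. real_of_int (Legendre (\<Prod>a\<in>A. x - a) (int p))) = real (card (S e)) * real_of_int e" for e
    by (simp add: S_def)
  then have "(\<Sum>x\<in>{0..<int p}. real_of_int (Legendre (\<Prod>a\<in>A. x - a) (int p)))
      = real (card (S 1)) - real (card (S (-1)))"
    unfolding part using dis fin by (simp add: sum.union_disjoint)
  also have "\<bar>\<dots>\<bar> \<le> 2 * E + real (card A)"
    using b[of 1] b[of "-1"] cp S0 by linarith
  also have "\<dots> = 3 * real (card A) + real p * (real (card A) + 1) / real l"
    using l(1) by (simp add: E_def field_simps)
  finally show ?thesis .
qed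

lemma Legendre_prod_sum_bound:
  fixes A :: "int set"
  assumes p: "prime p" "odd p" and A: "finite A" "A \<noteq> {}"
    "\<And>a b. a \<in> A \<Longrightarrow> b \<in> A \<Longrightarrow> a \<noteq> b \<Longrightarrow> \<not> int p dvd a - b"
  shows "\<bar>\<Sum>k<p. \<Prod>a\<in>A. real_of_int (Legendre (int k - a) (int p))\<bar>
      \<le> (11 * real (card A) + 8) * real p powr (3/4)"
proof -
  define m where "m = card A"
  define P where "P = real p powr (1/4)"
  have p0: "0 < p" and p1: "1 \<le> real p"
    using prime_gt_0_nat[OF p(1)] by auto
  have P1: "1 \<le> P"
    unfolding P_def using p1 by (simp add: ge_one_powr_ge_zero)
  have P4: "P ^ 4 = real p" and P3: "P ^ 3 = real p powr (3/4)"
    unfolding P_def using p0 by (simp_all add: powr_power)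
  have eq: "(\<Prod>a\<in>A. real_of_int (Legendre (x - a) (int p)))
      = real_of_int (Legendre (\<Prod>a\<in>A. x - a) (int p))" for x
    by (simp add: Legendre_prod[OF p])
  show ?thesis
  proof (cases "P < 2 * real m + 4")
    case True
    have "\<bar>\<Sum>k<p. \<Prod>a\<in>A. real_of_int (Legendre (int k - a) (int p))\<bar> \<le> (\<Sum>k<p. 1)"
      unfolding eq by (intro order_trans[OF sum_abs] sum_mono abs_real_Legendre_le)
    also have "\<dots> = P * P ^ 3"
      using P4 by (simp add: power_eq_if)
    also have "\<dots> \<le> (11 * real m + 8) * P ^ 3"
      using True P1 by (intro mult_right_mono) auto
    finally show ?thesis
      by (simp add: P3 m_def)
  next
    case False
    \<comment> \<open>Half of \<open>p^(1/4)\<close>. Here \<open>P\<close> is at least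
      \<open>4\<close>, so rounding down leaves at least \<open>P / 4\<close>.\<close>
    define l where "l = nat \<lfloor>P / 2\<rfloor>"
    have l_le: "real l \<le> P / 2" and l_ge: "P / 4 \<le> real l" "1 \<le> l"
    proof -
      show "real l \<le> P / 2"
        unfolding l_def using P1 by linarith
      have "P / 2 - 1 \<le> real l"
        unfolding l_def by linarith
      then show "P / 4 \<le> real l" "1 \<le> l"
        using False by linarith+
    qed
    have "real ((2 * l)\<^sup>2 * (m + 2) + m) < real p"
    proof -
      have "(2 * real l)\<^sup>2 \<le> P\<^sup>2"
        using l_le by (intro power_mono) auto
      then have "(2 * real l)\<^sup>2 * (real m + 2) + real m \<le> P\<^sup>2 * (real m + 2) + P\<^sup>2 * real m"
        using P1 by (intro add_mono mult_right_mono) (auto simp: mult_le_cancel_right1)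
      also have "\<dots> = P\<^sup>2 * (2 * real m + 2)"
        by (simp add: algebra_simps)
      also have "\<dots> < P\<^sup>2 * P\<^sup>2"
      proof (intro mult_strict_left_mono)
        have "P * 1 \<le> P\<^sup>2"
          unfolding power2_eq_square using P1 by (intro mult_left_mono) auto
        then show "2 * real m + 2 < P\<^sup>2"
          using False by linarith
      qed (use P1 in auto)
      also have "\<dots> = real p"
        using P4 by simp
      finally show ?thesis
        by (simp add: power_mult_distrib algebra_simps)
    qed
    then have l2: "(2 * l)\<^sup>2 * (m + 2) + m < p"
      by (simp only: of_nat_less_iff)
    \<comment> \<open>Stepanov's argument wants the constant term of the product to be a unit modulo
      \<open>p\<close>. A translation by some \<open>s\<close> avoiding the negatives of
      \<open>A\<close> achieves this and does not change the complete sum; it exists because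
      \<open>card A < p\<close>.\<close>
    obtain s where s: "\<And>a. a \<in> A \<Longrightarrow> \<not> int p dvd a + s"
    proof -
      have "card ((\<lambda>a. (- a) mod int p) ` A) \<le> m"
        unfolding m_def using A(1) by (rule card_image_le)
      also have "m < card {0..<int p}"
        using l2 by simp
      finally have "\<not> {0..<int p} \<subseteq> (\<lambda>a. (- a) mod int p) ` A"
        using A(1) by (metis card_mono finite_imageI not_le)
      then obtain s where s: "s \<in> {0..<int p}" "s \<notin> (\<lambda>a. (- a) mod int p) ` A"
        using subsetI by metis
      have "\<not> int p dvd a + s" if "a \<in> A" for a
      proof
        assume "int p dvd a + s"
        then have "int p dvd s - (- a)"
          by (simp add: add.commute)
        then have "s mod int p = (- a) mod int p"
          by (simp add: mod_eq_dvd_iff)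
        then have "s = (- a) mod int p"
          using s(1) by simp
        then show False
          using s(2) that by blast
      qed
      then show ?thesis
        by (rule that)
    qed
    define A' where "A' = (\<lambda>a. a + s) ` A"
    have cA': "card A' = m"
      by (simp add: A'_def m_def card_image)
    obtain a0 where a0: "a0 \<in> A'"
      using A(2) by (auto simp: A'_def)
    have "\<bar>\<Sum>x\<in>{0..<int p}. real_of_int (Legendre (\<Prod>a\<in>A'. x - a) (int p))\<bar>
        \<le> 3 * real (card A') + real p * (real (card A') + 1) / real l"
    proof (rule Legendre_prod_sum_bound_aux[OF p _ a0 _ _ l_ge(2)])
      show "finite A'"
        using A(1) by (simp add: A'_def)
      show "\<not> int p dvd a - b" if "a \<in> A'" "b \<in> A'" "a \<noteq> b" for a b
        using that A(3) by (auto simp: A'_def)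
      show "\<not> int p dvd a" if "a \<in> A'" for a
        using that s by (auto simp: A'_def)
      show "(2 * l)\<^sup>2 * (card A' + 2) + card A' < p"
        unfolding cA' by (rule l2)
    qed
    also have "(\<Sum>x\<in>{0..<int p}. real_of_int (Legendre (\<Prod>a\<in>A'. x - a) (int p)))
      = (\<Sum>x\<in>{0..<int p}. real_of_int (Legendre (\<Prod>a\<in>A. (x + - s) - a) (int p)))"
      unfolding A'_def by (simp add: prod.reindex algebra_simps)
    also have "\<dots> = (\<Sum>x\<in>{0..<int p}. real_of_int (Legendre (\<Prod>a\<in>A. x - a) (int p)))"
    proof (rule sum_residues_shift)
      show "0 < int p"
        using p0 by simp
      show "real_of_int (Legendre (\<Prod>a\<in>A. x - a) (int p)) = real_of_int (Legendre (\<Prod>a\<in>A. y - a) (int p))"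
        if "[x = y] (mod int p)" for x y
        by (intro arg_cong[where f = real_of_int] Legendre_cong cong_prod cong_diff that cong_refl)
    qed
    also have "\<dots> = (\<Sum>k<p. \<Prod>a\<in>A. real_of_int (Legendre (int k - a) (int p)))"
      unfolding eq by (rule sum_int_eq_nat[symmetric])
    also have "3 * real (card A') + real p * (real (card A') + 1) / real l \<le> (11 * real m + 8) * P ^ 3"
    proof -
      have "real p * (real m + 1) / real l \<le> real p * (real m + 1) / (P / 4)"
        using l_ge P1 by (intro divide_left_mono) auto
      also have "\<dots> = 4 * (real m + 1) * P ^ 3"
        using P1 unfolding P4[symmetric] by (simp add: field_simps power_eq_if)
      finally have 1: "real p * (real m + 1) / real l \<le> 4 * (real m + 1) * P ^ 3" .
      have 2: "3 * real m \<le> 3 * (real m * P ^ 3)"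
        using P1 one_le_power[OF P1, of 3] by (simp add: mult_le_cancel_left1)
      have 3: "0 \<le> real m * P ^ 3" "0 \<le> P ^ 3"
        using P1 by auto
      show ?thesis
      proof -
        have "4 * (real m + 1) * P ^ 3 = 4 * (real m * P ^ 3) + 4 * P ^ 3"
          "(11 * real m + 8) * P ^ 3 = 11 * (real m * P ^ 3) + 8 * P ^ 3"
          by (simp_all add: algebra_simps)
        then show ?thesis
          unfolding cA' using 1 2 3 by linarith
      qed
    qed
    finally show ?thesis
      by (simp add: P3 m_def)
  qed
qed

section \<open>Averages of products of Legendre symbols\<close>

definition chi :: "nat \<Rightarrow> int \<Rightarrow> real" where
  "chi p x = real_of_int (Legendre x (int p))"

lemma abs_chi_le: "\<bar>chi p x\<bar> \<le> 1"
  unfolding chi_def by (rule abs_real_Legendre_le)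

lemma chi_cases: "chi p x = 0 \<or> chi p x = 1 \<or> chi p x = -1"
  by (auto simp: chi_def Legendre_def)

lemma chi_eq_0_iff: "chi p x = 0 \<longleftrightarrow> int p dvd x"
  by (simp add: chi_def Legendre_eq_0_iff)

lemma chi_cong: "[x = y] (mod int p) \<Longrightarrow> chi p x = chi p y"
  unfolding chi_def by (metis Legendre_cong)

section \<open>Means over independent signs\<close>

definition signs :: "'i set \<Rightarrow> ('i \<Rightarrow> real) set" where
  "signs W = (\<Pi>\<^sub>E j\<in>W. {-1, 1})"

definition sign_avg :: "'i set \<Rightarrow> (('i \<Rightarrow> real) \<Rightarrow> real) \<Rightarrow> real" where
  "sign_avg W \<Phi> = (\<Sum>\<epsilon>\<in>signs W. \<Phi> \<epsilon>) / 2 ^ card W"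

lemma finite_signs: "finite W \<Longrightarrow> finite (signs W)"
  unfolding signs_def by (intro finite_PiE) auto

lemma card_signs: "finite W \<Longrightarrow> card (signs W) = 2 ^ card W"
  unfolding signs_def by (simp add: card_PiE numeral_2_eq_2)

lemma signs_cases: "\<epsilon> \<in> signs W \<Longrightarrow> j \<in> W \<Longrightarrow> \<epsilon> j = -1 \<or> \<epsilon> j = 1"
  unfolding signs_def by (auto simp: PiE_iff)

lemma sign_avg_prod:
  assumes "finite W"
  shows "sign_avg W (\<lambda>\<epsilon>. \<Prod>j\<in>W. g j (\<epsilon> j)) = (\<Prod>j\<in>W. (g j (-1) + g j 1) / 2)"
proof -
  have "(\<Prod>j\<in>W. \<Sum>y\<in>{-1, 1}. g j y / 2) = (\<Sum>\<epsilon>\<in>signs W. \<Prod>j\<in>W. g j (\<epsilon> j) / 2)"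
    unfolding signs_def using assms by (intro prod_sum_PiE) auto
  then show ?thesis
    by (simp add: sign_avg_def prod_dividef sum_divide_distrib add_divide_distrib)
qed

lemma sign_avg_mono:
  "(\<And>\<epsilon>. \<epsilon> \<in> signs W \<Longrightarrow> \<Phi> \<epsilon> \<le> \<Psi> \<epsilon>) \<Longrightarrow> sign_avg W \<Phi> \<le> sign_avg W \<Psi>"
  unfolding sign_avg_def by (intro divide_right_mono sum_mono) auto

lemma sign_avg_add: "sign_avg W (\<lambda>\<epsilon>. \<Phi> \<epsilon> + \<Psi> \<epsilon>) = sign_avg W \<Phi> + sign_avg W \<Psi>"
  by (simp add: sign_avg_def sum.distrib add_divide_distrib)

lemma sign_avg_cmult: "sign_avg W (\<lambda>\<epsilon>. c * \<Phi> \<epsilon>) = c * sign_avg W \<Phi>"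
  by (simp add: sign_avg_def sum_distrib_left)

lemma sign_avg_sum: "sign_avg W (\<lambda>\<epsilon>. \<Sum>f\<in>F. \<Phi> f \<epsilon>) = (\<Sum>f\<in>F. sign_avg W (\<Phi> f))"
  unfolding sign_avg_def by (subst sum.swap) (simp add: sum_divide_distrib)

lemma two_power_fact_le: "2 ^ n * fact n \<le> (fact (2 * n) :: nat)"
proof (induction n)
  case (Suc n)
  have "2 ^ Suc n * fact (Suc n) = 2 * Suc n * (2 ^ n * fact n)"
    by (simp add: algebra_simps)
  also have "\<dots> \<le> 2 * Suc n * fact (2 * n)"
    using Suc by (rule mult_left_mono) simp
  also have "\<dots> \<le> (2 * Suc n) * (Suc (2 * n) * fact (2 * n))"
    by (intro mult_left_mono) auto
  also have "\<dots> = fact (2 * Suc n)"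
    by (simp add: algebra_simps)
  finally show ?case .
qed simp

text \<open>A termwise comparison of power series: \<open>(2n)!\<close> is at least
  \<open>2^n n!\<close>.\<close>

lemma cosh_le_exp_half_square: "cosh x \<le> exp (x\<^sup>2 / 2 :: real)"
proof (rule sums_le)
  show "(\<lambda>n. x ^ (2 * n) /\<^sub>R fact (2 * n)) sums cosh x"
  proof -
    have "strict_mono ((*) (2::nat))"
      by (auto simp: strict_mono_def)
    moreover have "(if even n then x ^ n /\<^sub>R fact n else 0) = 0" if "n \<notin> range ((*) 2)" for n
      using that by (metis evenE rangeI)
    ultimately have "(\<lambda>n. if even (2 * n) then x ^ (2 * n) /\<^sub>R fact (2 * n) else 0) sums cosh x"
      by (subst sums_mono_reindex[where f = "\<lambda>n. if even n then x ^ n /\<^sub>R fact n else 0"])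
        (simp_all only: cosh_converges)
    then show ?thesis
      by simp
  qed
  show "(\<lambda>n. (x\<^sup>2 / 2) ^ n /\<^sub>R fact n) sums exp (x\<^sup>2 / 2)"
    by (rule exp_converges)
  fix n
  have "(2 ^ n * fact n :: real) \<le> fact (2 * n)"
  proof -
    have "real (2 ^ n * fact n) \<le> real (fact (2 * n))"
      by (simp only: of_nat_le_iff two_power_fact_le)
    then show ?thesis
      by simp
  qed
  moreover define y where "y = (x\<^sup>2) ^ n"
  moreover have "x ^ (2 * n) = y" "0 \<le> y"
    by (simp_all add: y_def power_mult)
  ultimately have "y / fact (2 * n) \<le> y / (2 ^ n * fact n)"
    by (intro divide_left_mono) auto
  then show "x ^ (2 * n) /\<^sub>R fact (2 * n) \<le> (x\<^sup>2 / 2) ^ n /\<^sub>R fact n"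
    unfolding \<open>x ^ (2 * n) = y\<close> power_divide y_def[symmetric] by (simp add: divide_inverse ac_simps)
qed

lemma even_power_le_fact_exp: "(x::real) ^ (2 * r) \<le> fact (2 * r) * (exp x + exp (- x))"
proof -
  have *: "y ^ n / fact n \<le> exp y" if "0 \<le> y" for y :: real and n
  proof -
    have "(\<Sum>i\<in>{n}. y ^ i /\<^sub>R fact i) \<le> (\<Sum>i. y ^ i /\<^sub>R fact i)"
      using that by (intro sum_le_suminf summable_exp_generic) auto
    then show ?thesis
      by (simp add: exp_def divide_inverse mult.commute)
  qed
  have "x ^ (2 * r) = \<bar>x\<bar> ^ (2 * r)"
    by (simp add: power_mult)
  also have "\<dots> \<le> fact (2 * r) * exp \<bar>x\<bar>"
    using *[of "\<bar>x\<bar>" "2 * r"] by (simp add: field_simps)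
  also have "\<dots> \<le> fact (2 * r) * (exp x + exp (- x))"
    by (intro mult_left_mono) (auto simp: abs_if)
  finally show ?thesis .
qed

text \<open>The sub-Gaussian argument: if the squares of the coefficients sum to at most 1, the
  exponential moment is at most \<open>exp (1/2)\<close>, hence at most \<open>2\<close>, and an
  even power is at most \<open>fact (2 * r)\<close> times a sum of two exponentials. The general
  case follows by scaling.\<close>

lemma khintchine:
  fixes b :: "'i \<Rightarrow> real"
  assumes W: "finite W"
  shows "sign_avg W (\<lambda>\<epsilon>. (\<Sum>j\<in>W. b j * \<epsilon> j) ^ (2 * r)) \<le> 4 * fact (2 * r) * (\<Sum>j\<in>W. (b j)\<^sup>2) ^ r"
proof -
  have E: "sign_avg W (\<lambda>\<epsilon>. exp (\<Sum>j\<in>W. c j * \<epsilon> j)) \<le> exp ((\<Sum>j\<in>W. (c j)\<^sup>2) / 2)" for c :: "'i \<Rightarrow> real"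
  proof -
    have "sign_avg W (\<lambda>\<epsilon>. exp (\<Sum>j\<in>W. c j * \<epsilon> j)) = (\<Prod>j\<in>W. cosh (c j))"
      using sign_avg_prod[OF W, of "\<lambda>j e. exp (c j * e)"] W
      by (simp add: exp_sum cosh_field_def add.commute)
    also have "\<dots> \<le> (\<Prod>j\<in>W. exp ((c j)\<^sup>2 / 2))"
      by (intro prod_mono) (auto simp: cosh_le_exp_half_square)
    finally show ?thesis
      using W by (simp add: exp_sum sum_divide_distrib)
  qed
  have N: "sign_avg W (\<lambda>\<epsilon>. (\<Sum>j\<in>W. c j * \<epsilon> j) ^ (2 * r)) \<le> 4 * fact (2 * r)"
    if "(\<Sum>j\<in>W. (c j)\<^sup>2) \<le> 1" for c :: "'i \<Rightarrow> real"
  proof -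
    have "sign_avg W (\<lambda>\<epsilon>. (\<Sum>j\<in>W. c j * \<epsilon> j) ^ (2 * r))
        \<le> sign_avg W (\<lambda>\<epsilon>. fact (2 * r) * (exp (\<Sum>j\<in>W. c j * \<epsilon> j) + exp (\<Sum>j\<in>W. (- c j) * \<epsilon> j)))"
      by (rule sign_avg_mono) (use even_power_le_fact_exp in \<open>simp add: sum_negf\<close>)
    also have "\<dots> = fact (2 * r) * (sign_avg W (\<lambda>\<epsilon>. exp (\<Sum>j\<in>W. c j * \<epsilon> j))
        + sign_avg W (\<lambda>\<epsilon>. exp (\<Sum>j\<in>W. (- c j) * \<epsilon> j)))"
      by (simp only: sign_avg_cmult sign_avg_add)
    also have "\<dots> \<le> fact (2 * r) * (exp (1/2) + exp (1/2))"
      using E[of c] E[of "\<lambda>j. - c j"] that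
      by (intro mult_left_mono add_mono) (auto elim!: order_trans)
    also have "\<dots> \<le> fact (2 * r) * 4"
    proof -
      have "exp (1/2) \<le> (2::real)"
        using exp_bound[of "1/2"] by (simp add: power2_eq_square)
      then show ?thesis
        by (intro mult_left_mono) auto
    qed
    finally show ?thesis
      by (simp add: mult.commute)
  qed
  define v where "v = (\<Sum>j\<in>W. (b j)\<^sup>2)"
  have v0: "0 \<le> v"
    unfolding v_def by (rule sum_nonneg) simp
  show ?thesis
  proof (cases "v = 0")
    case True
    then have "b j = 0" if "j \<in> W" for j
      using that W unfolding v_def by (simp add: sum_nonneg_eq_0_iff)
    then have "sign_avg W (\<lambda>\<epsilon>. (\<Sum>j\<in>W. b j * \<epsilon> j) ^ (2 * r)) = 0 ^ (2 * r)"
      using W by (simp add: sign_avg_def card_signs)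
    also have "\<dots> \<le> 4 * fact (2 * r) * v ^ r"
      by (cases r) (auto simp: True)
    finally show ?thesis
      by (simp add: v_def)
  next
    case False
    then have vp: "0 < v"
      using v0 by simp
    define c where "c j = b j / sqrt v" for j
    have "(\<Sum>j\<in>W. (c j)\<^sup>2) = 1"
      using vp by (simp add: c_def power_divide sum_divide_distrib[symmetric] v_def[symmetric])
    then have "sign_avg W (\<lambda>\<epsilon>. (\<Sum>j\<in>W. c j * \<epsilon> j) ^ (2 * r)) \<le> 4 * fact (2 * r)"
      by (intro N) simp
    moreover have "(\<Sum>j\<in>W. b j * \<epsilon> j) ^ (2 * r) = v ^ r * (\<Sum>j\<in>W. c j * \<epsilon> j) ^ (2 * r)" for \<epsilon>
    proof -
      have "(\<Sum>j\<in>W. b j * \<epsilon> j) = sqrt v * (\<Sum>j\<in>W. c j * \<epsilon> j)"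
        unfolding sum_distrib_left using vp by (intro sum.cong) (auto simp: c_def)
      moreover have "sqrt v ^ (2 * r) = v ^ r"
        using vp by (simp add: power_mult)
      ultimately show ?thesis
        by (simp add: power_mult_distrib)
    qed
    ultimately show ?thesis
      unfolding v_def[symmetric] using vp by (simp add: sign_avg_cmult mult.commute)
  qed
qed

lemma prod_tuple_multiplicity:
  assumes "finite W" "f ` {..<n::nat} \<subseteq> W"
  shows "(\<Prod>i<n. g (f i)) = (\<Prod>j\<in>W. g j ^ card {i \<in> {..<n}. f i = j})"
proof -
  have "(\<Prod>i<n. g (f i)) = (\<Prod>j\<in>W. \<Prod>i\<in>{i \<in> {..<n}. f i = j}. g (f i))"
    using prod.group[of "{..<n}" W f "\<lambda>i. g (f i)"] assms by simp
  also have "\<dots> = (\<Prod>j\<in>W. \<Prod>i\<in>{i \<in> {..<n}. f i = j}. g j)"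
    by (intro prod.cong refl) auto
  finally show ?thesis
    by simp
qed

section \<open>Means over the residues modulo p\<close>

definition Eavg :: "nat \<Rightarrow> (int \<Rightarrow> real) \<Rightarrow> real" where
  "Eavg p \<Phi> = (\<Sum>k<p. \<Phi> (int k)) / real p"

lemma Eavg_mono: "(\<And>k. \<Phi> k \<le> \<Psi> k) \<Longrightarrow> Eavg p \<Phi> \<le> Eavg p \<Psi>"
  unfolding Eavg_def by (intro divide_right_mono sum_mono) auto

lemma Eavg_mono': "(\<And>k. k < p \<Longrightarrow> \<Phi> (int k) \<le> \<Psi> (int k)) \<Longrightarrow> Eavg p \<Phi> \<le> Eavg p \<Psi>"
  unfolding Eavg_def by (intro divide_right_mono sum_mono) auto

lemma Eavg_add: "Eavg p (\<lambda>k. \<Phi> k + \<Psi> k) = Eavg p \<Phi> + Eavg p \<Psi>"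
  by (simp add: Eavg_def sum.distrib add_divide_distrib)

lemma Eavg_diff: "Eavg p (\<lambda>k. \<Phi> k - \<Psi> k) = Eavg p \<Phi> - Eavg p \<Psi>"
  by (simp add: Eavg_def sum_subtractf diff_divide_distrib)

lemma Eavg_cmult: "Eavg p (\<lambda>k. c * \<Phi> k) = c * Eavg p \<Phi>"
  by (simp add: Eavg_def sum_distrib_left)

lemma Eavg_const: "0 < p \<Longrightarrow> Eavg p (\<lambda>k. c) = c"
  by (simp add: Eavg_def)

lemma Eavg_sum: "Eavg p (\<lambda>k. \<Sum>f\<in>F. \<Phi> f k) = (\<Sum>f\<in>F. Eavg p (\<Phi> f))"
  unfolding Eavg_def by (subst sum.swap) (simp add: sum_divide_distrib)

lemma abs_Eavg_le: "\<bar>Eavg p \<Phi>\<bar> \<le> Eavg p (\<lambda>k. \<bar>\<Phi> k\<bar>)"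
  unfolding Eavg_def by (simp add: divide_right_mono)

text \<open>A union bound. It disposes of the few \<open>k\<close> at which one of the symbols is
  \<open>0\<close> and the symbols are not signs.\<close>

lemma Eavg_hit_bound:
  assumes "finite B" "0 < p"
  shows "Eavg p (\<lambda>k. of_bool (\<exists>a\<in>B. int p dvd k - a)) \<le> real (card B) / real p"
proof -
  have "(\<Sum>x\<in>{0..<int p}. of_bool (\<exists>a\<in>B. int p dvd x - a) :: real)
      \<le> (\<Sum>x\<in>{0..<int p}. \<Sum>a\<in>B. of_bool (int p dvd x - a))"
  proof (intro sum_mono)
    fix x
    show "(of_bool (\<exists>a\<in>B. int p dvd x - a) :: real) \<le> (\<Sum>a\<in>B. of_bool (int p dvd x - a))"
    proof (cases "\<exists>a\<in>B. int p dvd x - a")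
      case True
      then obtain a where "a \<in> B" "int p dvd x - a"
        by blast
      then have "(\<Sum>a\<in>{a}. of_bool (int p dvd x - a) :: real) \<le> (\<Sum>a\<in>B. of_bool (int p dvd x - a))"
        using assms(1) by (intro sum_mono2) auto
      then show ?thesis
        using True \<open>int p dvd x - a\<close> by simp
    qed (auto intro!: sum_nonneg)
  qed
  also have "\<dots> = (\<Sum>a\<in>B. real (card {x \<in> {0..<int p}. int p dvd x - a}))"
    by (subst sum.swap) (simp add: of_bool_def sum.If_cases Int_def conj_commute)
  also have "\<dots> \<le> (\<Sum>a\<in>B. 1)"
    using card_residue_class_le_1 by (intro sum_mono) (metis of_nat_1 of_nat_le_iff)
  finally have "(\<Sum>k<p. of_bool (\<exists>a\<in>B. int p dvd int k - a) :: real) \<le> real (card B)"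
    by (subst sum_int_eq_nat) simp
  then show ?thesis
    unfolding Eavg_def by (rule divide_right_mono) simp
qed

definition incong :: "nat \<Rightarrow> int set \<Rightarrow> bool" where
  "incong p W \<longleftrightarrow> (\<forall>a\<in>W. \<forall>b\<in>W. a \<noteq> b \<longrightarrow> \<not> int p dvd a - b)"

lemma incong_subset: "incong p W \<Longrightarrow> A \<subseteq> W \<Longrightarrow> incong p A"
  by (auto simp: incong_def)

lemma Eavg_chi_prod_bound:
  assumes p: "prime p" "odd p" and A: "finite A" "A \<noteq> {}" "incong p A"
  shows "\<bar>Eavg p (\<lambda>k. \<Prod>a\<in>A. chi p (k - a))\<bar> \<le> (11 * real (card A) + 8) * real p powr (- 1/4)"
proof -
  have "\<bar>\<Sum>k<p. \<Prod>a\<in>A. chi p (int k - a)\<bar> \<le> (11 * real (card A) + 8) * real p powr (3/4)"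
    unfolding chi_def using A(3) by (intro Legendre_prod_sum_bound p A) (auto simp: incong_def)
  then have "\<bar>Eavg p (\<lambda>k. \<Prod>a\<in>A. chi p (k - a))\<bar> \<le> (11 * real (card A) + 8) * real p powr (3/4) / real p"
    by (simp add: Eavg_def divide_right_mono)
  also have "\<dots> = (11 * real (card A) + 8) * real p powr (- 1/4)"
    using prime_gt_0_nat[OF p(1)] powr_diff[of "real p" "3/4" 1] by simp
  finally show ?thesis .
qed

lemma chi_power: "chi p x \<noteq> 0 \<Longrightarrow> chi p x ^ n = (if even n then 1 else chi p x)"
  using chi_cases[of p x] by auto

text \<open>Repeated factors cancel in pairs, apart from the zeros of the symbols. If all
  multiplicities are even, the sign average is \<open>1\<close> and dominates trivially; otherwise
  it is \<open>0\<close>, and the factors of odd multiplicity form a character sum with distinct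
  shifts. Keeping the sign average as main term is what allows a sum over tuples to be
  reassembled.\<close>

lemma Eavg_chi_tuple:
  assumes p: "prime p" "odd p" and W: "finite W" "incong p W" and f: "f ` {..<n} \<subseteq> W"
  shows "\<bar>Eavg p (\<lambda>k. \<Prod>i<n. chi p (k - f i))\<bar>
      \<le> sign_avg W (\<lambda>\<epsilon>. \<Prod>i<n. \<epsilon> (f i)) + (12 * real n + 8) * real p powr (- 1/4)"
proof -
  define m where "m j = card {i \<in> {..<n}. f i = j}" for j
  define Od where "Od = {j \<in> W. odd (m j)}"
  have p0: "0 < p"
    using p prime_gt_0_nat by blast
  have avg: "sign_avg W (\<lambda>\<epsilon>. \<Prod>i<n. \<epsilon> (f i)) = (\<Prod>j\<in>W. ((-1) ^ m j + 1) / 2)"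
    unfolding prod_tuple_multiplicity[OF W(1) f] m_def[symmetric]
    using sign_avg_prod[OF W(1), of "\<lambda>j e. e ^ m j"] by simp
  have prod_le: "\<bar>\<Prod>i\<in>B. chi p (g i)\<bar> \<le> 1" for B :: "'c set" and g
    unfolding abs_prod by (intro prod_le_1) (auto simp: abs_chi_le)
  show ?thesis
  proof (cases "Od = {}")
    case True
    then have "even (m j)" if "j \<in> W" for j
      using that by (auto simp: Od_def)
    then have "sign_avg W (\<lambda>\<epsilon>. \<Prod>i<n. \<epsilon> (f i)) = 1"
      unfolding avg by (intro prod.neutral) auto
    moreover have "\<bar>Eavg p (\<lambda>k. \<Prod>i<n. chi p (k - f i))\<bar> \<le> 1"
    proof -
      have "Eavg p (\<lambda>k. \<bar>\<Prod>i<n. chi p (k - f i)\<bar>) \<le> Eavg p (\<lambda>k. 1)"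
        by (rule Eavg_mono) (rule prod_le)
      then show ?thesis
        using abs_Eavg_le[of p "\<lambda>k. \<Prod>i<n. chi p (k - f i)"] Eavg_const[OF p0, of 1] by linarith
    qed
    ultimately show ?thesis
      by (simp add: add_increasing2)
  next
    case False
    then have avg0: "sign_avg W (\<lambda>\<epsilon>. \<Prod>i<n. \<epsilon> (f i)) = 0"
      unfolding avg using W(1) by (auto simp: Od_def intro!: prod_zero bexI)
    define B where "B = f ` {..<n}"
    have finB: "finite B" and cB: "card B \<le> n"
      using card_image_le[of "{..<n}" f] by (auto simp: B_def)
    have OdB: "Od \<subseteq> B"
    proof
      fix j assume "j \<in> Od"
      then have "m j \<noteq> 0"
        by (auto simp: Od_def dest: odd_pos)
      then have "{i \<in> {..<n}. f i = j} \<noteq> {}"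
        by (auto simp: m_def)
      then show "j \<in> B"
        by (auto simp: B_def)
    qed
    have finOd: "finite Od" and cOd: "card Od \<le> n"
      using OdB finB cB card_mono[OF finB OdB] finite_subset by auto
    have diff: "\<bar>(\<Prod>i<n. chi p (k - f i)) - (\<Prod>a\<in>Od. chi p (k - a))\<bar>
        \<le> of_bool (\<exists>a\<in>B. int p dvd k - a)" for k
    proof (cases "\<exists>a\<in>B. int p dvd k - a")
      case True
      then obtain i where "i < n" "int p dvd k - f i"
        by (auto simp: B_def)
      then have "chi p (k - f i) = 0"
        by (simp add: chi_eq_0_iff)
      then have z: "(\<Prod>i<n. chi p (k - f i)) = 0"
        using \<open>i < n\<close> by (intro prod_zero) auto
      show ?thesis
        unfolding z using True prod_le[of "\<lambda>a. k - a" Od] by simp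
    next
      case False
      have "(\<Prod>i<n. chi p (k - f i)) = (\<Prod>j\<in>W. chi p (k - j) ^ m j)"
        unfolding m_def using prod_tuple_multiplicity[OF W(1) f, of "\<lambda>j. chi p (k - j)"] by simp
      also have "\<dots> = (\<Prod>j\<in>W. if odd (m j) then chi p (k - j) else 1)"
      proof (intro prod.cong refl)
        fix j assume "j \<in> W"
        show "chi p (k - j) ^ m j = (if odd (m j) then chi p (k - j) else 1)"
        proof (cases "j \<in> B")
          case True
          then have "chi p (k - j) \<noteq> 0"
            using False by (auto simp: chi_eq_0_iff)
          then show ?thesis
            by (simp add: chi_power)
        next
          case False
          then have "{i \<in> {..<n}. f i = j} = {}"
            by (auto simp: B_def)
          then have "m j = 0"
            by (simp add: m_def)
          then show ?thesis
            by simp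
        qed
      qed
      also have "\<dots> = (\<Prod>a\<in>Od. chi p (k - a))"
        unfolding Od_def using W(1) by (rule prod.inter_filter[symmetric])
      finally show ?thesis
        by simp
    qed
    have "\<bar>Eavg p (\<lambda>k. (\<Prod>i<n. chi p (k - f i)) - (\<Prod>a\<in>Od. chi p (k - a)))\<bar>
        \<le> Eavg p (\<lambda>k. of_bool (\<exists>a\<in>B. int p dvd k - a))"
      by (rule order_trans[OF abs_Eavg_le Eavg_mono[OF diff]])
    also have "\<dots> \<le> real (card B) / real p"
      by (rule Eavg_hit_bound[OF finB p0])
    also have "\<dots> \<le> real n * real p powr (- 1/4)"
    proof -
      have "1 / real p = real p powr (- 1)"
        using p0 by (simp add: powr_minus_divide)
      also have "\<dots> \<le> real p powr (- 1/4)"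
        using p0 by (intro powr_mono) auto
      finally have "real (card B) * (1 / real p) \<le> real n * real p powr (- 1/4)"
        using cB by (intro mult_mono) auto
      then show ?thesis
        by simp
    qed
    finally have 1: "\<bar>Eavg p (\<lambda>k. \<Prod>i<n. chi p (k - f i)) - Eavg p (\<lambda>k. \<Prod>a\<in>Od. chi p (k - a))\<bar>
      \<le> real n * real p powr (- 1/4)"
      by (simp add: Eavg_diff)
    have "\<bar>Eavg p (\<lambda>k. \<Prod>a\<in>Od. chi p (k - a))\<bar> \<le> (11 * real (card Od) + 8) * real p powr (- 1/4)"
      using W(2) by (intro Eavg_chi_prod_bound p finOd False) (auto intro: incong_subset simp: Od_def)
    also have "\<dots> \<le> (11 * real n + 8) * real p powr (- 1/4)"
      using cOd by (intro mult_right_mono) auto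
    finally show ?thesis
      unfolding avg0 using 1 by (simp add: algebra_simps)
  qed
qed

lemma power_sum_tuples:
  fixes a :: "'i \<Rightarrow> real"
  assumes "finite W"
  shows "(\<Sum>j\<in>W. a j) ^ n = (\<Sum>f\<in>(\<Pi>\<^sub>E i\<in>{..<n}. W). \<Prod>i<n. a (f i))"
proof -
  have "(\<Prod>i<n. \<Sum>j\<in>W. a j) = (\<Sum>f\<in>(\<Pi>\<^sub>E i\<in>{..<n}. W). \<Prod>i<n. a (f i))"
    using assms by (intro prod_sum_PiE) auto
  then show ?thesis
    by simp
qed

text \<open>Expand into tuples, bound each by its sign average plus an error, and sum back with
  \<open>\<bar>b j\<bar>\<close> in place of \<open>b j\<close>: the main term is the moment of a
  Rademacher sum, and the error is multiplied by the absolute sum of the coefficients to the power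
  \<open>2 * r\<close>.\<close>

lemma Eavg_chi_moment:
  fixes b :: "int \<Rightarrow> real"
  assumes p: "prime p" "odd p" and W: "finite W" "incong p W"
  shows "Eavg p (\<lambda>k. (\<Sum>j\<in>W. b j * chi p (k - j)) ^ (2 * r))
      \<le> 4 * fact (2 * r) * (\<Sum>j\<in>W. (b j)\<^sup>2) ^ r
        + (24 * real r + 8) * real p powr (- 1/4) * (\<Sum>j\<in>W. \<bar>b j\<bar>) ^ (2 * r)"
proof -
  define n where "n = 2 * r"
  define F where "F = (\<Pi>\<^sub>E i\<in>{..<n}. W)"
  define C where "C = (12 * real n + 8) * real p powr (- 1/4)"
  have "Eavg p (\<lambda>k. (\<Sum>j\<in>W. b j * chi p (k - j)) ^ n)
      = (\<Sum>f\<in>F. (\<Prod>i<n. b (f i)) * Eavg p (\<lambda>k. \<Prod>i<n. chi p (k - f i)))"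
    unfolding power_sum_tuples[OF W(1)] F_def by (simp add: Eavg_sum prod.distrib Eavg_cmult)
  also have "\<dots> \<le> (\<Sum>f\<in>F. (\<Prod>i<n. \<bar>b (f i)\<bar>) * (sign_avg W (\<lambda>\<epsilon>. \<Prod>i<n. \<epsilon> (f i)) + C))"
  proof (intro sum_mono)
    fix f assume "f \<in> F"
    then have f: "f ` {..<n} \<subseteq> W"
      by (auto simp: F_def)
    have "(\<Prod>i<n. b (f i)) * Eavg p (\<lambda>k. \<Prod>i<n. chi p (k - f i))
        \<le> \<bar>\<Prod>i<n. b (f i)\<bar> * \<bar>Eavg p (\<lambda>k. \<Prod>i<n. chi p (k - f i))\<bar>"
      by (metis abs_ge_self abs_mult)
    also have "\<dots> \<le> (\<Prod>i<n. \<bar>b (f i)\<bar>) * (sign_avg W (\<lambda>\<epsilon>. \<Prod>i<n. \<epsilon> (f i)) + C)"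
      unfolding C_def abs_prod by (intro mult_left_mono Eavg_chi_tuple p W f prod_nonneg) auto
    finally show "(\<Prod>i<n. b (f i)) * Eavg p (\<lambda>k. \<Prod>i<n. chi p (k - f i))
        \<le> (\<Prod>i<n. \<bar>b (f i)\<bar>) * (sign_avg W (\<lambda>\<epsilon>. \<Prod>i<n. \<epsilon> (f i)) + C)" .
  qed
  also have "\<dots> = sign_avg W (\<lambda>\<epsilon>. \<Sum>f\<in>F. \<Prod>i<n. \<bar>b (f i)\<bar> * \<epsilon> (f i)) + C * (\<Sum>f\<in>F. \<Prod>i<n. \<bar>b (f i)\<bar>)"
    by (simp add: sign_avg_sum prod.distrib sign_avg_cmult sum.distrib distrib_left sum_distrib_left mult.commute[of C])
  also have "\<dots> = sign_avg W (\<lambda>\<epsilon>. (\<Sum>j\<in>W. \<bar>b j\<bar> * \<epsilon> j) ^ n) + C * (\<Sum>j\<in>W. \<bar>b j\<bar>) ^ n"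
    unfolding power_sum_tuples[OF W(1)] F_def ..
  also have "\<dots> \<le> 4 * fact (2 * r) * (\<Sum>j\<in>W. (\<bar>b j\<bar>)\<^sup>2) ^ r + C * (\<Sum>j\<in>W. \<bar>b j\<bar>) ^ n"
    unfolding n_def by (intro add_right_mono khintchine W)
  finally show ?thesis
    by (simp add: n_def C_def)
qed

section \<open>Limits along the primes\<close>

lemma eventually_primes_at_top:
  "eventually P primes_at_top \<longleftrightarrow> (\<exists>N. \<forall>p\<ge>N. prime p \<longrightarrow> P p)"
  by (simp add: primes_at_top_def eventually_inf_principal eventually_at_top_linorder)

lemma primes_at_top_neq_bot: "primes_at_top \<noteq> bot"
proof -
  have "\<exists>p\<ge>N. prime p" for N :: nat
    using bigger_prime[of N] by (auto intro: less_imp_le)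
  then show ?thesis
    unfolding trivial_limit_def eventually_primes_at_top by auto
qed

lemma eventually_odd_prime: "\<forall>\<^sub>F p in primes_at_top. prime p \<and> odd p \<and> N \<le> p"
  unfolding eventually_primes_at_top
proof (rule exI[of _ "max 3 N"], intro allI impI)
  fix p :: nat assume "max 3 N \<le> p" "prime p"
  then show "prime p \<and> odd p \<and> N \<le> p"
    using prime_odd_nat[of p] by auto
qed

lemma primes_at_top_le_at_top: "primes_at_top \<le> at_top"
  by (simp add: primes_at_top_def)

lemma tendsto_primes_at_top: "(f \<longlongrightarrow> l) at_top \<Longrightarrow> (f \<longlongrightarrow> l) primes_at_top"
  using primes_at_top_le_at_top tendsto_mono by blast

lemma incong_interval:
  assumes "W \<subseteq> {- h..h}" "2 * h < int p"
  shows "incong p W"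
  unfolding incong_def
proof (intro ballI impI)
  fix a b assume "a \<in> W" "b \<in> W" "a \<noteq> b"
  then have "a \<in> {- h..h}" "b \<in> {- h..h}" "a - b \<noteq> 0"
    using assms(1) by auto
  then have "\<bar>a - b\<bar> \<le> 2 * h" "a - b \<noteq> 0"
    by auto
  then show "\<not> int p dvd a - b"
    using assms(2) dvd_imp_le_int[of "a - b" "int p"] by linarith
qed

lemma eventually_incong:
  assumes "finite W"
  shows "\<forall>\<^sub>F p in primes_at_top. incong p W"
proof -
  define h where "h = Max (insert 0 (abs ` W))"
  have "\<bar>x\<bar> \<le> h" if "x \<in> W" for x
    unfolding h_def using assms that by (intro Max_ge) auto
  then have "W \<subseteq> {- h..h}"
    by (fastforce simp: abs_le_iff)
  have "0 \<le> h"
    unfolding h_def using assms by (intro Max_ge) auto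
  have "\<forall>\<^sub>F p in primes_at_top. prime p \<and> odd p \<and> nat (2 * h + 1) \<le> p"
    by (rule eventually_odd_prime)
  then show ?thesis
    by eventually_elim (rule incong_interval[OF \<open>W \<subseteq> {- h..h}\<close>], use \<open>0 \<le> h\<close> in linarith)
qed

lemma power_quarter_tendsto_0: "((\<lambda>p. c * real p powr (- 1/4)) \<longlongrightarrow> 0) primes_at_top"
proof -
  have "((\<lambda>p. real p powr (- (1/4))) \<longlongrightarrow> 0) at_top"
    by (intro tendsto_neg_powr filterlim_real_sequentially) auto
  then have "((\<lambda>p. c * real p powr (- 1/4)) \<longlongrightarrow> c * 0) at_top"
    by (intro tendsto_mult tendsto_const) simp
  then show ?thesis
    by (intro tendsto_primes_at_top) simp
qed

lemma Eavg_chi_prod_tendsto: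
  assumes "finite A"
  shows "((\<lambda>p. Eavg p (\<lambda>k. \<Prod>a\<in>A. chi p (k - a))) \<longlongrightarrow> of_bool (A = {})) primes_at_top"
proof (cases "A = {}")
  case True
  have "\<forall>\<^sub>F p in primes_at_top. 1 = Eavg p (\<lambda>k. \<Prod>a\<in>A. chi p (k - a))"
    using eventually_odd_prime[of 1] by eventually_elim (simp add: True Eavg_const)
  then show ?thesis
    using True tendsto_cong[of "\<lambda>p. 1"] by fastforce
next
  case False
  have "((\<lambda>p. Eavg p (\<lambda>k. \<Prod>a\<in>A. chi p (k - a))) \<longlongrightarrow> 0) primes_at_top"
  proof (rule Lim_null_comparison)
    show "\<forall>\<^sub>F p in primes_at_top. norm (Eavg p (\<lambda>k. \<Prod>a\<in>A. chi p (k - a)))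
        \<le> (11 * real (card A) + 8) * real p powr (- 1/4)"
      using eventually_odd_prime[of 1] eventually_incong[OF assms]
      by eventually_elim (use Eavg_chi_prod_bound assms False in simp)
  qed (rule power_quarter_tendsto_0)
  then show ?thesis
    using False by simp
qed

text \<open>On sign vectors \<open>\<Phi>\<close> agrees with the multilinear polynomial
  \<open>Q\<close>. Its monomials average to character sums, all of which tend to \<open>0\<close>
  except the empty one, and that one contributes the sign average.\<close>

lemma Eavg_pattern_tendsto:
  assumes W: "finite (W :: int set)"
  shows "((\<lambda>p. Eavg p (\<lambda>k. \<Phi> (\<lambda>j\<in>W. chi p (k - j)))) \<longlongrightarrow> sign_avg W \<Phi>) primes_at_top"
proof -
  define Q where "Q x = (\<Sum>\<epsilon>\<in>signs W. \<Phi> \<epsilon> * (\<Prod>j\<in>W. (\<epsilon> j * x j + 1) / 2))" for x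
  define T where "T = (\<Pi>\<^sub>E j\<in>W. {-1, 0, 1 :: real})"
  \<comment> \<open>A symbol may be \<open>0\<close>, and there \<open>Q\<close> need not agree with
    \<open>\<Phi>\<close>; \<open>K\<close> bounds the discrepancy over the finitely many
    patterns.\<close>
  define K where "K = (\<Sum>x\<in>T. \<bar>\<Phi> x - Q x\<bar>)"
  have finT: "finite T"
    unfolding T_def using W by (intro finite_PiE) auto
  have QS: "Q x = \<Phi> x" if x: "x \<in> signs W" for x
  proof -
    have "(\<Prod>j\<in>W. (\<epsilon> j * x j + 1) / 2) = of_bool (\<epsilon> = x)" if e: "\<epsilon> \<in> signs W" for \<epsilon>
    proof (cases "\<epsilon> = x")
      case True
      then show ?thesis
        using signs_cases[OF x] by (force intro!: prod.neutral)
    next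
      case False
      then obtain j where j: "j \<in> W" "\<epsilon> j \<noteq> x j"
        using e x unfolding signs_def by (meson PiE_ext)
      then have "(\<epsilon> j * x j + 1) / 2 = 0"
        using signs_cases[OF x j(1)] signs_cases[OF e j(1)] by auto
      then show ?thesis
        using False W j(1) by (auto intro!: prod_zero bexI[of _ j])
    qed
    then have "Q x = (\<Sum>\<epsilon>\<in>signs W. if \<epsilon> = x then \<Phi> \<epsilon> else 0)"
      unfolding Q_def by (intro sum.cong) auto
    then show ?thesis
      using x finite_signs[OF W] by simp
  qed
  have diff: "\<bar>\<Phi> (\<lambda>j\<in>W. chi p (k - j)) - Q (\<lambda>j\<in>W. chi p (k - j))\<bar>
      \<le> K * of_bool (\<exists>a\<in>W. int p dvd k - a)" for p k
  proof -
    define x where "x = (\<lambda>j\<in>W. chi p (k - j))"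
    have xT: "x \<in> T"
      using chi_cases[of p] by (auto simp: x_def T_def)
    show ?thesis
    proof (cases "\<exists>a\<in>W. int p dvd k - a")
      case True
      have "\<bar>\<Phi> x - Q x\<bar> \<le> K"
        unfolding K_def using finT xT by (intro member_le_sum) auto
      then show ?thesis
        using True by (simp add: x_def)
    next
      case False
      have "chi p (k - j) = -1 \<or> chi p (k - j) = 1" if "j \<in> W" for j
        using chi_cases[of p "k - j"] False that by (auto simp: chi_eq_0_iff)
      then have "x \<in> signs W"
        by (auto simp: signs_def x_def)
      then show ?thesis
        using False QS by (simp add: x_def)
    qed
  qed
  have 1: "((\<lambda>p. Eavg p (\<lambda>k. \<Phi> (\<lambda>j\<in>W. chi p (k - j))) - Eavg p (\<lambda>k. Q (\<lambda>j\<in>W. chi p (k - j)))) \<longlongrightarrow> 0) primes_at_top"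
  proof (rule Lim_null_comparison)
    show "\<forall>\<^sub>F p in primes_at_top. norm (Eavg p (\<lambda>k. \<Phi> (\<lambda>j\<in>W. chi p (k - j))) - Eavg p (\<lambda>k. Q (\<lambda>j\<in>W. chi p (k - j))))
        \<le> K * real (card W) * (1 / real p)"
      using eventually_odd_prime[of 1]
    proof eventually_elim
      case (elim p)
      have K0: "0 \<le> K"
        unfolding K_def by (rule sum_nonneg) simp
      have "\<bar>Eavg p (\<lambda>k. \<Phi> (\<lambda>j\<in>W. chi p (k - j)) - Q (\<lambda>j\<in>W. chi p (k - j)))\<bar>
          \<le> Eavg p (\<lambda>k. K * of_bool (\<exists>a\<in>W. int p dvd k - a))"
        by (rule order_trans[OF abs_Eavg_le Eavg_mono[OF diff]])
      also have "\<dots> \<le> K * (real (card W) / real p)"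
        unfolding Eavg_cmult using elim by (intro mult_left_mono Eavg_hit_bound W K0) auto
      finally show ?case
        by (simp add: Eavg_diff)
    qed
    show "((\<lambda>p. K * real (card W) * (1 / real p)) \<longlongrightarrow> 0) primes_at_top"
      by (intro tendsto_primes_at_top tendsto_mult_right_zero lim_1_over_n)
  qed
  have expand: "Eavg p (\<lambda>k. Q (\<lambda>j\<in>W. chi p (k - j))) =
      (\<Sum>\<epsilon>\<in>signs W. \<Phi> \<epsilon> / 2 ^ card W * (\<Sum>A\<in>Pow W. (\<Prod>a\<in>A. \<epsilon> a) * Eavg p (\<lambda>k. \<Prod>a\<in>A. chi p (k - a))))" for p
  proof -
    have "(\<Prod>j\<in>W. (\<epsilon> j * (\<lambda>j\<in>W. chi p (k - j)) j + 1) / 2)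
        = (\<Sum>A\<in>Pow W. (\<Prod>a\<in>A. \<epsilon> a) * (\<Prod>a\<in>A. chi p (k - a))) / 2 ^ card W" for \<epsilon> k
    proof -
      have "(\<Prod>j\<in>W. (\<epsilon> j * (\<lambda>j\<in>W. chi p (k - j)) j + 1) / 2) = (\<Prod>j\<in>W. \<epsilon> j * chi p (k - j) + 1) / 2 ^ card W"
        by (simp add: prod_dividef)
      also have "(\<Prod>j\<in>W. \<epsilon> j * chi p (k - j) + 1) = (\<Sum>A\<in>Pow W. (\<Prod>a\<in>A. \<epsilon> a) * (\<Prod>a\<in>A. chi p (k - a)))"
        by (subst prod_add[OF W]) (simp add: prod.distrib)
      finally show ?thesis .
    qed
    then have "Q (\<lambda>j\<in>W. chi p (k - j)) = (\<Sum>\<epsilon>\<in>signs W. \<Phi> \<epsilon> / 2 ^ card W *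
        (\<Sum>A\<in>Pow W. (\<Prod>a\<in>A. \<epsilon> a) * (\<Prod>a\<in>A. chi p (k - a))))" for k
      unfolding Q_def by (simp only: times_divide_eq_right times_divide_eq_left)
    then show ?thesis
      by (simp only: Eavg_sum Eavg_cmult)
  qed
  have 2: "((\<lambda>p. Eavg p (\<lambda>k. Q (\<lambda>j\<in>W. chi p (k - j)))) \<longlongrightarrow>
      (\<Sum>\<epsilon>\<in>signs W. \<Phi> \<epsilon> / 2 ^ card W * (\<Sum>A\<in>Pow W. (\<Prod>a\<in>A. \<epsilon> a) * of_bool (A = {})))) primes_at_top"
    unfolding expand
    by (intro tendsto_sum tendsto_mult tendsto_const Eavg_chi_prod_tendsto) (auto intro: finite_subset[OF _ W])
  have "(\<Sum>A\<in>Pow W. (\<Prod>a\<in>A. \<epsilon> a) * of_bool (A = {})) = (1 :: real)" for \<epsilon>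
  proof -
    have "(\<Sum>A\<in>Pow W. (\<Prod>a\<in>A. \<epsilon> a) * of_bool (A = {})) = (\<Sum>A\<in>Pow W. if A = {} then 1 else (0::real))"
      by (intro sum.cong) auto
    then show ?thesis
      using W by simp
  qed
  then have 3: "(\<Sum>\<epsilon>\<in>signs W. \<Phi> \<epsilon> / 2 ^ card W * (\<Sum>A\<in>Pow W. (\<Prod>a\<in>A. \<epsilon> a) * of_bool (A = {}))) = sign_avg W \<Phi>"
    by (simp add: sign_avg_def sum_divide_distrib)
  show ?thesis
    using tendsto_add[OF 1 2[unfolded 3]] by simp
qed

section \<open>Interpolation by Gauss sums\<close>

lemma unit_exp_add: "unit_exp (a + b) = unit_exp a * unit_exp b"
  by (simp add: unit_exp_def distrib_left exp_add)

lemma unit_exp_0 [simp]: "unit_exp 0 = 1"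
  by (simp add: unit_exp_def)

lemma norm_unit_exp [simp]: "norm (unit_exp a) = 1"
  by (simp add: unit_exp_def)

lemma unit_exp_of_int [simp]: "unit_exp (of_int n) = 1"
  by (simp add: unit_exp_def exp_eq_1 mult.commute mult.left_commute)

lemma unit_exp_add_int: "unit_exp (a + of_int n) = unit_exp a"
  by (simp add: unit_exp_add)

lemma unit_exp_power: "unit_exp a ^ n = unit_exp (real n * a)"
  by (induction n) (simp_all add: unit_exp_add distrib_right)

lemma zeta_pow_add: "zeta_pow p (a + b) = zeta_pow p a * zeta_pow p b"
  by (simp add: zeta_pow_def unit_exp_add add_divide_distrib)

lemma zeta_pow_0 [simp]: "zeta_pow p 0 = 1"
  by (simp add: zeta_pow_def)

lemma norm_zeta_pow [simp]: "norm (zeta_pow p a) = 1"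
  by (simp add: zeta_pow_def)

lemma zeta_pow_power: "zeta_pow p a ^ n = zeta_pow p (real n * a)"
  by (simp add: zeta_pow_def unit_exp_power)

lemma zeta_pow_cong:
  assumes "0 < p" "[a = b] (mod int p)"
  shows "zeta_pow p (of_int a) = zeta_pow p (of_int b)"
proof -
  obtain c where "a = b + int p * c"
    using assms(2) by (metis cong_iff_lin cong_sym)
  then have "of_int a / real p = of_int b / real p + of_int c"
    using assms(1) by (simp add: field_simps)
  then show ?thesis
    by (simp only: zeta_pow_def unit_exp_add_int)
qed

lemma zeta_pow_cong_mult:
  assumes "0 < p" "[a = b] (mod int p)"
  shows "zeta_pow p (of_int a * of_int t) = zeta_pow p (of_int b * of_int t)"
  using zeta_pow_cong[OF assms(1) cong_mult[OF assms(2) cong_refl, of t]] by simp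

lemma cong_imp_mod_eq: "[a = b] (mod m) \<Longrightarrow> a mod m = b mod (m :: int)"
  by (simp add: cong_iff_dvd_diff mod_eq_dvd_iff)

lemma sum_residues_mult:
  fixes g :: "int \<Rightarrow> 'b :: comm_monoid_add"
  assumes "0 < p" "coprime n p" "\<And>x y. [x = y] (mod p) \<Longrightarrow> g x = g y"
  shows "(\<Sum>x\<in>{0..<p}. g (x * n)) = (\<Sum>x\<in>{0..<p}. g x)"
proof -
  obtain m where m: "[n * m = 1] (mod p)"
    using assms(2) cong_solve_coprime_int by blast
  have *: "(x * n mod p * m) mod p = x" "(x * m mod p * n) mod p = x" if "x \<in> {0..<p}" for x
  proof -
    have "[x * (n * m) = x * 1] (mod p)"
      by (intro cong_mult cong_refl m)
    then have "(x * (n * m)) mod p = x"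
      using that cong_imp_mod_eq by fastforce
    then show "(x * n mod p * m) mod p = x" "(x * m mod p * n) mod p = x"
      by (simp_all add: mod_mult_left_eq mod_mult_right_eq ac_simps)
  qed
  show ?thesis
  proof (rule sum.reindex_bij_witness[where i = "\<lambda>y. (y * m) mod p" and j = "\<lambda>x. (x * n) mod p"])
    show "g (x * n mod p) = g (x * n)" for x
      by (rule assms(3)) (simp add: cong_def)
  qed (use * assms(1) in auto)
qed

lemma sum_symmetric_residues:
  fixes g :: "int \<Rightarrow> 'b :: comm_monoid_add"
  assumes "int p = 2 * h + 1" "0 \<le> h" "\<And>x y. [x = y] (mod int p) \<Longrightarrow> g x = g y"
  shows "(\<Sum>x\<in>{0..<int p}. g x) = (\<Sum>j\<in>{- h..h}. g j)"
proof -
  have "(\<Sum>x\<in>{0..<int p}. g x) = (\<Sum>x\<in>{0..<int p}. g (x + - h))"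
    using assms by (intro sum_residues_shift[symmetric]) auto
  also have "\<dots> = (\<Sum>j\<in>{- h..h}. g j)"
    using assms(1) by (intro sum.reindex_bij_witness[where i = "\<lambda>j. j + h" and j = "\<lambda>x. x - h"]) auto
  finally show ?thesis .
qed

text \<open>If every unit were a square, squaring would permute the nonzero residues, although
  \<open>1\<close> and \<open>p - 1\<close> have the same square.\<close>

lemma ex_nonresidue:
  assumes "prime p" "odd p"
  shows "\<exists>n. chi p n = -1"
proof (rule ccontr)
  assume *: "\<nexists>n. chi p n = -1"
  define A where "A = {1..<int p}"
  define f where "f x = x\<^sup>2 mod int p" for x
  have p3: "3 \<le> p"
    using assms prime_ge_2_nat[of p] by (cases "p = 2") auto
  have "A \<subseteq> f ` A"
  proof
    fix y assume y: "y \<in> A"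
    then have "\<not> int p dvd y"
      by (auto simp: A_def zdvd_not_zless)
    then have "chi p y \<noteq> 0"
      by (simp add: chi_eq_0_iff)
    then have "chi p y = 1"
      using * chi_cases[of p y] by blast
    then have "QuadRes (int p) y"
      by (auto simp: chi_def Legendre_def split: if_splits)
    then obtain z where z: "[z\<^sup>2 = y] (mod int p)"
      by (auto simp: QuadRes_def)
    have "f (z mod int p) = z\<^sup>2 mod int p"
      by (simp add: f_def power_mod)
    also have "\<dots> = y"
      using cong_imp_mod_eq[OF z] y by (simp add: A_def)
    finally have fz: "f (z mod int p) = y" .
    moreover have "z mod int p \<in> A"
    proof -
      have "z mod int p \<noteq> 0"
        using fz y by (auto simp: f_def A_def)
      moreover have "0 \<le> z mod int p" "z mod int p < int p"
        using p3 by simp_all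
      ultimately show ?thesis
        by (auto simp: A_def)
    qed
    ultimately show "y \<in> f ` A"
      by blast
  qed
  then have "inj_on f A"
    by (intro finite_surj_inj) (auto simp: A_def)
  moreover have "f 1 = f (int p - 1)"
  proof -
    have "(int p - 1)\<^sup>2 = 1 + int p * (int p - 2)"
      by (simp add: power2_eq_square algebra_simps)
    then show ?thesis
      using p3 by (simp add: f_def)
  qed
  moreover have "1 \<in> A" "int p - 1 \<in> A"
    using p3 by (auto simp: A_def)
  ultimately have "1 = int p - 1"
    by (rule inj_onD)
  then show False
    using p3 by simp
qed

lemma chi_mult: "prime p \<Longrightarrow> odd p \<Longrightarrow> chi p (a * b) = chi p a * chi p b"
  by (simp add: chi_def Legendre_mult)

lemma sum_chi_0:
  assumes "prime p" "odd p"
  shows "(\<Sum>x\<in>{0..<int p}. chi p x) = 0"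
proof -
  obtain n where n: "chi p n = -1"
    using ex_nonresidue[OF assms] by blast
  then have "\<not> int p dvd n"
    using chi_eq_0_iff[of p n] by auto
  then have "coprime n (int p)"
    using assms(1) by (metis coprime_commute prime_imp_coprime prime_nat_int_transfer)
  then have "(\<Sum>x\<in>{0..<int p}. chi p (x * n)) = (\<Sum>x\<in>{0..<int p}. chi p x)"
    using assms(1) prime_gt_0_nat by (intro sum_residues_mult chi_cong) auto
  then show ?thesis
    by (simp add: chi_mult[OF assms] n sum_negf)
qed

definition gauss_sum :: "nat \<Rightarrow> complex" where
  "gauss_sum p = (\<Sum>l\<in>{0..<int p}. of_real (chi p l) * zeta_pow p (of_int l))"

text \<open>For \<open>n\<close> prime to \<open>p\<close> substitute \<open>l * n\<close> for
  \<open>l\<close>; for \<open>n\<close> divisible by \<open>p\<close> both sides vanish since the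
  symbols sum to \<open>0\<close>. The latter case makes the identity usable for every
  coefficient.\<close>

lemma gauss_sum_separable:
  assumes p: "prime p" "odd p"
  shows "(\<Sum>l\<in>{0..<int p}. of_real (chi p l) * zeta_pow p (of_int (l * n))) = of_real (chi p n) * gauss_sum p"
proof (cases "int p dvd n")
  case True
  have p0: "0 < p"
    using p prime_gt_0_nat by blast
  have "zeta_pow p (of_int (l * n)) = 1" for l
    using zeta_pow_cong[OF p0, of "l * n" 0] True by (simp add: cong_0_iff)
  then have "(\<Sum>l\<in>{0..<int p}. of_real (chi p l) * zeta_pow p (of_int (l * n)))
      = of_real (\<Sum>l\<in>{0..<int p}. chi p l)"
    by simp
  also have "\<dots> = 0"
    by (simp only: sum_chi_0[OF p] of_real_0)
  finally show ?thesis
    using True by (simp add: chi_eq_0_iff[THEN iffD2])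
next
  case False
  have p0: "0 < p"
    using p prime_gt_0_nat by blast
  have cop: "coprime n (int p)"
    using False p(1) by (metis coprime_commute prime_imp_coprime prime_nat_int_transfer)
  have sq: "chi p n * chi p n = 1"
    using chi_cases[of p n] False by (auto simp: chi_eq_0_iff)
  have "(\<Sum>l\<in>{0..<int p}. of_real (chi p l) * zeta_pow p (of_int (l * n)))
      = of_real (chi p n) * (\<Sum>l\<in>{0..<int p}. of_real (chi p (l * n)) * zeta_pow p (of_int (l * n)))"
  proof -
    have *: "chi p l = chi p n * chi p (l * n)" for l
      using sq by (simp add: chi_mult[OF p] algebra_simps)
    show ?thesis
      unfolding sum_distrib_left by (intro sum.cong refl, subst *) (simp only: of_real_mult mult.assoc)
  qed
  also have "(\<Sum>l\<in>{0..<int p}. of_real (chi p (l * n)) * zeta_pow p (of_int (l * n))) = gauss_sum p"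
    unfolding gauss_sum_def
    using p0 by (intro sum_residues_mult cop) (auto simp: chi_cong zeta_pow_cong)
  finally show ?thesis .
qed

text \<open>The Lagrange interpolation kernel at the \<open>p\<close>-th roots of unity, in the variable \<open>z = e(y/p)\<close>.\<close>

definition wker :: "nat \<Rightarrow> complex \<Rightarrow> complex" where
  "wker p y = (\<Sum>i<p. exp (2 * of_real pi * \<i> * (of_nat i * y / of_nat p))) / of_nat p"

lemma zeta_pow_exp: "zeta_pow p y = exp (2 * of_real pi * \<i> * (of_real y / of_nat p))"
  by (simp add: zeta_pow_def unit_exp_def)

lemma wker_of_real: "wker p (of_real y) = (\<Sum>i<p. zeta_pow p (real i * y)) / of_nat p"
  by (simp add: wker_def zeta_pow_exp)

text \<open>The geometric sum, stated as a product so that it also covers the points where the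
  denominator vanishes.\<close>

lemma wker_geometric:
  assumes "0 < p"
  shows "wker p y * (of_nat p * (exp (2 * of_real pi * \<i> * (y / of_nat p)) - 1)) = exp (2 * of_real pi * \<i> * y) - 1"
proof -
  define q where "q = exp (2 * of_real pi * \<i> * (y / of_nat p))"
  have q: "exp (2 * of_real pi * \<i> * (of_nat i * y / of_nat p)) = q ^ i" for i
    by (simp add: q_def exp_of_nat_mult[symmetric] algebra_simps)
  have "exp (2 * of_real pi * \<i> * y) = q ^ p"
    using q[of p] assms by simp
  moreover have "q ^ p - 1 = (q - 1) * (\<Sum>i<p. q ^ i)"
    by (rule power_diff_1_eq)
  ultimately show ?thesis
    unfolding wker_def q q_def[symmetric] using assms by (simp add: mult.commute)
qed

lemma wker_add_period: "wker p (y + of_int (int p * c)) = wker p y"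
proof (cases "p = 0")
  case False
  have "exp (2 * of_real pi * \<i> * (of_nat i * (y + of_int (int p * c)) / of_nat p))
      = exp (2 * of_real pi * \<i> * (of_nat i * y / of_nat p))" for i
  proof -
    have "2 * of_real pi * \<i> * (of_nat i * (y + of_int (int p * c)) / of_nat p)
      = 2 * of_real pi * \<i> * (of_nat i * y / of_nat p) + 2 * of_real pi * \<i> * of_int (int i * c)"
      using False by (simp add: field_simps)
    moreover have "exp (2 * of_real pi * \<i> * of_int (int i * c)) = (1 :: complex)"
      using unit_exp_of_int[of "int i * c"] by (simp add: unit_exp_def)
    ultimately show ?thesis
      by (simp only: exp_add mult_1_right)
  qed
  then show ?thesis
    by (simp add: wker_def)
qed (simp add: wker_def)

lemma wker_cong:
  assumes "[a = b] (mod int p)"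
  shows "wker p (of_int a + z) = wker p (of_int b + z)"
proof -
  obtain c where "a = b + int p * c"
    using assms by (metis cong_iff_lin cong_sym)
  then have "of_int a + z = (of_int b + z) + of_int (int p * c)"
    by simp
  then show ?thesis
    by (simp only: wker_add_period)
qed

lemma wker_of_int:
  assumes "0 < p"
  shows "wker p (of_int n) = of_bool (int p dvd n)"
proof (cases "int p dvd n")
  case True
  then have "wker p (of_int n + 0) = wker p (of_int 0 + 0)"
    by (intro wker_cong) (simp add: cong_0_iff)
  also have "\<dots> = 1"
    using assms by (simp add: wker_def)
  finally show ?thesis
    using True by simp
next
  case False
  have "wker p (of_int n) * (of_nat p * (exp (2 * of_real pi * \<i> * (of_int n / of_nat p)) - 1)) = 0"
    using wker_geometric[OF assms, of "of_int n"] unit_exp_of_int[of n] by (simp add: unit_exp_def)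
  moreover have "exp (2 * of_real pi * \<i> * (of_int n / of_nat p)) \<noteq> (1 :: complex)"
  proof
    assume "exp (2 * of_real pi * \<i> * (of_int n / of_nat p)) = (1 :: complex)"
    then obtain m :: int where "2 * pi * (of_int n / real p) = of_int (2 * m) * pi"
      by (auto simp: exp_eq_1)
    then have "real_of_int n = real_of_int (m * int p)"
      using assms by (simp add: field_simps)
    then have "n = m * int p"
      by (simp only: of_int_eq_iff)
    then show False
      using False by simp
  qed
  ultimately show ?thesis
    using assms False by simp
qed

section \<open>The Fekete polynomial between consecutive roots of unity\<close>

lemma poly_shifted_fekete:
  "poly (shifted_fekete p t) z = (\<Sum>i<p. of_real (chi p (int i + t)) * z ^ i)"
  by (simp add: shifted_fekete_def poly_sum poly_monom chi_def)

text \<open>Each coefficient times the Gauss sum is replaced by its finite Fourier expansion; after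
  the interchange of sums, the inner sum over \<open>i\<close> is \<open>p\<close> times the
  interpolation kernel.\<close>

lemma gauss_times_fekete:
  assumes p: "prime p" "odd p"
  shows "gauss_sum p * poly (shifted_fekete p t) (zeta_pow p y)
     = of_nat p * (\<Sum>l\<in>{0..<int p}. of_real (chi p l) * zeta_pow p (of_int (l * t)) * wker p (of_int l + of_real y))"
proof -
  have p0: "0 < p"
    using p prime_gt_0_nat by blast
  have w: "of_nat p * wker p (of_int l + of_real y) = (\<Sum>i<p. zeta_pow p (real i * (of_int l + y)))" for l
    using wker_of_real[of p "of_int l + y"] p0 by simp
  have "gauss_sum p * poly (shifted_fekete p t) (zeta_pow p y)
      = (\<Sum>i<p. (of_real (chi p (int i + t)) * gauss_sum p) * zeta_pow p (real i * y))"
    by (simp add: poly_shifted_fekete zeta_pow_power sum_distrib_left ac_simps)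
  also have "\<dots> = (\<Sum>i<p. \<Sum>l\<in>{0..<int p}. of_real (chi p l) * zeta_pow p (of_int (l * (int i + t))) * zeta_pow p (real i * y))"
    unfolding gauss_sum_separable[OF p, symmetric] by (simp add: sum_distrib_right)
  also have "\<dots> = (\<Sum>l\<in>{0..<int p}. \<Sum>i<p. of_real (chi p l) * zeta_pow p (of_int (l * (int i + t))) * zeta_pow p (real i * y))"
    by (rule sum.swap)
  also have "\<dots> = (\<Sum>l\<in>{0..<int p}. of_real (chi p l) * zeta_pow p (of_int (l * t)) * (of_nat p * wker p (of_int l + of_real y)))"
  proof (intro sum.cong refl)
    fix l
    have "zeta_pow p (of_int (l * (int i + t))) * zeta_pow p (real i * y)
        = zeta_pow p (of_int (l * t)) * zeta_pow p (real i * (of_int l + y))" for i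
      by (simp add: zeta_pow_add[symmetric] algebra_simps)
    then show "(\<Sum>i<p. of_real (chi p l) * zeta_pow p (of_int (l * (int i + t))) * zeta_pow p (real i * y))
        = of_real (chi p l) * zeta_pow p (of_int (l * t)) * (of_nat p * wker p (of_int l + of_real y))"
      unfolding w by (simp add: sum_distrib_left mult.assoc)
  qed
  finally show ?thesis
    by (simp add: sum_distrib_left ac_simps)
qed

text \<open>At integers the kernel is the indicator of \<open>0\<close> modulo \<open>p\<close>, so
  only \<open>l = -1\<close> contributes. Up to the Gauss sum this evaluates the denominator of
  \<open>G_prime\<close>.\<close>

lemma gauss_times_fekete_1:
  assumes p: "prime p" "odd p"
  shows "gauss_sum p * poly (shifted_fekete p t) (zeta_pow p 1)
     = of_nat p * of_real (chi p (-1)) * zeta_pow p (of_int (- t))"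
proof -
  have p0: "0 < int p"
    using p prime_gt_0_nat by auto
  define g where "g l = of_real (chi p l) * zeta_pow p (of_int (l * t)) * wker p (of_int l + of_real 1)" for l
  have "(\<Sum>l\<in>{0..<int p}. g l) = (\<Sum>l\<in>{0..<int p}. g (l + (-1)))"
    unfolding g_def using p0
    by (intro sum_residues_shift[symmetric])
      (auto intro!: arg_cong2[where f = "(*)"] zeta_pow_cong_mult wker_cong arg_cong[where f = of_real] chi_cong)
  also have "\<dots> = (\<Sum>l\<in>{0..<int p}. if l = 0 then of_real (chi p (-1)) * zeta_pow p (of_int (- t)) else 0)"
  proof (intro sum.cong refl)
    fix l assume l: "l \<in> {0..<int p}"
    have "wker p (of_int (l + -1) + of_real 1) = of_bool (int p dvd l)"
      using wker_of_int[of p l] p0 by simp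
    moreover have "int p dvd l \<longleftrightarrow> l = 0"
      using l by (auto simp: zdvd_not_zless dest: zdvd_imp_le)
    ultimately show "g (l + -1) = (if l = 0 then of_real (chi p (-1)) * zeta_pow p (of_int (- t)) else 0)"
      by (simp add: g_def)
  qed
  also have "\<dots> = of_real (chi p (-1)) * zeta_pow p (of_int (- t))"
    using p0 by simp
  finally show ?thesis
    unfolding gauss_times_fekete[OF p] g_def by simp
qed

lemma norm_chi_minus_1: "prime p \<Longrightarrow> \<bar>chi p (-1)\<bar> = 1"
  using chi_cases[of p "-1"] chi_eq_0_iff[of p "-1"] not_prime_1 by auto

text \<open>The polynomial without shift, taken at the first root of unity, is the Gauss sum itself;
  \<open>gauss_times_fekete_1\<close> thus gives the square of the Gauss sum.\<close>

lemma norm_gauss_sum: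
  assumes p: "prime p" "odd p"
  shows "norm (gauss_sum p) = sqrt (real p)"
proof -
  have "poly (shifted_fekete p 0) (zeta_pow p 1) = gauss_sum p"
    by (simp add: poly_shifted_fekete gauss_sum_def zeta_pow_power sum_int_eq_nat[symmetric])
  then have "gauss_sum p * gauss_sum p = of_nat p * of_real (chi p (-1))"
    using gauss_times_fekete_1[OF p, of 0] by simp
  then have "norm (gauss_sum p * gauss_sum p) = norm (of_nat p * of_real (chi p (-1)) :: complex)"
    by simp
  then have "norm (gauss_sum p) * norm (gauss_sum p) = real p"
    using norm_chi_minus_1[OF p(1)] by (simp add: norm_mult)
  then show ?thesis
    by (simp add: real_sqrt_unique power2_eq_square)
qed

lemma norm_fekete_1:
  assumes p: "prime p" "odd p"
  shows "norm (poly (shifted_fekete p t) (zeta_pow p 1)) = sqrt (real p)"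
proof -
  have "sqrt (real p) * norm (poly (shifted_fekete p t) (zeta_pow p 1)) = real p"
    using arg_cong[OF gauss_times_fekete_1[OF p, of t], of norm] norm_chi_minus_1[OF p(1)]
    by (simp add: norm_mult norm_gauss_sum[OF p])
  also have "\<dots> = sqrt (real p) * sqrt (real p)"
    by simp
  finally have "sqrt (real p) * norm (poly (shifted_fekete p t) (zeta_pow p 1)) = sqrt (real p) * sqrt (real p)" .
  moreover have "sqrt (real p) \<noteq> 0"
    using prime_gt_0_nat[OF p(1)] by simp
  ultimately show ?thesis
    by (metis mult_left_cancel)
qed

text \<open>The interpolation formula as an entire function of \<open>z\<close>. Representatives
  symmetric about \<open>0\<close> are those for which the kernel decays in
  \<open>\<bar>j\<bar>\<close>, and they match the symmetric partial sums of the random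
  series.\<close>

definition G_ext :: "nat \<Rightarrow> int \<Rightarrow> int \<Rightarrow> complex \<Rightarrow> complex" where
  "G_ext p t k z = (\<Sum>j\<in>{- int ((p - 1) div 2)..int ((p - 1) div 2)}.
     of_real (chi p (k - j)) * zeta_pow p (of_int (j * t)) * wker p (of_int j + z))"

text \<open>Shifting the summation by \<open>k\<close> centres it at the arc. The phase
  \<open>(k - 1) * t\<close> in \<open>G_prime\<close> cancels what this shift and the value at the
  first root of unity produce, and \<open>chi p (-1)\<close> occurs in numerator and
  denominator.\<close>

lemma G_prime_eq_G_ext:
  assumes p: "prime p" "odd p"
  shows "G_prime p t k x = G_ext p t k (of_real x)"
proof -
  define h where "h = int ((p - 1) div 2)"
  have p0: "0 < p"
    using p prime_gt_0_nat by blast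
  have ph: "int p = 2 * h + 1"
    using p(2) by (auto simp: h_def elim!: oddE)
  have h0: "0 \<le> h"
    by (simp add: h_def)
  define g where "g l = of_real (chi p l) * zeta_pow p (of_int (l * t)) * wker p (of_int l + of_real (of_int k + x))" for l
  have gc: "g x = g y" if "[x = y] (mod int p)" for x y
    unfolding g_def using that p0
    by (auto intro!: arg_cong2[where f = "(*)"] zeta_pow_cong_mult wker_cong arg_cong[where f = of_real] chi_cong)
  have cm: "of_real (chi p (-1)) \<noteq> (0 :: complex)"
    using norm_chi_minus_1[OF p(1)] by auto
  have "(\<Sum>l\<in>{0..<int p}. g l) = (\<Sum>l\<in>{0..<int p}. g (l + - k))"
    using p0 gc by (intro sum_residues_shift[symmetric]) auto
  also have "\<dots> = (\<Sum>j\<in>{- h..h}. g (j + - k))"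
    by (intro sum_symmetric_residues ph h0 gc cong_add cong_refl)
  also have "\<dots> = of_real (chi p (-1)) * zeta_pow p (of_int (- k * t)) * G_ext p t k (of_real x)"
    unfolding G_ext_def h_def[symmetric] sum_distrib_left
  proof (intro sum.cong refl)
    fix j
    have "chi p (j + - k) = chi p (-1) * chi p (k - j)"
      unfolding chi_mult[OF p, symmetric] by simp
    moreover have "zeta_pow p (of_int ((j + - k) * t)) = zeta_pow p (of_int (- k * t)) * zeta_pow p (of_int (j * t))"
      unfolding zeta_pow_add[symmetric] by (simp add: algebra_simps)
    moreover have "of_int (j + - k) + of_real (of_int k + x) = (of_int j + of_real x :: complex)"
      by simp
    ultimately show "g (j + - k) = of_real (chi p (-1)) * zeta_pow p (of_int (- k * t)) *
        (of_real (chi p (k - j)) * zeta_pow p (of_int (j * t)) * wker p (of_int j + of_real x))"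
      unfolding g_def by (simp only: of_real_mult ac_simps)
  qed
  finally have F: "gauss_sum p * poly (shifted_fekete p t) (zeta_pow p (of_int k + x))
      = of_nat p * (of_real (chi p (-1)) * zeta_pow p (of_int (- k * t)) * G_ext p t k (of_real x))"
    unfolding gauss_times_fekete[OF p] g_def by simp
  have g0: "gauss_sum p \<noteq> 0"
    using norm_gauss_sum[OF p] p0 by auto
  have z0: "zeta_pow p y \<noteq> 0" for y
    by (simp add: zeta_pow_exp)
  have "G_prime p t k x = zeta_pow p (of_int ((k - 1) * t)) *
      (gauss_sum p * poly (shifted_fekete p t) (zeta_pow p (of_int k + x))) /
      (gauss_sum p * poly (shifted_fekete p t) (zeta_pow p 1))"
    using g0 by (simp add: G_prime_def)
  also have "\<dots> = zeta_pow p (of_int ((k - 1) * t)) * zeta_pow p (of_int (- k * t)) / zeta_pow p (of_int (- t)) * G_ext p t k (of_real x)"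
    unfolding F gauss_times_fekete_1[OF p] using p0 cm z0 by (simp add: field_simps)
  also have "zeta_pow p (of_int ((k - 1) * t)) * zeta_pow p (of_int (- k * t)) = zeta_pow p (of_int (- t))"
    unfolding zeta_pow_add[symmetric] by (simp add: algebra_simps)
  finally show ?thesis
    using z0 by simp
qed

lemma norm_fekete_eq:
  assumes p: "prime p" "odd p"
  shows "norm (poly (shifted_fekete p t) (zeta_pow p (of_int k + x))) = sqrt (real p) * norm (G_prime p t k x)"
  using prime_gt_0_nat[OF p(1)] unfolding G_prime_def
  by (simp add: norm_mult norm_divide norm_fekete_1[OF p])

text \<open>Supplies points at which the modulus is exactly \<open>1\<close>, the anchor for lower
  bounds on the logarithm.\<close>

lemma G_ext_of_int:
  assumes p: "prime p" "odd p"
  shows "G_ext p t k (of_int n) = of_real (chi p (k + n)) * zeta_pow p (of_int (- n * t))"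
proof -
  define h where "h = int ((p - 1) div 2)"
  have p0: "0 < p"
    using p prime_gt_0_nat by blast
  have ph: "int p = 2 * h + 1"
    using p(2) by (auto simp: h_def elim!: oddE)
  have h0: "0 \<le> h"
    by (simp add: h_def)
  define g where "g j = of_real (chi p (k - j)) * zeta_pow p (of_int (j * t)) * wker p (of_int j + of_int n)" for j
  have gc: "g x = g y" if "[x = y] (mod int p)" for x y
    unfolding g_def using that p0
    by (auto intro!: arg_cong2[where f = "(*)"] zeta_pow_cong_mult cong_diff wker_cong arg_cong[where f = of_real] chi_cong)
  have "G_ext p t k (of_int n) = (\<Sum>j\<in>{- h..h}. g j)"
    by (simp add: G_ext_def h_def g_def)
  also have "\<dots> = (\<Sum>l\<in>{0..<int p}. g l)"
    by (intro sum_symmetric_residues[symmetric] ph h0 gc)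
  also have "\<dots> = (\<Sum>l\<in>{0..<int p}. g (l + - n))"
    using p0 gc by (intro sum_residues_shift[symmetric]) auto
  also have "\<dots> = (\<Sum>l\<in>{0..<int p}. if l = 0 then of_real (chi p (k + n)) * zeta_pow p (of_int (- n * t)) else 0)"
  proof (intro sum.cong refl)
    fix l assume l: "l \<in> {0..<int p}"
    have "wker p (of_int (l + - n) + of_int n) = of_bool (int p dvd l)"
      using wker_of_int[of p l] p0 by simp
    moreover have "int p dvd l \<longleftrightarrow> l = 0"
      using l by (auto simp: zdvd_not_zless dest: zdvd_imp_le)
    ultimately show "g (l + - n) = (if l = 0 then of_real (chi p (k + n)) * zeta_pow p (of_int (- n * t)) else 0)"
      by (simp add: g_def)
  qed
  also have "\<dots> = of_real (chi p (k + n)) * zeta_pow p (of_int (- n * t))"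
    using p0 by simp
  finally show ?thesis .
qed

section \<open>Kernel estimates and the tail of the interpolation formula\<close>

lemma norm_exp_minus_1_le: "norm (exp w - 1 :: complex) \<le> exp (norm w) * norm w"
  using Taylor_exp_field[of w 0] by simp

lemma norm_exp_minus_1_minus_le: "norm (exp w - 1 - w :: complex) \<le> exp (norm w) * (norm w)\<^sup>2"
  using Taylor_exp_field[of w 1] by (simp add: power2_eq_square algebra_simps)

text \<open>A crude Jordan inequality from the cubic Taylor bound; the range up to \<open>2\<close>
  contains \<open>pi / 2\<close>.\<close>

lemma sin_ge_third:
  assumes "0 \<le> x" "x \<le> (2::real)"
  shows "x / 3 \<le> sin x"
proof -
  have "\<bar>sin x - (\<Sum>m<3. sin_coeff m * x ^ m)\<bar> \<le> inverse (fact 3) * \<bar>x\<bar> ^ 3"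
    by (rule Maclaurin_sin_bound)
  then have "\<bar>sin x - x\<bar> \<le> x ^ 3 / 6"
    using assms by (simp add: eval_nat_numeral sin_coeff_def)
  moreover have "x * x\<^sup>2 \<le> x * 4"
    using assms power_mono[of x 2 2] by (intro mult_left_mono) auto
  then have "x ^ 3 / 6 \<le> 2 * x / 3"
    by (simp add: power2_eq_square power3_eq_cube)
  ultimately show ?thesis
    by linarith
qed

lemma norm_zeta_pow_minus_1_ge:
  assumes "0 < p" "2 * \<bar>j\<bar> \<le> int p"
  shows "2 * \<bar>of_int j\<bar> / real p \<le> norm (zeta_pow p (of_int j) - 1)"
proof -
  define x where "x = pi * \<bar>of_int j\<bar> / real p"
  have "real_of_int (2 * \<bar>j\<bar>) \<le> real_of_int (int p)"
    using assms(2) by (simp only: of_int_le_iff)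
  then have j2: "2 * \<bar>real_of_int j\<bar> \<le> real p"
    by simp
  have "x \<le> pi / 2"
    using assms(1) j2 by (simp add: x_def field_simps)
  then have x: "x \<le> 2" and x0: "0 \<le> x"
    using pi_less_4 by (linarith, simp add: x_def)
  have "zeta_pow p (of_int j) = exp (\<i> * of_real (2 * pi * of_int j / real p))"
    by (simp add: zeta_pow_def unit_exp_def algebra_simps)
  then have "norm (zeta_pow p (of_int j) - 1) = 2 * \<bar>sin (2 * pi * of_int j / real p / 2)\<bar>"
    using dist_exp_i_1[of "2 * pi * of_int j / real p"] by (simp only: dist_norm)
  also have "\<bar>sin (2 * pi * of_int j / real p / 2)\<bar> = \<bar>sin x\<bar>"
    by (cases "0 \<le> j") (auto simp: x_def)
  finally have "norm (zeta_pow p (of_int j) - 1) = 2 * \<bar>sin x\<bar>" .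
  moreover have "x / 3 \<le> \<bar>sin x\<bar>"
    using sin_ge_third[OF x0 x] by linarith
  moreover have "\<bar>of_int j\<bar> / real p \<le> x / 3"
  proof -
    have "3 * \<bar>real_of_int j\<bar> \<le> pi * \<bar>real_of_int j\<bar>"
      using pi_gt3 by (intro mult_right_mono) auto
    then show ?thesis
      using assms(1) by (simp add: x_def field_simps)
  qed
  ultimately show ?thesis
    by simp
qed

lemma norm_wker_le: "norm (wker p (of_int j + z)) \<le> exp (2 * pi * norm z)"
proof -
  have "norm (exp (2 * of_real pi * \<i> * (of_nat i * (of_int j + z) / of_nat p))) \<le> exp (2 * pi * norm z)"
    if "i < p" for i
  proof -
    have "Re (2 * of_real pi * \<i> * (of_nat i * (of_int j + z) / of_nat p)) = 2 * pi * (real i / real p * - Im z)"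
      by (simp add: Re_divide Im_divide_of_nat Re_divide_of_nat power2_eq_square)
    also have "\<dots> \<le> 2 * pi * (1 * norm z)"
    proof (intro mult_left_mono)
      have "real i / real p * - Im z \<le> real i / real p * norm z"
        using abs_Im_le_cmod[of z] by (intro mult_left_mono) auto
      also have "\<dots> \<le> 1 * norm z"
        using that by (intro mult_right_mono) auto
      finally show "real i / real p * - Im z \<le> 1 * norm z" .
    qed auto
    finally show ?thesis
      by simp
  qed
  then have "norm (\<Sum>i<p. exp (2 * of_real pi * \<i> * (of_nat i * (of_int j + z) / of_nat p)))
      \<le> (\<Sum>i<p. exp (2 * pi * norm z))"
    by (intro order_trans[OF norm_sum] sum_mono) auto
  then show ?thesis
    by (cases "p = 0") (auto simp: wker_def norm_divide field_simps)
qed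

lemma norm_wker_real_le: "norm (wker p (of_int j + of_real x)) \<le> 1"
proof -
  have "norm (\<Sum>i<p. zeta_pow p (real i * (of_int j + x))) \<le> (\<Sum>i<p. 1)"
    by (intro order_trans[OF norm_sum] sum_mono) auto
  moreover have "wker p (of_int j + of_real x) = (\<Sum>i<p. zeta_pow p (real i * (of_int j + x))) / of_nat p"
    using wker_of_real[of p "of_int j + x"] by simp
  ultimately show ?thesis
    by (cases "p = 0") (simp_all add: norm_divide)
qed

text \<open>Away from \<open>0\<close>, \<open>w_p(j + z)\<close> is \<open>bker p j (e(z) - 1)\<close> up to \<open>O(1/j\<^sup>2)\<close>.\<close>

definition bker :: "nat \<Rightarrow> int \<Rightarrow> complex" where
  "bker p j = 1 / (of_nat p * (zeta_pow p (of_int j) - 1))"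

lemma norm_bker_le:
  assumes "0 < p" "2 * \<bar>j\<bar> \<le> int p" "j \<noteq> 0"
  shows "norm (bker p j) \<le> 1 / (2 * \<bar>of_int j\<bar>)"
proof -
  have "2 * \<bar>of_int j\<bar> = real p * (2 * \<bar>of_int j\<bar> / real p)"
    using assms(1) by simp
  also have "\<dots> \<le> real p * norm (zeta_pow p (of_int j) - 1)"
    by (intro mult_left_mono norm_zeta_pow_minus_1_ge assms) auto
  finally show ?thesis
    unfolding bker_def using assms(3) by (simp add: norm_divide norm_mult frac_le)
qed

text \<open>The maximum of \<open>exp (2 * pi * norm z)\<close> on the disc of radius
  \<open>5\<close>. That radius covers both \<open>z\<close> and \<open>1 - z\<close> for
  \<open>norm z \<le> 4\<close>.\<close>

definition K0 :: real where "K0 = exp (10 * pi)"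

lemma K0_pos: "0 < K0"
  by (simp add: K0_def)

lemma exp_2_pi_le_K0:
  assumes "norm z \<le> 5"
  shows "exp (2 * pi * norm z) \<le> K0"
proof -
  have "2 * pi * norm z \<le> 2 * pi * 5"
    using assms by (intro mult_left_mono) auto
  then show ?thesis
    by (simp add: K0_def)
qed

lemma norm_exp_minus_1_le_K0:
  assumes "norm z \<le> 5"
  shows "norm (exp (2 * of_real pi * \<i> * z) - 1) \<le> K0 + 1"
proof -
  define w where "w = 2 * of_real pi * \<i> * z"
  have "norm (exp w) \<le> exp (norm w)"
    by (rule norm_exp)
  also have "norm w = 2 * pi * norm z"
    by (simp add: w_def norm_mult)
  also have "exp (2 * pi * norm z) \<le> K0"
    by (rule exp_2_pi_le_K0[OF assms])
  finally show ?thesis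
    using norm_triangle_ineq4[of "exp w" 1] by (simp add: w_def)
qed

text \<open>Both terms have the numerator \<open>E\<close>, because \<open>e(j + z) = e(z)\<close>.
  The denominators are governed by \<open>u * v - 1\<close> and \<open>u - 1\<close>, which differ
  by \<open>u * (v - 1)\<close>, of size at most \<open>120 / P\<close>, while
  \<open>norm (u - 1)\<close> is at least \<open>2 * y / P\<close>. For
  \<open>\<bar>j\<bar> \<ge> 120\<close> this leaves at least \<open>y / P\<close> for the perturbed
  denominator.\<close>

lemma wker_approx:
  assumes p: "40 \<le> p" and j: "120 \<le> \<bar>j\<bar>" "2 * \<bar>j\<bar> \<le> int p" and z: "norm z \<le> 5"
  shows "norm (wker p (of_int j + z) - (exp (2 * of_real pi * \<i> * z) - 1) * bker p j)
      \<le> 60 * (K0 + 1) / (of_int j)\<^sup>2"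
proof -
  define P where "P = real p"
  define y where "y = \<bar>real_of_int j\<bar>"
  define u where "u = zeta_pow p (of_int j)"
  define v where "v = exp (2 * of_real pi * \<i> * (z / of_nat p))"
  define E where "E = exp (2 * of_real pi * \<i> * z) - 1"
  have P0: "40 \<le> P" "0 < P"
    using p by (auto simp: P_def)
  have "real_of_int 120 \<le> real_of_int \<bar>j\<bar>"
    using j(1) by (simp only: of_int_le_iff)
  then have y: "120 \<le> y"
    by (simp add: y_def)
  have u: "2 * y / P \<le> norm (u - 1)"
    unfolding u_def y_def P_def using p by (intro norm_zeta_pow_minus_1_ge j) auto
  have v: "norm (v - 1) \<le> 120 / P"
  proof -
    define w where "w = 2 * of_real pi * \<i> * (z / of_nat p)"
    have "norm w = 2 * pi * norm z / P"
      by (simp add: w_def norm_mult norm_divide P_def)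
    also have "\<dots> \<le> 2 * 4 * 5 / P"
      using z pi_less_4 P0 by (intro divide_right_mono mult_mono) auto
    finally have w: "norm w \<le> 40 / P"
      by simp
    also have "\<dots> \<le> 1"
      using P0 by simp
    finally have "exp (norm w) \<le> 3"
      using exp_le by (meson exp_le_cancel_iff order_trans)
    then have "exp (norm w) * norm w \<le> 3 * (40 / P)"
      using w by (intro mult_mono) auto
    then show ?thesis
      using norm_exp_minus_1_le[of w] by (simp add: v_def w_def)
  qed
  have nu: "norm u = 1"
    by (simp add: u_def)
  have uv: "y / P \<le> norm (u * v - 1)"
  proof -
    have "norm (u - 1) \<le> norm (u * v - 1) + norm (u * (v - 1))"
      using norm_triangle_ineq4[of "u * v - 1" "u * (v - 1)"] by (simp add: algebra_simps)
    moreover have "norm (u * (v - 1)) \<le> 120 / P"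
      using v by (simp add: norm_mult nu)
    moreover have "120 / P \<le> y / P"
      using y P0 by (intro divide_right_mono) auto
    ultimately show ?thesis
      using u by simp
  qed
  have pos: "0 < y / P" "0 < 2 * y / P"
    using y P0 by auto
  then have n0: "u - 1 \<noteq> 0" "u * v - 1 \<noteq> 0"
    using u uv by force+
  have eu: "exp (2 * of_real pi * \<i> * ((of_int j + z) / of_nat p)) = u * v"
    by (simp add: u_def v_def zeta_pow_exp exp_add[symmetric] add_divide_distrib distrib_left)
  have eE: "exp (2 * of_real pi * \<i> * (of_int j + z)) - 1 = E"
    using unit_exp_of_int[of j] by (simp add: E_def unit_exp_def distrib_left exp_add)
  have "wker p (of_int j + z) * (of_nat p * (u * v - 1)) = E"
    using wker_geometric[of p "of_int j + z"] p unfolding eu eE by simp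
  then have w: "wker p (of_int j + z) = E / (of_nat p * (u * v - 1))"
    using n0 p by (simp add: field_simps)
  have "wker p (of_int j + z) - E * bker p j = E * (u * (1 - v)) / (of_nat p * ((u * v - 1) * (u - 1)))"
    unfolding w bker_def u_def[symmetric] using n0 p by (simp add: divide_simps) (simp add: algebra_simps)
  then have "norm (wker p (of_int j + z) - E * bker p j) = norm E * norm (v - 1) / (P * (norm (u * v - 1) * norm (u - 1)))"
    by (simp add: norm_divide norm_mult nu P_def norm_minus_commute)
  also have "\<dots> \<le> (K0 + 1) * (120 / P) / (P * ((y / P) * (2 * y / P)))"
  proof (intro frac_le mult_mono u uv v)
    show "norm E \<le> K0 + 1"
      unfolding E_def by (rule norm_exp_minus_1_le_K0[OF z])
  qed (use pos P0 K0_pos y in \<open>auto simp: zero_less_mult_iff\<close>)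
  also have "\<dots> = 60 * (K0 + 1) / y\<^sup>2"
    using P0 y by (simp add: field_simps power2_eq_square)
  finally show ?thesis
    by (simp add: E_def y_def)
qed

section \<open>The long tail of the interpolation formula\<close>

definition tail :: "nat \<Rightarrow> nat \<Rightarrow> int set" where
  "tail p J = {j \<in> {- int ((p - 1) div 2)..int ((p - 1) div 2)}. int J < \<bar>j\<bar>}"

lemma finite_tail: "finite (tail p J)"
  by (rule finite_subset[of _ "{- int ((p - 1) div 2)..int ((p - 1) div 2)}"]) (auto simp: tail_def)

lemma tail_bound: "j \<in> tail p J \<Longrightarrow> 2 * \<bar>j\<bar> \<le> int p" "j \<in> tail p J \<Longrightarrow> int J < \<bar>j\<bar>"
  by (auto simp: tail_def abs_if)

lemma sum_tail_le:
  fixes g :: "nat \<Rightarrow> real"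
  shows "(\<Sum>j\<in>tail p J. g (nat \<bar>j\<bar>)) = 2 * (\<Sum>n\<in>{J<..(p - 1) div 2}. g n)"
proof -
  let ?h = "(p - 1) div 2"
  have eq: "tail p J = int ` {J<..?h} \<union> (\<lambda>n. - int n) ` {J<..?h}"
  proof
    show "tail p J \<subseteq> int ` {J<..?h} \<union> (\<lambda>n. - int n) ` {J<..?h}"
    proof
      fix j assume j: "j \<in> tail p J"
      show "j \<in> int ` {J<..?h} \<union> (\<lambda>n. - int n) ` {J<..?h}"
      proof (cases "0 \<le> j")
        case True
        then have "j = int (nat j)" "nat j \<in> {J<..?h}"
          using j by (auto simp: tail_def)
        then show ?thesis
          by blast
      next
        case False
        then have "j = - int (nat (- j))" "nat (- j) \<in> {J<..?h}"
          using j by (auto simp: tail_def)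
        then show ?thesis
          by blast
      qed
    qed
  qed (auto simp: tail_def)
  have dis: "int ` {J<..?h} \<inter> (\<lambda>n. - int n) ` {J<..?h} = {}"
    by auto
  have inj: "inj_on (\<lambda>n. - int n) A" for A
    by (auto simp: inj_on_def)
  show ?thesis
    unfolding eq by (subst sum.union_disjoint[OF _ _ dis]) (auto simp: sum.reindex inj)
qed

lemma sum_inverse_squares_le:
  assumes "0 < J"
  shows "(\<Sum>n\<in>{J<..m}. 1 / (real n)\<^sup>2) \<le> 1 / real J"
proof (cases "J \<le> m")
  case True
  have "(\<Sum>n\<in>{J<..m}. 1 / (real n)\<^sup>2) \<le> 1 / real J - 1 / real m"
    using True
  proof (induction m rule: dec_induct)
    case (step m)
    have "1 / (real (Suc m))\<^sup>2 \<le> 1 / (real m * real (Suc m))"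
      using step assms by (intro divide_left_mono) (auto simp: power2_eq_square)
    also have "\<dots> = 1 / real m - 1 / real (Suc m)"
      using step assms by (simp add: field_simps)
    finally have "1 / (real (Suc m))\<^sup>2 \<le> 1 / real m - 1 / real (Suc m)" .
    moreover have "{J<..Suc m} = insert (Suc m) {J<..m}"
      using step by auto
    ultimately show ?case
      using step by simp
  qed simp
  also have "\<dots> \<le> 1 / real J"
    by simp
  finally show ?thesis .
qed (use assms in simp)

lemma sum_tail_squares:
  assumes "0 < J"
  shows "(\<Sum>j\<in>tail p J. 1 / (of_int j)\<^sup>2) \<le> 2 / real J"
  using sum_tail_le[of "\<lambda>n. 1 / (real n)\<^sup>2" p J] sum_inverse_squares_le[OF assms, of "(p - 1) div 2"]
  by simp

lemma harm_le_ln: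
  assumes "0 < n"
  shows "harm n \<le> 1 + ln (real n)"
proof -
  have "harm (Suc (n - 1)) - ln (real (Suc (n - 1))) \<le> harm (Suc 0) - ln (real (Suc 0))"
    by (rule decseqD[OF decseq_harm_diff_ln]) simp
  then show ?thesis
    using assms by (simp add: harm_Suc harm_expand)
qed

lemma sum_tail_harm:
  assumes "0 < p"
  shows "(\<Sum>j\<in>tail p J. 1 / \<bar>of_int j\<bar>) \<le> 2 * (1 + ln (real p))"
proof -
  let ?h = "(p - 1) div 2"
  have "(\<Sum>n\<in>{J<..?h}. 1 / real n) \<le> (\<Sum>n\<in>{1..p}. 1 / real n)"
    by (intro sum_mono2) auto
  also have "\<dots> = harm p"
    by (simp add: harm_def divide_inverse)
  also have "\<dots> \<le> 1 + ln (real p)"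
    using harm_le_ln[OF assms] by simp
  finally show ?thesis
    using sum_tail_le[of "\<lambda>n. 1 / real n" p J] by simp
qed

definition tail_sum :: "nat \<Rightarrow> int \<Rightarrow> nat \<Rightarrow> int \<Rightarrow> complex" where
  "tail_sum p t J k = (\<Sum>j\<in>tail p J. of_real (chi p (k - j)) * zeta_pow p (of_int (j * t)) * bker p j)"

lemma G_ext_tail:
  assumes p: "40 \<le> p" and J: "120 \<le> J" and z: "norm z \<le> 5"
  shows "norm (\<Sum>j\<in>tail p J. of_real (chi p (k - j)) * zeta_pow p (of_int (j * t)) * wker p (of_int j + z))
      \<le> 120 * (K0 + 1) / real J + (K0 + 1) * norm (tail_sum p t J k)"
proof -
  define E where "E = exp (2 * of_real pi * \<i> * z) - 1"
  define c where "c j = of_real (chi p (k - j)) * zeta_pow p (of_int (j * t))" for j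
  have c: "norm (c j) \<le> 1" for j
    using abs_chi_le by (simp add: c_def norm_mult)
  have nE: "norm E \<le> K0 + 1"
    unfolding E_def by (rule norm_exp_minus_1_le_K0[OF z])
  have "(\<Sum>j\<in>tail p J. c j * wker p (of_int j + z))
      = (\<Sum>j\<in>tail p J. c j * (wker p (of_int j + z) - E * bker p j)) + E * tail_sum p t J k"
    by (simp add: tail_sum_def c_def sum_distrib_left sum.distrib[symmetric] algebra_simps)
  also have "norm \<dots> \<le> 120 * (K0 + 1) / real J + (K0 + 1) * norm (tail_sum p t J k)"
  proof (intro order_trans[OF norm_triangle_ineq] add_mono)
    have "norm (\<Sum>j\<in>tail p J. c j * (wker p (of_int j + z) - E * bker p j))
        \<le> (\<Sum>j\<in>tail p J. 60 * (K0 + 1) / (of_int j)\<^sup>2)"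
    proof (intro order_trans[OF norm_sum] sum_mono)
      fix j assume j: "j \<in> tail p J"
      have "norm (c j * (wker p (of_int j + z) - E * bker p j)) \<le> 1 * (60 * (K0 + 1) / (of_int j)\<^sup>2)"
        unfolding norm_mult E_def using tail_bound[OF j] J
        by (intro mult_mono c wker_approx p z) auto
      then show "norm (c j * (wker p (of_int j + z) - E * bker p j)) \<le> 60 * (K0 + 1) / (of_int j)\<^sup>2"
        by simp
    qed
    also have "\<dots> = 60 * (K0 + 1) * (\<Sum>j\<in>tail p J. 1 / (of_int j)\<^sup>2)"
      by (simp add: sum_distrib_left)
    also have "\<dots> \<le> 60 * (K0 + 1) * (2 / real J)"
      using J by (intro mult_left_mono sum_tail_squares) (auto simp: K0_def add_nonneg_nonneg)
    finally show "norm (\<Sum>j\<in>tail p J. c j * (wker p (of_int j + z) - E * bker p j)) \<le> 120 * (K0 + 1) / real J"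
      by simp
    show "norm (E * tail_sum p t J k) \<le> (K0 + 1) * norm (tail_sum p t J k)"
      unfolding norm_mult by (intro mult_right_mono nE) auto
  qed
  finally show ?thesis
    by (simp only: c_def)
qed

lemma power_add_le: "0 \<le> a \<Longrightarrow> 0 \<le> b \<Longrightarrow> (a + b) ^ r \<le> 2 ^ r * (a ^ r + b ^ r :: real)"
proof -
  assume "0 \<le> a" "0 \<le> b"
  then have "(a + b) ^ r \<le> (2 * max a b) ^ r"
    by (intro power_mono) auto
  also have "\<dots> = 2 ^ r * (max a b) ^ r"
    by (simp add: power_mult_distrib)
  also have "\<dots> \<le> 2 ^ r * (a ^ r + b ^ r)"
    using \<open>0 \<le> a\<close> \<open>0 \<le> b\<close> by (intro mult_left_mono) (auto simp: max_def)
  finally show ?thesis .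
qed

text \<open>The error terms of the character sum bound, as opposed to the diagonal contribution.\<close>

definition moment_err :: "nat \<Rightarrow> nat \<Rightarrow> real" where
  "moment_err r p = 2 ^ r * (2 * ((24 * real r + 8) * real p powr (- 1/4) * (1 + ln (real p)) ^ (2 * r)))"

text \<open>The squares of the coefficients sum to \<open>O(1/J)\<close>, which yields the main
  term; their absolute sum is of order \<open>log p\<close> and meets only the power saving. Real
  and imaginary parts are treated separately, as the moment bound is for real coefficients.\<close>

lemma tail_sum_moment:
  assumes p: "prime p" "odd p" and J: "0 < J"
  shows "Eavg p (\<lambda>k. norm (tail_sum p t J k) ^ (2 * r))
    \<le> 2 ^ r * (8 * fact (2 * r)) / real J ^ r + moment_err r p"
proof -
  define a where "a j = zeta_pow p (of_int (j * t)) * bker p j" for j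
  have p0: "0 < p"
    using p prime_gt_0_nat by blast
  have na: "norm (a j) \<le> 1 / (2 * \<bar>of_int j\<bar>)" if "j \<in> tail p J" for j
    unfolding a_def norm_mult using norm_bker_le[OF p0 tail_bound(1)[OF that]] tail_bound(2)[OF that] by auto
  have W: "incong p (tail p J)"
  proof (rule incong_interval)
    show "tail p J \<subseteq> {- int ((p - 1) div 2)..int ((p - 1) div 2)}"
      by (auto simp: tail_def)
    show "2 * int ((p - 1) div 2) < int p"
      using p0 by linarith
  qed
  have part: "Eavg p (\<lambda>k. (\<Sum>j\<in>tail p J. b j * chi p (k - j)) ^ (2 * r))
      \<le> 4 * fact (2 * r) / real J ^ r + (24 * real r + 8) * real p powr (- 1/4) * (1 + ln (real p)) ^ (2 * r)"
    if b: "\<And>j. j \<in> tail p J \<Longrightarrow> \<bar>b j\<bar> \<le> 1 / (2 * \<bar>of_int j\<bar>)" for b :: "int \<Rightarrow> real"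
  proof -
    have "(\<Sum>j\<in>tail p J. (b j)\<^sup>2) \<le> (\<Sum>j\<in>tail p J. 1 / (of_int j)\<^sup>2)"
    proof (intro sum_mono)
      fix j assume j: "j \<in> tail p J"
      have "\<bar>b j\<bar> \<le> 1 / \<bar>of_int j\<bar>"
        using tail_bound(2)[OF j] by (intro order_trans[OF b[OF j]] divide_left_mono) auto
      then have "\<bar>b j\<bar>\<^sup>2 \<le> (1 / \<bar>of_int j\<bar>)\<^sup>2"
        by (intro power_mono) auto
      then show "(b j)\<^sup>2 \<le> 1 / (of_int j)\<^sup>2"
        by (simp add: power_divide)
    qed
    also have "\<dots> \<le> 2 / real J"
      by (rule sum_tail_squares[OF J])
    finally have "(\<Sum>j\<in>tail p J. (b j)\<^sup>2) \<le> 2 / real J" .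
    have "(\<Sum>j\<in>tail p J. (b j)\<^sup>2) \<le> (\<Sum>j\<in>tail p J. 1/4 * (1 / (of_int j)\<^sup>2))"
    proof (intro sum_mono)
      fix j assume j: "j \<in> tail p J"
      have "\<bar>b j\<bar>\<^sup>2 \<le> (1 / (2 * \<bar>of_int j\<bar>))\<^sup>2"
        using b[OF j] by (intro power_mono) auto
      then show "(b j)\<^sup>2 \<le> 1/4 * (1 / (of_int j)\<^sup>2)"
        by (simp add: power_divide power_mult_distrib)
    qed
    also have "\<dots> \<le> 1/4 * (2 / real J)"
      unfolding sum_distrib_left[symmetric] by (intro mult_left_mono sum_tail_squares J) auto
    also have "\<dots> \<le> 1 / real J"
      using J by (simp add: field_simps)
    finally have 1: "(\<Sum>j\<in>tail p J. (b j)\<^sup>2) ^ r \<le> (1 / real J) ^ r"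
      by (intro power_mono sum_nonneg) auto
    have "(\<Sum>j\<in>tail p J. \<bar>b j\<bar>) \<le> (\<Sum>j\<in>tail p J. 1/2 * (1 / \<bar>of_int j\<bar>))"
      using b by (intro sum_mono) auto
    also have "\<dots> \<le> 1/2 * (2 * (1 + ln (real p)))"
      unfolding sum_distrib_left[symmetric] by (intro mult_left_mono sum_tail_harm p0) auto
    finally have 2: "(\<Sum>j\<in>tail p J. \<bar>b j\<bar>) ^ (2 * r) \<le> (1 + ln (real p)) ^ (2 * r)"
      by (intro power_mono sum_nonneg) auto
    have "Eavg p (\<lambda>k. (\<Sum>j\<in>tail p J. b j * chi p (k - j)) ^ (2 * r))
      \<le> 4 * fact (2 * r) * (\<Sum>j\<in>tail p J. (b j)\<^sup>2) ^ r
        + (24 * real r + 8) * real p powr (- 1/4) * (\<Sum>j\<in>tail p J. \<bar>b j\<bar>) ^ (2 * r)"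
      by (rule Eavg_chi_moment[OF p finite_tail W])
    also have "\<dots> \<le> 4 * fact (2 * r) * (1 / real J) ^ r
        + (24 * real r + 8) * real p powr (- 1/4) * (1 + ln (real p)) ^ (2 * r)"
      by (intro add_mono mult_left_mono 1 2) auto
    finally show ?thesis
      by (simp add: power_divide)
  qed
  have "norm (tail_sum p t J k) ^ (2 * r)
      \<le> 2 ^ r * ((\<Sum>j\<in>tail p J. Re (a j) * chi p (k - j)) ^ (2 * r)
        + (\<Sum>j\<in>tail p J. Im (a j) * chi p (k - j)) ^ (2 * r))" for k
  proof -
    define R where "R = (\<Sum>j\<in>tail p J. Re (a j) * chi p (k - j))"
    define I where "I = (\<Sum>j\<in>tail p J. Im (a j) * chi p (k - j))"
    have "tail_sum p t J k = (\<Sum>j\<in>tail p J. of_real (chi p (k - j)) * a j)"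
      by (simp add: tail_sum_def a_def mult.assoc)
    then have "Re (tail_sum p t J k) = R" "Im (tail_sum p t J k) = I"
      by (simp_all add: R_def I_def mult.commute)
    then have "norm (tail_sum p t J k) ^ (2 * r) = (R\<^sup>2 + I\<^sup>2) ^ r"
      by (simp add: power_mult cmod_power2)
    also have "\<dots> \<le> 2 ^ r * ((R\<^sup>2) ^ r + (I\<^sup>2) ^ r)"
      by (rule power_add_le) auto
    finally show ?thesis
      by (simp add: R_def I_def power_mult)
  qed
  then have "Eavg p (\<lambda>k. norm (tail_sum p t J k) ^ (2 * r))
     \<le> Eavg p (\<lambda>k. 2 ^ r * ((\<Sum>j\<in>tail p J. Re (a j) * chi p (k - j)) ^ (2 * r)
        + (\<Sum>j\<in>tail p J. Im (a j) * chi p (k - j)) ^ (2 * r)))"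
    by (rule Eavg_mono)
  also have "\<dots> = 2 ^ r * (Eavg p (\<lambda>k. (\<Sum>j\<in>tail p J. Re (a j) * chi p (k - j)) ^ (2 * r))
        + Eavg p (\<lambda>k. (\<Sum>j\<in>tail p J. Im (a j) * chi p (k - j)) ^ (2 * r)))"
    by (simp only: Eavg_cmult Eavg_add)
  also have "\<dots> \<le> 2 ^ r * ((4 * fact (2 * r) / real J ^ r + (24 * real r + 8) * real p powr (- 1/4) * (1 + ln (real p)) ^ (2 * r))
     + (4 * fact (2 * r) / real J ^ r + (24 * real r + 8) * real p powr (- 1/4) * (1 + ln (real p)) ^ (2 * r)))"
    by (intro mult_left_mono add_mono part)
       (use na abs_Re_le_cmod abs_Im_le_cmod in \<open>auto intro: order_trans\<close>)
  also have "\<dots> = 2 ^ r * (8 * fact (2 * r)) / real J ^ r + moment_err r p"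
    by (simp add: moment_err_def algebra_simps add_divide_distrib)
  finally show ?thesis .
qed

lemma moment_err_tendsto: "(moment_err r \<longlongrightarrow> 0) primes_at_top"
proof -
  \<comment> \<open>Chosen so that \<open>p^a\<close> to the power \<open>2 * r\<close> is at most
    \<open>p^(1/8)\<close>, half of the available saving.\<close>
  define a :: real where "a = 1 / (16 * (real r + 1))"
  have a0: "0 < a"
    by (simp add: a_def)
  define C where "C = 2 ^ r * (2 * ((24 * real r + 8) * (1 + 1 / a) ^ (2 * r)))"
  have le: "norm (moment_err r p) \<le> C * real p powr (- (1/8))" if p: "1 \<le> p" for p
  proof -
    have p1: "1 \<le> real p"
      using p by simp
    have "ln (real p) \<le> real p powr a / a"
      by (rule ln_powr_bound[OF p1 a0])
    moreover have "1 \<le> real p powr a"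
      using p1 a0 by (intro ge_one_powr_ge_zero) auto
    ultimately have "1 + ln (real p) \<le> (1 + 1 / a) * real p powr a"
      by (simp add: algebra_simps)
    then have "(1 + ln (real p)) ^ (2 * r) \<le> ((1 + 1 / a) * real p powr a) ^ (2 * r)"
      using p1 by (intro power_mono) auto
    also have "\<dots> = (1 + 1 / a) ^ (2 * r) * real p powr (a * real (2 * r))"
      using p1 by (simp add: power_mult_distrib powr_power mult.commute)
    also have "\<dots> \<le> (1 + 1 / a) ^ (2 * r) * real p powr (1/8)"
    proof (intro mult_left_mono powr_mono)
      show "a * real (2 * r) \<le> 1/8"
        by (simp add: a_def field_simps)
    qed (use p1 a0 in auto)
    finally have 1: "(1 + ln (real p)) ^ (2 * r) \<le> (1 + 1 / a) ^ (2 * r) * real p powr (1/8)" .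
    have "moment_err r p \<le> 2 ^ r * (2 * ((24 * real r + 8) * real p powr (- 1/4) * ((1 + 1 / a) ^ (2 * r) * real p powr (1/8))))"
      unfolding moment_err_def by (intro mult_left_mono 1) auto
    also have "\<dots> = C * (real p powr (- 1/4) * real p powr (1/8))"
      by (simp add: C_def)
    also have "real p powr (- 1/4) * real p powr (1/8) = real p powr (- (1/8))"
      using p1 by (simp add: powr_add[symmetric])
    finally have "moment_err r p \<le> C * real p powr (- (1/8))" .
    moreover have "0 \<le> moment_err r p"
      using p1 by (simp add: moment_err_def)
    ultimately show ?thesis
      by simp
  qed
  show ?thesis
  proof (rule Lim_null_comparison)
    show "\<forall>\<^sub>F p in primes_at_top. norm (moment_err r p) \<le> C * real p powr (- (1/8))"
      using eventually_odd_prime[of 1] by eventually_elim (use le in auto)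
    have "((\<lambda>p. real p powr (- (1/8))) \<longlongrightarrow> 0) at_top"
      by (intro tendsto_neg_powr filterlim_real_sequentially) auto
    then show "((\<lambda>p. C * real p powr (- (1/8))) \<longlongrightarrow> 0) primes_at_top"
      by (intro tendsto_primes_at_top tendsto_mult_right_zero)
  qed
qed

section \<open>An envelope on a fixed disc\<close>

text \<open>The constant absorbs the at most \<open>241\<close> terms with
  \<open>\<bar>j\<bar> \<le> 120\<close>, each bounded by \<open>K0\<close>, and the error of the
  tail approximation, which starts at \<open>120\<close>.\<close>

definition G_bound :: "nat \<Rightarrow> int \<Rightarrow> int \<Rightarrow> real" where
  "G_bound p t k = 243 * (K0 + 1) + (K0 + 1) * norm (tail_sum p t 120 k)"

lemma norm_G_ext_le:
  assumes p: "40 \<le> p" and z: "norm z \<le> 5"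
  shows "norm (G_ext p t k z) \<le> G_bound p t k"
proof -
  define h where "h = int ((p - 1) div 2)"
  define core where "core = {j \<in> {- h..h}. \<bar>j\<bar> \<le> 120}"
  define f where "f j = of_real (chi p (k - j)) * zeta_pow p (of_int (j * t)) * wker p (of_int j + z)" for j
  have split: "{- h..h} = core \<union> tail p 120" "core \<inter> tail p 120 = {}"
    by (auto simp: core_def tail_def h_def)
  have fin: "finite core"
    by (rule finite_subset[of _ "{- h..h}"]) (auto simp: core_def)
  have "G_ext p t k z = (\<Sum>j\<in>core. f j) + (\<Sum>j\<in>tail p 120. f j)"
    unfolding G_ext_def h_def[symmetric] f_def[symmetric] split(1)
    by (rule sum.union_disjoint[OF fin finite_tail split(2)])
  also have "norm \<dots> \<le> 241 * K0 + (120 * (K0 + 1) / real 120 + (K0 + 1) * norm (tail_sum p t 120 k))"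
  proof (intro order_trans[OF norm_triangle_ineq] add_mono)
    have "norm (\<Sum>j\<in>core. f j) \<le> (\<Sum>j\<in>core. K0)"
    proof (intro order_trans[OF norm_sum] sum_mono)
      fix j
      have "norm (wker p (of_int j + z)) \<le> K0"
        by (rule order_trans[OF norm_wker_le exp_2_pi_le_K0[OF z]])
      then have "\<bar>chi p (k - j)\<bar> * norm (wker p (of_int j + z)) \<le> 1 * K0"
        using abs_chi_le by (intro mult_mono) auto
      then show "norm (f j) \<le> K0"
        by (simp add: f_def norm_mult)
    qed
    also have "\<dots> = real (card core) * K0"
      by simp
    also have "card core \<le> card {-120..120::int}"
      by (intro card_mono) (auto simp: core_def)
    then have "real (card core) * K0 \<le> 241 * K0"
      by (intro mult_right_mono) (auto simp: K0_def)
    finally show "norm (\<Sum>j\<in>core. f j) \<le> 241 * K0" .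
    show "norm (\<Sum>j\<in>tail p 120. f j) \<le> 120 * (K0 + 1) / real 120 + (K0 + 1) * norm (tail_sum p t 120 k)"
      unfolding f_def by (rule G_ext_tail[OF p _ z]) simp
  qed
  also have "\<dots> \<le> G_bound p t k"
    by (simp add: G_bound_def K0_def)
  finally show ?thesis .
qed

lemma G_bound_ge_1: "1 \<le> G_bound p t k"
proof -
  have "0 \<le> (K0 + 1) * norm (tail_sum p t 120 k)" "0 \<le> K0"
    by (simp_all add: K0_def add_nonneg_nonneg)
  then show ?thesis
    using add_mono[of 1 "243 * (K0 + 1)" 0 "(K0 + 1) * norm (tail_sum p t 120 k)"]
    unfolding G_bound_def by simp
qed

text \<open>The uniform integrability behind all later truncations; the bound is the same for all
  shifts \<open>t\<close>.\<close>

lemma G_bound_moment: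
  "\<exists>C. \<forall>\<^sub>F p in primes_at_top. \<forall>t. Eavg p (\<lambda>k. G_bound p t k ^ (2 * r)) \<le> C"
proof -
  define C1 where "C1 = 2 ^ r * (8 * fact (2 * r)) / real 120 ^ r + 1"
  define C where "C = 2 ^ (2 * r) * ((243 * (K0 + 1)) ^ (2 * r) + (K0 + 1) ^ (2 * r) * C1)"
  have "\<forall>\<^sub>F p in primes_at_top. \<bar>moment_err r p\<bar> < 1"
    using moment_err_tendsto[of r] by (auto simp: tendsto_iff dist_real_def)
  with eventually_odd_prime[of 1]
  have "\<forall>\<^sub>F p in primes_at_top. \<forall>t. Eavg p (\<lambda>k. G_bound p t k ^ (2 * r)) \<le> C"
  proof eventually_elim
    case (elim p)
    show ?case
    proof
      fix t
      have K: "0 \<le> K0 + 1"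
        by (simp add: K0_def add_nonneg_nonneg)
      have m: "Eavg p (\<lambda>k. norm (tail_sum p t 120 k) ^ (2 * r)) \<le> C1"
        using tail_sum_moment[of p 120 t r] elim unfolding C1_def by auto
      have "Eavg p (\<lambda>k. G_bound p t k ^ (2 * r))
          \<le> Eavg p (\<lambda>k. 2 ^ (2 * r) * ((243 * (K0 + 1)) ^ (2 * r) + (K0 + 1) ^ (2 * r) * norm (tail_sum p t 120 k) ^ (2 * r)))"
        unfolding G_bound_def power_mult_distrib[of "K0 + 1", symmetric]
        using K by (intro Eavg_mono power_add_le) auto
      also have "\<dots> = 2 ^ (2 * r) * ((243 * (K0 + 1)) ^ (2 * r) + (K0 + 1) ^ (2 * r) * Eavg p (\<lambda>k. norm (tail_sum p t 120 k) ^ (2 * r)))"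
        using elim by (simp add: Eavg_cmult Eavg_add Eavg_const)
      also have "\<dots> \<le> C"
        unfolding C_def using K by (intro mult_left_mono add_left_mono m) auto
      finally show "Eavg p (\<lambda>k. G_bound p t k ^ (2 * r)) \<le> C" .
    qed
  qed
  then show ?thesis
    by blast
qed

section \<open>The limiting kernel\<close>

text \<open>With \<open>w = 2 pi i y / p\<close> the denominators are \<open>p (exp w - 1)\<close>
  and \<open>p w\<close>. The difference is therefore \<open>wker\<close> times
  \<open>(exp w - 1 - w) / w\<close>, of order \<open>norm w\<close>, and no lower bound for a
  denominator enters.\<close>

lemma wker_series_kernel:
  assumes x: "0 \<le> x" "x \<le> 1" and p: "8 * (\<bar>j\<bar> + 1) \<le> int p"
  shows "norm (wker p (of_int j + of_real x) - series_kernel j x) \<le> 24 * (\<bar>of_int j\<bar> + 1) / real p"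
proof -
  define y where "y = of_int j + x"
  have "0 \<le> \<bar>j\<bar>"
    by simp
  then have p0: "0 < p"
    using p by presburger
  have yc: "of_int j + of_real x = (of_real y :: complex)"
    by (simp add: y_def)
  show ?thesis
  proof (cases "y = 0")
    case True
    have "wker p 0 = 1"
      using wker_of_int[OF p0, of 0] by simp
    then show ?thesis
      unfolding yc using True by (simp add: series_kernel_def y_def)
  next
    case False
    define w :: complex where "w = 2 * of_real pi * \<i> * (of_real y / of_nat p)"
    have w0: "w \<noteq> 0"
      using False p0 by (simp add: w_def)
    have "real_of_int (8 * (\<bar>j\<bar> + 1)) \<le> real_of_int (int p)"
      using p by (simp only: of_int_le_iff)
    then have pj: "8 * (\<bar>of_int j\<bar> + 1) \<le> real p"
      by simp
    have "norm w = 2 * pi * \<bar>y\<bar> / real p"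
      by (simp add: w_def norm_mult norm_divide)
    also have "\<dots> \<le> 2 * 4 * (\<bar>of_int j\<bar> + 1) / real p"
      using x pi_less_4 p0 by (intro divide_right_mono mult_mono) (auto simp: y_def)
    finally have nw: "norm w \<le> 8 * (\<bar>of_int j\<bar> + 1) / real p"
      by simp
    also have "\<dots> \<le> 1"
      using pj p0 by simp
    finally have "exp (norm w) \<le> 3"
      using exp_le by (meson exp_le_cancel_iff order_trans)
    have "exp (2 * of_real pi * \<i> * of_real y) = unit_exp x"
      using unit_exp_add_int[of x j] by (simp add: y_def unit_exp_def add.commute)
    then have geo: "wker p (of_real y) * (of_nat p * (exp w - 1)) = unit_exp x - 1"
      using wker_geometric[OF p0, of "of_real y"] by (simp add: w_def)
    have wp: "of_nat p * w = 2 * of_real pi * \<i> * of_real y"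
      using p0 by (simp add: w_def)
    have "series_kernel j x = (unit_exp x - 1) / (of_nat p * w)"
      unfolding wp using False by (simp add: series_kernel_def y_def)
    also have "\<dots> = wker p (of_real y) * (exp w - 1) / w"
      unfolding geo[symmetric] using p0 by simp
    finally have "series_kernel j x - wker p (of_real y) = wker p (of_real y) * ((exp w - 1 - w) / w)"
      using w0 by (simp add: field_simps)
    then have "norm (wker p (of_real y) - series_kernel j x) = norm (wker p (of_real y)) * (norm (exp w - 1 - w) / norm w)"
      by (metis norm_divide norm_minus_commute norm_mult)
    also have "\<dots> \<le> 1 * (exp (norm w) * (norm w)\<^sup>2 / norm w)"
      using norm_wker_real_le[of p j x] unfolding yc
      by (intro mult_mono divide_right_mono norm_exp_minus_1_minus_le) auto
    also have "\<dots> = exp (norm w) * norm w"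
      using w0 by (simp add: power2_eq_square)
    also have "\<dots> \<le> 3 * (8 * (\<bar>of_int j\<bar> + 1) / real p)"
      using nw \<open>exp (norm w) \<le> 3\<close> by (intro mult_mono) auto
    finally show ?thesis
      unfolding yc by simp
  qed
qed

text \<open>Separates \<open>x\<close> from the index: up to a summable error the kernel is a
  function of \<open>x\<close> times \<open>1 / j\<close>, so uniform convergence reduces to that of
  a scalar series.\<close>

lemma series_kernel_approx:
  assumes x: "0 \<le> x" "x \<le> 1" and j: "2 \<le> \<bar>j\<bar>"
  shows "norm (series_kernel j x - (unit_exp x - 1) / (2 * of_real pi * \<i> * of_int j)) \<le> 2 / (of_int j)\<^sup>2"
proof -
  define a where "a = real_of_int j"
  have "real_of_int 2 \<le> real_of_int \<bar>j\<bar>"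
    using j by (simp only: of_int_le_iff)
  then have a: "2 \<le> \<bar>a\<bar>"
    by (simp add: a_def)
  then have a1: "\<bar>a\<bar> / 2 \<le> \<bar>a + x\<bar>" "a \<noteq> 0"
    using x by (auto simp: abs_if split: if_splits)
  then have a2: "a + x \<noteq> 0"
    using a by auto
  define c :: complex where "c = 2 * of_real pi * \<i>"
  have c: "c \<noteq> 0" "norm c = 2 * pi"
    by (auto simp: c_def norm_mult)
  have "series_kernel j x = (unit_exp x - 1) / (c * of_real (a + x))"
    using a2 by (simp add: series_kernel_def a_def c_def)
  moreover have "(unit_exp x - 1) / (2 * of_real pi * \<i> * of_int j) = (unit_exp x - 1) / (c * of_real a)"
    by (simp add: c_def a_def)
  moreover have "(unit_exp x - 1) / (c * of_real (a + x)) - (unit_exp x - 1) / (c * of_real a)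
      = - (unit_exp x - 1) * of_real x / (c * of_real (a * (a + x)))"
    using a1(2) a2 c(1) by (simp add: divide_simps del: of_real_add) (simp add: algebra_simps)
  moreover have pa: "0 < \<bar>a\<bar> * (\<bar>a\<bar> / 2)"
    using a by (intro mult_pos_pos) auto
  ultimately have "series_kernel j x - (unit_exp x - 1) / (2 * of_real pi * \<i> * of_int j)
      = - (unit_exp x - 1) * of_real x / (c * of_real (a * (a + x)))"
    by metis
  then have "norm (series_kernel j x - (unit_exp x - 1) / (2 * of_real pi * \<i> * of_int j))
      = norm (- (unit_exp x - 1) * of_real x / (c * of_real (a * (a + x))))"
    by (rule arg_cong)
  also have "\<dots> = norm (unit_exp x - 1) * \<bar>x\<bar> / (2 * pi * (\<bar>a\<bar> * \<bar>a + x\<bar>))"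
    unfolding norm_divide norm_mult norm_minus_cancel norm_of_real c(2) abs_mult ..
  also have "\<dots> \<le> 2 * 1 / (2 * 1 * (\<bar>a\<bar> * (\<bar>a\<bar> / 2)))"
  proof (intro frac_le mult_mono a1)
    show "norm (unit_exp x - 1) \<le> 2"
      using norm_triangle_ineq4[of "unit_exp x" 1] by simp
  qed (use x pi_gt3 pa in auto)
  also have "\<dots> = 2 / a\<^sup>2"
    using a by (simp add: power2_eq_square)
  finally show ?thesis
    by (simp add: a_def)
qed

section \<open>Square integrability of the logarithm of a holomorphic function\<close>

text \<open>Borel--Caratheodory for a logarithm of \<open>g\<close>.\<close>

lemma zero_free_lower_bound:
  assumes holo: "g holomorphic_on ball 0 2" and nz: "\<And>z. z \<in> ball 0 2 \<Longrightarrow> g z \<noteq> 0"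
    and B: "\<And>z. z \<in> ball 0 2 \<Longrightarrow> norm (g z) < B" and g0: "1 \<le> norm (g 0)" and z: "norm z \<le> 1"
  shows "1 / B\<^sup>2 \<le> norm (g z)"
proof -
  have "contractible (ball (0::complex) 2)"
    by (intro convex_imp_contractible convex_ball)
  then obtain h where h: "h holomorphic_on ball 0 2" "\<And>z. z \<in> ball 0 2 \<Longrightarrow> g z = exp (h z)"
    using contractible_imp_holomorphic_log[OF holo _ nz] by blast
  have B0: "1 < B"
    using B[of 0] g0 by simp
  define A where "A = ln B - Re (h 0)"
  have reh: "Re (h z) < ln B" if "z \<in> ball 0 2" for z
  proof -
    have "exp (Re (h z)) < exp (ln B)"
      using B[OF that] h(2)[OF that] B0 by simp
    then show ?thesis
      by simp
  qed
  have re0: "0 \<le> Re (h 0)"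
  proof -
    have "exp 0 \<le> exp (Re (h 0))"
      using g0 h(2)[of 0] by simp
    then show ?thesis
      by (simp only: exp_le_cancel_iff)
  qed
  have A0: "0 < A"
    using reh[of 0] by (simp add: A_def)
  define w where "w z = h z - h 0" for z
  have rew: "Re (w z) < A" if "z \<in> ball 0 2" for z
    using reh[OF that] by (simp add: w_def A_def)
  \<comment> \<open>The Moebius map \<open>w / (2 A - w)\<close> takes the half-plane
    \<open>Re w < A\<close> into the unit disc and fixes \<open>0\<close>. Schwarz's lemma on the
    disc of radius \<open>2\<close> gives modulus at most \<open>1/2\<close> for
    \<open>norm z \<le> 1\<close>, that is, \<open>norm (w z) \<le> 2 * A\<close>.\<close>
  define F where "F z = w (2 * z) / (2 * of_real A - w (2 * z))" for z
  have den: "2 * of_real A - w z \<noteq> 0" if "z \<in> ball 0 2" for z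
  proof
    assume "2 * of_real A - w z = 0"
    then have "Re (w z) = 2 * A"
      by (simp add: complex_eq_iff)
    then show False
      using rew[OF that] A0 by simp
  qed
  have lt: "norm (w z) < norm (2 * of_real A - w z)" if "z \<in> ball 0 2" for z
  proof -
    have "(norm (2 * of_real A - w z))\<^sup>2 - (norm (w z))\<^sup>2 = 4 * A * (A - Re (w z))"
      unfolding cmod_power2 by (simp add: power2_eq_square algebra_simps)
    also have "\<dots> > 0"
      using A0 rew[OF that] by simp
    finally show ?thesis
      by (simp add: power2_less_imp_less)
  qed
  have dbl: "2 * z \<in> ball 0 2" if "norm z < 1" for z :: complex
    using that by (simp add: norm_mult)
  have Fholo: "F holomorphic_on ball 0 1"
  proof -
    have "(h \<circ> (\<lambda>z. 2 * z)) holomorphic_on ball 0 1"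
      by (rule holomorphic_on_compose_gen[OF _ h(1)]) (auto intro!: holomorphic_intros simp: norm_mult)
    then have "(\<lambda>z. h (2 * z)) holomorphic_on ball 0 1"
      by (simp add: o_def)
    then show ?thesis
      unfolding F_def w_def using den dbl by (intro holomorphic_intros) (auto simp: w_def)
  qed
  have "norm (F (z / 2)) \<le> norm (z / 2)"
  proof (rule Schwarz_Lemma(1)[OF Fholo])
    show "F 0 = 0"
      by (simp add: F_def w_def)
    show "norm (F u) < 1" if "norm u < 1" for u
    proof -
      have "0 < norm (2 * of_real A - w (2 * u))"
        using den[OF dbl[OF that]] by simp
      then show ?thesis
        using lt[OF dbl[OF that]] by (simp add: F_def norm_divide)
    qed
    show "norm (z / 2) < 1"
      using z by (simp add: norm_divide)
  qed
  then have F2: "norm (F (z / 2)) \<le> 1 / 2"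
    using z by (simp add: norm_divide)
  have zb: "z \<in> ball 0 2"
    using z by simp
  have "norm (w z) = norm (F (z / 2)) * norm (2 * of_real A - w z)"
    using den[OF zb] by (simp add: F_def norm_divide)
  also have "\<dots> \<le> 1 / 2 * (2 * A + norm (w z))"
    using A0 norm_triangle_ineq4[of "2 * of_real A" "w z"] F2 by (intro mult_mono) (auto simp: norm_mult)
  finally have "norm (w z) \<le> 2 * A"
    by simp
  then have "- (2 * A) \<le> Re (w z)"
    using abs_Re_le_cmod[of "w z"] by linarith
  then have "- 2 * ln B \<le> Re (h z)"
    using re0 by (simp add: w_def A_def)
  then have "exp (- 2 * ln B) \<le> norm (g z)"
    using h(2)[OF zb] by simp
  also have "exp (- 2 * ln B) = 1 / B\<^sup>2"
  proof -
    have "exp (- 2 * ln B) = exp (- (ln B + ln B))"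
      by simp
    also have "\<dots> = 1 / (B * B)"
      using B0 by (simp only: exp_minus exp_add exp_ln inverse_eq_divide less_trans[OF zero_less_one])
    finally show ?thesis
      by (simp add: power2_eq_square)
  qed
  finally show ?thesis .
qed

text \<open>Each zero is divided out by a Blaschke-type factor that at least doubles \<open>|g(0)|\<close> and preserves the
  bound, which is possible at most \<open>n\<close> times.\<close>

lemma factored_lower_bound:
  assumes "g holomorphic_on ball 0 5" "\<And>z. norm z \<le> 4 \<Longrightarrow> norm (g z) \<le> B" "1 \<le> norm (g 0)"
    "B < 2 ^ n * norm (g 0)"
  shows "\<exists>\<rho>s :: complex list. length \<rho>s \<le> n \<and> (\<forall>\<rho>\<in>set \<rho>s. norm \<rho> < 2) \<and>
    (\<forall>z. norm z \<le> 1 \<longrightarrow> 1 / (2 * B)\<^sup>2 * (\<Prod>\<rho>\<leftarrow>\<rho>s. norm (z - \<rho>) / 8) \<le> norm (g z))"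
  using assms
proof (induction n arbitrary: g)
  \<comment> \<open>For \<open>n = 0\<close> the hypotheses contradict each other at the
    origin.\<close>
  case 0
  then show ?case
    using 0(2)[of 0] 0(4) by (metis less_le_not_le mult_1 norm_zero power_0 zero_le_numeral)
next
  case (Suc n)
  have B1: "1 \<le> B"
    using Suc.prems(2)[of 0] Suc.prems(3) by simp
  show ?case
  proof (cases "\<exists>\<rho>\<in>ball 0 2. g \<rho> = 0")
    case False
    have "1 / (2 * B)\<^sup>2 \<le> norm (g z)" if "norm z \<le> 1" for z
    proof (rule zero_free_lower_bound[where g = g and B = "2 * B"])
      show "g holomorphic_on ball 0 2"
        using Suc.prems(1) by (rule holomorphic_on_subset) auto
      show "norm (g z) < 2 * B" if "z \<in> ball 0 2" for z
        using Suc.prems(2)[of z] that B1 by simp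
    qed (use False Suc.prems(3) that in auto)
    then show ?thesis
      by (intro exI[of _ "[]"]) auto
  next
    case True
    then obtain \<rho> where \<rho>: "norm \<rho> < 2" "g \<rho> = 0"
      by auto
    have \<rho>0: "\<rho> \<noteq> 0"
      using \<rho>(2) Suc.prems(3) by auto
    define q where "q z = (if z = \<rho> then deriv g \<rho> else (g z - g \<rho>) / (z - \<rho>))" for z
    have qh: "q holomorphic_on ball 0 5"
      unfolding q_def using Suc.prems(1) by (rule pole_lemma_open) auto
    \<comment> \<open>The inverse Blaschke factor of the disc of radius \<open>4\<close>: on the
      boundary \<open>norm (16 - cnj \<rho> * z) = 4 * norm (z - \<rho>)\<close>, so
      \<open>g1\<close> and \<open>g\<close> have equal modulus there, and the maximum principle
      keeps the bound \<open>B\<close> inside.\<close>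
    define g1 where "g1 z = q z * (16 - cnj \<rho> * z) / 4" for z
    have g1h: "g1 holomorphic_on ball 0 5"
      unfolding g1_def by (intro holomorphic_intros qh) auto
    have sphere: "norm (g1 z) = norm (g z)" if "norm z = 4" for z
    proof -
      have zr: "z \<noteq> \<rho>"
        using that \<rho>(1) by auto
      have "z * cnj z = 16"
        using that by (simp add: complex_norm_square[symmetric])
      then have "16 - cnj \<rho> * z = z * cnj (z - \<rho>)"
        by (simp add: algebra_simps)
      then have n: "norm (16 - cnj \<rho> * z) = 4 * norm (z - \<rho>)"
        using that by (simp add: norm_mult del: complex_cnj_diff)
      have eq: "g1 z = g z / (z - \<rho>) * (16 - cnj \<rho> * z) / 4"
        using zr \<rho>(2) by (simp only: g1_def q_def if_False diff_zero)
      show ?thesis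
        unfolding eq norm_divide norm_mult n using zr by simp
    qed
    have g1B: "norm (g1 z) \<le> B" if "norm z \<le> 4" for z
    proof (rule maximum_modulus_frontier[of g1 "cball 0 4"])
      show "g1 holomorphic_on interior (cball 0 4)"
        using g1h by (rule holomorphic_on_subset) auto
      show "continuous_on (closure (cball 0 4)) g1"
        using holomorphic_on_imp_continuous_on[OF g1h] by (rule continuous_on_subset) auto
      show "norm (g1 z) \<le> B" if "z \<in> frontier (cball 0 4)" for z
        using that sphere[of z] Suc.prems(2)[of z] by simp
    qed (use that in auto)
    have "norm (g1 0) = norm (g 0) * 4 / norm \<rho>"
      using \<rho>0 \<rho>(2) by (simp add: g1_def q_def norm_divide norm_mult)
    moreover have "2 * norm (g 0) \<le> norm (g 0) * 4 / norm \<rho>"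
    proof -
      have "2 * norm (g 0) * norm \<rho> \<le> 2 * norm (g 0) * 2"
        using \<rho>(1) by (intro mult_left_mono) auto
      then show ?thesis
        using \<rho>0 by (simp add: field_simps)
    qed
    ultimately have g10: "2 * norm (g 0) \<le> norm (g1 0)"
      by simp
    have "B < 2 ^ n * (2 * norm (g 0))"
      using Suc.prems(4) by simp
    also have "\<dots> \<le> 2 ^ n * norm (g1 0)"
      using g10 by (intro mult_left_mono) auto
    finally have "B < 2 ^ n * norm (g1 0)" .
    moreover have "1 \<le> norm (g1 0)"
      using g10 Suc.prems(3) by linarith
    ultimately obtain \<rho>s :: "complex list" where \<rho>s: "length \<rho>s \<le> n" "\<forall>\<rho>\<in>set \<rho>s. norm \<rho> < 2"
      "\<And>z. norm z \<le> 1 \<Longrightarrow> 1 / (2 * B)\<^sup>2 * (\<Prod>\<rho>\<leftarrow>\<rho>s. norm (z - \<rho>) / 8) \<le> norm (g1 z)"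
      using Suc.IH[OF g1h g1B] by blast
    have "1 / (2 * B)\<^sup>2 * (\<Prod>\<rho>\<leftarrow>\<rho> # \<rho>s. norm (z - \<rho>) / 8) \<le> norm (g z)" if z: "norm z \<le> 1" for z
    proof (cases "z = \<rho>")
      case True
      then show ?thesis
        by simp
    next
      case False
      \<comment> \<open>For \<open>norm z \<le> 1\<close> the factor is at most
        \<open>18 / 4\<close>, generously \<open>32 / 4 = 8\<close>, divided by
        \<open>norm (z - \<rho>)\<close>; this is the \<open>8\<close> of the statement.\<close>
      have "norm (16 - cnj \<rho> * z) \<le> 16 + norm \<rho> * norm z"
        using norm_triangle_ineq4[of 16 "cnj \<rho> * z"] by (simp add: norm_mult)
      also have "norm \<rho> * norm z \<le> 2 * 1"
        using \<rho>(1) z by (intro mult_mono) auto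
      finally have d: "norm (16 - cnj \<rho> * z) \<le> 32"
        by simp
      have "g1 z * (4 * (z - \<rho>)) = g z * (16 - cnj \<rho> * z)"
        using False \<rho>(2) by (simp add: g1_def q_def field_simps)
      then have "norm (g1 z) * (4 * norm (z - \<rho>)) = norm (g z) * norm (16 - cnj \<rho> * z)"
        by (metis norm_mult norm_numeral)
      also have "\<dots> \<le> norm (g z) * 32"
        using d by (intro mult_left_mono) auto
      finally have "norm (g1 z) * (norm (z - \<rho>) / 8) \<le> norm (g z)"
        by simp
      moreover have "(1 / (2 * B)\<^sup>2 * (\<Prod>\<rho>\<leftarrow>\<rho>s. norm (z - \<rho>) / 8)) * (norm (z - \<rho>) / 8) \<le> norm (g1 z) * (norm (z - \<rho>) / 8)"
        by (intro mult_right_mono \<rho>s z) auto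
      ultimately show ?thesis
        by (simp add: ac_simps)
    qed
    then show ?thesis
      using \<rho>s(1,2) \<rho>(1) by (intro exI[of _ "\<rho> # \<rho>s"]) auto
  qed
qed

section \<open>Integrating the logarithmic singularities\<close>

text \<open>Uniform in the position of \<open>a\<close>: within distance \<open>1\<close> of
  \<open>a\<close> the singularity contributes at most \<open>4\<close>, and farther away the
  integrand is at most \<open>1\<close>.\<close>

lemma nn_integral_inverse_sqrt_dist:
  "(\<integral>\<^sup>+x. ennreal (\<bar>x - a\<bar> powr (- 1/2)) * indicator {0..1} x \<partial>lborel) \<le> ennreal 5"
proof -
  define f where "f x = ennreal (\<bar>x\<bar> powr (- 1/2)) * indicator {-1..1} x" for x :: real
  have [measurable]: "f \<in> borel_measurable borel"
    unfolding f_def by measurable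
  have half: "(\<integral>\<^sup>+x. ennreal (x powr (- 1/2)) * indicator {0..1} x \<partial>lborel) = ennreal 2"
  proof -
    have "((\<lambda>x. x powr (- 1/2)) has_integral (1 powr (- 1/2 + 1) / (- 1/2 + 1))) {0..1::real}"
      by (rule has_integral_powr_from_0) auto
    then have "((\<lambda>x. x powr (- 1/2)) has_integral 2) {0..1::real}"
      by simp
    then show ?thesis
      by (intro nn_integral_has_integral_lebesgue') auto
  qed
  have half': "(\<integral>\<^sup>+x. ennreal (\<bar>x\<bar> powr (- 1/2)) * indicator {-1..0} x \<partial>lborel) = ennreal 2"
  proof -
    have "(\<integral>\<^sup>+x. ennreal (\<bar>x\<bar> powr (- 1/2)) * indicator {-1..0} x \<partial>lborel)
        = (\<integral>\<^sup>+x. ennreal (\<bar>0 + (-1) * x\<bar> powr (- 1/2)) * indicator {-1..0} (0 + (-1) * x) \<partial>lborel)"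
      by (subst nn_integral_real_affine[where c = "-1" and t = 0]) simp_all
    also have "\<dots> = (\<integral>\<^sup>+x. ennreal (x powr (- 1/2)) * indicator {0..1} x \<partial>lborel)"
      by (intro nn_integral_cong) (auto simp: indicator_def)
    finally show ?thesis
      using half by simp
  qed
  have "(\<integral>\<^sup>+x. f x \<partial>lborel) \<le> (\<integral>\<^sup>+x. ennreal (x powr (- 1/2)) * indicator {0..1} x
      + ennreal (\<bar>x\<bar> powr (- 1/2)) * indicator {-1..0} x \<partial>lborel)"
    by (intro nn_integral_mono) (auto simp: f_def indicator_def)
  also have "\<dots> = ennreal 2 + ennreal 2"
    by (subst nn_integral_add) (simp_all only: half half', measurable)
  finally have f4: "(\<integral>\<^sup>+x. f x \<partial>lborel) \<le> ennreal 4"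
    by (simp flip: ennreal_plus)
  have "(\<integral>\<^sup>+x. ennreal (\<bar>x - a\<bar> powr (- 1/2)) * indicator {0..1} x \<partial>lborel)
      \<le> (\<integral>\<^sup>+x. f (- a + 1 * x) + indicator {0..1} x \<partial>lborel)"
  proof (intro nn_integral_mono)
    fix x :: real
    show "ennreal (\<bar>x - a\<bar> powr (- 1/2)) * indicator {0..1} x \<le> f (- a + 1 * x) + indicator {0..1} x"
    proof (cases "\<bar>x - a\<bar> \<le> 1")
      case True
      then have "f (- a + 1 * x) = ennreal (\<bar>x - a\<bar> powr (- 1/2))"
        by (auto simp: f_def indicator_def abs_le_iff)
      then show ?thesis
        by (auto simp: indicator_def)
    next
      case False
      then have "\<bar>x - a\<bar> powr (- 1/2) \<le> 1 powr (- 1/2)"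
        by (intro powr_mono2') auto
      then have "ennreal (\<bar>x - a\<bar> powr (- 1/2)) \<le> 1"
        by simp
      then show ?thesis
        by (auto simp: indicator_def add_increasing)
    qed
  qed
  also have "\<dots> = (\<integral>\<^sup>+x. f (- a + 1 * x) \<partial>lborel) + (\<integral>\<^sup>+x. indicator {0..1::real} x \<partial>lborel)"
    by (rule nn_integral_add) auto
  also have "(\<integral>\<^sup>+x. f (- a + 1 * x) \<partial>lborel) = (\<integral>\<^sup>+x. f x \<partial>lborel)"
    by (subst nn_integral_real_affine[where c = 1 and t = "- a" and f = f]) simp_all
  also have "(\<integral>\<^sup>+x. f x \<partial>lborel) + (\<integral>\<^sup>+x. indicator {0..1::real} x \<partial>lborel) \<le> ennreal 4 + ennreal 1"
    by (intro add_mono f4) simp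
  finally show ?thesis
    by (simp flip: ennreal_plus)
qed

text \<open>Trades the squared logarithm for an integrable power. The factor
  \<open>48 = 16 * 3\<close> comes from \<open>ln y \<le> 4 * y powr (1/4)\<close> and
  \<open>8 powr (1/2) \<le> 3\<close>.\<close>

lemma ln_square_le_powr:
  assumes "0 < d" "d \<le> (8::real)"
  shows "(ln (8 / d))\<^sup>2 \<le> 48 * d powr (- 1/2)"
proof -
  have "ln (8 / d) \<le> (8 / d) powr (1/4) / (1/4)"
    by (rule ln_powr_bound) (use assms in auto)
  moreover have "0 \<le> ln (8 / d)"
    using assms by simp
  ultimately have "(ln (8 / d))\<^sup>2 \<le> (4 * (8 / d) powr (1/4))\<^sup>2"
    by (intro power_mono) auto
  also have "\<dots> = 16 * (8 / d) powr (1/2)"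
    using assms by (simp add: power_mult_distrib powr_power)
  also have "(8 / d) powr (1/2) = 8 powr (1/2) * d powr (- 1/2)"
    using assms by (simp add: powr_divide powr_minus_divide)
  also have "8 powr (1/2) \<le> (3::real)"
    by (simp add: powr_half_sqrt real_le_lsqrt)
  finally show ?thesis
    using assms by simp
qed

lemma prod_list_pos: "(\<And>x. x \<in> set xs \<Longrightarrow> 0 < f x) \<Longrightarrow> 0 < (\<Prod>x\<leftarrow>xs. f x :: real)"
  by (induction xs) auto

lemma ln_prod_list: "(\<And>x. x \<in> set xs \<Longrightarrow> 0 < f x) \<Longrightarrow> ln (\<Prod>x\<leftarrow>xs. f x) = (\<Sum>x\<leftarrow>xs. ln (f x :: real))"
proof (induction xs)
  case (Cons a xs)
  have "0 < (\<Prod>x\<leftarrow>xs. f x)"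
    using Cons.prems by (intro prod_list_pos) auto
  then show ?case
  proof -
    have "0 < f a"
      using Cons.prems by simp
    then have "ln (f a * (\<Prod>x\<leftarrow>xs. f x)) = ln (f a) + ln (\<Prod>x\<leftarrow>xs. f x)"
      using \<open>0 < (\<Prod>x\<leftarrow>xs. f x)\<close> by (intro ln_mult_pos) auto
    then show ?thesis
      using Cons by simp
  qed
qed simp

text \<open>Cauchy-Schwarz against the constant list.\<close>

lemma sum_list_square_le: "(\<Sum>x\<leftarrow>xs. f x)\<^sup>2 \<le> real (length xs) * (\<Sum>x\<leftarrow>xs. (f x :: real)\<^sup>2)"
proof (induction xs)
  case (Cons a xs)
  define n where "n = real (length xs)"
  define S where "S = (\<Sum>x\<leftarrow>xs. f x)"
  define Q where "Q = (\<Sum>x\<leftarrow>xs. (f x)\<^sup>2)"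
  have IH: "S\<^sup>2 \<le> n * Q"
    using Cons by (simp add: n_def S_def Q_def)
  have "2 * f a * S \<le> n * (f a)\<^sup>2 + Q"
  proof (cases "n = 0")
    case True
    then show ?thesis
      by (simp add: S_def Q_def n_def)
  next
    case False
    then have n: "0 < n"
      by (simp add: n_def)
    have "0 \<le> (n * f a - S)\<^sup>2"
      by simp
    then have "n * (2 * f a * S) \<le> n * (n * (f a)\<^sup>2) + S\<^sup>2"
      by (simp add: power2_eq_square algebra_simps)
    also have "\<dots> \<le> n * (n * (f a)\<^sup>2 + Q)"
      using IH by (simp add: algebra_simps)
    finally show ?thesis
      using n by simp
  qed
  then have "(f a + S)\<^sup>2 \<le> (n + 1) * ((f a)\<^sup>2 + Q)"
    using IH by (simp add: power2_eq_square algebra_simps)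
  then show ?case
    by (simp add: n_def S_def Q_def add.commute)
qed simp

text \<open>Each zero is replaced by its real part: it is no farther from \<open>x\<close>, so the
  bound becomes one by singularities on the line, in which \<open>x\<close> must avoid the real
  parts. The constant is \<open>72 = 2 * 6^2\<close>.\<close>

lemma ln_square_pointwise:
  assumes g: "1 \<le> B" "norm (g z) \<le> B" "g z \<noteq> 0" and z: "z = of_real x" "0 \<le> x" "x \<le> 1"
    and \<rho>s: "\<forall>\<rho>\<in>set \<rho>s. norm \<rho> < 2" "1 / (2 * B)\<^sup>2 * (\<Prod>\<rho>\<leftarrow>\<rho>s. norm (z - \<rho>) / 8) \<le> norm (g z)"
    and x: "x \<notin> Re ` set \<rho>s"
  shows "(ln (norm (g z)))\<^sup>2 \<le> 72 * B\<^sup>2 + 2 * real (length \<rho>s) * (\<Sum>\<rho>\<leftarrow>\<rho>s. 48 * \<bar>x - Re \<rho>\<bar> powr (- 1/2))"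
proof -
  define L where "L = (\<Sum>\<rho>\<leftarrow>\<rho>s. ln (8 / norm (z - \<rho>)))"
  have nz: "0 < norm (z - \<rho>)" "\<bar>x - Re \<rho>\<bar> \<le> norm (z - \<rho>)" "norm (z - \<rho>) \<le> 8" "0 < \<bar>x - Re \<rho>\<bar>"
    if "\<rho> \<in> set \<rho>s" for \<rho>
  proof -
    show a: "\<bar>x - Re \<rho>\<bar> \<le> norm (z - \<rho>)"
      using abs_Re_le_cmod[of "z - \<rho>"] z by simp
    show b: "0 < \<bar>x - Re \<rho>\<bar>"
      using x that by auto
    show "0 < norm (z - \<rho>)"
      using a b by linarith
    have "norm (z - \<rho>) \<le> norm z + norm \<rho>"
      by (rule norm_triangle_ineq4)
    then show "norm (z - \<rho>) \<le> 8"
      using \<rho>s(1) that z by force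
  qed
  have L0: "0 \<le> L"
    unfolding L_def using nz by (intro sum_list_nonneg) auto
  have P0: "0 < (\<Prod>\<rho>\<leftarrow>\<rho>s. norm (z - \<rho>) / 8)"
    using nz by (intro prod_list_pos) auto
  have "ln (1 / (2 * B)\<^sup>2 * (\<Prod>\<rho>\<leftarrow>\<rho>s. norm (z - \<rho>) / 8)) \<le> ln (norm (g z))"
    using \<rho>s(2) P0 g(1) by (intro ln_mono) auto
  also have "ln (1 / (2 * B)\<^sup>2 * (\<Prod>\<rho>\<leftarrow>\<rho>s. norm (z - \<rho>) / 8))
      = ln (1 / (2 * B)\<^sup>2) + ln (\<Prod>\<rho>\<leftarrow>\<rho>s. norm (z - \<rho>) / 8)"
    using P0 g(1) by (subst ln_mult) auto
  also have "ln (1 / (2 * B)\<^sup>2) = - 2 * ln (2 * B)"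
  proof -
    have "ln (1 / y\<^sup>2) = - 2 * ln y" if "0 < y" for y :: real
      using that by (simp add: ln_div ln_realpow)
    from this[of "2 * B"] show ?thesis
      using g(1) by linarith
  qed
  also have "ln (\<Prod>\<rho>\<leftarrow>\<rho>s. norm (z - \<rho>) / 8) = - L"
  proof -
    have "ln (norm (z - \<rho>) / 8) = - ln (8 / norm (z - \<rho>))" if "\<rho> \<in> set \<rho>s" for \<rho>
      using nz[OF that] by (simp add: ln_div)
    then have "(\<Sum>\<rho>\<leftarrow>\<rho>s. ln (norm (z - \<rho>) / 8)) = (\<Sum>\<rho>\<leftarrow>\<rho>s. - ln (8 / norm (z - \<rho>)))"
      by (intro arg_cong[where f = sum_list] map_cong) auto
    then show ?thesis
      using nz by (subst ln_prod_list) (auto simp: L_def uminus_sum_list_map o_def)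
  qed
  finally have lower: "- (2 * ln (2 * B) + L) \<le> ln (norm (g z))"
    by simp
  have "ln (norm (g z)) \<le> ln B"
    using g by (intro ln_mono) auto
  moreover have lnB: "ln (2 * B) \<le> 2 * B" "ln B \<le> B"
    using g(1) ln_le_minus_one[of "2 * B"] ln_le_minus_one[of B] by auto
  ultimately have "\<bar>ln (norm (g z))\<bar> \<le> 6 * B + L"
    using lower L0 g(1) by linarith
  then have "(ln (norm (g z)))\<^sup>2 \<le> (6 * B + L)\<^sup>2"
    using abs_le_square_iff[of "ln (norm (g z))" "6 * B + L"] by simp
  also have "\<dots> \<le> 2 * (6 * B)\<^sup>2 + 2 * L\<^sup>2"
    using sum_squares_bound[of "6 * B" L] by (simp add: power2_sum)
  also have "L\<^sup>2 \<le> real (length \<rho>s) * (\<Sum>\<rho>\<leftarrow>\<rho>s. (ln (8 / norm (z - \<rho>)))\<^sup>2)"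
    unfolding L_def by (rule sum_list_square_le)
  also have "(\<Sum>\<rho>\<leftarrow>\<rho>s. (ln (8 / norm (z - \<rho>)))\<^sup>2) \<le> (\<Sum>\<rho>\<leftarrow>\<rho>s. 48 * \<bar>x - Re \<rho>\<bar> powr (- 1/2))"
  proof (rule sum_list_mono)
    fix \<rho> assume \<rho>: "\<rho> \<in> set \<rho>s"
    have "(ln (8 / norm (z - \<rho>)))\<^sup>2 \<le> 48 * norm (z - \<rho>) powr (- 1/2)"
      using nz[OF \<rho>] by (intro ln_square_le_powr) auto
    also have "norm (z - \<rho>) powr (- 1/2) \<le> \<bar>x - Re \<rho>\<bar> powr (- 1/2)"
      using nz[OF \<rho>] by (intro powr_mono2') auto
    finally show "(ln (8 / norm (z - \<rho>)))\<^sup>2 \<le> 48 * \<bar>x - Re \<rho>\<bar> powr (- 1/2)"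
      by simp
  qed
  finally show ?thesis
    by (simp add: power_mult_distrib mult_left_mono)
qed

lemma borel_measurable_sum_list_ennreal:
  fixes f :: "'c \<Rightarrow> 'b \<Rightarrow> ennreal"
  shows "(\<And>r. r \<in> set rs \<Longrightarrow> f r \<in> borel_measurable M) \<Longrightarrow> (\<lambda>x. \<Sum>r\<leftarrow>rs. f r x) \<in> borel_measurable M"
  by (induction rs) auto

lemma nn_integral_sum_list:
  assumes "\<And>r. r \<in> set rs \<Longrightarrow> f r \<in> borel_measurable M"
  shows "(\<integral>\<^sup>+x. (\<Sum>r\<leftarrow>rs. f r x) \<partial>M) = (\<Sum>r\<leftarrow>rs. (\<integral>\<^sup>+x. f r x \<partial>M))"
  using assms
proof (induction rs)
  case (Cons r rs)
  have "(\<lambda>x. \<Sum>r\<leftarrow>rs. f r x) \<in> borel_measurable M"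
    using Cons.prems by (intro borel_measurable_sum_list_ennreal) auto
  then show ?case
    using Cons by (simp add: nn_integral_add)
qed simp

lemma ennreal_sum_list:
  assumes "\<And>x. 0 \<le> f x"
  shows "ennreal (\<Sum>x\<leftarrow>xs. f x) = (\<Sum>x\<leftarrow>xs. ennreal (f x))"
proof (induction xs)
  case (Cons a xs)
  have "0 \<le> (\<Sum>x\<leftarrow>xs. f x)"
    using assms by (intro sum_list_nonneg) auto
  then show ?case
    using Cons assms by (simp add: ennreal_plus)
qed simp

lemma ln_square_integral_bound:
  assumes g: "g holomorphic_on ball 0 5" "\<And>z. norm z \<le> 4 \<Longrightarrow> norm (g z) \<le> B" "1 \<le> norm (g 0)"
  shows "(\<integral>\<^sup>+x. ennreal ((ln (norm (g (of_real x))))\<^sup>2) * indicator {0..1} x \<partial>lborel) \<le> ennreal (2000 * B\<^sup>2)"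
proof -
  have B1: "1 \<le> B"
    using g(2)[of 0] g(3) by simp
  \<comment> \<open>About \<open>B\<close> zeros are granted, though \<open>2 ^ n > B\<close> would
    allow logarithmically many. The result is still quadratic in \<open>B\<close>, and all moments
    of the envelope are available.\<close>
  define n where "n = nat \<lceil>B\<rceil>"
  have nB: "B \<le> real n" "real n \<le> 2 * B"
    using B1 by (simp_all add: n_def) linarith
  have "B < 2 ^ n"
    using nB(1) of_nat_less_two_power[of n, where ?'a = real] by linarith
  also have "\<dots> \<le> 2 ^ n * norm (g 0)"
    using g(3) by simp
  finally obtain \<rho>s :: "complex list" where \<rho>s: "length \<rho>s \<le> n" "\<forall>\<rho>\<in>set \<rho>s. norm \<rho> < 2"
      "\<And>z. norm z \<le> 1 \<Longrightarrow> 1 / (2 * B)\<^sup>2 * (\<Prod>\<rho>\<leftarrow>\<rho>s. norm (z - \<rho>) / 8) \<le> norm (g z)"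
    using factored_lower_bound[OF g, of n] by blast
  define c where "c = 2 * real (length \<rho>s) * 48"
  have c0: "0 \<le> c"
    by (simp add: c_def)
  have "AE x in lborel. x \<notin> Re ` set \<rho>s"
    by (intro AE_not_in finite_imp_null_set_lborel) auto
  then have "AE x in lborel. ennreal ((ln (norm (g (of_real x))))\<^sup>2) * indicator {0..1} x
     \<le> ennreal (72 * B\<^sup>2) * indicator {0..1} x + ennreal c * (\<Sum>\<rho>\<leftarrow>\<rho>s. ennreal (\<bar>x - Re \<rho>\<bar> powr (- 1/2)) * indicator {0..1} x)"
  proof eventually_elim
    case (elim x)
    show ?case
    proof (cases "x \<in> {0..1}")
      case True
      have "(ln (norm (g (of_real x))))\<^sup>2 \<le> 72 * B\<^sup>2 + c * (\<Sum>\<rho>\<leftarrow>\<rho>s. \<bar>x - Re \<rho>\<bar> powr (- 1/2))"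
      proof (cases "g (of_real x) = 0")
        \<comment> \<open>By convention \<open>ln 0 = 0\<close>, so the left side vanishes at a
          zero.\<close>
        case True
        then show ?thesis
          using c0 by (auto intro!: add_nonneg_nonneg mult_nonneg_nonneg sum_list_nonneg)
      next
        case False
        have "(ln (norm (g (of_real x))))\<^sup>2 \<le> 72 * B\<^sup>2 + 2 * real (length \<rho>s) * (\<Sum>\<rho>\<leftarrow>\<rho>s. 48 * \<bar>x - Re \<rho>\<bar> powr (- 1/2))"
          using True \<rho>s elim False B1 g(2)[of "of_real x"]
          by (intro ln_square_pointwise[where z = "of_real x" and g = g]) auto
        then show ?thesis
          by (simp add: c_def sum_list_const_mult)
      qed
      then have "ennreal ((ln (norm (g (of_real x))))\<^sup>2)
          \<le> ennreal (72 * B\<^sup>2 + c * (\<Sum>\<rho>\<leftarrow>\<rho>s. \<bar>x - Re \<rho>\<bar> powr (- 1/2)))"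
        by (rule ennreal_leI)
      also have "\<dots> = ennreal (72 * B\<^sup>2) + ennreal c * ennreal (\<Sum>\<rho>\<leftarrow>\<rho>s. \<bar>x - Re \<rho>\<bar> powr (- 1/2))"
        using c0 by (subst ennreal_plus) (auto simp: ennreal_mult' intro!: mult_nonneg_nonneg sum_list_nonneg)
      also have "ennreal (\<Sum>\<rho>\<leftarrow>\<rho>s. \<bar>x - Re \<rho>\<bar> powr (- 1/2)) = (\<Sum>\<rho>\<leftarrow>\<rho>s. ennreal (\<bar>x - Re \<rho>\<bar> powr (- 1/2)))"
        by (rule ennreal_sum_list) simp
      finally show ?thesis
        using True by simp
    qed simp
  qed
  then have "(\<integral>\<^sup>+x. ennreal ((ln (norm (g (of_real x))))\<^sup>2) * indicator {0..1} x \<partial>lborel)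
     \<le> (\<integral>\<^sup>+x. ennreal (72 * B\<^sup>2) * indicator {0..1} x + ennreal c * (\<Sum>\<rho>\<leftarrow>\<rho>s. ennreal (\<bar>x - Re \<rho>\<bar> powr (- 1/2)) * indicator {0..1} x) \<partial>lborel)"
    by (rule nn_integral_mono_AE)
  also have "\<dots> = ennreal (72 * B\<^sup>2) + ennreal c * (\<Sum>\<rho>\<leftarrow>\<rho>s. (\<integral>\<^sup>+x. ennreal (\<bar>x - Re \<rho>\<bar> powr (- 1/2)) * indicator {0..1} x \<partial>lborel))"
  proof -
    define h where "h x = (\<Sum>\<rho>\<leftarrow>\<rho>s. ennreal (\<bar>x - Re \<rho>\<bar> powr (- 1/2)) * indicator {0..1} x)" for x
    have [measurable]: "h \<in> borel_measurable lborel"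
      unfolding h_def by (intro borel_measurable_sum_list_ennreal) measurable
    have "(\<integral>\<^sup>+x. ennreal (72 * B\<^sup>2) * indicator {0..1} x + ennreal c * h x \<partial>lborel)
        = (\<integral>\<^sup>+x. ennreal (72 * B\<^sup>2) * indicator {0..1::real} x \<partial>lborel) + (\<integral>\<^sup>+x. ennreal c * h x \<partial>lborel)"
      by (rule nn_integral_add) measurable
    also have "(\<integral>\<^sup>+x. ennreal c * h x \<partial>lborel) = ennreal c * (\<integral>\<^sup>+x. h x \<partial>lborel)"
      by (rule nn_integral_cmult) measurable
    also have "(\<integral>\<^sup>+x. h x \<partial>lborel)
        = (\<Sum>\<rho>\<leftarrow>\<rho>s. (\<integral>\<^sup>+x. ennreal (\<bar>x - Re \<rho>\<bar> powr (- 1/2)) * indicator {0..1} x \<partial>lborel))"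
      unfolding h_def by (rule nn_integral_sum_list) measurable
    finally show ?thesis
      by (simp add: h_def nn_integral_cmult)
  qed
  also have "\<dots> \<le> ennreal (72 * B\<^sup>2) + ennreal c * (\<Sum>\<rho>\<leftarrow>\<rho>s. ennreal 5)"
    by (intro add_left_mono mult_left_mono sum_list_mono nn_integral_inverse_sqrt_dist) auto
  also have "(\<Sum>\<rho>\<leftarrow>\<rho>s. ennreal 5) = ennreal (5 * real (length \<rho>s))"
  proof (induction \<rho>s)
    case (Cons a xs)
    then show ?case
      by (simp add: ennreal_plus[symmetric] algebra_simps del: ennreal_plus ennreal_numeral)
  qed simp
  also have "ennreal (72 * B\<^sup>2) + ennreal c * ennreal (5 * real (length \<rho>s)) = ennreal (72 * B\<^sup>2 + c * (5 * real (length \<rho>s)))"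
    using c0 by (simp add: ennreal_mult'' ennreal_plus)
  also have "\<dots> \<le> ennreal (2000 * B\<^sup>2)"
  proof (rule ennreal_leI)
    have "real (length \<rho>s) \<le> 2 * B"
      using \<rho>s(1) nB by linarith
    then have "(real (length \<rho>s))\<^sup>2 \<le> (2 * B)\<^sup>2"
      by (intro power_mono) auto
    moreover have "c * (5 * real (length \<rho>s)) = 480 * (real (length \<rho>s))\<^sup>2" "(2 * B)\<^sup>2 = 4 * B\<^sup>2"
      by (simp_all add: c_def power2_eq_square)
    ultimately show "72 * B\<^sup>2 + c * (5 * real (length \<rho>s)) \<le> 2000 * B\<^sup>2"
      using zero_le_power2[of B] by linarith
  qed
  finally show ?thesis .
qed

section \<open>The random series\<close>

locale rademacher = prob_space M for M :: "'a measure" +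
  fixes X :: "int \<Rightarrow> 'a \<Rightarrow> real"
  assumes indep: "indep_vars (\<lambda>_. borel) X UNIV"
    and plus: "\<And>j. measure M {\<omega> \<in> space M. X j \<omega> = 1} = 1 / 2"
    and minus: "\<And>j. measure M {\<omega> \<in> space M. X j \<omega> = -1} = 1 / 2"
begin

lemma X_measurable [measurable]: "X j \<in> borel_measurable M"
  using indep by (auto simp: indep_vars_def)

lemma AE_X: "AE \<omega> in M. X j \<omega> = -1 \<or> X j \<omega> = 1"
proof -
  have "{\<omega> \<in> space M. X j \<omega> = -1 \<or> X j \<omega> = 1} = {\<omega> \<in> space M. X j \<omega> = -1} \<union> {\<omega> \<in> space M. X j \<omega> = 1}"
    by auto
  also have "prob \<dots> = 1/2 + 1/2"
    by (subst finite_measure_Union) (use plus[of j] minus[of j] in auto)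
  finally have "prob {\<omega> \<in> space M. X j \<omega> = -1 \<or> X j \<omega> = 1} = 1"
    by simp
  then show ?thesis
    using AE_prob_1[of "{\<omega> \<in> space M. X j \<omega> = -1 \<or> X j \<omega> = 1}"] by (auto elim: AE_mp)
qed

lemma AE_all_X: "AE \<omega> in M. \<forall>j. X j \<omega> = -1 \<or> X j \<omega> = 1"
  using AE_X by (simp add: AE_all_countable)

lemma prob_pattern:
  assumes W: "finite W" and e: "\<epsilon> \<in> signs W"
  shows "prob {\<omega> \<in> space M. \<forall>j\<in>W. X j \<omega> = \<epsilon> j} = 1 / 2 ^ card W"
proof (cases "W = {}")
  case True
  then show ?thesis
    by (simp add: prob_space)
next
  case False
  have eq: "{\<omega> \<in> space M. \<forall>j\<in>W. X j \<omega> = \<epsilon> j} = (\<Inter>j\<in>W. X j -` {\<epsilon> j} \<inter> space M)"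
    using False by auto
  have 1: "prob (\<Inter>j\<in>W. X j -` {\<epsilon> j} \<inter> space M) = (\<Prod>j\<in>W. prob (X j -` {\<epsilon> j} \<inter> space M))"
    by (rule indep_varsD[OF indep False W subset_UNIV]) simp
  have 2: "prob (X j -` {\<epsilon> j} \<inter> space M) = 1 / 2" if "j \<in> W" for j
  proof -
    have c: "\<epsilon> j = -1 \<or> \<epsilon> j = 1"
      by (rule signs_cases[OF e that])
    have v: "X j -` {\<epsilon> j} \<inter> space M = {\<omega> \<in> space M. X j \<omega> = \<epsilon> j}"
      by auto
    show ?thesis
      unfolding v using c by (elim disjE) (simp_all only: plus minus)
  qed
  have "(\<Prod>j\<in>W. prob (X j -` {\<epsilon> j} \<inter> space M)) = (\<Prod>j\<in>W. 1 / 2)"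
    by (rule prod.cong[OF refl 2])
  then show ?thesis
    unfolding eq 1 by (simp add: power_one_over)
qed

text \<open>Almost surely the variable is a finite combination of indicators of sign patterns. The
  function \<open>\<Phi>\<close> is arbitrary on other vectors, whence the separate measurability
  hypothesis.\<close>

lemma expectation_pattern:
  assumes W: "finite W" and m: "(\<lambda>\<omega>. \<Phi> (\<lambda>j\<in>W. X j \<omega>)) \<in> borel_measurable M"
  shows "integrable M (\<lambda>\<omega>. \<Phi> (\<lambda>j\<in>W. X j \<omega>) :: real)"
    and "expectation (\<lambda>\<omega>. \<Phi> (\<lambda>j\<in>W. X j \<omega>)) = sign_avg W \<Phi>"
proof -
  define A where "A \<epsilon> = {\<omega> \<in> space M. \<forall>j\<in>W. X j \<omega> = \<epsilon> j}" for \<epsilon>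
  have [measurable]: "A \<epsilon> \<in> events" for \<epsilon>
    unfolding A_def using W by measurable
  have ae: "AE \<omega> in M. \<Phi> (\<lambda>j\<in>W. X j \<omega>) = (\<Sum>\<epsilon>\<in>signs W. \<Phi> \<epsilon> * indicator (A \<epsilon>) \<omega>)"
    using AE_all_X AE_space
  proof eventually_elim
    case (elim \<omega>)
    define x where "x = (\<lambda>j\<in>W. X j \<omega>)"
    have x: "x \<in> signs W"
      using elim by (auto simp: x_def signs_def)
    have "(\<Sum>\<epsilon>\<in>signs W. \<Phi> \<epsilon> * indicator (A \<epsilon>) \<omega>) = (\<Sum>\<epsilon>\<in>signs W. if \<epsilon> = x then \<Phi> \<epsilon> else 0)"
    proof (intro sum.cong refl)
      fix \<epsilon> assume e: "\<epsilon> \<in> signs W"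
      have "\<omega> \<in> A \<epsilon> \<longleftrightarrow> \<epsilon> = x"
      proof
        assume "\<omega> \<in> A \<epsilon>"
        then have "\<epsilon> j = x j" if "j \<in> W" for j
          using that by (simp add: A_def x_def)
        then show "\<epsilon> = x"
          using e x unfolding signs_def by (metis PiE_ext)
      qed (use elim in \<open>auto simp: A_def x_def\<close>)
      then show "\<Phi> \<epsilon> * indicator (A \<epsilon>) \<omega> = (if \<epsilon> = x then \<Phi> \<epsilon> else 0)"
        by (simp add: indicator_def)
    qed
    also have "\<dots> = \<Phi> x"
      using x finite_signs[OF W] by simp
    finally show ?case
      by (simp add: x_def)
  qed
  have int: "integrable M (\<lambda>\<omega>. \<Sum>\<epsilon>\<in>signs W. \<Phi> \<epsilon> * indicator (A \<epsilon>) \<omega>)"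
    by (intro Bochner_Integration.integrable_sum integrable_mult_right integrable_real_indicator)
      (auto simp: emeasure_eq_measure)
  show "integrable M (\<lambda>\<omega>. \<Phi> (\<lambda>j\<in>W. X j \<omega>))"
    using integrable_cong_AE[THEN iffD2, OF m _ ae] int by simp
  have "expectation (\<lambda>\<omega>. \<Phi> (\<lambda>j\<in>W. X j \<omega>)) = expectation (\<lambda>\<omega>. \<Sum>\<epsilon>\<in>signs W. \<Phi> \<epsilon> * indicator (A \<epsilon>) \<omega>)"
    using m ae by (intro integral_cong_AE) auto
  also have "\<dots> = (\<Sum>\<epsilon>\<in>signs W. \<Phi> \<epsilon> * prob (A \<epsilon>))"
    by (subst Bochner_Integration.integral_sum)
      (auto intro!: integrable_mult_right integrable_real_indicator simp: emeasure_eq_measure)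
  also have "\<dots> = (\<Sum>\<epsilon>\<in>signs W. \<Phi> \<epsilon> * (1 / 2 ^ card W))"
    by (intro sum.cong refl) (simp add: A_def prob_pattern[OF W])
  finally show "expectation (\<lambda>\<omega>. \<Phi> (\<lambda>j\<in>W. X j \<omega>)) = sign_avg W \<Phi>"
    by (simp add: sign_avg_def sum_divide_distrib)
qed

text \<open>The case \<open>r = 1\<close> of \<open>khintchine\<close>, applied to real and
  imaginary parts; the constant is \<open>4 * fact 2\<close>.\<close>

lemma second_moment:
  fixes a :: "int \<Rightarrow> complex"
  assumes W: "finite W"
  shows "expectation (\<lambda>\<omega>. (norm (\<Sum>j\<in>W. a j * of_real (X j \<omega>)))\<^sup>2) \<le> 8 * (\<Sum>j\<in>W. (norm (a j))\<^sup>2)"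
    and "integrable M (\<lambda>\<omega>. (norm (\<Sum>j\<in>W. a j * of_real (X j \<omega>)))\<^sup>2)"
proof -
  have eq: "(norm (\<Sum>j\<in>W. a j * of_real (v j)))\<^sup>2 = (\<Sum>j\<in>W. Re (a j) * v j)\<^sup>2 + (\<Sum>j\<in>W. Im (a j) * v j)\<^sup>2" for v
    by (simp add: cmod_power2)
  have r: "(\<Sum>j\<in>W. b j * X j \<omega>) = (\<Sum>j\<in>W. b j * (\<lambda>j\<in>W. X j \<omega>) j)" for b :: "int \<Rightarrow> real" and \<omega>
    by (intro sum.cong) auto
  have part: "integrable M (\<lambda>\<omega>. (\<Sum>j\<in>W. b j * X j \<omega>)\<^sup>2) \<and>
      expectation (\<lambda>\<omega>. (\<Sum>j\<in>W. b j * X j \<omega>)\<^sup>2) \<le> 8 * (\<Sum>j\<in>W. (b j)\<^sup>2)" for b :: "int \<Rightarrow> real"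
  proof
    have m: "(\<lambda>\<omega>. (\<Sum>j\<in>W. b j * (\<lambda>j\<in>W. X j \<omega>) j)\<^sup>2) \<in> borel_measurable M"
      unfolding r[symmetric] by measurable
    show "integrable M (\<lambda>\<omega>. (\<Sum>j\<in>W. b j * X j \<omega>)\<^sup>2)"
      unfolding r by (rule expectation_pattern(1)[OF W m])
    have "expectation (\<lambda>\<omega>. (\<Sum>j\<in>W. b j * X j \<omega>)\<^sup>2) = sign_avg W (\<lambda>\<epsilon>. (\<Sum>j\<in>W. b j * \<epsilon> j)\<^sup>2)"
      unfolding r by (rule expectation_pattern(2)[OF W m])
    also have "\<dots> \<le> 8 * (\<Sum>j\<in>W. (b j)\<^sup>2)"
      using khintchine[OF W, of b 1] by (simp add: fact_2 numeral_2_eq_2[symmetric])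
    finally show "expectation (\<lambda>\<omega>. (\<Sum>j\<in>W. b j * X j \<omega>)\<^sup>2) \<le> 8 * (\<Sum>j\<in>W. (b j)\<^sup>2)" .
  qed
  show "integrable M (\<lambda>\<omega>. (norm (\<Sum>j\<in>W. a j * of_real (X j \<omega>)))\<^sup>2)"
    unfolding eq using part by (intro Bochner_Integration.integrable_add) auto
  have "expectation (\<lambda>\<omega>. (norm (\<Sum>j\<in>W. a j * of_real (X j \<omega>)))\<^sup>2)
      = expectation (\<lambda>\<omega>. (\<Sum>j\<in>W. Re (a j) * X j \<omega>)\<^sup>2) + expectation (\<lambda>\<omega>. (\<Sum>j\<in>W. Im (a j) * X j \<omega>)\<^sup>2)"
    unfolding eq using part by (intro Bochner_Integration.integral_add) auto
  also have "\<dots> \<le> 8 * (\<Sum>j\<in>W. (Re (a j))\<^sup>2) + 8 * (\<Sum>j\<in>W. (Im (a j))\<^sup>2)"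
    using part by (intro add_mono) auto
  also have "\<dots> = 8 * (\<Sum>j\<in>W. (norm (a j))\<^sup>2)"
    by (simp add: cmod_power2 sum.distrib distrib_left)
  finally show "expectation (\<lambda>\<omega>. (norm (\<Sum>j\<in>W. a j * of_real (X j \<omega>)))\<^sup>2) \<le> 8 * (\<Sum>j\<in>W. (norm (a j))\<^sup>2)" .
qed

section \<open>Almost sure convergence of the random series\<close>

text \<open>The terms \<open>j = i\<close> and \<open>j = - i\<close> of the series of
  \<open>unit_exp (\<alpha> * j) * X j / j\<close>, paired as in the symmetric partial sums.\<close>

definition block_sum :: "real \<Rightarrow> nat \<Rightarrow> 'a \<Rightarrow> complex" where
  "block_sum \<alpha> i \<omega> = (unit_exp (\<alpha> * of_int (int i)) * of_real (X (int i) \<omega>)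
     - unit_exp (\<alpha> * of_int (- int i)) * of_real (X (- int i) \<omega>)) / of_nat i"

lemma block_sum_measurable [measurable]: "block_sum \<alpha> i \<in> borel_measurable M"
  unfolding block_sum_def by measurable

lemma norm_block_sum_le:
  assumes "\<forall>j. X j \<omega> = -1 \<or> X j \<omega> = 1"
  shows "norm (block_sum \<alpha> i \<omega>) \<le> 2 / real i"
proof -
  have "norm (X j \<omega>) = 1" for j
    using assms[rule_format, of j] by auto
  then have "norm (unit_exp (\<alpha> * of_int (int i)) * of_real (X (int i) \<omega>)
     - unit_exp (\<alpha> * of_int (- int i)) * of_real (X (- int i) \<omega>)) \<le> 1 + 1"
    by (intro order_trans[OF norm_triangle_ineq4] add_mono) (simp_all add: norm_mult)
  then show ?thesis
    by (simp add: block_sum_def norm_divide divide_right_mono)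
qed

lemma block_increment_moment:
  assumes n: "0 < n"
  shows "(\<integral>\<^sup>+\<omega>. ennreal (norm (\<Sum>i\<in>{n\<^sup>2<..(Suc n)\<^sup>2}. block_sum \<alpha> i \<omega>)) \<partial>M) \<le> ennreal (49 * real n powr (- 3/2))"
proof -
  define I where "I = {n\<^sup>2<..(Suc n)\<^sup>2}"
  define W where "W = int ` I \<union> (\<lambda>i. - int i) ` I"
  define a where "a j = unit_exp (\<alpha> * of_int j) / of_int j" for j :: int
  have finW: "finite W"
    by (simp add: W_def I_def)
  have pos: "0 < i" if "i \<in> I" for i
    using that by (simp add: I_def)
  have dis: "int ` I \<inter> (\<lambda>i. - int i) ` I = {}"
    using pos by force
  have inj: "inj_on (\<lambda>i. - int i) I"
    by (auto simp: inj_on_def)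
  have finI: "finite I"
    by (simp add: I_def)
  have sumW: "(\<Sum>j\<in>W. h j) = (\<Sum>i\<in>I. h (int i) + h (- int i))" for h :: "int \<Rightarrow> 'b :: comm_monoid_add"
    unfolding W_def using dis inj finI by (subst sum.union_disjoint) (auto simp: sum.reindex sum.distrib)
  have S: "(\<Sum>i\<in>I. block_sum \<alpha> i \<omega>) = (\<Sum>j\<in>W. a j * of_real (X j \<omega>))" for \<omega>
    unfolding sumW by (intro sum.cong refl) (simp add: block_sum_def a_def diff_divide_distrib)
  have "(\<Sum>j\<in>W. (norm (a j))\<^sup>2) = (\<Sum>i\<in>I. 2 / (real i)\<^sup>2)"
    unfolding sumW by (intro sum.cong refl) (simp add: a_def norm_divide power_divide)
  also have "\<dots> \<le> (\<Sum>i\<in>I. 2 / (real n) ^ 4)"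
  proof (intro sum_mono divide_left_mono)
    fix i assume "i \<in> I"
    then have "real (n\<^sup>2) \<le> real i"
      by (simp only: of_nat_le_iff) (simp add: I_def)
    then have "(real (n\<^sup>2))\<^sup>2 \<le> (real i)\<^sup>2"
      by (intro power_mono) auto
    then show "real n ^ 4 \<le> (real i)\<^sup>2"
      by simp
    show "0 < (real i)\<^sup>2 * real n ^ 4"
      using n pos[OF \<open>i \<in> I\<close>] by simp
  qed auto
  also have "\<dots> = real (card I) * (2 / real n ^ 4)"
    by simp
  also have "card I = 2 * n + 1"
    by (simp add: I_def power2_eq_square)
  also have "real (2 * n + 1) * (2 / real n ^ 4) \<le> 3 * real n * (2 / real n ^ 4)"
    using n by (intro mult_right_mono) auto
  also have "\<dots> = 6 / real n ^ 3"
    using n by (simp add: field_simps power_eq_if)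
  finally have a2: "(\<Sum>j\<in>W. (norm (a j))\<^sup>2) \<le> 6 / real n ^ 3" .
  \<comment> \<open>Balances the two terms of \<open>Y \<le> s + Y^2 / s\<close>, which passes from
    the second moment, at most \<open>48 * s^2\<close>, to the first; hence
    \<open>49 = 1 + 48\<close>.\<close>
  define s where "s = real n powr (- 3/2)"
  have s0: "0 < s"
    using n by (simp add: s_def)
  have ss: "s * s = 1 / real n ^ 3"
  proof -
    have "s * s = real n powr (- 3)"
      by (simp add: s_def powr_add[symmetric])
    also have "\<dots> = 1 / real n ^ 3"
      using n by (simp add: powr_minus_divide powr_realpow)
    finally show ?thesis .
  qed
  define Y where "Y \<omega> = norm (\<Sum>j\<in>W. a j * of_real (X j \<omega>))" for \<omega>
  have [measurable]: "Y \<in> borel_measurable M"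
    unfolding Y_def by measurable
  have intY: "integrable M (\<lambda>\<omega>. (Y \<omega>)\<^sup>2)" and EY: "expectation (\<lambda>\<omega>. (Y \<omega>)\<^sup>2) \<le> 48 / real n ^ 3"
    unfolding Y_def using second_moment[OF finW, of a] a2 by auto
  have amgm: "Y \<omega> \<le> s + (Y \<omega>)\<^sup>2 / s" for \<omega>
  proof (cases "Y \<omega> \<le> s")
    case False
    then have "Y \<omega> * s \<le> (Y \<omega>)\<^sup>2"
      using s0 by (simp add: power2_eq_square)
    then have "Y \<omega> \<le> (Y \<omega>)\<^sup>2 / s"
      using s0 by (simp add: pos_le_divide_eq)
    then show ?thesis
      using s0 by simp
  qed (use s0 in \<open>auto intro: add_increasing2\<close>)
  have "(\<integral>\<^sup>+\<omega>. ennreal (Y \<omega>) \<partial>M) \<le> (\<integral>\<^sup>+\<omega>. ennreal (s + (Y \<omega>)\<^sup>2 / s) \<partial>M)"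
    by (intro nn_integral_mono ennreal_leI amgm)
  also have "\<dots> = ennreal (expectation (\<lambda>\<omega>. s + (Y \<omega>)\<^sup>2 / s))"
    using intY s0 by (intro nn_integral_eq_integral) auto
  also have "expectation (\<lambda>\<omega>. s + (Y \<omega>)\<^sup>2 / s) = s + expectation (\<lambda>\<omega>. (Y \<omega>)\<^sup>2) / s"
    using intY by (subst Bochner_Integration.integral_add) (auto simp: prob_space)
  also have "\<dots> \<le> s + 48 / real n ^ 3 / s"
    using EY s0 by (intro add_left_mono divide_right_mono) auto
  also have "48 / real n ^ 3 / s = 48 * (s * s) / s"
    by (simp only: ss)
  also have "\<dots> = 48 * s"
    using s0 by simp
  finally have "(\<integral>\<^sup>+\<omega>. ennreal (Y \<omega>) \<partial>M) \<le> ennreal (49 * s)"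
    by (simp add: ennreal_leI)
  then show ?thesis
    unfolding I_def[symmetric] S by (simp add: Y_def s_def)
qed

end

lemma sum_symmetric_interval:
  fixes h :: "int \<Rightarrow> 'b :: comm_monoid_add"
  shows "(\<Sum>j = - int J..int J. h j) = h 0 + (\<Sum>i\<in>{0<..J}. h (int i) + h (- int i))"
proof (induction J)
  case (Suc J)
  have "{- int (Suc J)..int (Suc J)} = insert (int (Suc J)) (insert (- int (Suc J)) {- int J..int J})"
    by auto
  then have "(\<Sum>j = - int (Suc J)..int (Suc J). h j)
      = h (int (Suc J)) + (h (- int (Suc J)) + (\<Sum>j = - int J..int J. h j))"
    by simp
  moreover have "{0<..Suc J} = insert (Suc J) {0<..J}"
    by auto
  ultimately show ?case
    using Suc by (simp add: ac_simps)
qed simp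

lemma ex_square_interval: "\<exists>r. r\<^sup>2 \<le> N \<and> N < (Suc r)\<^sup>2"
proof (induction N)
  case (Suc N)
  then obtain r where r: "r\<^sup>2 \<le> N" "N < (Suc r)\<^sup>2"
    by blast
  show ?case
  proof (cases "Suc N < (Suc r)\<^sup>2")
    case False
    then have "Suc N = (Suc r)\<^sup>2"
      using r by simp
    then show ?thesis
      by (intro exI[of _ "Suc r"]) (simp add: power2_eq_square)
  qed (use r in \<open>auto intro: exI[of _ r]\<close>)
qed (auto intro: exI[of _ 0])

text \<open>As a uniform limit of the trigonometric polynomials \<open>wker p\<close>, the kernel is
  continuous also at its removable singularity.\<close>

lemma continuous_on_series_kernel: "continuous_on {0..1} (series_kernel j)"
proof (rule uniform_limit_theorem[where F = sequentially])
  show "\<forall>\<^sub>F p in sequentially. continuous_on {0..1} (\<lambda>x. wker p (of_int j + of_real x))"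
    unfolding wker_def using eventually_gt_at_top[of 0]
    by eventually_elim (intro continuous_intros, auto)
  show "uniform_limit {0..1} (\<lambda>p x. wker p (of_int j + of_real x)) (series_kernel j) sequentially"
  proof (rule uniform_limitI)
    fix e :: real assume e: "0 < e"
    have "(\<lambda>p. 24 * (\<bar>of_int j\<bar> + 1) * (1 / real p)) \<longlonglongrightarrow> 24 * (\<bar>of_int j\<bar> + 1) * 0"
      by (intro tendsto_mult tendsto_const lim_1_over_n)
    then have "\<forall>\<^sub>F p in sequentially. 24 * (\<bar>of_int j\<bar> + 1) * (1 / real p) < e"
      using e by (intro order_tendstoD(2)) auto
    with eventually_ge_at_top[of "nat (8 * (\<bar>j\<bar> + 1))"]
    show "\<forall>\<^sub>F p in sequentially. \<forall>x\<in>{0..1}. dist (wker p (of_int j + of_real x)) (series_kernel j x) < e"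
    proof eventually_elim
      case (elim p)
      then have "8 * (\<bar>j\<bar> + 1) \<le> int p"
        by linarith
      then show ?case
        using wker_series_kernel[of _ j p] elim(2) unfolding dist_norm by force
    qed
  qed
qed simp

context rademacher
begin

text \<open>The second moment of the block between \<open>n\<^sup>2\<close> and \<open>(n + 1)\<^sup>2\<close> is \<open>O(n^(-3))\<close>, and the trivial
  bound inside a block tends to \<open>0\<close>; this makes a maximal inequality unnecessary.\<close>

lemma AE_block_sum_convergent: "AE \<omega> in M. convergent (\<lambda>N. \<Sum>i\<in>{0<..N}. block_sum \<alpha> i \<omega>)"
proof -
  define E where "E n \<omega> = (\<Sum>i\<in>{n\<^sup>2<..(Suc n)\<^sup>2}. block_sum \<alpha> i \<omega>)" for n \<omega>
  have [measurable]: "E n \<in> borel_measurable M" for n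
    unfolding E_def by measurable
  have "(\<integral>\<^sup>+\<omega>. (\<Sum>n. ennreal (norm (E (Suc n) \<omega>))) \<partial>M) = (\<Sum>n. (\<integral>\<^sup>+\<omega>. ennreal (norm (E (Suc n) \<omega>)) \<partial>M))"
    by (intro nn_integral_suminf) measurable
  also have "\<dots> \<le> (\<Sum>n. ennreal (49 * real (Suc n) powr (- 3/2)))"
    unfolding E_def by (intro suminf_le block_increment_moment) auto
  also have "\<dots> = ennreal (\<Sum>n. 49 * real (Suc n) powr (- 3/2))"
  proof (rule suminf_ennreal_eq)
    have "summable (\<lambda>n. real n powr (- 3/2))"
      by (subst summable_real_powr_iff) auto
    then have "summable (\<lambda>n. 49 * real (Suc n) powr (- 3/2))"
      by (intro summable_mult) (simp only: summable_Suc_iff[of "\<lambda>n. real n powr (- 3/2)"])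
    then show "(\<lambda>n. 49 * real (Suc n) powr (- 3/2)) sums (\<Sum>n. 49 * real (Suc n) powr (- 3/2))"
      by (rule summable_sums)
  qed auto
  finally have "(\<integral>\<^sup>+\<omega>. (\<Sum>n. ennreal (norm (E (Suc n) \<omega>))) \<partial>M) \<noteq> \<infinity>"
    by (auto simp: top_unique)
  then have "AE \<omega> in M. (\<Sum>n. ennreal (norm (E (Suc n) \<omega>))) \<noteq> \<infinity>"
    by (intro nn_integral_PInf_AE) measurable
  with AE_all_X show ?thesis
  proof eventually_elim
    case (elim \<omega>)
    define T where "T N = (\<Sum>i\<in>{0<..N}. block_sum \<alpha> i \<omega>)" for N
    have "summable (\<lambda>n. norm (E (Suc n) \<omega>))"
      using elim(2) by (intro summable_suminf_not_top) auto
    then have sumE: "summable (\<lambda>n. E (Suc n) \<omega>)"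
      by (rule summable_norm_cancel)
    have step: "T ((Suc n)\<^sup>2) = T (n\<^sup>2) + E n \<omega>" for n
    proof -
      have "n\<^sup>2 \<le> (Suc n)\<^sup>2"
        by (intro power_mono) auto
      moreover have "{0<..b} = {0<..a} \<union> {a<..b}" if "a \<le> b" for a b :: nat
        using that by auto
      ultimately have "{0<..(Suc n)\<^sup>2} = {0<..n\<^sup>2} \<union> {n\<^sup>2<..(Suc n)\<^sup>2}"
        by blast
      then show ?thesis
        unfolding T_def E_def by (simp only:) (intro sum.union_disjoint, auto)
    qed
    have T: "T ((Suc n)\<^sup>2) = T 1 + (\<Sum>m<n. E (Suc m) \<omega>)" for n
    proof (induction n)
      case (Suc n)
      then show ?case
        using step[of "Suc n"] by (simp add: add.assoc)
    qed simp
    define L where "L = T 1 + (\<Sum>m. E (Suc m) \<omega>)"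
    have "(\<lambda>n. T ((Suc n)\<^sup>2)) \<longlonglongrightarrow> L"
      unfolding T L_def by (intro tendsto_intros summable_LIMSEQ sumE)
    then have lim: "(\<lambda>n. T (n\<^sup>2)) \<longlonglongrightarrow> L"
      by (rule LIMSEQ_imp_Suc)
    have "T \<longlonglongrightarrow> L"
    proof (rule LIMSEQ_I)
      fix e :: real assume e: "0 < e"
      obtain n1 where n1: "\<And>n. n1 \<le> n \<Longrightarrow> norm (T (n\<^sup>2) - L) < e / 2"
        using LIMSEQ_D[OF lim, of "e / 2"] e by auto
      \<comment> \<open>Within one block at most \<open>3 * r\<close> terms of size
        \<open>2 / r^2\<close> are added, in total \<open>6 / r\<close>, which is to be below
        \<open>e / 2\<close>.\<close>
      obtain n2 where n2: "12 / e < real n2"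
        using reals_Archimedean2 by blast
      define n0 where "n0 = max 1 (max n1 n2)"
      have "norm (T N - L) < e" if N: "n0\<^sup>2 \<le> N" for N
      proof -
        obtain r where r: "r\<^sup>2 \<le> N" "N < (Suc r)\<^sup>2"
          using ex_square_interval by blast
        have "n0 \<le> r"
        proof (rule ccontr)
          assume "\<not> n0 \<le> r"
          then have "(Suc r)\<^sup>2 \<le> n0\<^sup>2"
            by (intro power_mono) auto
          then show False
            using N r by linarith
        qed
        then have r1: "1 \<le> r" "n1 \<le> r" "n2 \<le> r"
          by (auto simp: n0_def)
        have "{0<..N} = {0<..r\<^sup>2} \<union> {r\<^sup>2<..N}"
          using r by auto
        then have "T N = T (r\<^sup>2) + (\<Sum>i\<in>{r\<^sup>2<..N}. block_sum \<alpha> i \<omega>)"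
          unfolding T_def by (simp only:) (intro sum.union_disjoint, auto)
        moreover have "norm (\<Sum>i\<in>{r\<^sup>2<..N}. block_sum \<alpha> i \<omega>) \<le> (\<Sum>i\<in>{r\<^sup>2<..N}. 2 / (real r)\<^sup>2)"
        proof (intro order_trans[OF norm_sum] sum_mono)
          fix i assume i: "i \<in> {r\<^sup>2<..N}"
          have "norm (block_sum \<alpha> i \<omega>) \<le> 2 / real i"
            by (rule norm_block_sum_le[OF elim(1)])
          also have "\<dots> \<le> 2 / real (r\<^sup>2)"
            using i r1 by (intro divide_left_mono) auto
          finally show "norm (block_sum \<alpha> i \<omega>) \<le> 2 / (real r)\<^sup>2"
            by simp
        qed
        moreover have "(\<Sum>i\<in>{r\<^sup>2<..N}. 2 / (real r)\<^sup>2) \<le> 6 / real r"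
        proof -
          have "N - r\<^sup>2 \<le> 3 * r"
            using r r1 by (simp add: power2_eq_square)
          then have "real (N - r\<^sup>2) * (2 / (real r)\<^sup>2) \<le> real (3 * r) * (2 / (real r)\<^sup>2)"
            by (intro mult_right_mono) (simp_all only: of_nat_le_iff, auto)
          also have "\<dots> = 6 / real r"
            using r1 by (simp add: power2_eq_square)
          finally show ?thesis
            by simp
        qed
        moreover have "6 / real r < e / 2"
        proof -
          have "12 / e < real r"
            using n2 r1(3) by linarith
          then show ?thesis
            using e r1(1) by (simp add: field_simps)
        qed
        ultimately show ?thesis
          using n1[OF r1(2)] norm_triangle_ineq[of "T (r\<^sup>2) - L" "\<Sum>i\<in>{r\<^sup>2<..N}. block_sum \<alpha> i \<omega>"]
          by (simp add: algebra_simps)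
      qed
      then show "\<exists>no. \<forall>n\<ge>no. norm (T n - L) < e"
        by blast
    qed
    then show ?case
      unfolding T_def convergent_def by blast
  qed
qed

lemma AE_uniformly_convergent: "AE \<omega> in M. uniformly_convergent_on {0..1} (G_partial X \<alpha> \<omega>)"
  using AE_all_X AE_block_sum_convergent[of \<alpha>]
proof eventually_elim
  case (elim \<omega>)
  define T where "T N = (\<Sum>i\<in>{0<..N}. block_sum \<alpha> i \<omega>)" for N
  obtain L where L: "T \<longlonglongrightarrow> L"
    using elim(2) unfolding T_def convergent_def by blast
  define c where "c x = (unit_exp x - 1) / (2 * of_real pi * \<i>)" for x
  define u where "u j x = unit_exp (\<alpha> * of_int j) * series_kernel j x * of_real (X j \<omega>)" for j x
  \<comment> \<open>What remains of the pair \<open>j = i\<close>, \<open>j = - i\<close> after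
    removing its factored part. It is \<open>O(1/i^2)\<close> uniformly in \<open>x\<close>, hence
    summable by Weierstrass, while the removed parts form a bounded function of \<open>x\<close>
    times a convergent scalar sequence.\<close>
  define r where "r i x = (if i = 0 then u 0 x else u (int i) x + u (- int i) x - c x * block_sum \<alpha> i \<omega>)" for i x
  have X1: "norm (X j \<omega>) = 1" for j
    using elim(1)[rule_format, of j] by auto
  have nc: "norm (c x) \<le> 1" for x
  proof -
    have "norm (unit_exp x - 1) \<le> 2"
      using norm_triangle_ineq4[of "unit_exp x" 1] by simp
    then have "norm (unit_exp x - 1) / (2 * pi) \<le> 2 / (2 * pi)"
      by (intro divide_right_mono) auto
    moreover have "norm (c x) = norm (unit_exp x - 1) / (2 * pi)"
      by (simp add: c_def norm_divide norm_mult)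
    ultimately have "norm (c x) \<le> 2 / (2 * pi)"
      by simp
    also have "\<dots> \<le> 1"
      using pi_gt3 by simp
    finally show ?thesis .
  qed
  have G: "G_partial X \<alpha> \<omega> J x = (\<Sum>i<Suc J. r i x) + c x * T J" for J x
  proof -
    have "{..<Suc J} = insert 0 {0<..J}"
      by auto
    moreover have "(\<Sum>i\<in>{0<..J}. r i x) = (\<Sum>i\<in>{0<..J}. u (int i) x + u (- int i) x - c x * block_sum \<alpha> i \<omega>)"
      by (intro sum.cong) (auto simp: r_def)
    moreover have "r 0 x = u 0 x"
      by (simp add: r_def)
    ultimately have "(\<Sum>i<Suc J. r i x) = u 0 x + (\<Sum>i\<in>{0<..J}. u (int i) x + u (- int i) x - c x * block_sum \<alpha> i \<omega>)"
      by simp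
    then show ?thesis
      unfolding G_partial_def u_def[symmetric] sum_symmetric_interval
      by (simp add: sum_subtractf T_def sum_distrib_left)
  qed
  have rb: "norm (r i x) \<le> 4 / (real i)\<^sup>2" if i: "2 \<le> i" and x: "x \<in> {0..1}" for i x
  proof -
    have one: "norm (u j x - unit_exp (\<alpha> * of_int j) * (c x / of_int j) * of_real (X j \<omega>)) \<le> 2 / (of_int j)\<^sup>2"
      if "2 \<le> \<bar>j\<bar>" for j
    proof -
      have "u j x - unit_exp (\<alpha> * of_int j) * (c x / of_int j) * of_real (X j \<omega>)
          = unit_exp (\<alpha> * of_int j) * (series_kernel j x - c x / of_int j) * of_real (X j \<omega>)"
        by (simp add: u_def algebra_simps)
      moreover have "c x / of_int j = (unit_exp x - 1) / (2 * of_real pi * \<i> * of_int j)"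
        by (simp add: c_def)
      ultimately have "norm (u j x - unit_exp (\<alpha> * of_int j) * (c x / of_int j) * of_real (X j \<omega>))
          = norm (series_kernel j x - (unit_exp x - 1) / (2 * of_real pi * \<i> * of_int j))"
        using X1 by (simp add: norm_mult)
      then show ?thesis
        using series_kernel_approx[of x j] x that by simp
    qed
    have "r i x = (u (int i) x - unit_exp (\<alpha> * of_int (int i)) * (c x / of_int (int i)) * of_real (X (int i) \<omega>))
        + (u (- int i) x - unit_exp (\<alpha> * of_int (- int i)) * (c x / of_int (- int i)) * of_real (X (- int i) \<omega>))"
      using i by (simp add: r_def block_sum_def field_simps)
    also have "norm \<dots> \<le> 2 / (of_int (int i))\<^sup>2 + 2 / (of_int (- int i))\<^sup>2"
      using i by (intro order_trans[OF norm_triangle_ineq] add_mono one) auto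
    finally show ?thesis
      by simp
  qed
  have "uniform_limit {0..1} (\<lambda>n x. \<Sum>i<n. r i x) (\<lambda>x. \<Sum>i. r i x) sequentially"
  proof (rule Weierstrass_m_test_ev)
    show "\<forall>\<^sub>F n in sequentially. \<forall>x\<in>{0..1}. norm (r n x) \<le> 4 / (real n)\<^sup>2"
      using eventually_ge_at_top[of 2] by eventually_elim (use rb in auto)
    have "summable (\<lambda>n. 4 * (1 / (real n)\<^sup>2))"
      using inverse_power_summable[of 2, where 'a = real] by (intro summable_mult) (simp add: divide_inverse)
    then show "summable (\<lambda>n. 4 / (real n)\<^sup>2)"
      by simp
  qed
  then have "uniform_limit {0..1} (\<lambda>n x. \<Sum>i<Suc n. r i x) (\<lambda>x. \<Sum>i. r i x) sequentially"
    by (rule filterlim_compose[OF _ filterlim_Suc])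
  moreover have "uniform_limit {0..1} (\<lambda>n x. c x * T n) (\<lambda>x. c x * L) sequentially"
  proof (rule uniform_limitI)
    fix e :: real assume "0 < e"
    with L have "\<forall>\<^sub>F n in sequentially. dist (T n) L < e"
      by (rule tendstoD)
    then show "\<forall>\<^sub>F n in sequentially. \<forall>x\<in>{0..1}. dist (c x * T n) (c x * L) < e"
    proof eventually_elim
      case (elim n)
      have "norm (c x * (T n - L)) \<le> 1 * norm (T n - L)" for x
        unfolding norm_mult using nc by (intro mult_right_mono) auto
      then show ?case
        using elim by (auto simp: dist_norm right_diff_distrib[symmetric] intro: order_le_less_trans)
    qed
  qed
  ultimately have "uniform_limit {0..1} (G_partial X \<alpha> \<omega>) (\<lambda>x. (\<Sum>i. r i x) + c x * L) sequentially"
    unfolding G[abs_def] by (rule uniform_limit_add)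
  then show ?case
    by (rule uniformly_convergentI)
qed

end

section \<open>Continuity and measurability of the limiting paths\<close>

lemma G_random_uniform_limit:
  assumes "uniformly_convergent_on {0..1} (G_partial X \<alpha> \<omega>)"
  shows "uniform_limit {0..1} (G_partial X \<alpha> \<omega>) (G_random X \<alpha> \<omega>) sequentially"
  using assms unfolding G_random_def by (simp add: uniformly_convergent_uniform_limit_iff)

lemma continuous_on_G_partial: "continuous_on {0..1} (G_partial X \<alpha> \<omega> J)"
  unfolding G_partial_def by (intro continuous_intros continuous_on_series_kernel)

lemma continuous_on_G_random: "continuous_on {0..1} (G_random X \<alpha> \<omega>)"
proof (cases "uniformly_convergent_on {0..1} (G_partial X \<alpha> \<omega>)")
  case True
  show ?thesis
    by (rule uniform_limit_theorem[OF _ G_random_uniform_limit[OF True]])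
      (auto simp: continuous_on_G_partial)
next
  case False
  then show ?thesis
    by (simp add: G_random_def)
qed

lemma le_on_rationals_imp_le:
  fixes f :: "real \<Rightarrow> real"
  assumes f: "continuous_on {0..1} f" and le: "\<And>q. q \<in> \<rat> \<Longrightarrow> q \<in> {0..1} \<Longrightarrow> f q \<le> c" and x: "x \<in> {0..1}"
  shows "f x \<le> c"
proof -
  define q where "q n = real_of_int \<lfloor>real (Suc n) * x\<rfloor> / real (Suc n)" for n
  have q01: "q n \<in> {0..1}" for n
  proof -
    have "real_of_int \<lfloor>real (Suc n) * x\<rfloor> \<le> real (Suc n) * x"
      by simp
    also have "\<dots> \<le> real (Suc n) * 1"
      using x by (intro mult_left_mono) auto
    finally have "real_of_int \<lfloor>real (Suc n) * x\<rfloor> \<le> real (Suc n)"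
      by simp
    moreover have "0 \<le> real_of_int \<lfloor>real (Suc n) * x\<rfloor>"
      using x by simp
    ultimately show ?thesis
      by (simp add: q_def)
  qed
  have qr: "q n \<in> \<rat>" for n
    by (simp add: q_def)
  have "q \<longlonglongrightarrow> x"
  proof (rule real_tendsto_sandwich)
    show "\<forall>\<^sub>F n in sequentially. x - 1 / real (Suc n) \<le> q n"
    proof (intro always_eventually allI)
      fix n
      have "real (Suc n) * x - 1 \<le> real_of_int \<lfloor>real (Suc n) * x\<rfloor>"
        by linarith
      then have "(real (Suc n) * x - 1) / real (Suc n) \<le> q n"
        unfolding q_def by (intro divide_right_mono) auto
      then show "x - 1 / real (Suc n) \<le> q n"
        by (simp add: diff_divide_distrib)
    qed
    show "\<forall>\<^sub>F n in sequentially. q n \<le> x"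
    proof (intro always_eventually allI)
      fix n
      have "q n \<le> real (Suc n) * x / real (Suc n)"
        unfolding q_def by (intro divide_right_mono) auto
      then show "q n \<le> x"
        by simp
    qed
    have "(\<lambda>n. x - 1 / real (Suc n)) \<longlonglongrightarrow> x - 0"
      by (intro tendsto_intros LIMSEQ_Suc[OF lim_1_over_n])
    then show "(\<lambda>n. x - 1 / real (Suc n)) \<longlonglongrightarrow> x"
      by simp
  qed simp
  then have "(\<lambda>n. f (q n)) \<longlonglongrightarrow> f x"
    using q01 x by (intro continuous_on_tendsto_compose[OF f]) auto
  then show ?thesis
    by (rule LIMSEQ_le_const2) (use le q01 qr in auto)
qed

context rademacher
begin

text \<open>The Cauchy criterion with countable quantifiers only, over \<open>nat\<close> and the
  rationals, which makes the convergence event measurable.\<close>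

lemma uniformly_convergent_iff:
  "uniformly_convergent_on {0..1} (G_partial X \<alpha> \<omega>) \<longleftrightarrow>
    (\<forall>n::nat. \<exists>N. \<forall>k\<ge>N. \<forall>m\<ge>N. \<forall>q::rat. of_rat q \<in> {0..1::real} \<longrightarrow>
       norm (G_partial X \<alpha> \<omega> k (of_rat q) - G_partial X \<alpha> \<omega> m (of_rat q)) \<le> 1 / real (Suc n))"
    (is "_ \<longleftrightarrow> ?R")
proof
  assume "uniformly_convergent_on {0..1} (G_partial X \<alpha> \<omega>)"
  then have cauchy: "uniformly_Cauchy_on {0..1} (G_partial X \<alpha> \<omega>)"
    by (rule uniformly_convergent_Cauchy)
  show ?R
  proof
    fix n :: nat
    obtain N where "\<And>x k m. x \<in> {0..1} \<Longrightarrow> k \<ge> N \<Longrightarrow> m \<ge> N \<Longrightarrow>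
        dist (G_partial X \<alpha> \<omega> k x) (G_partial X \<alpha> \<omega> m x) < 1 / real (Suc n)"
      using cauchy unfolding uniformly_Cauchy_on_def by (metis of_nat_0_less_iff zero_less_Suc zero_less_divide_1_iff)
    then show "\<exists>N. \<forall>k\<ge>N. \<forall>m\<ge>N. \<forall>q::rat. of_rat q \<in> {0..1::real} \<longrightarrow>
       norm (G_partial X \<alpha> \<omega> k (of_rat q) - G_partial X \<alpha> \<omega> m (of_rat q)) \<le> 1 / real (Suc n)"
      unfolding dist_norm by (meson less_imp_le)
  qed
next
  assume R: ?R
  have "uniformly_Cauchy_on {0..1} (G_partial X \<alpha> \<omega>)"
    unfolding uniformly_Cauchy_on_def
  proof (intro allI impI)
    fix e :: real assume "0 < e"
    then obtain n where n: "1 / real (Suc n) < e"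
      using nat_approx_posE by blast
    obtain N where N: "\<And>k m q. k \<ge> N \<Longrightarrow> m \<ge> N \<Longrightarrow> of_rat q \<in> {0..1::real} \<Longrightarrow>
       norm (G_partial X \<alpha> \<omega> k (of_rat q) - G_partial X \<alpha> \<omega> m (of_rat q)) \<le> 1 / real (Suc n)"
      using R by meson
    have "norm (G_partial X \<alpha> \<omega> k x - G_partial X \<alpha> \<omega> m x) \<le> 1 / real (Suc n)"
      if "x \<in> {0..1}" "k \<ge> N" "m \<ge> N" for x k m
    proof (rule le_on_rationals_imp_le[OF _ _ that(1)])
      show "continuous_on {0..1} (\<lambda>x. norm (G_partial X \<alpha> \<omega> k x - G_partial X \<alpha> \<omega> m x))"
        by (intro continuous_intros continuous_on_G_partial)
      show "norm (G_partial X \<alpha> \<omega> k q - G_partial X \<alpha> \<omega> m q) \<le> 1 / real (Suc n)"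
        if "q \<in> \<rat>" "q \<in> {0..1}" for q
        using that \<open>k \<ge> N\<close> \<open>m \<ge> N\<close> N by (auto elim!: Rats_cases)
    qed
    then show "\<exists>M. \<forall>x\<in>{0..1}. \<forall>m\<ge>M. \<forall>n\<ge>M. dist (G_partial X \<alpha> \<omega> m x) (G_partial X \<alpha> \<omega> n x) < e"
      unfolding dist_norm using n by (meson order_le_less_trans)
  qed
  then show "uniformly_convergent_on {0..1} (G_partial X \<alpha> \<omega>)"
    by (rule Cauchy_uniformly_convergent)
qed

lemma G_partial_measurable [measurable]: "(\<lambda>\<omega>. G_partial X \<alpha> \<omega> J x) \<in> borel_measurable M"
  unfolding G_partial_def by measurable

lemma uniformly_convergent_measurable [measurable]:
  "Measurable.pred M (\<lambda>\<omega>. uniformly_convergent_on {0..1} (G_partial X \<alpha> \<omega>))"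
  unfolding uniformly_convergent_iff by measurable

end

section \<open>Weak convergence\<close>

abbreviation restrict01 :: "(real \<Rightarrow> complex) \<Rightarrow> real \<Rightarrow> complex" where
  "restrict01 f \<equiv> (\<lambda>x\<in>{0..1}. f x)"

lemma mspace_C01: "mspace C01 = {f. f \<in> extensional {0..1} \<and> continuous_on {0..1} f}"
proof -
  have "compactin (top_of_set {0..1::real}) (topspace (top_of_set {0..1}))"
    by (simp add: compactin_subtopology compactin_euclidean_iff)
  from compactin_mspace_cfunspace[OF this, of euclidean_metric] show ?thesis
    by (auto simp: C01_def mtopology_of_def)
qed

lemma restrict01_in_C01:
  assumes "continuous_on {0..1} f"
  shows "restrict01 f \<in> mspace C01"
proof -
  have "continuous_on {0..1} (restrict01 f)"
    using assms by (rule continuous_on_eq) simp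
  then show ?thesis
    by (simp add: mspace_C01)
qed

lemma mdist_C01_le_iff:
  assumes "f \<in> mspace C01" "g \<in> mspace C01"
  shows "mdist C01 f g \<le> a \<longleftrightarrow> (\<forall>x\<in>{0..1}. norm (f x - g x) \<le> a)"
  using assms unfolding C01_def by (subst cfunspace_mdist_le) (auto simp: dist_norm)

lemma norm_le_mdist_C01:
  assumes "f \<in> mspace C01" "g \<in> mspace C01" "x \<in> {0..1}"
  shows "norm (f x - g x) \<le> mdist C01 f g"
  using mdist_C01_le_iff[OF assms(1,2), of "mdist C01 f g"] assms(3) by simp

interpretation C01: Metric_space "mspace C01" "mdist C01"
  by (rule Metric_space_mspace_mdist)

text \<open>The form in which continuity of a functional is used throughout: along almost surely
  convergent paths and along convergent coefficient vectors.\<close>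

definition seq_cont :: "((real \<Rightarrow> complex) \<Rightarrow> real) \<Rightarrow> bool" where
  "seq_cont \<phi> \<longleftrightarrow> (\<forall>u f. (\<forall>n::nat. u n \<in> mspace C01) \<longrightarrow> f \<in> mspace C01 \<longrightarrow>
     (\<lambda>n. mdist C01 (u n) f) \<longlonglongrightarrow> 0 \<longrightarrow> (\<lambda>n. \<phi> (u n)) \<longlonglongrightarrow> \<phi> f)"

lemma seq_contD:
  "seq_cont \<phi> \<Longrightarrow> (\<And>n. u n \<in> mspace C01) \<Longrightarrow> f \<in> mspace C01 \<Longrightarrow>
    (\<lambda>n. mdist C01 (u n) f) \<longlonglongrightarrow> 0 \<Longrightarrow> (\<lambda>n. \<phi> (u n)) \<longlonglongrightarrow> \<phi> f"
  by (simp add: seq_cont_def)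

lemma mdist_C01_tendsto_0:
  assumes "\<And>n. u n \<in> mspace C01" "f \<in> mspace C01" "uniform_limit {0..1} u f sequentially"
  shows "(\<lambda>n. mdist C01 (u n) f) \<longlonglongrightarrow> 0"
proof (rule tendstoI)
  fix e :: real assume e: "0 < e"
  then have "\<forall>\<^sub>F n in sequentially. \<forall>x\<in>{0..1}. dist (u n x) (f x) < e / 2"
    by (intro uniform_limitD[OF assms(3)]) simp
  then show "\<forall>\<^sub>F n in sequentially. dist (mdist C01 (u n) f) 0 < e"
  proof eventually_elim
    case (elim n)
    then have "mdist C01 (u n) f \<le> e / 2"
      unfolding mdist_C01_le_iff[OF assms(1,2)] by (auto simp: dist_norm intro: less_imp_le)
    then show ?case
      using e by simp
  qed
qed

lemma seq_cont_uniform_limit: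
  assumes "seq_cont \<phi>" "\<And>n. continuous_on {0..1} (u n)" "continuous_on {0..1} f"
    "uniform_limit {0..1} u f sequentially"
  shows "(\<lambda>n. \<phi> (restrict01 (u n))) \<longlonglongrightarrow> \<phi> (restrict01 f)"
proof (rule seq_contD[OF assms(1)])
  show m: "restrict01 (u n) \<in> mspace C01" "restrict01 f \<in> mspace C01" for n
    using assms by (auto intro: restrict01_in_C01)
  have "uniform_limit {0..1} (\<lambda>n. restrict01 (u n)) (restrict01 f) sequentially"
    by (rule uniform_limit_cong'[THEN iffD1, OF _ _ assms(4)]) auto
  then show "(\<lambda>n. mdist C01 (restrict01 (u n)) (restrict01 f)) \<longlonglongrightarrow> 0"
    by (intro mdist_C01_tendsto_0 m)
qed

lemma continuous_map_imp_tendsto: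
  fixes \<phi> :: "(real \<Rightarrow> complex) \<Rightarrow> complex"
  assumes "continuous_map (mtopology_of C01) euclidean \<phi>"
    "\<And>n. u n \<in> mspace C01" "f \<in> mspace C01" "(\<lambda>n. mdist C01 (u n) f) \<longlonglongrightarrow> 0"
  shows "(\<lambda>n. \<phi> (u n)) \<longlonglongrightarrow> \<phi> f"
proof -
  have "limitin (mtopology_of C01) u f sequentially"
    unfolding mtopology_of_def C01.limitin_metric_dist_null using assms by simp
  then have "limitin euclidean (\<phi> \<circ> u) (\<phi> f) sequentially"
    by (rule continuous_map_limit[OF assms(1)])
  then show ?thesis
    by (simp add: o_def)
qed

text \<open>Inherited in the limit from \<open>wker\<close>, which at real arguments is a mean of
  unimodular numbers.\<close>

lemma norm_series_kernel_le:
  assumes "x \<in> {0..1}"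
  shows "norm (series_kernel j x) \<le> 1"
proof -
  have "(\<lambda>p. 1 + 24 * (\<bar>of_int j\<bar> + 1) * (1 / real p)) \<longlonglongrightarrow> 1 + 24 * (\<bar>of_int j\<bar> + 1) * 0"
    by (intro tendsto_intros lim_1_over_n)
  then have lim: "(\<lambda>p. 1 + 24 * (\<bar>of_int j\<bar> + 1) * (1 / real p)) \<longlonglongrightarrow> 1"
    by simp
  show ?thesis
  proof (rule LIMSEQ_le_const[OF lim])
    show "\<exists>N. \<forall>p\<ge>N. norm (series_kernel j x) \<le> 1 + 24 * (\<bar>of_int j\<bar> + 1) * (1 / real p)"
    proof (intro exI[of _ "nat (8 * (\<bar>j\<bar> + 1))"] allI impI)
      fix p assume "nat (8 * (\<bar>j\<bar> + 1)) \<le> p"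
      then have "8 * (\<bar>j\<bar> + 1) \<le> int p"
        by linarith
      then have "norm (wker p (of_int j + of_real x) - series_kernel j x) \<le> 24 * (\<bar>of_int j\<bar> + 1) / real p"
        using assms by (intro wker_series_kernel) auto
      moreover have "norm (wker p (of_int j + of_real x)) \<le> 1"
        by (rule norm_wker_real_le)
      ultimately show "norm (series_kernel j x) \<le> 1 + 24 * (\<bar>of_int j\<bar> + 1) * (1 / real p)"
        using norm_triangle_ineq3[of "wker p (of_int j + of_real x)" "series_kernel j x"] by simp
    qed
  qed
qed

section \<open>Truncated paths as functions of finitely many signs\<close>

text \<open>The coefficients \<open>v\<close> are left open so that the random signs and the symbols
  \<open>chi p (k - j)\<close> can be inserted alike.\<close>

definition partial_path :: "real \<Rightarrow> nat \<Rightarrow> (int \<Rightarrow> real) \<Rightarrow> real \<Rightarrow> complex" where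
  "partial_path \<alpha> J v = restrict01 (\<lambda>x. \<Sum>j = - int J..int J. unit_exp (\<alpha> * of_int j) * series_kernel j x * of_real (v j))"

lemma partial_path_in_C01: "partial_path \<alpha> J v \<in> mspace C01"
  unfolding partial_path_def by (intro restrict01_in_C01 continuous_intros continuous_on_series_kernel)

lemma partial_path_G_partial: "partial_path \<alpha> J (\<lambda>j. X j \<omega>) = restrict01 (G_partial X \<alpha> \<omega> J)"
  by (simp add: partial_path_def G_partial_def)

lemma partial_path_restrict: "partial_path \<alpha> J (\<lambda>j\<in>{- int J..int J}. v j) = partial_path \<alpha> J v"
  by (auto simp: partial_path_def intro!: restrict_ext sum.cong)

lemma mdist_partial_path_le:
  "mdist C01 (partial_path \<alpha> J v) (partial_path \<alpha> J w) \<le> (\<Sum>j = - int J..int J. \<bar>v j - w j\<bar>)"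
  unfolding mdist_C01_le_iff[OF partial_path_in_C01 partial_path_in_C01]
proof
  fix x :: real assume x: "x \<in> {0..1}"
  have "partial_path \<alpha> J v x - partial_path \<alpha> J w x
      = (\<Sum>j = - int J..int J. unit_exp (\<alpha> * of_int j) * series_kernel j x * of_real (v j - w j))"
    using x by (simp add: partial_path_def sum_subtractf[symmetric] algebra_simps)
  also have "norm \<dots> \<le> (\<Sum>j = - int J..int J. \<bar>v j - w j\<bar>)"
  proof (intro order_trans[OF norm_sum] sum_mono)
    fix j
    have "norm (series_kernel j x) * \<bar>v j - w j\<bar> \<le> 1 * \<bar>v j - w j\<bar>"
      using x by (intro mult_right_mono norm_series_kernel_le) auto
    then show "norm (unit_exp (\<alpha> * of_int j) * series_kernel j x * of_real (v j - w j)) \<le> \<bar>v j - w j\<bar>"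
      by (simp only: norm_mult norm_unit_exp norm_of_real mult_1)
  qed
  finally show "norm (partial_path \<alpha> J v x - partial_path \<alpha> J w x) \<le> (\<Sum>j = - int J..int J. \<bar>v j - w j\<bar>)" .
qed

text \<open>Gives measurability of a functional of the truncated path by composing a continuous
  function with the measurable coefficient vector, so that no sigma-algebra on the path space is
  involved.\<close>

lemma partial_path_functional_continuous:
  assumes "seq_cont \<phi>"
  shows "continuous_on UNIV (\<lambda>v. \<phi> (partial_path \<alpha> J v))"
proof -
  have "continuous (at v within UNIV) (\<lambda>v. \<phi> (partial_path \<alpha> J v))" for v
  proof (rule continuous_within_sequentiallyI)
    fix u :: "nat \<Rightarrow> int \<Rightarrow> real" assume u: "u \<longlonglongrightarrow> v"
    have "(\<lambda>n. mdist C01 (partial_path \<alpha> J (u n)) (partial_path \<alpha> J v)) \<longlonglongrightarrow> 0"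
    proof (rule Lim_null_comparison)
      show "\<forall>\<^sub>F n in sequentially. norm (mdist C01 (partial_path \<alpha> J (u n)) (partial_path \<alpha> J v))
          \<le> (\<Sum>j = - int J..int J. \<bar>u n j - v j\<bar>)"
        by (intro always_eventually allI) (simp add: mdist_partial_path_le)
      have "(\<lambda>n. u n j) \<longlonglongrightarrow> v j" for j
        by (rule continuous_on_tendsto_compose[OF continuous_on_product_coordinates u]) auto
      then have "(\<lambda>n. \<Sum>j = - int J..int J. \<bar>u n j - v j\<bar>) \<longlonglongrightarrow> (\<Sum>j = - int J..int J. \<bar>v j - v j\<bar>)"
        by (intro tendsto_intros)
      then show "(\<lambda>n. \<Sum>j = - int J..int J. \<bar>u n j - v j\<bar>) \<longlonglongrightarrow> 0"
        by simp
    qed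
    then show "(\<lambda>n. \<phi> (partial_path \<alpha> J (u n))) \<longlonglongrightarrow> \<phi> (partial_path \<alpha> J v)"
      by (intro seq_contD[OF assms] partial_path_in_C01)
  qed
  then show ?thesis
    by (simp add: continuous_on_eq_continuous_within)
qed

context rademacher
begin

lemma partial_functional_measurable:
  assumes "seq_cont \<phi>"
  shows "(\<lambda>\<omega>. \<phi> (restrict01 (G_partial X \<alpha> \<omega> J))) \<in> borel_measurable M"
proof -
  have "(\<lambda>v. \<phi> (partial_path \<alpha> J v)) \<in> borel_measurable borel"
    by (rule borel_measurable_continuous_onI[OF partial_path_functional_continuous[OF assms]])
  moreover have "(\<lambda>\<omega> j. X j \<omega>) \<in> borel_measurable M"
    by (rule measurable_coordinatewise_then_product) measurable
  ultimately have "(\<lambda>\<omega>. \<phi> (partial_path \<alpha> J (\<lambda>j. X j \<omega>))) \<in> borel_measurable M"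
    by (rule measurable_compose[rotated])
  then show ?thesis
    by (simp only: partial_path_G_partial)
qed

text \<open>Off the convergence event the truncated paths are replaced by the zero path. By the
  convention in \<open>G_random\<close> the functionals then converge at every outcome, not merely
  almost surely.\<close>

lemma functional_measurable:
  assumes "seq_cont \<phi>"
  shows "(\<lambda>\<omega>. \<phi> (restrict01 (G_random X \<alpha> \<omega>))) \<in> borel_measurable M"
proof (rule borel_measurable_LIMSEQ_metric)
  fix J
  have [measurable]: "(\<lambda>\<omega>. \<phi> (restrict01 (G_partial X \<alpha> \<omega> J))) \<in> borel_measurable M"
    by (rule partial_functional_measurable[OF assms])
  show "(\<lambda>\<omega>. if uniformly_convergent_on {0..1} (G_partial X \<alpha> \<omega>) then \<phi> (restrict01 (G_partial X \<alpha> \<omega> J))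
      else \<phi> (restrict01 (\<lambda>x. 0))) \<in> borel_measurable M"
    by measurable
next
  fix \<omega>
  show "(\<lambda>J. if uniformly_convergent_on {0..1} (G_partial X \<alpha> \<omega>) then \<phi> (restrict01 (G_partial X \<alpha> \<omega> J))
      else \<phi> (restrict01 (\<lambda>x. 0))) \<longlonglongrightarrow> \<phi> (restrict01 (G_random X \<alpha> \<omega>))"
  proof (cases "uniformly_convergent_on {0..1} (G_partial X \<alpha> \<omega>)")
    case True
    have "(\<lambda>J. \<phi> (restrict01 (G_partial X \<alpha> \<omega> J))) \<longlonglongrightarrow> \<phi> (restrict01 (G_random X \<alpha> \<omega>))"
      by (intro seq_cont_uniform_limit assms continuous_on_G_partial continuous_on_G_random G_random_uniform_limit True)
    then show ?thesis
      using True by simp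
  next
    case False
    then have "G_random X \<alpha> \<omega> = (\<lambda>x. 0)"
      by (simp add: G_random_def fun_eq_iff)
    then show ?thesis
      using False by simp
  qed
qed

lemma partial_functional_expectation:
  assumes "seq_cont \<phi>"
  shows "expectation (\<lambda>\<omega>. \<phi> (restrict01 (G_partial X \<alpha> \<omega> J)))
    = sign_avg {- int J..int J} (\<lambda>v. \<phi> (partial_path \<alpha> J v))"
proof -
  have eq: "\<phi> (restrict01 (G_partial X \<alpha> \<omega> J)) = \<phi> (partial_path \<alpha> J (\<lambda>j\<in>{- int J..int J}. X j \<omega>))" for \<omega>
    by (simp only: partial_path_restrict partial_path_G_partial)
  show ?thesis
    unfolding eq using partial_functional_measurable[OF assms, of \<alpha> J] unfolding eq
    by (intro expectation_pattern(2)) auto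
qed

lemma partial_expectation_tendsto:
  assumes "seq_cont \<phi>" and B: "\<And>f. f \<in> mspace C01 \<Longrightarrow> \<bar>\<phi> f\<bar> \<le> B"
  shows "(\<lambda>J. expectation (\<lambda>\<omega>. \<phi> (restrict01 (G_partial X \<alpha> \<omega> J))))
     \<longlonglongrightarrow> expectation (\<lambda>\<omega>. \<phi> (restrict01 (G_random X \<alpha> \<omega>)))"
proof (rule integral_dominated_convergence[where w = "\<lambda>_. B"])
  show "AE \<omega> in M. (\<lambda>J. \<phi> (restrict01 (G_partial X \<alpha> \<omega> J))) \<longlonglongrightarrow> \<phi> (restrict01 (G_random X \<alpha> \<omega>))"
    using AE_uniformly_convergent[of \<alpha>]
    by eventually_elim
      (intro seq_cont_uniform_limit assms continuous_on_G_partial continuous_on_G_random G_random_uniform_limit)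
  show "AE \<omega> in M. norm (\<phi> (restrict01 (G_partial X \<alpha> \<omega> J))) \<le> B" for J
    by (intro AE_I2) (simp add: B restrict01_in_C01 continuous_on_G_partial)
qed (use assms functional_measurable partial_functional_measurable in auto)

end

section \<open>Paths along the primes against truncated series\<close>

lemma nearest_int_close: "\<bar>real_of_int (nearest_int y) - y\<bar> \<le> 1 / 2"
proof (cases "frac y = 1/2")
  case True
  then show ?thesis
    by (simp add: nearest_int_def frac_def)
next
  case False
  then show ?thesis
    using of_int_round_abs_le[of y] by (simp add: nearest_int_def)
qed

definition near_shift :: "real \<Rightarrow> nat \<Rightarrow> int" where
  "near_shift \<alpha> p = nearest_int (\<alpha> * real p)"

lemma near_shift_tendsto: "((\<lambda>p. zeta_pow p (of_int (j * near_shift \<alpha> p))) \<longlongrightarrow> unit_exp (\<alpha> * of_int j)) primes_at_top"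
proof -
  have "((\<lambda>p. real_of_int (near_shift \<alpha> p) / real p - \<alpha>) \<longlongrightarrow> 0) at_top"
  proof (rule Lim_null_comparison)
    show "\<forall>\<^sub>F p in at_top. norm (real_of_int (near_shift \<alpha> p) / real p - \<alpha>) \<le> 1 / real p"
      using eventually_gt_at_top[of 0]
    proof eventually_elim
      case (elim p)
      have "\<bar>real_of_int (near_shift \<alpha> p) / real p - \<alpha>\<bar> = \<bar>real_of_int (near_shift \<alpha> p) - \<alpha> * real p\<bar> / real p"
      proof -
        have "real_of_int (near_shift \<alpha> p) / real p - \<alpha> = (real_of_int (near_shift \<alpha> p) - \<alpha> * real p) / real p"
          using elim by (simp add: field_simps)
        then show ?thesis
          by (simp only: abs_divide abs_of_nat)
      qed
      also have "\<dots> \<le> 1 / real p"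
        using nearest_int_close[of "\<alpha> * real p"] by (intro divide_right_mono) (auto simp: near_shift_def)
      finally show ?case
        by simp
    qed
  qed (rule lim_1_over_n)
  then have "((\<lambda>p. real_of_int (near_shift \<alpha> p) / real p) \<longlongrightarrow> \<alpha>) at_top"
    by (simp add: LIM_zero_iff)
  then have "((\<lambda>p. unit_exp (of_int j * (real_of_int (near_shift \<alpha> p) / real p))) \<longlongrightarrow> unit_exp (of_int j * \<alpha>)) at_top"
    unfolding unit_exp_def by (intro tendsto_exp tendsto_mult tendsto_of_real tendsto_const)
  then show ?thesis
    by (intro tendsto_primes_at_top) (simp add: zeta_pow_def mult.commute)
qed

lemma continuous_on_wker: "0 < p \<Longrightarrow> continuous_on S (\<lambda>z. wker p (of_int j + z))"
  unfolding wker_def by (intro continuous_intros) auto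

lemma continuous_on_G_ext: "0 < p \<Longrightarrow> continuous_on S (G_ext p t k)"
  unfolding G_ext_def by (intro continuous_intros continuous_on_wker) auto

lemma continuous_on_G_prime:
  assumes "prime p" "odd p"
  shows "continuous_on {0..1} (G_prime p t k)"
proof -
  have "continuous_on {0..1} (\<lambda>x. G_ext p t k (of_real x))"
    by (rule continuous_on_compose2[OF continuous_on_G_ext[of p UNIV]])
      (auto intro!: continuous_intros prime_gt_0_nat assms)
  then show ?thesis
    using G_prime_eq_G_ext[OF assms] by (simp cong: continuous_on_cong)
qed

definition prime_path :: "real \<Rightarrow> nat \<Rightarrow> int \<Rightarrow> real \<Rightarrow> complex" where
  "prime_path \<alpha> p k = restrict01 (G_prime p (near_shift \<alpha> p) k)"

lemma prime_path_in_C01: "prime p \<Longrightarrow> odd p \<Longrightarrow> prime_path \<alpha> p k \<in> mspace C01"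
  unfolding prime_path_def by (intro restrict01_in_C01 continuous_on_G_prime)

text \<open>For \<open>\<bar>j\<bar> \<le> J\<close>, the cost of replacing the shift phase by its
  limit and \<open>wker\<close> by \<open>series_kernel\<close>.\<close>

definition core_err :: "real \<Rightarrow> nat \<Rightarrow> nat \<Rightarrow> real" where
  "core_err \<alpha> J p = (\<Sum>j = - int J..int J. norm (zeta_pow p (of_int (j * near_shift \<alpha> p)) - unit_exp (\<alpha> * of_int j))
      + 24 * (\<bar>of_int j\<bar> + 1) * (1 / real p))"

lemma core_err_tendsto: "(core_err \<alpha> J \<longlongrightarrow> 0) primes_at_top"
proof -
  have "((\<lambda>p. core_err \<alpha> J p) \<longlongrightarrow> (\<Sum>j = - int J..int J.
      norm (unit_exp (\<alpha> * of_int j) - unit_exp (\<alpha> * of_int j)) + 24 * (\<bar>of_int j\<bar> + 1) * 0)) primes_at_top"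
    unfolding core_err_def
    by (intro tendsto_intros near_shift_tendsto tendsto_primes_at_top[OF lim_1_over_n])
  then show ?thesis
    by simp
qed

lemma mdist_prime_path_le:
  assumes p: "prime p" "odd p" "40 \<le> p" "8 * (J + 1) \<le> p" and J: "120 \<le> J"
  shows "mdist C01 (prime_path \<alpha> p k) (partial_path \<alpha> J (\<lambda>j. chi p (k - j)))
     \<le> core_err \<alpha> J p + 120 * (K0 + 1) / real J + (K0 + 1) * norm (tail_sum p (near_shift \<alpha> p) J k)"
  unfolding mdist_C01_le_iff[OF prime_path_in_C01[OF p(1,2)] partial_path_in_C01]
proof
  fix x :: real assume x: "x \<in> {0..1}"
  define h where "h = int ((p - 1) div 2)"
  define a where "a j = zeta_pow p (of_int (j * near_shift \<alpha> p))" for j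
  define w where "w j = wker p (of_int j + of_real x)" for j
  \<comment> \<open>The bound \<open>8 * (J + 1) \<le> p\<close> puts the core inside the range of
    summation; below it also serves \<open>wker_series_kernel\<close>.\<close>
  have Jh: "int J \<le> h"
    using p(4) by (simp add: h_def)
  have split: "{- h..h} = {- int J..int J} \<union> tail p J" "{- int J..int J} \<inter> tail p J = {}"
    using Jh by (auto simp: tail_def h_def)
  have "G_prime p (near_shift \<alpha> p) k x = (\<Sum>j = - int J..int J. of_real (chi p (k - j)) * a j * w j)
      + (\<Sum>j\<in>tail p J. of_real (chi p (k - j)) * a j * w j)"
    unfolding G_prime_eq_G_ext[OF p(1,2)] G_ext_def h_def[symmetric] a_def w_def split(1)
    by (rule sum.union_disjoint[OF _ finite_tail split(2)]) simp
  moreover have "norm (\<Sum>j\<in>tail p J. of_real (chi p (k - j)) * a j * w j)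
      \<le> 120 * (K0 + 1) / real J + (K0 + 1) * norm (tail_sum p (near_shift \<alpha> p) J k)"
    unfolding a_def w_def using x by (intro G_ext_tail p J) auto
  moreover have "norm ((\<Sum>j = - int J..int J. of_real (chi p (k - j)) * a j * w j)
      - (\<Sum>j = - int J..int J. unit_exp (\<alpha> * of_int j) * series_kernel j x * of_real (chi p (k - j)))) \<le> core_err \<alpha> J p"
    unfolding sum_subtractf[symmetric] core_err_def
  proof (intro order_trans[OF norm_sum] sum_mono)
    fix j assume j: "j \<in> {- int J..int J}"
    define b where "b = unit_exp (\<alpha> * of_int j)"
    define s where "s = series_kernel j x"
    have "of_real (chi p (k - j)) * a j * w j - b * s * of_real (chi p (k - j))
        = of_real (chi p (k - j)) * ((a j - b) * w j + b * (w j - s))"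
      by (simp add: algebra_simps)
    also have "norm \<dots> \<le> 1 * (norm (a j - b) * 1 + 1 * (24 * (\<bar>of_int j\<bar> + 1) / real p))"
      unfolding norm_mult
    proof (intro mult_mono)
      show "norm (of_real (chi p (k - j)) :: complex) \<le> 1"
        using abs_chi_le by simp
      have "8 * (\<bar>j\<bar> + 1) \<le> int p"
        using j p(4) by (auto simp: abs_le_iff)
      then have "norm (w j - s) \<le> 24 * (\<bar>of_int j\<bar> + 1) / real p"
        unfolding w_def s_def using x by (intro wker_series_kernel) auto
      moreover have "norm (w j) \<le> 1"
        unfolding w_def by (rule norm_wker_real_le)
      ultimately show "norm ((a j - b) * w j + b * (w j - s)) \<le> norm (a j - b) * 1 + 1 * (24 * (\<bar>of_int j\<bar> + 1) / real p)"
        by (intro order_trans[OF norm_triangle_ineq] add_mono) (simp_all add: norm_mult b_def mult_left_le)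
    qed auto
    finally show "norm (of_real (chi p (k - j)) * a j * w j - unit_exp (\<alpha> * of_int j) * series_kernel j x * of_real (chi p (k - j)))
        \<le> norm (zeta_pow p (of_int (j * near_shift \<alpha> p)) - unit_exp (\<alpha> * of_int j)) + 24 * (\<bar>of_int j\<bar> + 1) * (1 / real p)"
      by (simp add: a_def b_def s_def)
  qed
  ultimately have "norm (G_prime p (near_shift \<alpha> p) k x
      - (\<Sum>j = - int J..int J. unit_exp (\<alpha> * of_int j) * series_kernel j x * of_real (chi p (k - j))))
      \<le> core_err \<alpha> J p + (120 * (K0 + 1) / real J + (K0 + 1) * norm (tail_sum p (near_shift \<alpha> p) J k))"
    by (smt (verit) add_diff_eq diff_add_eq norm_triangle_ineq)
  then show "norm (prime_path \<alpha> p k x - partial_path \<alpha> J (\<lambda>j. chi p (k - j)) x)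
     \<le> core_err \<alpha> J p + 120 * (K0 + 1) / real J + (K0 + 1) * norm (tail_sum p (near_shift \<alpha> p) J k)"
    using x by (simp add: prime_path_def partial_path_def)
qed

text \<open>From the second moment by \<open>y \<le> s + y^2 / s\<close> with
  \<open>s = 1 / sqrt J\<close>, the value that balances the main terms;
  \<open>33 = 1 + 32\<close>.\<close>

lemma tail_sum_first_moment:
  assumes p: "prime p" "odd p" and J: "0 < J"
  shows "Eavg p (\<lambda>k. norm (tail_sum p t J k)) \<le> 33 / sqrt (real J) + sqrt (real J) * moment_err 1 p"
proof -
  define s where "s = 1 / sqrt (real J)"
  have s0: "0 < s"
    using J by (simp add: s_def)
  have p0: "0 < p"
    using p prime_gt_0_nat by blast
  have amgm: "y \<le> s + y\<^sup>2 / s" if "0 \<le> y" for y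
  proof (cases "y \<le> s")
    case False
    then have "y * s \<le> y\<^sup>2"
      using s0 by (simp add: power2_eq_square)
    then have "y \<le> y\<^sup>2 / s"
      using s0 by (simp add: pos_le_divide_eq)
    then show ?thesis
      using s0 by simp
  qed (use s0 in \<open>auto intro: add_increasing2\<close>)
  have "Eavg p (\<lambda>k. norm (tail_sum p t J k)) \<le> Eavg p (\<lambda>k. s + 1 / s * norm (tail_sum p t J k) ^ (2 * 1))"
    using amgm by (intro Eavg_mono) simp
  also have "\<dots> = s + 1 / s * Eavg p (\<lambda>k. norm (tail_sum p t J k) ^ (2 * 1))"
    unfolding Eavg_add Eavg_cmult Eavg_const[OF p0] ..
  also have "\<dots> \<le> s + 1 / s * (2 ^ 1 * (8 * fact (2 * 1)) / real J ^ 1 + moment_err 1 p)"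
    using s0 by (intro add_left_mono mult_left_mono tail_sum_moment p J) auto
  also have "\<dots> = 33 / sqrt (real J) + sqrt (real J) * moment_err 1 p"
  proof -
    have "sqrt (real J) / real J = 1 / sqrt (real J)"
      using J by (simp add: real_div_sqrt field_simps)
    then have "sqrt (real J) * 32 / real J = 32 * (1 / sqrt (real J))"
      by (simp only: times_divide_eq_right[symmetric] mult.commute[of _ 32] mult.assoc)
    then show ?thesis
      by (simp add: s_def fact_2 distrib_left)
  qed
  finally show ?thesis .
qed

text \<open>A double limit in four quarters of \<open>e\<close>: \<open>J\<close> is fixed first to
  control \<open>\<delta>\<close> and \<open>v\<close>, then \<open>p\<close> controls
  \<open>\<eta>\<close> and \<open>w\<close>.\<close>

lemma tendsto_interchange:
  fixes u :: "'b \<Rightarrow> real"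
  assumes close: "\<And>J. Jmin \<le> J \<Longrightarrow> \<forall>\<^sub>F p in F. \<bar>u p - w J p\<bar> \<le> \<delta> J + \<eta> J p"
    and "\<And>J. (\<eta> J \<longlongrightarrow> 0) F" "\<And>J. (w J \<longlongrightarrow> v J) F" "\<delta> \<longlonglongrightarrow> 0" "v \<longlonglongrightarrow> l"
  shows "(u \<longlongrightarrow> l) F"
proof (rule tendstoI)
  fix e :: real assume e: "0 < e"
  have "\<forall>\<^sub>F J in sequentially. dist (\<delta> J) 0 < e / 4" "\<forall>\<^sub>F J in sequentially. dist (v J) l < e / 4"
    using tendstoD[OF assms(4), of "e / 4"] tendstoD[OF assms(5), of "e / 4"] e by simp_all
  then have "\<forall>\<^sub>F J in sequentially. Jmin \<le> J \<and> \<bar>\<delta> J\<bar> < e / 4 \<and> dist (v J) l < e / 4"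
    using eventually_ge_at_top[of Jmin] by eventually_elim auto
  then obtain J where J: "Jmin \<le> J" "\<bar>\<delta> J\<bar> < e / 4" "dist (v J) l < e / 4"
    by (auto dest: eventually_happens)
  have "\<forall>\<^sub>F p in F. dist (\<eta> J p) 0 < e / 4" "\<forall>\<^sub>F p in F. dist (w J p) (v J) < e / 4"
    using tendstoD[OF assms(2), of "e / 4" J] tendstoD[OF assms(3), of "e / 4" J] e by simp_all
  with close[OF J(1)] show "\<forall>\<^sub>F p in F. dist (u p) l < e"
  proof eventually_elim
    case (elim p)
    then show ?case
      using J unfolding dist_real_def by linarith
  qed
qed

context rademacher
begin

text \<open>Truncating the path at \<open>J\<close> costs at most \<open>L\<close> times the mean
  distance in \<open>C01\<close>. The truncated functional depends on finitely many symbols and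
  converges by \<open>Eavg_pattern_tendsto\<close>, and \<open>J\<close> tends to infinity
  last.\<close>

lemma weak_limit_lipschitz:
  assumes B: "\<And>f. f \<in> mspace C01 \<Longrightarrow> \<bar>\<phi> f\<bar> \<le> B"
    and Lip: "\<And>f g. f \<in> mspace C01 \<Longrightarrow> g \<in> mspace C01 \<Longrightarrow> \<bar>\<phi> f - \<phi> g\<bar> \<le> L * mdist C01 f g"
    and L: "0 \<le> L"
  shows "seq_cont \<phi>"
    and "((\<lambda>p. Eavg p (\<lambda>k. \<phi> (prime_path \<alpha> p k))) \<longlongrightarrow> expectation (\<lambda>\<omega>. \<phi> (restrict01 (G_random X \<alpha> \<omega>)))) primes_at_top"
proof -
  show sc: "seq_cont \<phi>"
    unfolding seq_cont_def
  proof (intro allI impI)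
    fix u f assume u: "\<forall>n::nat. u n \<in> mspace C01" "f \<in> mspace C01" "(\<lambda>n. mdist C01 (u n) f) \<longlonglongrightarrow> 0"
    have "(\<lambda>n. \<phi> (u n) - \<phi> f) \<longlonglongrightarrow> 0"
    proof (rule Lim_null_comparison)
      show "\<forall>\<^sub>F n in sequentially. norm (\<phi> (u n) - \<phi> f) \<le> L * mdist C01 (u n) f"
        using u Lip by (intro always_eventually allI) auto
      show "(\<lambda>n. L * mdist C01 (u n) f) \<longlonglongrightarrow> 0"
        using u(3) by (intro tendsto_mult_right_zero)
    qed
    then show "(\<lambda>n. \<phi> (u n)) \<longlonglongrightarrow> \<phi> f"
      by (simp add: LIM_zero_iff)
  qed
  have v: "(\<lambda>J. sign_avg {- int J..int J} (\<lambda>v. \<phi> (partial_path \<alpha> J v)))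
      \<longlonglongrightarrow> expectation (\<lambda>\<omega>. \<phi> (restrict01 (G_random X \<alpha> \<omega>)))"
    using partial_expectation_tendsto[OF sc B] partial_functional_expectation[OF sc] by simp
  show "((\<lambda>p. Eavg p (\<lambda>k. \<phi> (prime_path \<alpha> p k))) \<longlongrightarrow> expectation (\<lambda>\<omega>. \<phi> (restrict01 (G_random X \<alpha> \<omega>)))) primes_at_top"
  proof (rule tendsto_interchange[where Jmin = 120 and v = "\<lambda>J. sign_avg {- int J..int J} (\<lambda>v. \<phi> (partial_path \<alpha> J v))"
      and w = "\<lambda>J p. Eavg p (\<lambda>k. \<phi> (partial_path \<alpha> J (\<lambda>j\<in>{- int J..int J}. chi p (k - j))))"
      and \<delta> = "\<lambda>J. L * (120 * (K0 + 1) * (1 / real J) + (K0 + 1) * (33 * (1 / sqrt (real J))))"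
      and \<eta> = "\<lambda>J p. L * (core_err \<alpha> J p + (K0 + 1) * (sqrt (real J) * moment_err 1 p))"])
    show "((\<lambda>p. Eavg p (\<lambda>k. \<phi> (partial_path \<alpha> J (\<lambda>j\<in>{- int J..int J}. chi p (k - j)))))
        \<longlongrightarrow> sign_avg {- int J..int J} (\<lambda>v. \<phi> (partial_path \<alpha> J v))) primes_at_top" for J
      by (rule Eavg_pattern_tendsto) simp
    show "(\<lambda>J. sign_avg {- int J..int J} (\<lambda>v. \<phi> (partial_path \<alpha> J v)))
      \<longlonglongrightarrow> expectation (\<lambda>\<omega>. \<phi> (restrict01 (G_random X \<alpha> \<omega>)))"
      by (rule v)
    have "(\<lambda>J. L * (120 * (K0 + 1) * (1 / real J) + (K0 + 1) * (33 * (1 / sqrt (real J)))))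
        \<longlonglongrightarrow> L * (120 * (K0 + 1) * 0 + (K0 + 1) * (33 * 0))"
    proof (intro tendsto_intros lim_1_over_n)
      show "(\<lambda>J. 1 / sqrt (real J)) \<longlonglongrightarrow> 0"
        by (rule tendsto_divide_0[OF tendsto_const])
          (rule filterlim_at_top_imp_at_infinity[OF filterlim_compose[OF sqrt_at_top filterlim_real_sequentially]])
    qed
    then show "(\<lambda>J. L * (120 * (K0 + 1) * (1 / real J) + (K0 + 1) * (33 * (1 / sqrt (real J))))) \<longlonglongrightarrow> 0"
      by simp
    show "((\<lambda>p. L * (core_err \<alpha> J p + (K0 + 1) * (sqrt (real J) * moment_err 1 p))) \<longlongrightarrow> 0) primes_at_top" for J
      by (intro tendsto_mult_right_zero tendsto_add_zero core_err_tendsto moment_err_tendsto)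
    fix J :: nat assume J: "120 \<le> J"
    show "\<forall>\<^sub>F p in primes_at_top. \<bar>Eavg p (\<lambda>k. \<phi> (prime_path \<alpha> p k))
        - Eavg p (\<lambda>k. \<phi> (partial_path \<alpha> J (\<lambda>j\<in>{- int J..int J}. chi p (k - j))))\<bar>
      \<le> L * (120 * (K0 + 1) * (1 / real J) + (K0 + 1) * (33 * (1 / sqrt (real J))))
        + L * (core_err \<alpha> J p + (K0 + 1) * (sqrt (real J) * moment_err 1 p))"
      using eventually_odd_prime[of "max 40 (8 * (J + 1))"]
    proof eventually_elim
      case (elim p)
      then have p: "prime p" "odd p" "40 \<le> p" "8 * (J + 1) \<le> p" and p0: "0 < p"
        by auto
      let ?T = "\<lambda>k. norm (tail_sum p (near_shift \<alpha> p) J k)"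
      let ?c = "core_err \<alpha> J p + 120 * (K0 + 1) / real J"
      have "\<bar>Eavg p (\<lambda>k. \<phi> (prime_path \<alpha> p k)) - Eavg p (\<lambda>k. \<phi> (partial_path \<alpha> J (\<lambda>j. chi p (k - j))))\<bar>
          \<le> Eavg p (\<lambda>k. \<bar>\<phi> (prime_path \<alpha> p k) - \<phi> (partial_path \<alpha> J (\<lambda>j. chi p (k - j)))\<bar>)"
        unfolding Eavg_diff[symmetric] by (rule abs_Eavg_le)
      also have "\<dots> \<le> Eavg p (\<lambda>k. L * (?c + (K0 + 1) * ?T k))"
      proof (rule Eavg_mono)
        fix k
        have "\<bar>\<phi> (prime_path \<alpha> p k) - \<phi> (partial_path \<alpha> J (\<lambda>j. chi p (k - j)))\<bar>
            \<le> L * mdist C01 (prime_path \<alpha> p k) (partial_path \<alpha> J (\<lambda>j. chi p (k - j)))"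
          by (intro Lip prime_path_in_C01 p partial_path_in_C01)
        also have "\<dots> \<le> L * (?c + (K0 + 1) * ?T k)"
          by (intro mult_left_mono mdist_prime_path_le p J L)
        finally show "\<bar>\<phi> (prime_path \<alpha> p k) - \<phi> (partial_path \<alpha> J (\<lambda>j. chi p (k - j)))\<bar> \<le> L * (?c + (K0 + 1) * ?T k)" .
      qed
      also have "\<dots> = L * (?c + (K0 + 1) * Eavg p ?T)"
        unfolding Eavg_cmult Eavg_add Eavg_const[OF p0] ..
      also have "\<dots> \<le> L * (?c + (K0 + 1) * (33 / sqrt (real J) + sqrt (real J) * moment_err 1 p))"
        using J K0_pos by (intro mult_left_mono add_left_mono tail_sum_first_moment p L) auto
      finally show ?case
        unfolding partial_path_restrict by (simp add: algebra_simps add_divide_distrib)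
    qed
  qed
qed

end

text \<open>These are Lipschitz and increase to \<open>\<phi>\<close> where \<open>\<phi>\<close> is continuous, so the Lipschitz case yields the
  lower limit for \<open>\<phi>\<close>; applied to \<open>-\<phi>\<close> it yields the upper one.\<close>

definition inf_conv :: "((real \<Rightarrow> complex) \<Rightarrow> real) \<Rightarrow> nat \<Rightarrow> (real \<Rightarrow> complex) \<Rightarrow> real" where
  "inf_conv \<phi> n f = (INF g\<in>mspace C01. \<phi> g + real n * mdist C01 f g)"

lemma C01_nonempty: "mspace C01 \<noteq> {}"
  using restrict01_in_C01[of "\<lambda>_. 0"] by auto

context
  fixes \<phi> :: "(real \<Rightarrow> complex) \<Rightarrow> real" and B :: real
  assumes B: "\<And>f. f \<in> mspace C01 \<Longrightarrow> \<bar>\<phi> f\<bar> \<le> B"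
begin

lemma inf_conv_term_ge: "g \<in> mspace C01 \<Longrightarrow> - B \<le> \<phi> g + real n * mdist C01 f g"
  using B[of g] C01.nonneg[of f g] by (simp add: abs_le_iff add_increasing2)

lemma inf_conv_bdd: "bdd_below ((\<lambda>g. \<phi> g + real n * mdist C01 f g) ` mspace C01)"
  using inf_conv_term_ge by (auto intro!: bdd_belowI2)

lemma inf_conv_lower:
  assumes "f \<in> mspace C01" "g \<in> mspace C01"
  shows "inf_conv \<phi> n f \<le> \<phi> g + real n * mdist C01 f g"
  unfolding inf_conv_def by (rule cINF_lower[OF inf_conv_bdd assms(2)])

lemma inf_conv_le: "f \<in> mspace C01 \<Longrightarrow> inf_conv \<phi> n f \<le> \<phi> f"
  using inf_conv_lower[of f f n] by simp

lemma inf_conv_ge: "- B \<le> inf_conv \<phi> n f"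
  unfolding inf_conv_def by (rule cINF_greatest[OF C01_nonempty]) (rule inf_conv_term_ge)

lemma inf_conv_bounded: "f \<in> mspace C01 \<Longrightarrow> \<bar>inf_conv \<phi> n f\<bar> \<le> B"
  using inf_conv_le[of f n] inf_conv_ge[of n f] B[of f] by (simp add: abs_le_iff)

lemma inf_conv_lipschitz_aux:
  assumes "f \<in> mspace C01" "g \<in> mspace C01"
  shows "inf_conv \<phi> n f - real n * mdist C01 f g \<le> inf_conv \<phi> n g"
  unfolding inf_conv_def[of \<phi> n g]
proof (rule cINF_greatest[OF C01_nonempty])
  fix h assume h: "h \<in> mspace C01"
  have "inf_conv \<phi> n f \<le> \<phi> h + real n * mdist C01 f h"
    by (rule inf_conv_lower[OF assms(1) h])
  also have "real n * mdist C01 f h \<le> real n * (mdist C01 f g + mdist C01 g h)"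
    using C01.triangle[OF assms h] by (intro mult_left_mono) auto
  finally show "inf_conv \<phi> n f - real n * mdist C01 f g \<le> \<phi> h + real n * mdist C01 g h"
    by (simp add: algebra_simps)
qed

lemma inf_conv_lipschitz:
  assumes "f \<in> mspace C01" "g \<in> mspace C01"
  shows "\<bar>inf_conv \<phi> n f - inf_conv \<phi> n g\<bar> \<le> real n * mdist C01 f g"
  using inf_conv_lipschitz_aux[OF assms, of n] inf_conv_lipschitz_aux[OF assms(2,1), of n]
  by (simp add: abs_le_iff C01.commute)

text \<open>Because \<open>\<phi>\<close> is bounded, near-minimisers \<open>g n\<close> lie within
  \<open>O(1/n)\<close> of \<open>f\<close>; continuity at \<open>f\<close> then pushes the infimum
  up to \<open>\<phi> f\<close>.\<close>

lemma inf_conv_tendsto: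
  assumes sc: "seq_cont \<phi>" and f: "f \<in> mspace C01"
  shows "(\<lambda>n. inf_conv \<phi> n f) \<longlonglongrightarrow> \<phi> f"
proof -
  have "\<exists>g\<in>mspace C01. \<phi> g + real n * mdist C01 f g < inf_conv \<phi> n f + 1 / real (Suc n)" for n
  proof (rule ccontr)
    assume "\<not> (\<exists>g\<in>mspace C01. \<phi> g + real n * mdist C01 f g < inf_conv \<phi> n f + 1 / real (Suc n))"
    then have "inf_conv \<phi> n f + 1 / real (Suc n) \<le> inf_conv \<phi> n f"
      unfolding inf_conv_def[of \<phi> n f] by (intro cINF_greatest[OF C01_nonempty]) (auto simp: not_less)
    then show False
      by (simp add: field_simps)
  qed
  then obtain g where g: "\<And>n. g n \<in> mspace C01"
      "\<And>n. \<phi> (g n) + real n * mdist C01 f (g n) < inf_conv \<phi> n f + 1 / real (Suc n)"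
    by metis
  have d0: "0 \<le> mdist C01 f h" for h
    by simp
  have "(\<lambda>n. mdist C01 (g n) f) \<longlonglongrightarrow> 0"
  proof (rule Lim_null_comparison)
    show "\<forall>\<^sub>F n in sequentially. norm (mdist C01 (g n) f) \<le> (2 * B + 1) * (1 / real n)"
      using eventually_gt_at_top[of 0]
    proof eventually_elim
      case (elim n)
      have "real n * mdist C01 f (g n) \<le> 2 * B + 1"
      proof -
        have "1 / real (Suc n) \<le> 1"
          by simp
        then show ?thesis
          using g(2)[of n] inf_conv_le[OF f, of n] B[OF f] B[OF g(1)[of n]] by linarith
      qed
      then show ?case
        using elim by (simp add: C01.commute field_simps)
    qed
    show "(\<lambda>n. (2 * B + 1) * (1 / real n)) \<longlonglongrightarrow> 0"
      by (intro tendsto_mult_right_zero lim_1_over_n)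
  qed
  then have "(\<lambda>n. \<phi> (g n)) \<longlonglongrightarrow> \<phi> f"
    by (intro seq_contD[OF sc] g f)
  then have lim: "(\<lambda>n. \<phi> (g n) - 1 / real (Suc n)) \<longlonglongrightarrow> \<phi> f - 0"
    by (intro tendsto_diff LIMSEQ_Suc[OF lim_1_over_n])
  show ?thesis
  proof (rule real_tendsto_sandwich)
    show "\<forall>\<^sub>F n in sequentially. \<phi> (g n) - 1 / real (Suc n) \<le> inf_conv \<phi> n f"
    proof (intro always_eventually allI)
      fix n
      have "0 \<le> real n * mdist C01 f (g n)"
        by simp
      then show "\<phi> (g n) - 1 / real (Suc n) \<le> inf_conv \<phi> n f"
        using g(2)[of n] by linarith
    qed
    show "\<forall>\<^sub>F n in sequentially. inf_conv \<phi> n f \<le> \<phi> f"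
      by (intro always_eventually allI inf_conv_le f)
    show "(\<lambda>n. \<phi> (g n) - 1 / real (Suc n)) \<longlonglongrightarrow> \<phi> f"
      using lim by simp
  qed simp
qed

end

lemma seq_cont_uminus: "seq_cont \<phi> \<Longrightarrow> seq_cont (\<lambda>f. - \<phi> f)"
  unfolding seq_cont_def by (auto intro: tendsto_minus)

context rademacher
begin

lemma weak_lower_limit:
  assumes sc: "seq_cont \<phi>" and B: "\<And>f. f \<in> mspace C01 \<Longrightarrow> \<bar>\<phi> f\<bar> \<le> B" and e: "0 < e"
  shows "\<forall>\<^sub>F p in primes_at_top. expectation (\<lambda>\<omega>. \<phi> (restrict01 (G_random X \<alpha> \<omega>))) - e
    < Eavg p (\<lambda>k. \<phi> (prime_path \<alpha> p k))"
proof -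
  let ?E = "\<lambda>\<phi>. expectation (\<lambda>\<omega>. \<phi> (restrict01 (G_random X \<alpha> \<omega>)))"
  have path: "restrict01 (G_random X \<alpha> \<omega>) \<in> mspace C01" for \<omega>
    by (intro restrict01_in_C01 continuous_on_G_random)
  note weak = weak_limit_lipschitz[where \<phi> = "inf_conv \<phi> n" and B = B and L = "real n" for n,
      OF inf_conv_bounded[OF B] inf_conv_lipschitz[OF B] of_nat_0_le_iff]
  have "(\<lambda>n. ?E (inf_conv \<phi> n)) \<longlonglongrightarrow> ?E \<phi>"
  proof (rule integral_dominated_convergence[where w = "\<lambda>_. B"])
    show "AE \<omega> in M. (\<lambda>n. inf_conv \<phi> n (restrict01 (G_random X \<alpha> \<omega>))) \<longlonglongrightarrow> \<phi> (restrict01 (G_random X \<alpha> \<omega>))"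
      by (intro AE_I2 inf_conv_tendsto[OF B sc] path)
    show "AE \<omega> in M. norm (inf_conv \<phi> n (restrict01 (G_random X \<alpha> \<omega>))) \<le> B" for n
      using inf_conv_bounded[OF B] path by auto
    show "(\<lambda>\<omega>. inf_conv \<phi> n (restrict01 (G_random X \<alpha> \<omega>))) \<in> borel_measurable M" for n
      by (rule functional_measurable[OF weak(1)])
  qed (use sc functional_measurable in auto)
  then have "\<forall>\<^sub>F n in sequentially. ?E \<phi> - e / 2 < ?E (inf_conv \<phi> n)"
    using e by (intro order_tendstoD(1)) auto
  then obtain n where n: "?E \<phi> - e / 2 < ?E (inf_conv \<phi> n)"
    by (auto dest: eventually_happens)
  have "\<forall>\<^sub>F p in primes_at_top. ?E (inf_conv \<phi> n) - e / 2 < Eavg p (\<lambda>k. inf_conv \<phi> n (prime_path \<alpha> p k))"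
    using e by (intro order_tendstoD(1)[OF weak(2)]) auto
  with eventually_odd_prime[of 1] show ?thesis
  proof eventually_elim
    case (elim p)
    have "Eavg p (\<lambda>k. inf_conv \<phi> n (prime_path \<alpha> p k)) \<le> Eavg p (\<lambda>k. \<phi> (prime_path \<alpha> p k))"
      using elim by (intro Eavg_mono inf_conv_le[OF B] prime_path_in_C01) auto
    then show ?case
      using elim n by simp
  qed
qed

lemma weak_limit:
  assumes sc: "seq_cont \<phi>" and B: "\<And>f. f \<in> mspace C01 \<Longrightarrow> \<bar>\<phi> f\<bar> \<le> B"
  shows "((\<lambda>p. Eavg p (\<lambda>k. \<phi> (prime_path \<alpha> p k))) \<longlongrightarrow> expectation (\<lambda>\<omega>. \<phi> (restrict01 (G_random X \<alpha> \<omega>)))) primes_at_top"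
proof (rule tendstoI)
  fix e :: real assume e: "0 < e"
  have B': "\<bar>- \<phi> f\<bar> \<le> B" if "f \<in> mspace C01" for f
    using B[OF that] by simp
  have "\<forall>\<^sub>F p in primes_at_top. expectation (\<lambda>\<omega>. \<phi> (restrict01 (G_random X \<alpha> \<omega>))) - e
      < Eavg p (\<lambda>k. \<phi> (prime_path \<alpha> p k))"
    by (rule weak_lower_limit[OF sc _ e]) (rule B)
  moreover have "\<forall>\<^sub>F p in primes_at_top. expectation (\<lambda>\<omega>. - \<phi> (restrict01 (G_random X \<alpha> \<omega>))) - e
      < Eavg p (\<lambda>k. - \<phi> (prime_path \<alpha> p k))"
    by (rule weak_lower_limit[OF seq_cont_uminus[OF sc] _ e]) (rule B')
  ultimately show "\<forall>\<^sub>F p in primes_at_top. dist (Eavg p (\<lambda>k. \<phi> (prime_path \<alpha> p k)))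
      (expectation (\<lambda>\<omega>. \<phi> (restrict01 (G_random X \<alpha> \<omega>)))) < e"
  proof eventually_elim
    case (elim p)
    have "Eavg p (\<lambda>k. - \<phi> (prime_path \<alpha> p k)) = - Eavg p (\<lambda>k. \<phi> (prime_path \<alpha> p k))"
      using Eavg_cmult[of p "-1"] by simp
    then show ?case
      using elim by (simp add: dist_real_def abs_less_iff)
  qed
qed

lemma weak_limit_complex:
  fixes \<phi> :: "(real \<Rightarrow> complex) \<Rightarrow> complex"
  assumes cont: "continuous_map (mtopology_of C01) euclidean \<phi>" and bdd: "bounded (\<phi> ` mspace C01)"
  shows "((\<lambda>p. (\<Sum>k<p. \<phi> (prime_path \<alpha> p (int k))) / of_nat p)
    \<longlongrightarrow> (LINT \<omega>|M. \<phi> (restrict01 (G_random X \<alpha> \<omega>)))) primes_at_top"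
proof -
  obtain B where B: "\<And>f. f \<in> mspace C01 \<Longrightarrow> norm (\<phi> f) \<le> B"
    using bdd by (auto simp: bounded_iff)
  have BR: "\<bar>Re (\<phi> f)\<bar> \<le> B" and BI: "\<bar>Im (\<phi> f)\<bar> \<le> B" if "f \<in> mspace C01" for f
    using B[OF that] abs_Re_le_cmod[of "\<phi> f"] abs_Im_le_cmod[of "\<phi> f"] by linarith+
  have scR: "seq_cont (\<lambda>f. Re (\<phi> f))" and scI: "seq_cont (\<lambda>f. Im (\<phi> f))"
    unfolding seq_cont_def using continuous_map_imp_tendsto[OF cont] by (auto intro: tendsto_Re tendsto_Im)
  have meas: "(\<lambda>\<omega>. \<phi> (restrict01 (G_random X \<alpha> \<omega>))) \<in> borel_measurable M"
    using functional_measurable[OF scR] functional_measurable[OF scI]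
    by (simp add: borel_measurable_complex_iff)
  have int: "integrable M (\<lambda>\<omega>. \<phi> (restrict01 (G_random X \<alpha> \<omega>)))"
  proof (rule integrable_const_bound[OF _ meas, where B = B])
    show "AE \<omega> in M. norm (\<phi> (restrict01 (G_random X \<alpha> \<omega>))) \<le> B"
      by (intro AE_I2) (simp add: B restrict01_in_C01 continuous_on_G_random)
  qed
  have "Re ((\<Sum>k<p. \<phi> (prime_path \<alpha> p (int k))) / of_nat p) = Eavg p (\<lambda>k. Re (\<phi> (prime_path \<alpha> p k)))"
    "Im ((\<Sum>k<p. \<phi> (prime_path \<alpha> p (int k))) / of_nat p) = Eavg p (\<lambda>k. Im (\<phi> (prime_path \<alpha> p k)))" for p
    by (simp_all add: Eavg_def Re_divide_of_nat Im_divide_of_nat)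
  moreover have "Re (LINT \<omega>|M. \<phi> (restrict01 (G_random X \<alpha> \<omega>))) = expectation (\<lambda>\<omega>. Re (\<phi> (restrict01 (G_random X \<alpha> \<omega>))))"
    "Im (LINT \<omega>|M. \<phi> (restrict01 (G_random X \<alpha> \<omega>))) = expectation (\<lambda>\<omega>. Im (\<phi> (restrict01 (G_random X \<alpha> \<omega>))))"
    using int by simp_all
  ultimately show ?thesis
    unfolding tendsto_complex_iff using weak_limit[OF scR BR] weak_limit[OF scI BI] by simp
qed

end

section \<open>Norms and Mahler measure\<close>

definition I01 :: "real measure" where
  "I01 = restrict_space lborel {0..1}"

lemma space_I01 [simp]: "space I01 = {0..1}"
  by (simp add: I01_def space_restrict_space)

interpretation I01: prob_space I01
proof
  show "emeasure I01 (space I01) = 1"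
    unfolding I01_def by (subst emeasure_restrict_space) (auto simp: space_restrict_space)
qed

lemma integral_I01:
  fixes f :: "real \<Rightarrow> real"
  shows "integral\<^sup>L I01 f = (LBINT x:{0..1}. f x)"
  unfolding I01_def by (subst integral_restrict_space) (auto simp: set_lebesgue_integral_def)

lemma nn_integral_I01: "(\<integral>\<^sup>+x. f x \<partial>I01) = (\<integral>\<^sup>+x. f x * indicator {0..1} x \<partial>lborel)"
  unfolding I01_def by (subst nn_integral_restrict_space) auto

lemma borel_measurable_I01:
  assumes "f \<in> borel_measurable borel"
  shows "f \<in> borel_measurable I01"
  unfolding I01_def by (intro measurable_restrict_space1) (use assms in simp)

lemma continuous_on_measurable_I01:
  fixes f :: "real \<Rightarrow> 'b :: topological_space"
  assumes "continuous_on {0..1} f"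
  shows "f \<in> borel_measurable I01"
proof -
  have "sets I01 = sets (restrict_space borel {0..1})"
    unfolding I01_def by (intro sets_restrict_space_cong) simp
  then show ?thesis
    using borel_measurable_continuous_on_restrict[OF assms] measurable_cong_sets by blast
qed

lemma continuous_on_nonneg_norm:
  fixes f :: "real \<Rightarrow> complex"
  assumes "continuous_on {0..1} f" "continuous_on {0..} \<psi>"
  shows "continuous_on {0..1} (\<lambda>x. \<psi> (norm (f x)))"
  by (rule continuous_on_compose2[OF assms(2)]) (auto intro: continuous_intros assms(1))

definition path_functional :: "(real \<Rightarrow> real) \<Rightarrow> (real \<Rightarrow> complex) \<Rightarrow> real" where
  "path_functional \<psi> f = (\<integral>x. \<psi> (norm (f x)) \<partial>I01)"

lemma path_functional_restrict01: "path_functional \<psi> (restrict01 f) = path_functional \<psi> f"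
  unfolding path_functional_def by (intro Bochner_Integration.integral_cong) auto

context
  fixes \<psi> :: "real \<Rightarrow> real" and B :: real
  assumes cont: "continuous_on {0..} \<psi>" and bdd: "\<And>y. 0 \<le> y \<Longrightarrow> \<bar>\<psi> y\<bar> \<le> B"
begin

lemma path_functional_integrable:
  fixes f :: "real \<Rightarrow> complex"
  assumes "continuous_on {0..1} f"
  shows "integrable I01 (\<lambda>x. \<psi> (norm (f x)))"
proof (rule I01.integrable_const_bound[where B = B])
  show "AE x in I01. norm (\<psi> (norm (f x))) \<le> B"
    by (intro AE_I2) (simp add: bdd)
qed (intro continuous_on_measurable_I01 continuous_on_nonneg_norm cont assms)

lemma path_functional_bounded:
  assumes "f \<in> mspace C01"
  shows "\<bar>path_functional \<psi> f\<bar> \<le> B"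
proof -
  have f: "continuous_on {0..1} f"
    using assms by (simp add: mspace_C01)
  have "\<bar>path_functional \<psi> f\<bar> \<le> (\<integral>x. \<bar>\<psi> (norm (f x))\<bar> \<partial>I01)"
    unfolding path_functional_def by (rule integral_abs_bound)
  also have "\<dots> \<le> (\<integral>x. B \<partial>I01)"
    by (intro integral_mono integrable_abs path_functional_integrable f) (auto simp: bdd)
  finally show ?thesis
    using I01.prob_space by simp
qed

lemma seq_cont_path_functional: "seq_cont (path_functional \<psi>)"
  unfolding seq_cont_def
proof (intro allI impI)
  fix u f assume u: "\<forall>n::nat. u n \<in> mspace C01" "f \<in> mspace C01" "(\<lambda>n. mdist C01 (u n) f) \<longlonglongrightarrow> 0"
  have c: "continuous_on {0..1} (u n)" "continuous_on {0..1} f" for n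
    using u by (auto simp: mspace_C01)
  show "(\<lambda>n. path_functional \<psi> (u n)) \<longlonglongrightarrow> path_functional \<psi> f"
    unfolding path_functional_def
  proof (rule integral_dominated_convergence[where w = "\<lambda>_. B"])
    show "AE x in I01. (\<lambda>n. \<psi> (norm (u n x))) \<longlonglongrightarrow> \<psi> (norm (f x))"
    proof (rule AE_I2)
      fix x assume x: "x \<in> space I01"
      have "(\<lambda>n. u n x - f x) \<longlonglongrightarrow> 0"
      proof (rule Lim_null_comparison[OF _ u(3)])
        show "\<forall>\<^sub>F n in sequentially. norm (u n x - f x) \<le> mdist C01 (u n) f"
          using u x by (intro always_eventually allI norm_le_mdist_C01) auto
      qed
      then have "(\<lambda>n. u n x) \<longlonglongrightarrow> f x"
        by (simp add: LIM_zero_iff)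
      then have "(\<lambda>n. norm (u n x)) \<longlonglongrightarrow> norm (f x)"
        by (rule tendsto_norm)
      then show "(\<lambda>n. \<psi> (norm (u n x))) \<longlonglongrightarrow> \<psi> (norm (f x))"
        by (intro continuous_on_tendsto_compose[OF cont]) auto
    qed
    show "AE x in I01. norm (\<psi> (norm (u n x))) \<le> B" for n
      by (intro AE_I2) (simp add: bdd)
  qed (auto intro: continuous_on_measurable_I01 continuous_on_nonneg_norm cont c)
qed

end

section \<open>Second moments along the primes\<close>

lemma holomorphic_G_ext: "0 < p \<Longrightarrow> G_ext p t k holomorphic_on S"
  unfolding G_ext_def wker_def by (intro holomorphic_intros) auto

text \<open>\<open>G_p(k,0) = \<chi>(k)\<close> vanishes for \<open>k = 0\<close>; in that case the path is reversed, since \<open>|G_p(0,1)| = |\<chi>(1)| = 1\<close>.\<close>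

lemma ln_moment_bound:
  assumes p: "prime p" "odd p" "40 \<le> p" and k: "0 \<le> k" "k < int p"
  shows "(\<integral>\<^sup>+x. ennreal ((ln (norm (G_prime p t k x)))\<^sup>2) \<partial>I01) \<le> ennreal (2000 * (G_bound p t k)\<^sup>2)"
proof -
  have p0: "0 < p"
    using p by simp
  have chi1: "\<bar>chi p n\<bar> = 1" if "0 < n" "n < int p" for n
    using chi_cases[of p n] that by (auto simp: chi_eq_0_iff zdvd_not_zless)
  have G: "G_prime p t k x = G_ext p t k (of_real x)" for x
    by (rule G_prime_eq_G_ext[OF p(1,2)])
  show ?thesis
  proof (cases "k = 0")
    case False
    have "(\<integral>\<^sup>+x. ennreal ((ln (norm (G_ext p t k (of_real x))))\<^sup>2) * indicator {0..1} x \<partial>lborel)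
        \<le> ennreal (2000 * (G_bound p t k)\<^sup>2)"
    proof (rule ln_square_integral_bound)
      show "G_ext p t k holomorphic_on ball 0 5"
        by (rule holomorphic_G_ext[OF p0])
      show "norm (G_ext p t k z) \<le> G_bound p t k" if "norm z \<le> 4" for z
        using that by (intro norm_G_ext_le p) auto
      show "1 \<le> norm (G_ext p t k 0)"
        using G_ext_of_int[OF p(1,2), of t k 0] chi1[of k] False k by simp
    qed
    then show ?thesis
      by (simp add: nn_integral_I01 G)
  next
    case True
    have "(\<integral>\<^sup>+x. ennreal ((ln (norm (G_ext p t k (1 - of_real x))))\<^sup>2) * indicator {0..1} x \<partial>lborel)
        \<le> ennreal (2000 * (G_bound p t k)\<^sup>2)"
    proof (rule ln_square_integral_bound[where g = "\<lambda>z. G_ext p t k (1 - z)"])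
      have "(G_ext p t k \<circ> (\<lambda>z. 1 - z)) holomorphic_on ball 0 5"
        by (rule holomorphic_on_compose_gen[OF _ holomorphic_G_ext[OF p0, of t k UNIV]]) (auto intro!: holomorphic_intros)
      then show "(\<lambda>z. G_ext p t k (1 - z)) holomorphic_on ball 0 5"
        by (simp add: o_def)
      show "norm (G_ext p t k (1 - z)) \<le> G_bound p t k" if "norm z \<le> 4" for z
        using that norm_triangle_ineq4[of 1 z] by (intro norm_G_ext_le p) auto
      show "1 \<le> norm (G_ext p t k (1 - 0))"
        using G_ext_of_int[OF p(1,2), of t k 1] chi1[of 1] True p by (simp add: norm_mult)
    qed
    also have "(\<integral>\<^sup>+x. ennreal ((ln (norm (G_ext p t k (1 - of_real x))))\<^sup>2) * indicator {0..1} x \<partial>lborel)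
        = (\<integral>\<^sup>+x. ennreal ((ln (norm (G_ext p t k (of_real (1 + (-1) * x)))))\<^sup>2) * indicator {0..1} (1 + (-1) * x) \<partial>lborel)"
      by (intro nn_integral_cong) (auto simp: indicator_def)
    also have "\<dots> = (\<integral>\<^sup>+x. ennreal ((ln (norm (G_ext p t k (of_real x))))\<^sup>2) * indicator {0..1} x \<partial>lborel)"
    proof -
      have "continuous_on UNIV (\<lambda>x::real. G_ext p t k (of_real x))"
        by (rule continuous_on_compose2[OF continuous_on_G_ext[OF p0, of UNIV]]) (auto intro!: continuous_intros)
      then have [measurable]: "(\<lambda>x::real. G_ext p t k (of_real x)) \<in> borel_measurable borel"
        by (rule borel_measurable_continuous_onI)
      show ?thesis
        by (subst nn_integral_real_affine[where c = "-1" and t = 1 and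
            f = "\<lambda>x. ennreal ((ln (norm (G_ext p t k (of_real x))))\<^sup>2) * indicator {0..1} x"]) simp_all
    qed
    finally show ?thesis
      by (simp add: nn_integral_I01 G)
  qed
qed

lemma norm_G_prime_le:
  assumes "prime p" "odd p" "40 \<le> p" "x \<in> {0..1}"
  shows "norm (G_prime p t k x) \<le> G_bound p t k"
  unfolding G_prime_eq_G_ext[OF assms(1,2)] using assms by (intro norm_G_ext_le) auto

text \<open>The envelope is at least \<open>1\<close>, so the exponent may be raised from
  \<open>q\<close> to an integer \<open>r\<close>, for which \<open>G_bound_moment\<close> is
  available.\<close>

lemma powr_moment_bound:
  assumes p: "prime p" "odd p" "40 \<le> p" and q: "0 < q" "q \<le> real r"
  shows "(\<integral>\<^sup>+x. ennreal ((norm (G_prime p t k x) powr q)\<^sup>2) \<partial>I01) \<le> ennreal (G_bound p t k ^ (2 * r))"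
proof -
  have "(norm (G_prime p t k x) powr q)\<^sup>2 \<le> G_bound p t k ^ (2 * r)" if "x \<in> {0..1}" for x
  proof -
    have "norm (G_prime p t k x) powr q \<le> G_bound p t k powr q"
      using q norm_G_prime_le[OF p that] by (intro powr_mono2) auto
    also have "\<dots> \<le> G_bound p t k powr real r"
      using q G_bound_ge_1 by (intro powr_mono) auto
    also have "\<dots> = G_bound p t k ^ r"
      using G_bound_ge_1[of p t k] by (simp add: powr_realpow)
    finally have "(norm (G_prime p t k x) powr q)\<^sup>2 \<le> (G_bound p t k ^ r)\<^sup>2"
      by (intro power_mono) auto
    then show ?thesis
      by (simp add: power_mult[symmetric] mult.commute)
  qed
  then have "(\<integral>\<^sup>+x. ennreal ((norm (G_prime p t k x) powr q)\<^sup>2) \<partial>I01) \<le> (\<integral>\<^sup>+x. ennreal (G_bound p t k ^ (2 * r)) \<partial>I01)"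
    by (intro nn_integral_mono ennreal_leI) auto
  then show ?thesis
    using I01.emeasure_space_1 by simp
qed

lemma unit_exp_eqD:
  assumes "unit_exp a = unit_exp b"
  shows "\<exists>n::int. a - b = of_int n"
proof -
  obtain n :: int where "2 * of_real pi * \<i> * of_real a = 2 * of_real pi * \<i> * of_real b + of_int (2 * n) * of_real pi * \<i>"
    using assms unfolding unit_exp_def exp_eq by auto
  then have "Im (2 * of_real pi * \<i> * of_real a) = Im (2 * of_real pi * \<i> * of_real b + of_int (2 * n) * of_real pi * \<i>)"
    by (rule arg_cong)
  then have "2 * pi * (a - b) = 2 * pi * of_int n"
    by (simp add: algebra_simps)
  then have "a - b = of_int n"
    by (simp only: mult_cancel_left) simp
  then show ?thesis ..
qed

text \<open>Zeros on an arc are roots of the Fekete polynomial, which is nonzero by its value at the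
  first root of unity. The arc is \<open>1 / p\<close> of a turn, less than a full one, so its
  parametrisation is injective.\<close>

lemma finite_zeros_G_prime:
  assumes p: "prime p" "odd p"
  shows "finite {x \<in> {0..1}. G_prime p t k x = 0}"
proof -
  let ?F = "shifted_fekete p t"
  have p1: "1 < p"
    using p prime_gt_1_nat by blast
  have "poly ?F (zeta_pow p 1) \<noteq> 0"
    using norm_fekete_1[OF p, of t] p1 by auto
  then have "?F \<noteq> 0"
    by auto
  then have fin: "finite {z. poly ?F z = 0}"
    by (rule poly_roots_finite)
  have inj: "inj_on (\<lambda>x. zeta_pow p (of_int k + x)) {0..1}"
  proof (rule inj_onI)
    fix x y :: real assume xy: "x \<in> {0..1}" "y \<in> {0..1}" "zeta_pow p (of_int k + x) = zeta_pow p (of_int k + y)"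
    then obtain n :: int where n: "(of_int k + x) / real p - (of_int k + y) / real p = of_int n"
      unfolding zeta_pow_def using unit_exp_eqD by blast
    then have "(x - y) / real p = of_int n"
      by (simp add: diff_divide_distrib[symmetric])
    then have eq: "x - y = real p * of_int n"
      using p1 by (simp add: field_simps)
    have "\<bar>x - y\<bar> < real p"
      using xy p1 by (auto simp: abs_le_iff abs_less_iff)
    then have "real p * \<bar>of_int n\<bar> < real p * 1"
      unfolding eq by (simp add: abs_mult)
    then have "\<bar>real_of_int n\<bar> < 1"
      using p1 by (simp only: mult_less_cancel_left_pos of_nat_0_less_iff less_trans[OF zero_less_one])
    then have "n = 0"
      by linarith
    then show "x = y"
      using eq by simp
  qed
  have "(\<lambda>x. zeta_pow p (of_int k + x)) ` {x \<in> {0..1}. G_prime p t k x = 0} \<subseteq> {z. poly ?F z = 0}"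
  proof
    fix z assume "z \<in> (\<lambda>x. zeta_pow p (of_int k + x)) ` {x \<in> {0..1}. G_prime p t k x = 0}"
    then obtain x where "G_prime p t k x = 0" "z = zeta_pow p (of_int k + x)"
      by auto
    then show "z \<in> {z. poly ?F z = 0}"
      using norm_fekete_eq[OF p, of t k x] by simp
  qed
  then have "finite ((\<lambda>x. zeta_pow p (of_int k + x)) ` {x \<in> {0..1}. G_prime p t k x = 0})"
    using fin finite_subset by blast
  then show ?thesis
    by (rule finite_imageD) (rule inj_on_subset[OF inj], auto)
qed

lemma AE_G_prime_nonzero:
  assumes p: "prime p" "odd p"
  shows "AE x in I01. G_prime p t k x \<noteq> 0"
proof -
  have "AE x in lborel. x \<notin> {x \<in> {0..1}. G_prime p t k x = 0}"
    by (intro AE_not_in finite_imp_null_set_lborel finite_zeros_G_prime p)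
  then have "AE x in lborel. x \<in> {0..1} \<longrightarrow> G_prime p t k x \<noteq> 0"
    by eventually_elim auto
  then show ?thesis
    unfolding I01_def by (subst AE_restrict_space_iff) auto
qed

section \<open>The random series on the product space\<close>

context rademacher
begin

sublocale pair: pair_prob_space M I01 ..

lemma G_random_pair_measurable:
  "(\<lambda>(\<omega>, x). G_random X \<alpha> \<omega> x) \<in> borel_measurable (M \<Otimes>\<^sub>M I01)"
proof (rule borel_measurable_LIMSEQ_metric)
  fix J
  have [measurable]: "series_kernel j \<in> borel_measurable I01" for j
    by (rule continuous_on_measurable_I01[OF continuous_on_series_kernel])
  have [measurable]: "(\<lambda>(\<omega>, x). G_partial X \<alpha> \<omega> J x) \<in> borel_measurable (M \<Otimes>\<^sub>M I01)"
    unfolding G_partial_def by measurable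
  show "(\<lambda>(\<omega>, x). if uniformly_convergent_on {0..1} (G_partial X \<alpha> \<omega>) then G_partial X \<alpha> \<omega> J x else 0)
      \<in> borel_measurable (M \<Otimes>\<^sub>M I01)"
    by measurable
next
  fix z assume z: "z \<in> space (M \<Otimes>\<^sub>M I01)"
  obtain \<omega> x where wx: "z = (\<omega>, x)" "x \<in> {0..1}"
    using z by (cases z) (auto simp: space_pair_measure)
  show "(\<lambda>J. case z of (\<omega>, x) \<Rightarrow> if uniformly_convergent_on {0..1} (G_partial X \<alpha> \<omega>) then G_partial X \<alpha> \<omega> J x else 0)
      \<longlonglongrightarrow> (case z of (\<omega>, x) \<Rightarrow> G_random X \<alpha> \<omega> x)"
  proof (cases "uniformly_convergent_on {0..1} (G_partial X \<alpha> \<omega>)")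
    case True
    have "(\<lambda>J. G_partial X \<alpha> \<omega> J x) \<longlonglongrightarrow> G_random X \<alpha> \<omega> x"
      by (rule tendsto_uniform_limitI[OF G_random_uniform_limit[OF True] wx(2)])
    then show ?thesis
      using True wx(1) by simp
  next
    case False
    then show ?thesis
      using wx(1) by (simp add: G_random_def)
  qed
qed

definition Z :: "real \<Rightarrow> 'a \<times> real \<Rightarrow> real" where
  "Z \<alpha> = (\<lambda>(\<omega>, x). norm (G_random X \<alpha> \<omega> x))"

lemma Z_measurable [measurable]: "Z \<alpha> \<in> borel_measurable (M \<Otimes>\<^sub>M I01)"
proof -
  have "Z \<alpha> = (\<lambda>z. norm ((\<lambda>(\<omega>, x). G_random X \<alpha> \<omega> x) z))"
    by (auto simp: Z_def)
  then show ?thesis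
    using G_random_pair_measurable[of \<alpha>] by simp
qed

lemma Z_nonneg: "0 \<le> Z \<alpha> z"
  by (cases z) (simp add: Z_def)

lemma functional_Z_measurable:
  assumes "continuous_on {0..} \<psi>"
  shows "(\<lambda>z. \<psi> (Z \<alpha> z)) \<in> borel_measurable (M \<Otimes>\<^sub>M I01)"
proof -
  \<comment> \<open>Continuity of \<open>\<psi>\<close> is known only on \<open>{0..}\<close>;
    composing with \<open>max 0\<close> extends it to the line without changing it at values of
    \<open>Z\<close>.\<close>
  have "continuous_on UNIV (\<lambda>y. \<psi> (max 0 y))"
    by (rule continuous_on_compose2[OF assms]) (auto intro!: continuous_intros)
  then have [measurable]: "(\<lambda>y. \<psi> (max 0 y)) \<in> borel_measurable borel"
    by (rule borel_measurable_continuous_onI)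
  have "(\<lambda>z. \<psi> (max 0 (Z \<alpha> z))) \<in> borel_measurable (M \<Otimes>\<^sub>M I01)"
    by measurable
  then show ?thesis
    by (simp add: Z_nonneg max_absorb2)
qed

lemma functional_Z_integrable:
  fixes B :: real
  assumes "continuous_on {0..} \<psi>" "\<And>y. 0 \<le> y \<Longrightarrow> \<bar>\<psi> y\<bar> \<le> B"
  shows "integrable (M \<Otimes>\<^sub>M I01) (\<lambda>z. \<psi> (Z \<alpha> z))"
proof (rule pair.P.integrable_const_bound[where B = B])
  show "AE z in M \<Otimes>\<^sub>M I01. norm (\<psi> (Z \<alpha> z)) \<le> B"
    by (intro AE_I2) (simp add: assms(2) Z_nonneg)
qed (rule functional_Z_measurable[OF assms(1)])

text \<open>Weak convergence applied to \<open>path_functional\<close>; Fubini turns the expected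
  mean over \<open>x\<close> into one integral over the product space.\<close>

lemma functional_limit:
  fixes B :: real
  assumes "continuous_on {0..} \<psi>" "\<And>y. 0 \<le> y \<Longrightarrow> \<bar>\<psi> y\<bar> \<le> B"
  shows "((\<lambda>p. Eavg p (\<lambda>k. path_functional \<psi> (G_prime p (near_shift \<alpha> p) k)))
     \<longlongrightarrow> (\<integral>z. \<psi> (Z \<alpha> z) \<partial>(M \<Otimes>\<^sub>M I01))) primes_at_top"
proof -
  have "((\<lambda>p. Eavg p (\<lambda>k. path_functional \<psi> (prime_path \<alpha> p k)))
    \<longlongrightarrow> expectation (\<lambda>\<omega>. path_functional \<psi> (restrict01 (G_random X \<alpha> \<omega>)))) primes_at_top"
    by (rule weak_limit[OF seq_cont_path_functional[OF assms] path_functional_bounded[OF assms]])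
  also have "expectation (\<lambda>\<omega>. path_functional \<psi> (restrict01 (G_random X \<alpha> \<omega>))) = (\<integral>z. \<psi> (Z \<alpha> z) \<partial>(M \<Otimes>\<^sub>M I01))"
    unfolding path_functional_restrict01 unfolding path_functional_def
    using pair.integral_fst[of "\<lambda>\<omega> x. \<psi> (norm (G_random X \<alpha> \<omega> x))"] functional_Z_integrable[OF assms, of \<alpha>]
    by (simp add: Z_def case_prod_unfold)
  finally show ?thesis
    by (simp only: prime_path_def path_functional_restrict01)
qed

end

section \<open>Truncation controlled by second moments\<close>

definition clip :: "nat \<Rightarrow> real \<Rightarrow> real" where
  "clip n y = max (- real n) (min (real n) y)"

lemma abs_clip_le: "\<bar>clip n y\<bar> \<le> real n" "\<bar>clip n y\<bar> \<le> \<bar>y\<bar>"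
  by (auto simp: clip_def)

text \<open>Beyond the threshold \<open>\<bar>y\<bar> / n\<close> exceeds \<open>1\<close>.
  Integrated, this makes the truncation error \<open>O(1/n)\<close> under a bounded second
  moment.\<close>

lemma clip_error:
  assumes "0 < n"
  shows "\<bar>y - clip n y\<bar> \<le> y\<^sup>2 * (1 / real n)"
proof (cases "\<bar>y\<bar> \<le> real n")
  case True
  then have "clip n y = y"
    by (auto simp: clip_def)
  then show ?thesis
    by simp
next
  case False
  have "\<bar>y - clip n y\<bar> \<le> \<bar>y\<bar>"
    by (auto simp: clip_def)
  also have "\<dots> \<le> \<bar>y\<bar> * (\<bar>y\<bar> / real n)"
    using False assms by (intro mult_le_cancel_left1[THEN iffD2]) auto
  also have "\<dots> = y\<^sup>2 * (1 / real n)"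
    by (simp add: power2_eq_square)
  finally show ?thesis .
qed

lemma clip_tendsto: "(\<lambda>n. clip n y) \<longlonglongrightarrow> y"
proof (rule tendsto_eventually)
  obtain m where "\<bar>y\<bar> < real m"
    using reals_Archimedean2 by blast
  then have m: "\<bar>y\<bar> \<le> real n" if "m \<le> n" for n
    using that by (meson less_imp_le less_le_trans of_nat_le_iff order_trans)
  show "\<forall>\<^sub>F n in sequentially. clip n y = y"
    using eventually_ge_at_top[of m] by eventually_elim (use m in \<open>fastforce simp: clip_def abs_le_iff\<close>)
qed

lemma abs_le_1_plus_square: "\<bar>y\<bar> \<le> 1 + (y::real)\<^sup>2"
proof (cases "\<bar>y\<bar> \<le> 1")
  case False
  then have "\<bar>y\<bar> * 1 \<le> \<bar>y\<bar> * \<bar>y\<bar>"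
    by (intro mult_left_mono) auto
  then show ?thesis
    by (simp add: power2_eq_square)
qed (auto intro: add_increasing2)

lemma (in finite_measure) integrable_of_nn_integral_square:
  fixes f :: "'a \<Rightarrow> real"
  assumes [measurable]: "f \<in> borel_measurable M" and D: "(\<integral>\<^sup>+x. ennreal ((f x)\<^sup>2) \<partial>M) \<le> ennreal D"
  shows "integrable M (\<lambda>x. (f x)\<^sup>2)" "integrable M f"
proof -
  show sq: "integrable M (\<lambda>x. (f x)\<^sup>2)"
    using D by (intro integrableI_nonneg) (auto simp: less_top[symmetric] top_unique)
  show "integrable M f"
  proof (rule Bochner_Integration.integrable_bound)
    show "integrable M (\<lambda>x. 1 + (f x)\<^sup>2)"
      using sq by auto
    show "AE x in M. norm (f x) \<le> norm (1 + (f x)\<^sup>2)"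
      by (intro AE_I2) (use abs_le_1_plus_square in auto)
  qed simp
qed

lemma (in finite_measure) square_integral_le:
  fixes f :: "'a \<Rightarrow> real"
  assumes [measurable]: "f \<in> borel_measurable M" and D: "(\<integral>\<^sup>+x. ennreal ((f x)\<^sup>2) \<partial>M) \<le> ennreal D" "0 \<le> D"
  shows "(\<integral>x. (f x)\<^sup>2 \<partial>M) \<le> D"
proof -
  have "ennreal (\<integral>x. (f x)\<^sup>2 \<partial>M) = (\<integral>\<^sup>+x. ennreal ((f x)\<^sup>2) \<partial>M)"
    by (rule nn_integral_eq_integral[symmetric]) (auto intro: integrable_of_nn_integral_square assms)
  with D(1) have "ennreal (\<integral>x. (f x)\<^sup>2 \<partial>M) \<le> ennreal D"
    by simp
  then show ?thesis
    by (simp only: ennreal_le_iff[OF D(2)])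
qed

lemma norm_G_prime_measurable:
  assumes "prime p" "odd p" "\<psi> \<in> borel_measurable borel"
  shows "(\<lambda>x. \<psi> (norm (G_prime p t k x))) \<in> borel_measurable I01"
proof -
  have [measurable]: "(\<lambda>x. norm (G_prime p t k x)) \<in> borel_measurable I01"
    by (intro continuous_on_measurable_I01 continuous_on_norm continuous_on_G_prime assms)
  show ?thesis
    using assms(3) by measurable
qed

text \<open>Integrability is asked arc by arc, which is how the moment bounds supply it. Consecutive
  arcs share an endpoint, so the decomposition of the indicator holds only almost
  everywhere.\<close>

lemma sum_over_intervals:
  fixes f :: "real \<Rightarrow> real"
  assumes p: "0 < p" and meas [measurable]: "f \<in> borel_measurable borel" and int: "\<And>k. k < p \<Longrightarrow> integrable I01 (\<lambda>x. f ((real k + x) / real p))"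
  shows "(LBINT u:{0..1}. f u) = Eavg p (\<lambda>k. \<integral>x. f ((of_int k + x) / real p) \<partial>I01)"
proof -
  define F where "F k u = indicator {real k / real p..real (Suc k) / real p} u * f u" for k u
  have F: "integrable lborel (F k)" "(\<integral>u. F k u \<partial>lborel) = (\<integral>x. f ((real k + x) / real p) \<partial>I01) / real p"
    if k: "k < p" for k
  proof -
    have eq: "F k (real k / real p + 1 / real p * x) = indicator {0..1} x * f ((real k + x) / real p)" for x
    proof -
      have e: "real k / real p + 1 / real p * x = (real k + x) / real p"
        by (simp add: add_divide_distrib)
      have "(real k + x) / real p \<in> {real k / real p..real (Suc k) / real p} \<longleftrightarrow> x \<in> {0..1}"
        using p by (simp add: divide_le_cancel)
      then show ?thesis
        unfolding F_def e by (simp add: indicator_def)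
    qed
    have "integrable lborel (\<lambda>x. indicator {0..1} x *\<^sub>R f ((real k + x) / real p))"
      using int[OF k] unfolding I01_def by (subst (asm) integrable_restrict_space) auto
    then have "integrable lborel (\<lambda>x. F k (real k / real p + 1 / real p * x))"
      unfolding eq by simp
    then show "integrable lborel (F k)"
      using p by (subst (asm) lborel_integrable_real_affine_iff) auto
    have "(\<integral>u. F k u \<partial>lborel) = \<bar>1 / real p\<bar> *\<^sub>R (\<integral>x. F k (real k / real p + 1 / real p * x) \<partial>lborel)"
      using p by (intro lborel_integral_real_affine) auto
    also have "(\<integral>x. F k (real k / real p + 1 / real p * x) \<partial>lborel) = (\<integral>x. f ((real k + x) / real p) \<partial>I01)"
      unfolding eq integral_I01 by (simp add: set_lebesgue_integral_def)
    finally show "(\<integral>u. F k u \<partial>lborel) = (\<integral>x. f ((real k + x) / real p) \<partial>I01) / real p"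
      using p by simp
  qed
  define S where "S m u = indicator {0..real m / real p} u * f u" for m u
  have S: "(\<integral>u. S m u \<partial>lborel) = (\<Sum>k<m. \<integral>u. F k u \<partial>lborel)" if "m \<le> p" for m
  proof -
    have ae: "AE u in lborel. S m u = (\<Sum>k<m. F k u)" if "m \<le> p" for m
      using that
    proof (induction m)
      case 0
      have "AE u in lborel. u \<noteq> (0::real)"
        by (rule AE_lborel_singleton)
      then show ?case
        by eventually_elim (auto simp: S_def indicator_def)
    next
      case (Suc m)
      have "AE u in lborel. u \<noteq> real m / real p"
        by (rule AE_lborel_singleton)
      moreover have "AE u in lborel. S m u = (\<Sum>k<m. F k u)"
        using Suc by simp
      ultimately show ?case
      proof eventually_elim
        case (elim u)
        have split: "indicator {0..b} u = indicator {0..a} u + (indicator {a..b} u :: real)"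
          if "u \<noteq> a" "0 \<le> a" "a \<le> b" for a b
          using that by (auto simp: indicator_def)
        have "indicator {0..real (Suc m) / real p} u
            = indicator {0..real m / real p} u + (indicator {real m / real p..real (Suc m) / real p} u :: real)"
          using elim(1) by (intro split divide_right_mono) auto
        then have "S (Suc m) u = S m u + F m u"
          by (simp add: S_def F_def distrib_right)
        then show ?case
          using elim(2) by simp
      qed
    qed
    have intsum: "integrable lborel (\<lambda>u. \<Sum>k<m. F k u)"
      using F(1) that by (intro Bochner_Integration.integrable_sum) auto
    have "(\<integral>u. S m u \<partial>lborel) = (\<integral>u. (\<Sum>k<m. F k u) \<partial>lborel)"
    proof (rule integral_cong_AE)
      show "S m \<in> borel_measurable lborel"
        unfolding S_def by measurable
    qed (use ae[OF that] intsum in auto)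
    then show ?thesis
      using F(1) that by (simp add: Bochner_Integration.integral_sum)
  qed
  show ?thesis
    using S[of p] F(2) p by (simp add: S_def set_lebesgue_integral_def Eavg_def sum_divide_distrib)
qed

section \<open>From bounded to unbounded functions of the modulus\<close>

context rademacher
begin

context
  fixes \<alpha> :: real and \<psi> :: "real \<Rightarrow> real" and D :: "nat \<Rightarrow> int \<Rightarrow> real" and C :: real
  assumes meas: "\<psi> \<in> borel_measurable borel"
    and moment: "\<forall>\<^sub>F p in primes_at_top. \<forall>k<p.
      (\<integral>\<^sup>+x. ennreal ((\<psi> (norm (G_prime p (near_shift \<alpha> p) (int k) x)))\<^sup>2) \<partial>I01) \<le> ennreal (D p (int k))"
    and D_nonneg: "\<And>p k. 0 \<le> D p k"
    and D_avg: "\<forall>\<^sub>F p in primes_at_top. Eavg p (D p) \<le> C"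
begin

text \<open>Weak convergence carries the averaged second moment of \<open>\<psi>\<close> along the
  primes over to any bounded continuous \<open>\<eta>\<close> dominated by \<open>\<psi>\<close>.
  Domination is asked at positive arguments only, since paths along the primes vanish on null sets;
  \<open>\<eta> 0\<close> stays free, which is how zeros of the random path can be detected.\<close>

lemma truncated_square_bound:
  fixes B :: real
  assumes cont: "continuous_on {0..} \<eta>" and bdd: "\<And>y. 0 \<le> y \<Longrightarrow> \<bar>\<eta> y\<bar> \<le> B"
    and le: "\<And>y. 0 < y \<Longrightarrow> \<bar>\<eta> y\<bar> \<le> \<bar>\<psi> y\<bar>"
  shows "(\<integral>z. (\<eta> (Z \<alpha> z))\<^sup>2 \<partial>(M \<Otimes>\<^sub>M I01)) \<le> C"
proof (rule tendsto_upperbound[OF _ _ primes_at_top_neq_bot])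
  have cont2: "continuous_on {0..} (\<lambda>y. (\<eta> y)\<^sup>2)"
    by (intro continuous_intros cont)
  have bdd2: "\<bar>(\<eta> y)\<^sup>2\<bar> \<le> B\<^sup>2" if "0 \<le> y" for y
    using power_mono[OF bdd[OF that], of 2] by simp
  show "((\<lambda>p. Eavg p (\<lambda>k. path_functional (\<lambda>y. (\<eta> y)\<^sup>2) (G_prime p (near_shift \<alpha> p) k)))
     \<longlongrightarrow> (\<integral>z. (\<eta> (Z \<alpha> z))\<^sup>2 \<partial>(M \<Otimes>\<^sub>M I01))) primes_at_top"
    by (rule functional_limit[OF cont2 bdd2])
  show "\<forall>\<^sub>F p in primes_at_top. Eavg p (\<lambda>k. path_functional (\<lambda>y. (\<eta> y)\<^sup>2) (G_prime p (near_shift \<alpha> p) k)) \<le> C"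
    using eventually_odd_prime[of 1] moment D_avg
  proof eventually_elim
    case (elim p)
    have "path_functional (\<lambda>y. (\<eta> y)\<^sup>2) (G_prime p (near_shift \<alpha> p) (int k)) \<le> D p (int k)" if k: "k < p" for k
    proof -
      let ?G = "G_prime p (near_shift \<alpha> p) (int k)"
      have c: "continuous_on {0..1} ?G"
        using elim by (intro continuous_on_G_prime) auto
      have "ennreal (path_functional (\<lambda>y. (\<eta> y)\<^sup>2) ?G) = (\<integral>\<^sup>+x. ennreal ((\<eta> (norm (?G x)))\<^sup>2) \<partial>I01)"
        unfolding path_functional_def
        by (rule nn_integral_eq_integral[symmetric]) (intro path_functional_integrable[OF cont2 bdd2] c, auto)
      also have "\<dots> \<le> (\<integral>\<^sup>+x. ennreal ((\<psi> (norm (?G x)))\<^sup>2) \<partial>I01)"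
      proof (rule nn_integral_mono_AE)
        have "AE x in I01. ?G x \<noteq> 0"
          using elim by (intro AE_G_prime_nonzero) auto
        then show "AE x in I01. ennreal ((\<eta> (norm (?G x)))\<^sup>2) \<le> ennreal ((\<psi> (norm (?G x)))\<^sup>2)"
        proof eventually_elim
          case (elim x)
          then show ?case
            using le[of "norm (?G x)"] by (intro ennreal_leI) (simp add: abs_le_square_iff)
        qed
      qed
      also have "\<dots> \<le> ennreal (D p (int k))"
        using elim k by blast
      finally show ?thesis
        using D_nonneg by (simp add: ennreal_le_iff)
    qed
    then have "Eavg p (\<lambda>k. path_functional (\<lambda>y. (\<eta> y)\<^sup>2) (G_prime p (near_shift \<alpha> p) k)) \<le> Eavg p (D p)"
      by (rule Eavg_mono')
    then show ?case
      using elim by simp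
  qed
qed

text \<open>Here \<open>\<eta> n\<close> is a version of the truncated \<open>\<psi>\<close> that is
  continuous also at \<open>0\<close>, where \<open>\<psi>\<close> itself may jump. Fatou's lemma
  gives \<open>\<psi>\<close> a second moment on the limit side; on the side of the primes
  \<open>clip_error\<close> makes the truncation error \<open>O(1/n)\<close> uniformly in
  \<open>p\<close>.\<close>

lemma transfer_limit:
  assumes cont: "\<And>n. continuous_on {0..} (\<eta> n)" and bdd: "\<And>n y. 0 \<le> y \<Longrightarrow> \<bar>\<eta> n y\<bar> \<le> real n"
    and eq: "\<And>n y. 0 < y \<Longrightarrow> \<eta> n y = clip n (\<psi> y)"
    and nz: "AE z in M \<Otimes>\<^sub>M I01. Z \<alpha> z \<noteq> 0"
  shows "integrable (M \<Otimes>\<^sub>M I01) (\<lambda>z. \<psi> (Z \<alpha> z))"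
    and "((\<lambda>p. Eavg p (\<lambda>k. \<integral>x. \<psi> (norm (G_prime p (near_shift \<alpha> p) k x)) \<partial>I01))
      \<longlongrightarrow> (\<integral>z. \<psi> (Z \<alpha> z) \<partial>(M \<Otimes>\<^sub>M I01))) primes_at_top"
proof -
  let ?N = "M \<Otimes>\<^sub>M I01"
  have [measurable]: "(\<lambda>z. \<eta> n (Z \<alpha> z)) \<in> borel_measurable ?N" for n
    by (rule functional_Z_measurable[OF cont])
  have [measurable]: "(\<lambda>z. \<psi> (Z \<alpha> z)) \<in> borel_measurable ?N"
    using meas by measurable
  have le: "\<bar>\<eta> n y\<bar> \<le> \<bar>\<psi> y\<bar>" if "0 < y" for n y
    using that abs_clip_le(2) by (simp add: eq)
  have clipZ: "AE z in ?N. \<forall>n. \<eta> n (Z \<alpha> z) = clip n (\<psi> (Z \<alpha> z))"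
    using nz
  proof eventually_elim
    case (elim z)
    then have "0 < Z \<alpha> z"
      using Z_nonneg[of \<alpha> z] by simp
    then show ?case
      by (simp add: eq)
  qed
  have sq: "(\<integral>\<^sup>+z. ennreal ((\<eta> n (Z \<alpha> z))\<^sup>2) \<partial>?N) \<le> ennreal C" for n
  proof -
    have "(\<integral>\<^sup>+z. ennreal ((\<eta> n (Z \<alpha> z))\<^sup>2) \<partial>?N) = ennreal (\<integral>z. (\<eta> n (Z \<alpha> z))\<^sup>2 \<partial>?N)"
    proof (rule nn_integral_eq_integral)
      have "continuous_on {0..} (\<lambda>y. (\<eta> n y)\<^sup>2)"
        by (intro continuous_intros cont)
      moreover have "\<bar>(\<eta> n y)\<^sup>2\<bar> \<le> (real n)\<^sup>2" if "0 \<le> y" for y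
        using power_mono[OF bdd[OF that], of n 2] by simp
      ultimately show "integrable ?N (\<lambda>z. (\<eta> n (Z \<alpha> z))\<^sup>2)"
        by (rule functional_Z_integrable)
    qed auto
    also have "\<dots> \<le> ennreal C"
      by (intro ennreal_leI truncated_square_bound[OF cont bdd le])
    finally show ?thesis .
  qed
  have sq\<psi>: "(\<integral>\<^sup>+z. ennreal ((\<psi> (Z \<alpha> z))\<^sup>2) \<partial>?N) \<le> ennreal C"
  proof -
    have "(\<integral>\<^sup>+z. ennreal ((\<psi> (Z \<alpha> z))\<^sup>2) \<partial>?N) = (\<integral>\<^sup>+z. liminf (\<lambda>n. ennreal ((\<eta> n (Z \<alpha> z))\<^sup>2)) \<partial>?N)"
    proof (rule nn_integral_cong_AE)
      show "AE z in ?N. ennreal ((\<psi> (Z \<alpha> z))\<^sup>2) = liminf (\<lambda>n. ennreal ((\<eta> n (Z \<alpha> z))\<^sup>2))"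
        using clipZ
      proof eventually_elim
        case (elim z)
        have L: "(\<lambda>n. ennreal ((clip n (\<psi> (Z \<alpha> z)))\<^sup>2)) \<longlonglongrightarrow> ennreal ((\<psi> (Z \<alpha> z))\<^sup>2)"
          by (intro tendsto_ennrealI tendsto_power clip_tendsto)
        show ?case
          using elim by (simp only: lim_imp_Liminf[OF trivial_limit_sequentially L])
      qed
    qed
    also have "\<dots> \<le> liminf (\<lambda>n. \<integral>\<^sup>+z. ennreal ((\<eta> n (Z \<alpha> z))\<^sup>2) \<partial>?N)"
      by (rule nn_integral_liminf) measurable
    also have "\<dots> \<le> ennreal C"
      using sq by (intro order_trans[OF Liminf_le_Limsup Limsup_bounded]) auto
    finally show ?thesis .
  qed
  show int\<psi>: "integrable ?N (\<lambda>z. \<psi> (Z \<alpha> z))"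
    by (rule pair.P.integrable_of_nn_integral_square(2)[OF _ sq\<psi>]) measurable
  have v: "(\<lambda>n. \<integral>z. \<eta> n (Z \<alpha> z) \<partial>?N) \<longlonglongrightarrow> (\<integral>z. \<psi> (Z \<alpha> z) \<partial>?N)"
  proof (rule integral_dominated_convergence[where w = "\<lambda>z. \<bar>\<psi> (Z \<alpha> z)\<bar>"])
    show "AE z in ?N. (\<lambda>n. \<eta> n (Z \<alpha> z)) \<longlonglongrightarrow> \<psi> (Z \<alpha> z)"
      using clipZ by eventually_elim (simp add: clip_tendsto)
    show "AE z in ?N. norm (\<eta> n (Z \<alpha> z)) \<le> \<bar>\<psi> (Z \<alpha> z)\<bar>" for n
      using clipZ by eventually_elim (simp add: abs_clip_le)
  qed (use int\<psi> in auto)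
  show "((\<lambda>p. Eavg p (\<lambda>k. \<integral>x. \<psi> (norm (G_prime p (near_shift \<alpha> p) k x)) \<partial>I01))
      \<longlongrightarrow> (\<integral>z. \<psi> (Z \<alpha> z) \<partial>?N)) primes_at_top"
  proof (rule tendsto_interchange[where Jmin = 1 and v = "\<lambda>n. \<integral>z. \<eta> n (Z \<alpha> z) \<partial>?N"
      and w = "\<lambda>n p. Eavg p (\<lambda>k. path_functional (\<eta> n) (G_prime p (near_shift \<alpha> p) k))"
      and \<delta> = "\<lambda>n. C * (1 / real n)" and \<eta> = "\<lambda>_ _. 0"])
    show "((\<lambda>p. Eavg p (\<lambda>k. path_functional (\<eta> n) (G_prime p (near_shift \<alpha> p) k)))
        \<longlongrightarrow> (\<integral>z. \<eta> n (Z \<alpha> z) \<partial>?N)) primes_at_top" for n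
      by (rule functional_limit[OF cont bdd])
    show "(\<lambda>n. C * (1 / real n)) \<longlonglongrightarrow> 0"
      by (intro tendsto_mult_right_zero lim_1_over_n)
    fix n :: nat assume n: "1 \<le> n"
    show "\<forall>\<^sub>F p in primes_at_top. \<bar>Eavg p (\<lambda>k. \<integral>x. \<psi> (norm (G_prime p (near_shift \<alpha> p) k x)) \<partial>I01)
        - Eavg p (\<lambda>k. path_functional (\<eta> n) (G_prime p (near_shift \<alpha> p) k))\<bar> \<le> C * (1 / real n) + 0"
      using eventually_odd_prime[of 1] moment D_avg
    proof eventually_elim
      case (elim p)
      then have p: "prime p" "odd p"
        by auto
      have diff: "\<bar>(\<integral>x. \<psi> (norm (G_prime p (near_shift \<alpha> p) (int k) x)) \<partial>I01)
          - path_functional (\<eta> n) (G_prime p (near_shift \<alpha> p) (int k))\<bar> \<le> 1 / real n * D p (int k)" if k: "k < p" for k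
      proof -
        let ?G = "G_prime p (near_shift \<alpha> p) (int k)"
        have m: "(\<lambda>x. \<psi> (norm (?G x))) \<in> borel_measurable I01"
          by (rule norm_G_prime_measurable[OF p meas])
        have D: "(\<integral>\<^sup>+x. ennreal ((\<psi> (norm (?G x)))\<^sup>2) \<partial>I01) \<le> ennreal (D p (int k))"
          using elim k by blast
        note int = I01.integrable_of_nn_integral_square[OF m D]
        have int\<eta>: "integrable I01 (\<lambda>x. \<eta> n (norm (?G x)))"
          by (intro path_functional_integrable[OF cont bdd] continuous_on_G_prime p)
        have "\<bar>(\<integral>x. \<psi> (norm (?G x)) \<partial>I01) - path_functional (\<eta> n) ?G\<bar>
            = \<bar>\<integral>x. \<psi> (norm (?G x)) - \<eta> n (norm (?G x)) \<partial>I01\<bar>"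
          unfolding path_functional_def using int int\<eta> by simp
        also have "\<dots> \<le> (\<integral>x. \<bar>\<psi> (norm (?G x)) - \<eta> n (norm (?G x))\<bar> \<partial>I01)"
          by (rule integral_abs_bound)
        also have "\<dots> \<le> (\<integral>x. (\<psi> (norm (?G x)))\<^sup>2 * (1 / real n) \<partial>I01)"
        proof (rule integral_mono_AE)
          show "AE x in I01. \<bar>\<psi> (norm (?G x)) - \<eta> n (norm (?G x))\<bar> \<le> (\<psi> (norm (?G x)))\<^sup>2 * (1 / real n)"
            using AE_G_prime_nonzero[OF p, of "near_shift \<alpha> p" "int k"]
          proof eventually_elim
            case (elim x)
            then have "\<eta> n (norm (?G x)) = clip n (\<psi> (norm (?G x)))"
              by (simp add: eq)
            then show ?case
              using clip_error[of n] n by simp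
          qed
        qed (use int int\<eta> in auto)
        also have "\<dots> = (\<integral>x. (\<psi> (norm (?G x)))\<^sup>2 \<partial>I01) * (1 / real n)"
          by (rule integral_mult_left_zero)
        also have "\<dots> \<le> D p (int k) * (1 / real n)"
          by (intro mult_right_mono I01.square_integral_le m D D_nonneg) auto
        finally show ?thesis
          by (simp add: mult.commute)
      qed
      have "\<bar>Eavg p (\<lambda>k. \<integral>x. \<psi> (norm (G_prime p (near_shift \<alpha> p) k x)) \<partial>I01)
          - Eavg p (\<lambda>k. path_functional (\<eta> n) (G_prime p (near_shift \<alpha> p) k))\<bar>
          \<le> Eavg p (\<lambda>k. 1 / real n * D p k)"
        unfolding Eavg_diff[symmetric]
        by (rule order_trans[OF abs_Eavg_le Eavg_mono']) (rule diff)
      also have "\<dots> \<le> 1 / real n * C"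
        unfolding Eavg_cmult using elim by (intro mult_left_mono) auto
      finally show ?case
        by (simp add: mult.commute)
    qed
  qed (use v in auto)
qed

end

lemma ln_moments:
  obtains C where "\<forall>\<^sub>F p in primes_at_top. \<forall>k<p.
      (\<integral>\<^sup>+x. ennreal ((ln (norm (G_prime p (near_shift \<alpha> p) (int k) x)))\<^sup>2) \<partial>I01)
        \<le> ennreal (2000 * (G_bound p (near_shift \<alpha> p) (int k))\<^sup>2)"
    "\<forall>\<^sub>F p in primes_at_top. Eavg p (\<lambda>k. 2000 * (G_bound p (near_shift \<alpha> p) k)\<^sup>2) \<le> C"
proof -
  obtain C where C: "\<forall>\<^sub>F p in primes_at_top. \<forall>t. Eavg p (\<lambda>k. G_bound p t k ^ (2 * 1)) \<le> C"
    using G_bound_moment[of 1] by blast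
  have "\<forall>\<^sub>F p in primes_at_top. \<forall>k<p.
      (\<integral>\<^sup>+x. ennreal ((ln (norm (G_prime p (near_shift \<alpha> p) (int k) x)))\<^sup>2) \<partial>I01)
        \<le> ennreal (2000 * (G_bound p (near_shift \<alpha> p) (int k))\<^sup>2)"
    using eventually_odd_prime[of 40] by eventually_elim (intro allI impI ln_moment_bound, auto)
  moreover have "\<forall>\<^sub>F p in primes_at_top. Eavg p (\<lambda>k. 2000 * (G_bound p (near_shift \<alpha> p) k)\<^sup>2) \<le> 2000 * C"
    using C by eventually_elim (simp add: Eavg_cmult)
  ultimately show ?thesis
    by (rule that)
qed

lemma powr_moments:
  assumes "0 < q"
  obtains C r where "\<forall>\<^sub>F p in primes_at_top. \<forall>k<p.
      (\<integral>\<^sup>+x. ennreal ((norm (G_prime p (near_shift \<alpha> p) (int k) x) powr q)\<^sup>2) \<partial>I01)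
        \<le> ennreal (G_bound p (near_shift \<alpha> p) (int k) ^ (2 * r))"
    "\<forall>\<^sub>F p in primes_at_top. Eavg p (\<lambda>k. G_bound p (near_shift \<alpha> p) k ^ (2 * r)) \<le> C"
proof -
  obtain r :: nat where r: "q \<le> real r"
    using real_arch_simple by blast
  obtain C where C: "\<forall>\<^sub>F p in primes_at_top. \<forall>t. Eavg p (\<lambda>k. G_bound p t k ^ (2 * r)) \<le> C"
    using G_bound_moment[of r] by blast
  have "\<forall>\<^sub>F p in primes_at_top. \<forall>k<p.
      (\<integral>\<^sup>+x. ennreal ((norm (G_prime p (near_shift \<alpha> p) (int k) x) powr q)\<^sup>2) \<partial>I01)
        \<le> ennreal (G_bound p (near_shift \<alpha> p) (int k) ^ (2 * r))"
    using eventually_odd_prime[of 40] by eventually_elim (intro allI impI powr_moment_bound assms r, auto)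
  moreover have "\<forall>\<^sub>F p in primes_at_top. Eavg p (\<lambda>k. G_bound p (near_shift \<alpha> p) k ^ (2 * r)) \<le> C"
    using C by eventually_elim simp
  ultimately show ?thesis
    by (rule that)
qed

text \<open>The inner cut at \<open>exp (- real n)\<close>, where \<open>ln\<close> reaches
  \<open>- real n\<close>, makes the truncated logarithm continuous up to and beyond
  \<open>0\<close>.\<close>

definition ln_cut :: "nat \<Rightarrow> real \<Rightarrow> real" where
  "ln_cut n y = clip n (ln (max y (exp (- real n))))"

lemma ln_cut_eq:
  assumes "0 < y"
  shows "ln_cut n y = clip n (ln y)"
proof (cases "y \<le> exp (- real n)")
  case True
  then have "ln y \<le> ln (exp (- real n))"
    using assms by (intro ln_mono) auto
  then show ?thesis
    using True by (simp add: ln_cut_def clip_def)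
qed (simp add: ln_cut_def)

lemma ln_cut_0: "ln_cut n 0 = - real n"
  by (simp add: ln_cut_def clip_def)

lemma continuous_on_ln_cut: "continuous_on S (ln_cut n)"
  unfolding ln_cut_def clip_def by (intro continuous_intros) (auto simp: max_def)

lemma abs_ln_cut_le: "\<bar>ln_cut n y\<bar> \<le> real n"
  unfolding ln_cut_def by (rule abs_clip_le)

text \<open>The library has \<open>ln 0 = 0\<close>, so the zeros of the random series would be invisible to the limit of the
  truncated logarithms. Instead \<open>ln_cut n 0 = -n\<close>, whose second moment is bounded independently of \<open>n\<close>.\<close>

lemma AE_Z_nonzero: "AE z in M \<Otimes>\<^sub>M I01. Z \<alpha> z \<noteq> 0"
proof -
  let ?N = "M \<Otimes>\<^sub>M I01"
  obtain C where C: "\<forall>\<^sub>F p in primes_at_top. \<forall>k<p.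
      (\<integral>\<^sup>+x. ennreal ((ln (norm (G_prime p (near_shift \<alpha> p) (int k) x)))\<^sup>2) \<partial>I01)
        \<le> ennreal (2000 * (G_bound p (near_shift \<alpha> p) (int k))\<^sup>2)"
    "\<forall>\<^sub>F p in primes_at_top. Eavg p (\<lambda>k. 2000 * (G_bound p (near_shift \<alpha> p) k)\<^sup>2) \<le> C"
    by (rule ln_moments)
  define A where "A = {z \<in> space ?N. Z \<alpha> z = 0}"
  have [measurable]: "A \<in> sets ?N"
    unfolding A_def by measurable
  have bound: "(real n)\<^sup>2 * measure ?N A \<le> C" for n
  proof -
    have "(real n)\<^sup>2 * measure ?N A = (\<integral>z. (real n)\<^sup>2 * indicator A z \<partial>?N)"
      by simp
    also have "\<dots> \<le> (\<integral>z. (ln_cut n (Z \<alpha> z))\<^sup>2 \<partial>?N)"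
    proof (rule integral_mono)
      show "integrable ?N (\<lambda>z. (real n)\<^sup>2 * indicator A z)"
        by (intro integrable_mult_right integrable_real_indicator) (auto simp: pair.P.emeasure_eq_measure)
      show "integrable ?N (\<lambda>z. (ln_cut n (Z \<alpha> z))\<^sup>2)"
      proof (rule functional_Z_integrable)
        show "continuous_on {0..} (\<lambda>y. (ln_cut n y)\<^sup>2)"
          by (intro continuous_intros continuous_on_ln_cut)
        show "\<bar>(ln_cut n y)\<^sup>2\<bar> \<le> (real n)\<^sup>2" for y
          using power_mono[OF abs_ln_cut_le[of n y], of 2] by simp
      qed
      show "(real n)\<^sup>2 * indicator A z \<le> (ln_cut n (Z \<alpha> z))\<^sup>2" for z
        by (auto simp: A_def indicator_def ln_cut_0)
    qed
    also have "\<dots> \<le> C"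
      by (rule truncated_square_bound[OF _ C(1) _ C(2)])
        (auto intro: continuous_on_ln_cut abs_ln_cut_le simp: ln_cut_eq abs_clip_le)
    finally show ?thesis .
  qed
  have "measure ?N A = 0"
  proof (rule ccontr)
    assume "measure ?N A \<noteq> 0"
    then have pos: "0 < measure ?N A"
      by (simp add: less_le)
    obtain n :: nat where n: "C / measure ?N A < real n"
      using reals_Archimedean2 by blast
    have "0 \<le> C"
      using bound[of 0] by simp
    then have n1: "1 \<le> real n"
      using n pos by (cases n) (auto simp: divide_less_0_iff)
    then have "real n * 1 \<le> (real n)\<^sup>2"
      unfolding power2_eq_square by (intro mult_left_mono) auto
    then have "real n * measure ?N A \<le> (real n)\<^sup>2 * measure ?N A"
      using pos by (intro mult_right_mono) auto
    then have "real n * measure ?N A \<le> C"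
      using bound[of n] by linarith
    then show False
      using n pos by (simp add: field_simps)
  qed
  then have "AE z in ?N. z \<notin> A"
    by (simp add: pair.P.prob_eq_0)
  then show ?thesis
    by (rule AE_mp) (auto simp: A_def)
qed

lemma powr_limit:
  assumes q: "0 < q"
  shows "integrable (M \<Otimes>\<^sub>M I01) (\<lambda>z. Z \<alpha> z powr q)"
    and "((\<lambda>p. Eavg p (\<lambda>k. \<integral>x. norm (G_prime p (near_shift \<alpha> p) k x) powr q \<partial>I01))
      \<longlongrightarrow> (\<integral>z. Z \<alpha> z powr q \<partial>(M \<Otimes>\<^sub>M I01))) primes_at_top"
proof -
  obtain C r where C: "\<forall>\<^sub>F p in primes_at_top. \<forall>k<p.
      (\<integral>\<^sup>+x. ennreal ((norm (G_prime p (near_shift \<alpha> p) (int k) x) powr q)\<^sup>2) \<partial>I01)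
        \<le> ennreal (G_bound p (near_shift \<alpha> p) (int k) ^ (2 * r))"
    "\<forall>\<^sub>F p in primes_at_top. Eavg p (\<lambda>k. G_bound p (near_shift \<alpha> p) k ^ (2 * r)) \<le> C"
    by (rule powr_moments[OF q])
  have m: "(\<lambda>y. y powr q) \<in> borel_measurable borel"
    by measurable
  have D: "0 \<le> G_bound p (near_shift \<alpha> p) k ^ (2 * r)" for p k
    by simp
  have cont: "continuous_on {0..} (\<lambda>y. clip n (y powr q))" for n
    unfolding clip_def using q by (intro continuous_intros continuous_on_powr') auto
  note tr = transfer_limit[OF m C(1) D C(2), where \<eta> = "\<lambda>n y. clip n (y powr q)", OF cont abs_clip_le(1) refl AE_Z_nonzero]
  show "integrable (M \<Otimes>\<^sub>M I01) (\<lambda>z. Z \<alpha> z powr q)"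
    by (rule tr(1))
  show "((\<lambda>p. Eavg p (\<lambda>k. \<integral>x. norm (G_prime p (near_shift \<alpha> p) k x) powr q \<partial>I01))
      \<longlongrightarrow> (\<integral>z. Z \<alpha> z powr q \<partial>(M \<Otimes>\<^sub>M I01))) primes_at_top"
    by (rule tr(2))
qed

lemma ln_limit:
  shows "integrable (M \<Otimes>\<^sub>M I01) (\<lambda>z. ln (Z \<alpha> z))"
    and "((\<lambda>p. Eavg p (\<lambda>k. \<integral>x. ln (norm (G_prime p (near_shift \<alpha> p) k x)) \<partial>I01))
      \<longlongrightarrow> (\<integral>z. ln (Z \<alpha> z) \<partial>(M \<Otimes>\<^sub>M I01))) primes_at_top"
proof -
  obtain C where C: "\<forall>\<^sub>F p in primes_at_top. \<forall>k<p.
      (\<integral>\<^sup>+x. ennreal ((ln (norm (G_prime p (near_shift \<alpha> p) (int k) x)))\<^sup>2) \<partial>I01)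
        \<le> ennreal (2000 * (G_bound p (near_shift \<alpha> p) (int k))\<^sup>2)"
    "\<forall>\<^sub>F p in primes_at_top. Eavg p (\<lambda>k. 2000 * (G_bound p (near_shift \<alpha> p) k)\<^sup>2) \<le> C"
    by (rule ln_moments)
  have m: "(ln :: real \<Rightarrow> real) \<in> borel_measurable borel"
    by measurable
  have D: "0 \<le> 2000 * (G_bound p (near_shift \<alpha> p) k)\<^sup>2" for p k
    by simp
  note tr = transfer_limit[OF m C(1) D C(2) continuous_on_ln_cut abs_ln_cut_le ln_cut_eq AE_Z_nonzero]
  show "integrable (M \<Otimes>\<^sub>M I01) (\<lambda>z. ln (Z \<alpha> z))"
    by (rule tr(1))
  show "((\<lambda>p. Eavg p (\<lambda>k. \<integral>x. ln (norm (G_prime p (near_shift \<alpha> p) k x)) \<partial>I01))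
      \<longlongrightarrow> (\<integral>z. ln (Z \<alpha> z) \<partial>(M \<Otimes>\<^sub>M I01))) primes_at_top"
    by (rule tr(2))
qed

end

section \<open>Cutting the circle into arcs\<close>

lemma unit_exp_measurable [measurable]: "unit_exp \<in> borel_measurable borel"
proof -
  have "continuous_on UNIV unit_exp"
    unfolding unit_exp_def by (intro continuous_intros)
  then show ?thesis
    by (rule borel_measurable_continuous_onI)
qed

lemma norm_fekete_measurable [measurable]:
  "(\<lambda>u. norm (poly (shifted_fekete p t) (unit_exp u))) \<in> borel_measurable borel"
  unfolding poly_shifted_fekete by measurable

lemma norm_fekete_unit_exp:
  assumes "prime p" "odd p"
  shows "norm (poly (shifted_fekete p t) (unit_exp ((of_int k + x) / real p))) = sqrt (real p) * norm (G_prime p t k x)"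
  using norm_fekete_eq[OF assms, of t k x] by (simp add: zeta_pow_def)

context rademacher
begin

lemma poly_norm_eq:
  assumes p: "prime p" "odd p" "40 \<le> p" and q: "0 < q"
  shows "poly_norm q (shifted_fekete p t) / sqrt (real p)
    = (Eavg p (\<lambda>k. \<integral>x. norm (G_prime p t k x) powr q \<partial>I01)) powr (1 / q)"
proof -
  define f where "f u = norm (poly (shifted_fekete p t) (unit_exp u)) powr q" for u
  have p0: "0 < p"
    using p by simp
  have [measurable]: "f \<in> borel_measurable borel"
    unfolding f_def by measurable
  have feq: "f ((of_int k + x) / real p) = sqrt (real p) powr q * norm (G_prime p t k x) powr q" for k x
    unfolding f_def norm_fekete_unit_exp[OF p(1,2)] by (simp add: powr_mult)
  have int: "integrable I01 (\<lambda>x. f ((real k + x) / real p))" for k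
  proof -
    obtain r :: nat where r: "q \<le> real r"
      using real_arch_simple by blast
    have m: "(\<lambda>x. norm (G_prime p t (int k) x) powr q) \<in> borel_measurable I01"
      using norm_G_prime_measurable[OF p(1,2), of "\<lambda>y. y powr q"] by simp
    have "integrable I01 (\<lambda>x. norm (G_prime p t (int k) x) powr q)"
      by (rule I01.integrable_of_nn_integral_square(2)[OF m powr_moment_bound[OF p q r]])
    then show ?thesis
      using feq[of "int k"] by simp
  qed
  define E where "E = Eavg p (\<lambda>k. \<integral>x. norm (G_prime p t k x) powr q \<partial>I01)"
  have E0: "0 \<le> E"
    unfolding E_def Eavg_def by (intro divide_nonneg_nonneg sum_nonneg) auto
  have "(LBINT u:{0..1}. f u) = sqrt (real p) powr q * E"
    unfolding sum_over_intervals[OF p0 \<open>f \<in> borel_measurable borel\<close> int] feq E_def by (simp add: Eavg_cmult)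
  then have "poly_norm q (shifted_fekete p t) = (sqrt (real p) powr q * E) powr (1 / q)"
    by (simp add: poly_norm_def f_def)
  also have "\<dots> = sqrt (real p) * E powr (1 / q)"
    using q E0 p0 by (simp add: powr_mult powr_powr)
  finally show ?thesis
    using p0 by (simp add: E_def)
qed

lemma mahler_eq:
  assumes p: "prime p" "odd p" "40 \<le> p"
  shows "mahler (shifted_fekete p t) / sqrt (real p)
    = exp (Eavg p (\<lambda>k. \<integral>x. ln (norm (G_prime p t k x)) \<partial>I01))"
proof -
  define f where "f u = ln (norm (poly (shifted_fekete p t) (unit_exp u)))" for u
  have p0: "0 < p"
    using p by simp
  have meas [measurable]: "f \<in> borel_measurable borel"
    unfolding f_def by measurable
  have intG: "integrable I01 (\<lambda>x. ln (norm (G_prime p t (int k) x)))" if "k < p" for k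
  proof -
    have m: "(\<lambda>x. ln (norm (G_prime p t (int k) x))) \<in> borel_measurable I01"
      by (intro norm_G_prime_measurable p) measurable
    show ?thesis
      by (rule I01.integrable_of_nn_integral_square(2)[OF m ln_moment_bound[OF p]]) (use that in auto)
  qed
  \<comment> \<open>The logarithm of the product splits only where \<open>G_prime\<close> is
    nonzero, hence almost everywhere.\<close>
  have ae: "AE x in I01. f ((of_int k + x) / real p) = ln (sqrt (real p)) + ln (norm (G_prime p t k x))" for k
    using AE_G_prime_nonzero[OF p(1,2), of t k]
  proof eventually_elim
    case (elim x)
    then show ?case
      unfolding f_def norm_fekete_unit_exp[OF p(1,2)] using p0 by (intro ln_mult_pos) auto
  qed
  have mI: "(\<lambda>x. f ((of_int k + x) / real p)) \<in> borel_measurable I01" for k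
    by (intro borel_measurable_I01) measurable
  have int: "integrable I01 (\<lambda>x. f ((real k + x) / real p))"
    and eq: "(\<integral>x. f ((of_int (int k) + x) / real p) \<partial>I01)
      = ln (sqrt (real p)) + (\<integral>x. ln (norm (G_prime p t (int k) x)) \<partial>I01)" if k: "k < p" for k
  proof -
    have i: "integrable I01 (\<lambda>x. ln (sqrt (real p)) + ln (norm (G_prime p t (int k) x)))"
      using intG[OF k] by simp
    have "integrable I01 (\<lambda>x. f ((of_int (int k) + x) / real p))"
      using i ae[of "int k"] mI[of "int k"] by (subst integrable_cong_AE) auto
    then show "integrable I01 (\<lambda>x. f ((real k + x) / real p))"
      by simp
    have "(\<integral>x. f ((of_int (int k) + x) / real p) \<partial>I01)
        = (\<integral>x. ln (sqrt (real p)) + ln (norm (G_prime p t (int k) x)) \<partial>I01)"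
      using i ae[of "int k"] mI[of "int k"] by (intro integral_cong_AE) auto
    also have "\<dots> = ln (sqrt (real p)) + (\<integral>x. ln (norm (G_prime p t (int k) x)) \<partial>I01)"
      using intG[OF k] I01.prob_space by (subst Bochner_Integration.integral_add) auto
    finally show "(\<integral>x. f ((of_int (int k) + x) / real p) \<partial>I01)
      = ln (sqrt (real p)) + (\<integral>x. ln (norm (G_prime p t (int k) x)) \<partial>I01)" .
  qed
  define E where "E = Eavg p (\<lambda>k. \<integral>x. ln (norm (G_prime p t k x)) \<partial>I01)"
  have "(LBINT u:{0..1}. f u) = Eavg p (\<lambda>k. \<integral>x. f ((of_int k + x) / real p) \<partial>I01)"
    by (rule sum_over_intervals[OF p0 meas int])
  also have "\<dots> = Eavg p (\<lambda>k. ln (sqrt (real p)) + (\<integral>x. ln (norm (G_prime p t k x)) \<partial>I01))"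
    unfolding Eavg_def using eq by (intro arg_cong2[where f = "(/)"] sum.cong) auto
  also have "\<dots> = ln (sqrt (real p)) + E"
    by (simp only: Eavg_add Eavg_const[OF p0] E_def)
  finally have "mahler (shifted_fekete p t) = exp (ln (sqrt (real p)) + E)"
    by (simp add: mahler_def f_def)
  then show ?thesis
    using p0 by (simp add: exp_add E_def)
qed

text \<open>Fubini, with the joint integrability supplied by \<open>powr_limit\<close>.\<close>

lemma kappa_eq:
  assumes "0 < q"
  shows "kappa M X q \<alpha> = (\<integral>z. Z \<alpha> z powr q \<partial>(M \<Otimes>\<^sub>M I01)) powr (1 / q)"
  unfolding kappa_def integral_I01[symmetric]
  using pair.integral_snd[of "\<lambda>\<omega> x. norm (G_random X \<alpha> \<omega> x) powr q"] powr_limit(1)[OF assms, of \<alpha>]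
  by (simp add: Z_def case_prod_unfold)

lemma kappa0_eq: "kappa0 M X \<alpha> = exp (\<integral>z. ln (Z \<alpha> z) \<partial>(M \<Otimes>\<^sub>M I01))"
  unfolding kappa0_def integral_I01[symmetric]
  using pair.integral_snd[of "\<lambda>\<omega> x. ln (norm (G_random X \<alpha> \<omega> x))"] ln_limit(1)[of \<alpha>]
  by (simp add: Z_def case_prod_unfold)

lemma poly_norm_limit:
  assumes q: "0 < q"
  shows "((\<lambda>p. poly_norm q (shifted_fekete p (near_shift \<alpha> p)) / sqrt (real p)) \<longlongrightarrow> kappa M X q \<alpha>) primes_at_top"
proof -
  have "((\<lambda>p. (Eavg p (\<lambda>k. \<integral>x. norm (G_prime p (near_shift \<alpha> p) k x) powr q \<partial>I01)) powr (1 / q))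
      \<longlongrightarrow> kappa M X q \<alpha>) primes_at_top"
    unfolding kappa_eq[OF q]
  proof (rule tendsto_powr'[OF powr_limit(2)[OF q] tendsto_const])
    \<comment> \<open>Continuity of the power at a limit that might be \<open>0\<close> is covered
      by the second alternative: positive exponent and nonnegative means.\<close>
    show "(\<integral>z. Z \<alpha> z powr q \<partial>(M \<Otimes>\<^sub>M I01)) \<noteq> 0 \<or> 0 < 1 / q \<and>
        (\<forall>\<^sub>F p in primes_at_top. 0 \<le> Eavg p (\<lambda>k. \<integral>x. norm (G_prime p (near_shift \<alpha> p) k x) powr q \<partial>I01))"
      using q unfolding Eavg_def
      by (intro disjI2 conjI always_eventually allI divide_nonneg_nonneg sum_nonneg) auto
  qed
  moreover have "\<forall>\<^sub>F p in primes_at_top. (Eavg p (\<lambda>k. \<integral>x. norm (G_prime p (near_shift \<alpha> p) k x) powr q \<partial>I01)) powr (1 / q)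
      = poly_norm q (shifted_fekete p (near_shift \<alpha> p)) / sqrt (real p)"
    using eventually_odd_prime[of 40] by eventually_elim (rule poly_norm_eq[symmetric], use q in auto)
  ultimately show ?thesis
    by (rule Lim_transform_eventually)
qed

lemma mahler_limit:
  "((\<lambda>p. mahler (shifted_fekete p (near_shift \<alpha> p)) / sqrt (real p)) \<longlongrightarrow> kappa0 M X \<alpha>) primes_at_top"
proof -
  have "((\<lambda>p. exp (Eavg p (\<lambda>k. \<integral>x. ln (norm (G_prime p (near_shift \<alpha> p) k x)) \<partial>I01)))
      \<longlongrightarrow> kappa0 M X \<alpha>) primes_at_top"
    unfolding kappa0_eq by (rule tendsto_exp[OF ln_limit(2)])
  moreover have "\<forall>\<^sub>F p in primes_at_top. exp (Eavg p (\<lambda>k. \<integral>x. ln (norm (G_prime p (near_shift \<alpha> p) k x)) \<partial>I01))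
      = mahler (shifted_fekete p (near_shift \<alpha> p)) / sqrt (real p)"
    using eventually_odd_prime[of 40] by eventually_elim (rule mahler_eq[symmetric], auto)
  ultimately show ?thesis
    by (rule Lim_transform_eventually)
qed

end

theorem theorem3p1:
  fixes \<alpha> :: real
    and M :: "'a measure"
    and X :: "int \<Rightarrow> 'a \<Rightarrow> real"
  assumes alpha: "0 \<le> \<alpha>" "\<alpha> \<le> 1"
    and M: "prob_space M"
    and indep: "prob_space.indep_vars M (\<lambda>_. borel) X UNIV"
    and plus: "\<And>j. measure M {\<omega> \<in> space M. X j \<omega> = 1} = 1 / 2"
    and minus: "\<And>j. measure M {\<omega> \<in> space M. X j \<omega> = -1} = 1 / 2"
  shows
    "(\<forall>\<phi> :: (real \<Rightarrow> complex) \<Rightarrow> complex.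
        continuous_map (mtopology_of C01) euclidean \<phi> \<and> bounded (\<phi> ` mspace C01) \<longrightarrow>
        ((\<lambda>p. (\<Sum>k<p. \<phi> (\<lambda>x\<in>{0..1}. G_prime p (nearest_int (\<alpha> * real p)) (int k) x))
               / of_nat p)
          \<longlongrightarrow> (LINT \<omega>|M. \<phi> (\<lambda>x\<in>{0..1}. G_random X \<alpha> \<omega> x))) primes_at_top)
     \<and> (\<forall>q > 0. ((\<lambda>p. poly_norm q (shifted_fekete p (nearest_int (\<alpha> * real p))) / sqrt (real p))
          \<longlongrightarrow> kappa M X q \<alpha>) primes_at_top)
     \<and> ((\<lambda>p. mahler (shifted_fekete p (nearest_int (\<alpha> * real p))) / sqrt (real p))
          \<longlongrightarrow> kappa0 M X \<alpha>) primes_at_top"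
proof (intro conjI allI impI)
  interpret rademacher M X
    using M indep plus minus by (simp add: rademacher_def rademacher_axioms_def)
  note path_defs = prime_path_def near_shift_def
  show "((\<lambda>p. (\<Sum>k<p. \<phi> (\<lambda>x\<in>{0..1}. G_prime p (nearest_int (\<alpha> * real p)) (int k) x)) / of_nat p)
      \<longlongrightarrow> (LINT \<omega>|M. \<phi> (\<lambda>x\<in>{0..1}. G_random X \<alpha> \<omega> x))) primes_at_top"
    if "continuous_map (mtopology_of C01) euclidean \<phi> \<and> bounded (\<phi> ` mspace C01)"
    for \<phi> :: "(real \<Rightarrow> complex) \<Rightarrow> complex"
    using weak_limit_complex[of \<phi> \<alpha>] that unfolding path_defs by blast
  show "((\<lambda>p. poly_norm q (shifted_fekete p (nearest_int (\<alpha> * real p))) / sqrt (real p))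
      \<longlongrightarrow> kappa M X q \<alpha>) primes_at_top" if "0 < q" for q
    using poly_norm_limit[OF that, of \<alpha>] unfolding path_defs .
  show "((\<lambda>p. mahler (shifted_fekete p (nearest_int (\<alpha> * real p))) / sqrt (real p))
      \<longlongrightarrow> kappa0 M X \<alpha>) primes_at_top"
    using mahler_limit[of \<alpha>] unfolding path_defs .
qed

end
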